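(* The operator $H^\Omega_{\pi_{\tilde\sigma}}$ is associated with the intrinsic pre-Dirichlet form $\mathcal{E}^\Omega_{\pi_{\tilde\sigma}}$, i.e., for all $F,G\in\mathcal{F}C_b^\infty(\mathfrak{D},\Omega_X^{\mathbb{R}_+})$ $$\mathcal{E}^\Omega_{\pi_{\tilde\sigma}}(F,G)=(H^\Omega_{\pi_{\tilde\sigma}}F,G)_{L^2(\pi_{\tilde\sigma})},$$ or, equivalently, $H^\Omega_{\pi_{\tilde\sigma}}=-\mathrm{div}^\Omega_{\pi_{\tilde\sigma}}\nabla^\Omega$ on $\mathcal{F}C_b^\infty(\mathfrak{D},\Omega_X^{\mathbb{R}_+})$.
   Context: Setting. $\mathbb{R}_+:=(0,+\infty)$ and $\lambda$ is Lebesgue measure on $\mathbb{R}_+$. $X$ is a connected, oriented, non-compact $C^\infty$ Riemannian manifold with Riemannian volume $m$, gradient $\nabla^X$ and Laplace--Beltrami operator $\Delta^X$. $\mathcal{B}_c(X)$ and $\mathcal{O}_c(X)$ denote the families of Borel, resp. open, subsets of $X$ with compact closure; $\Lambda_{mk}:=\Lambda\times\mathbb{R}_+$ for $\Lambda\subset X$; $\mathcal{B}_c(X\times\mathbb{R}_+)$ is the family of Borel subsets of $X\times\mathbb{R}_+$ whose projection on $X$ belongs to $\mathcal{B}_c(X)$. The measure $\tilde\sigma$ on $X\times\mathbb{R}_+$ is $\tilde\sigma(dx,ds)=q(x,s)\,\lambda(ds)\,m(dx)$, $q(x,s)=\rho(x)p(x,s)$, where $\sigma(dx)=\rho(x)m(dx)$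 is a nonatomic Radon measure with $\rho>0$ $m$-a.e., and for $m$-a.e. $x$, $p(x,\cdot)>0$ $\lambda$-a.e. and $p(x,s)\lambda(ds)$ is a finite measure. It is assumed that $\tilde\sigma$ is infinite and that $\int_{\Lambda_{mk}}\max\{1,s\}\,q(x,s)\,\lambda(ds)m(dx)<\infty$ for every $\Lambda\in\mathcal{B}_c(X)$ (in particular $\tilde\sigma(\Lambda_{mk})<\infty$). Marked configuration space. $\Omega_X^{\mathbb{R}_+}$ is the set of all $\omega\subset X\times\mathbb{R}_+$ such that (a) distinct points $(x,s),(x',s')\in\omega$ have $x\ne x'$, and (b) the projection $\gamma$ of $\omega$ on $X$ is a locally finite subset of $X$; one writes $\omega=(\gamma,s)$, with $s_x$ the mark of $x\in\gamma$, and identifies $\gamma$ with the measure $\sum_{x\in\gamma}\varepsilon_x$. $\mathcal{B}(\Omega_X^{\mathbb{R}_+})$ is the smallest $\sigma$-algebra making all maps $\omega\mapsto\#(\omega\cap B)$, $B\in\mathcal{B}_c(X\times\mathbb{R}_+)$, measurable. $\langle f,\omega\rangle:=\sum_{(x,s)\in\omega}f(x,s)$. Marked Poisson measure. $\pi_{\tilde\sigma}$ is the unique probability measure on $\mathcal{B}(\Omega_X^{\mathbb{R}_+})$ such that for each $\Lambda\in\mathcal{O}_c(X)$ its image under $\omega\mapsto\omega\cap\Lambda_{mk}$ is $e^{-\tilde\sigma(\Lambda_{mk})}\sum_{n\ge0}\frac1{n!}\tilde\sigma_{\Lambda,n}$, where $\tilde\sigma_{\Lambda,0}$ is the unit mass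 at $\varnothing$ and $\tilde\sigma_{\Lambda,n}$ is the image of $\tilde\sigma^{\otimes n}$ on $\Lambda_{mk}^n$ under $((x_1,s_1),\dots,(x_n,s_n))\mapsto\{(x_1,s_1),\dots,(x_n,s_n)\}$ (defined where the $x_i$ are pairwise distinct). $L^2(\pi_{\tilde\sigma})=L^2(\Omega_X^{\mathbb{R}_+},\pi_{\tilde\sigma})$. Test functions. $\mathfrak{D}$ is the set of real $C^\infty$ functions $\varphi$ on $X\times\mathbb{R}_+$ with support in $\mathcal{B}_c(X\times\mathbb{R}_+)$ such that $\varphi$ and all its derivatives (with respect to $\nabla^X$ and $\partial/\partial s$) are bounded and for all $n\in\mathbb{N}$, $|\frac{\partial^n}{\partial s^n}\varphi(x,s)|\le C_{n,\varphi}(\max\{1,s\})^{-n}$. $\mathcal{F}C_b^\infty(\mathfrak{D},\Omega_X^{\mathbb{R}_+})$ is the set of functions $F(\omega)=g_F(\langle\varphi_1,\omega\rangle,\dots,\langle\varphi_N,\omega\rangle)$ ( * ) with $\varphi_j\in\mathfrak{D}$ and $g_F\in C_b^\infty(\mathbb{R}^N)$ (all derivatives bounded). Further standing assumption. $\sqrt q\in H_0^{1,2}(X\times\mathbb{R}_+)$: for every $A\in\mathcal{B}_c(X\times\mathbb{R}_+)$ the restriction of $\sqrt q$ to $A$ coincides with the restriction of some element of $H^{1,2}(X\times\mathbb{R}_+)$, the closure of $\mathfrak{D}$ in the norm $\|\varphi\|_{1,2}^2=\int(|\nabla^X\varphi|^2_{T_x(X)}+s^2|\partial_s\varphi|^2+|\varphi|^2)\,m(dx)\lambda(ds)$.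 Gradients. On $X\times\mathbb{R}_+$: $\nabla^{X\times\mathbb{R}_+}:=(\nabla^X,s\frac{\partial}{\partial s})$ with values in $T_{(x,s)}(X\times\mathbb{R}_+):=T_x(X)\dotplus\mathbb{R}$ (direct-sum scalar product). On $\Omega_X^{\mathbb{R}_+}$: $T_\omega(\Omega_X^{\mathbb{R}_+}):=L^2(X\to T(X)\dotplus\mathbb{R};\gamma)$ with scalar product $\int_X\langle V^1(x),V^2(x)\rangle_{T_x(X)\dotplus\mathbb{R}}\,\gamma(dx)$, and for $F$ of the form ( * ), $(\nabla^\Omega F)(\omega;x)=\sum_{j}\frac{\partial g_F}{\partial r_j}(\langle\varphi_1,\omega\rangle,\dots,\langle\varphi_N,\omega\rangle)\nabla^{X\times\mathbb{R}_+}\varphi_j(x,s_x)$, $x\in\gamma$. Divergence. For a vector field $\omega\mapsto V_\omega\in T_\omega(\Omega_X^{\mathbb{R}_+})$, $\mathrm{div}^\Omega_{\pi_{\tilde\sigma}}V$ is defined by $\int\langle V_\omega,\nabla^\Omega F(\omega)\rangle_{T_\omega(\Omega_X^{\mathbb{R}_+})}\pi_{\tilde\sigma}(d\omega)=-\int F\,\mathrm{div}^\Omega_{\pi_{\tilde\sigma}}V\,d\pi_{\tilde\sigma}$ for all $F\in\mathcal{F}C_b^\infty(\mathfrak{D},\Omega_X^{\mathbb{R}_+})$, provided it exists (the left side being continuous in $F$ on $L^2(\pi_{\tilde\sigma})$). Form and operator. $\mathcal{E}^\Omega_{\pi_{\tilde\sigma}}(F,G):=\int\langle\nabla^\Omega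 F(\omega),\nabla^\Omega G(\omega)\rangle_{T_\omega(\Omega_X^{\mathbb{R}_+})}\,\pi_{\tilde\sigma}(d\omega)$. For $F$ of the form ( * ), $$(H^\Omega_{\pi_{\tilde\sigma}}F)(\omega):=-\sum_{j,k=1}^N\frac{\partial^2g_F}{\partial r_j\partial r_k}(\langle\varphi_1,\omega\rangle,\dots,\langle\varphi_N,\omega\rangle)\big\langle\langle\nabla^{X\times\mathbb{R}_+}\varphi_j,\nabla^{X\times\mathbb{R}_+}\varphi_k\rangle_{T(X\times\mathbb{R}_+)},\omega\big\rangle+\sum_{j=1}^N\frac{\partial g_F}{\partial r_j}(\langle\varphi_1,\omega\rangle,\dots,\langle\varphi_N,\omega\rangle)\langle H\varphi_j,\omega\rangle,$$ where, for $\varphi\in\mathfrak{D}$, $H\varphi:=-\Delta^X\varphi-s^2\frac{\partial^2\varphi}{\partial s^2}-2s\frac{\partial\varphi}{\partial s}-\langle\nabla^{X\times\mathbb{R}_+}\log q,\nabla^{X\times\mathbb{R}_+}\varphi\rangle_{T(X\times\mathbb{R}_+)}$ (weak derivatives of $q$). (That $H^\Omega_{\pi_{\tilde\sigma}}F$, as an element of $L^2(\pi_{\tilde\sigma})$, does not depend on the representation ( * ) of $F$ is a consequence of the theorem.) *)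

theory Defs
  imports "HOL-Probability.Probability"
begin

section \<open>Smooth functions on open subsets of normed spaces\<close>

text \<open>\<open>S\<close> is meant to be an open subset of a finite-dimensional space; \<open>Ck_on k S f\<close> then says that
  \<open>f\<close> is of class \<open>C^k\<close> on \<open>S\<close>.\<close>

primrec Ck_on :: "nat \<Rightarrow> 'a::real_normed_vector set \<Rightarrow> ('a \<Rightarrow> 'b::real_normed_vector) \<Rightarrow> bool" where
  "Ck_on 0 S f \<longleftrightarrow> continuous_on S f"
| "Ck_on (Suc k) S f \<longleftrightarrow>
     (\<forall>y\<in>S. f differentiable (at y)) \<and> (\<forall>v. Ck_on k S (\<lambda>y. frechet_derivative f (at y) v))"

definition smooth_on :: "'a::real_normed_vector set \<Rightarrow> ('a \<Rightarrow> 'b::real_normed_vector) \<Rightarrow> bool" where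
  "smooth_on S f \<longleftrightarrow> (\<forall>k. Ck_on k S f)"

text \<open>\<open>D\<close> is a weak derivative of \<open>f\<close> in direction \<open>v\<close> on the open set \<open>U\<close>.\<close>

definition weak_deriv ::
  "'a::euclidean_space set \<Rightarrow> ('a \<Rightarrow> real) \<Rightarrow> 'a \<Rightarrow> ('a \<Rightarrow> real) \<Rightarrow> bool" where
  "weak_deriv U f v D \<longleftrightarrow>
     (\<forall>K. compact K \<and> K \<subseteq> U \<longrightarrow> set_integrable lborel K f \<and> set_integrable lborel K D) \<and>
     (\<forall>\<psi> :: 'a \<Rightarrow> real.
        smooth_on UNIV \<psi> \<and> (\<exists>K. compact K \<and> K \<subseteq> U \<and> (\<forall>y. y \<notin> K \<longrightarrow> \<psi> y = 0)) \<longrightarrow>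
        (LINT y:U|lborel. f y * frechet_derivative \<psi> (at y) v) = - (LINT y:U|lborel. D y * \<psi> y))"


section \<open>Riemannian manifolds\<close>

text \<open>The manifold \<open>X\<close> is the whole of a Hausdorff second countable type \<open>'x\<close>; a chart is its domain
  together with its coordinate map. The metric is given by its Gram matrix in each chart.\<close>

type_synonym ('x, 'n) chart = "'x set \<times> ('x \<Rightarrow> real ^ 'n)"

record ('x, 'n) riemannian =
  atlas :: "('x, 'n) chart set"
  gram :: "('x, 'n) chart \<Rightarrow> 'x \<Rightarrow> real ^ 'n ^ 'n"

abbreviation cdom :: "('x, 'n) chart \<Rightarrow> 'x set" where
  "cdom c \<equiv> fst c"

abbreviation cmap :: "('x, 'n) chart \<Rightarrow> 'x \<Rightarrow> real ^ 'n" where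
  "cmap c \<equiv> snd c"

abbreviation cimg :: "('x, 'n) chart \<Rightarrow> (real ^ 'n) set" where
  "cimg c \<equiv> cmap c ` cdom c"

abbreviation cinv :: "('x, 'n) chart \<Rightarrow> real ^ 'n \<Rightarrow> 'x" where
  "cinv c \<equiv> inv_into (cdom c) (cmap c)"

definition jac :: "('x, 'n::finite) chart \<Rightarrow> ('x, 'n) chart \<Rightarrow> 'x \<Rightarrow> real ^ 'n ^ 'n" where
  "jac c d x = matrix (frechet_derivative (cmap d \<circ> cinv c) (at (cmap c x)))"

definition oriented_smooth_atlas ::
  "('x::topological_space, 'n::finite) chart set \<Rightarrow> bool" where
  "oriented_smooth_atlas \<A> \<longleftrightarrow>
     (\<Union>c\<in>\<A>. cdom c) = UNIV \<and>
     (\<forall>c\<in>\<A>. open (cdom c) \<and> open (cimg c) \<and> homeomorphism (cdom c) (cimg c) (cmap c) (cinv c)) \<and>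
     (\<forall>c\<in>\<A>. \<forall>d\<in>\<A>. smooth_on (cmap c ` (cdom c \<inter> cdom d)) (cmap d \<circ> cinv c) \<and>
                    (\<forall>x\<in>cdom c \<inter> cdom d. det (jac c d x) > 0))"

definition oriented_riemannian_manifold ::
  "('x::{t2_space, second_countable_topology}, 'n::finite) riemannian \<Rightarrow> bool" where
  "oriented_riemannian_manifold M \<longleftrightarrow>
     oriented_smooth_atlas (atlas M) \<and>
     (\<forall>c\<in>atlas M. smooth_on (cimg c) (\<lambda>y. gram M c (cinv c y)) \<and>
        (\<forall>x\<in>cdom c. transpose (gram M c x) = gram M c x \<and>
                     (\<forall>v. v \<noteq> 0 \<longrightarrow> v \<bullet> (gram M c x *v v) > 0))) \<and>
     (\<forall>c\<in>atlas M. \<forall>d\<in>atlas M. \<forall>x\<in>cdom c \<inter> cdom d.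
        gram M c x = transpose (jac c d x) ** gram M d x ** jac c d x)"

definition chart_at :: "('x, 'n::finite) riemannian \<Rightarrow> 'x \<Rightarrow> ('x, 'n) chart" where
  "chart_at M x = (SOME c. c \<in> atlas M \<and> x \<in> cdom c)"

definition riemannian_volume ::
  "('x::topological_space, 'n::finite) riemannian \<Rightarrow> 'x measure \<Rightarrow> bool" where
  "riemannian_volume M m \<longleftrightarrow> sets m = sets borel \<and>
     (\<forall>c\<in>atlas M. \<forall>A\<in>sets borel. A \<subseteq> cdom c \<longrightarrow>
        emeasure m A =
          (\<integral>\<^sup>+y\<in>cmap c ` A. ennreal (sqrt (det (gram M c (cinv c y)))) \<partial>lborel))"

text \<open>A tangent vector is the compatible family of its coordinate vectors in all charts
  around the base point (and \<open>0\<close> in the other charts).\<close>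

type_synonym ('x, 'n) tangent = "('x, 'n) chart \<Rightarrow> real ^ 'n"

definition tangent_space ::
  "('x, 'n::finite) riemannian \<Rightarrow> 'x \<Rightarrow> ('x, 'n) tangent set" where
  "tangent_space M x = {v.
     (\<forall>c. \<not> (c \<in> atlas M \<and> x \<in> cdom c) \<longrightarrow> v c = 0) \<and>
     (\<forall>c\<in>atlas M. \<forall>d\<in>atlas M. x \<in> cdom c \<inter> cdom d \<longrightarrow> v d = jac c d x *v v c)}"

definition tinner ::
  "('x, 'n::finite) riemannian \<Rightarrow> 'x \<Rightarrow> ('x, 'n) tangent \<Rightarrow> ('x, 'n) tangent \<Rightarrow> real" where
  "tinner M x v w = (let c = chart_at M x in v c \<bullet> (gram M c x *v w c))"

definition chart_pd :: "('x, 'n::finite) chart \<Rightarrow> 'n \<Rightarrow> ('x \<Rightarrow> real) \<Rightarrow> 'x \<Rightarrow> real" where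
  "chart_pd c i f x = frechet_derivative (f \<circ> cinv c) (at (cmap c x)) (axis i 1)"

definition grad_X ::
  "('x, 'n::finite) riemannian \<Rightarrow> ('x \<Rightarrow> real) \<Rightarrow> 'x \<Rightarrow> ('x, 'n) tangent" where
  "grad_X M f x = (\<lambda>c. if c \<in> atlas M \<and> x \<in> cdom c
                       then matrix_inv (gram M c x) *v (\<chi> i. chart_pd c i f x) else 0)"

definition div_X ::
  "('x, 'n::finite) riemannian \<Rightarrow> ('x \<Rightarrow> ('x, 'n) tangent) \<Rightarrow> 'x \<Rightarrow> real" where
  "div_X M V x = (let c = chart_at M x in
     (\<Sum>i\<in>UNIV. chart_pd c i (\<lambda>z. sqrt (det (gram M c z)) * V z c $ i) x)
       / sqrt (det (gram M c x)))"

definition laplace_beltrami ::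
  "('x, 'n::finite) riemannian \<Rightarrow> ('x \<Rightarrow> real) \<Rightarrow> 'x \<Rightarrow> real" where
  "laplace_beltrami M f = div_X M (grad_X M f)"

text \<open>Christoffel symbol with upper index \<open>k\<close> and lower indices \<open>i\<close>, \<open>j\<close>.\<close>

definition christoffel ::
  "('x, 'n::finite) riemannian \<Rightarrow> ('x, 'n) chart \<Rightarrow> 'x \<Rightarrow> 'n \<Rightarrow> 'n \<Rightarrow> 'n \<Rightarrow> real" where
  "christoffel M c x k i j = (1 / 2) * (\<Sum>l\<in>UNIV. matrix_inv (gram M c x) $ k $ l *
     (chart_pd c i (\<lambda>z. gram M c z $ j $ l) x + chart_pd c j (\<lambda>z. gram M c z $ i $ l) x
        - chart_pd c l (\<lambda>z. gram M c z $ i $ j) x))"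

text \<open>Components, in the chart \<open>c\<close>, of the iterated covariant derivative of a function (Levi-Civita
  connection): \<open>cov_deriv M c f [i1, ..., ik]\<close> is the component of the \<open>k\<close>-fold one, the last
  differentiation coming first.\<close>

function cov_deriv ::
  "('x, 'n::finite) riemannian \<Rightarrow> ('x, 'n) chart \<Rightarrow> ('x \<Rightarrow> real) \<Rightarrow> 'n list \<Rightarrow> 'x \<Rightarrow> real" where
  "cov_deriv M c f [] = f"
| "cov_deriv M c f (i # js) = (\<lambda>x. chart_pd c i (cov_deriv M c f js) x -
     (\<Sum>r<length js. \<Sum>l\<in>UNIV. christoffel M c x l i (js ! r) * cov_deriv M c f (js[r := l]) x))"
  by pat_completeness auto
termination
  by (relation "Wellfounded.measure (\<lambda>(M, c, f, js). length js)") auto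

definition cov_deriv_norm ::
  "('x, 'n::finite) riemannian \<Rightarrow> ('x, 'n) chart \<Rightarrow> nat \<Rightarrow> ('x \<Rightarrow> real) \<Rightarrow> 'x \<Rightarrow> real" where
  "cov_deriv_norm M c k f x = sqrt
     (\<Sum>ks\<in>{ks. length ks = k}. \<Sum>js\<in>{js. length js = k}.
        (\<Prod>r<k. matrix_inv (gram M c x) $ (ks ! r) $ (js ! r)) *
        cov_deriv M c f ks x * cov_deriv M c f js x)"


section \<open>The space of points with marks\<close>

text \<open>Functions of \<open>(x, s)\<close> live on \<open>'x \<times> real\<close>; only their values for \<open>s > 0\<close> matter.\<close>

definition Bc :: "'x::topological_space set set" where
  "Bc = {A. A \<in> sets borel \<and> compact (closure A)}"

definition Oc :: "'x::topological_space set set" where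
  "Oc = {A. open A \<and> compact (closure A)}"

definition mk :: "'x set \<Rightarrow> ('x \<times> real) set" where
  "mk A = A \<times> {0<..}"

definition Bc_mk :: "('x::topological_space \<times> real) set set" where
  "Bc_mk = {B. B \<in> sets borel \<and> B \<subseteq> mk UNIV \<and> fst ` B \<in> Bc}"

definition lebesgue_pos :: "real measure" where
  "lebesgue_pos = restrict_space lborel {0<..}"

definition deriv_s :: "nat \<Rightarrow> ('x \<times> real \<Rightarrow> real) \<Rightarrow> 'x \<times> real \<Rightarrow> real" where
  "deriv_s n \<phi> z = (deriv ^^ n) (\<lambda>t. \<phi> (fst z, t)) (snd z)"

definition smooth_mk ::
  "('x, 'n::finite) riemannian \<Rightarrow> ('x \<times> real \<Rightarrow> real) \<Rightarrow> bool" where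
  "smooth_mk M \<phi> \<longleftrightarrow>
     (\<forall>c\<in>atlas M. smooth_on (cimg c \<times> {0<..}) (\<lambda>y. \<phi> (cinv c (fst y), snd y)))"

definition support_mk :: "('x::topological_space \<times> real \<Rightarrow> real) \<Rightarrow> ('x \<times> real) set" where
  "support_mk \<phi> = closure {z \<in> mk UNIV. \<phi> z \<noteq> 0} \<inter> mk UNIV"

definition test_functions ::
  "('x::topological_space, 'n::finite) riemannian \<Rightarrow> ('x \<times> real \<Rightarrow> real) set" where
  "test_functions M = {\<phi>.
     smooth_mk M \<phi> \<and> support_mk \<phi> \<in> Bc_mk \<and>
     (\<forall>k l. \<exists>C. \<forall>c\<in>atlas M. \<forall>x\<in>cdom c. \<forall>s>0.
        cov_deriv_norm M c k (\<lambda>z. deriv_s l \<phi> (z, s)) x \<le> C) \<and>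
     (\<forall>n. \<exists>C. \<forall>x. \<forall>s>0. \<bar>deriv_s n \<phi> (x, s)\<bar> \<le> C / max 1 s ^ n)}"

text \<open>The tangent space of \<open>X \<times> (0, \<infinity>)\<close> at \<open>(x, s)\<close> is \<open>T_x(X) \<times> real\<close>, and the gradient is
  \<open>(\<nabla>, s \<partial>/\<partial>s)\<close>.\<close>

type_synonym ('x, 'n) mtangent = "('x, 'n) tangent \<times> real"

definition minner ::
  "('x, 'n::finite) riemannian \<Rightarrow> 'x \<Rightarrow> ('x, 'n) mtangent \<Rightarrow> ('x, 'n) mtangent \<Rightarrow> real" where
  "minner M x v w = tinner M x (fst v) (fst w) + snd v * snd w"

definition mscale :: "real \<Rightarrow> ('x, 'n::finite) mtangent \<Rightarrow> ('x, 'n) mtangent" where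
  "mscale a v = (\<lambda>c. a *\<^sub>R fst v c, a * snd v)"

definition grad_mk ::
  "('x, 'n::finite) riemannian \<Rightarrow> ('x \<times> real \<Rightarrow> real) \<Rightarrow> 'x \<times> real \<Rightarrow> ('x, 'n) mtangent" where
  "grad_mk M \<phi> z = (grad_X M (\<lambda>x. \<phi> (x, snd z)) (fst z), snd z * deriv_s 1 \<phi> z)"

subsection \<open>The Sobolev spaces\<close>

definition sobolev_sq ::
  "('x, 'n::finite) riemannian \<Rightarrow> 'x measure \<Rightarrow> ('x \<times> real \<Rightarrow> real) \<Rightarrow> ennreal" where
  "sobolev_sq M m \<phi> =
     (\<integral>\<^sup>+z. ennreal (minner M (fst z) (grad_mk M \<phi> z) (grad_mk M \<phi> z) + (\<phi> z)\<^sup>2)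
        \<partial>(m \<Otimes>\<^sub>M lebesgue_pos))"

text \<open>The closure of the test functions of finite norm: elements of the completion are
  identified with their \<open>L\<^sup>2\<close>-limits.\<close>

definition H12 ::
  "('x::topological_space, 'n::finite) riemannian \<Rightarrow> 'x measure \<Rightarrow> ('x \<times> real \<Rightarrow> real) set" where
  "H12 M m = {u. u \<in> borel_measurable (m \<Otimes>\<^sub>M lebesgue_pos) \<and>
     (\<exists>\<phi> :: nat \<Rightarrow> 'x \<times> real \<Rightarrow> real.
        (\<forall>n. \<phi> n \<in> test_functions M \<and> sobolev_sq M m (\<phi> n) < \<infinity>) \<and>
        (\<forall>\<epsilon>>0. \<exists>n0. \<forall>i\<ge>n0. \<forall>j\<ge>n0. sobolev_sq M m (\<lambda>z. \<phi> i z - \<phi> j z) < ennreal \<epsilon>) \<and>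
        (\<lambda>n. \<integral>\<^sup>+z. ennreal ((\<phi> n z - u z)\<^sup>2) \<partial>(m \<Otimes>\<^sub>M lebesgue_pos)) \<longlonglongrightarrow> 0)}"

definition H12_loc ::
  "('x::topological_space, 'n::finite) riemannian \<Rightarrow> 'x measure \<Rightarrow> ('x \<times> real \<Rightarrow> real) set" where
  "H12_loc M m = {v. \<forall>A\<in>Bc_mk. \<exists>u\<in>H12 M m. AE z in m \<Otimes>\<^sub>M lebesgue_pos. z \<in> A \<longrightarrow> v z = u z}"

text \<open>\<open>W\<close> is a version of the weak gradient \<open>(\<nabla> q, s \<partial>q/\<partial>s)\<close>: lowering the index of its first
  component, and dividing the second one by \<open>s\<close>, gives the weak partial derivatives of \<open>q\<close> in
  each chart.\<close>

definition is_weak_grad_mk ::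
  "('x, 'n::finite) riemannian \<Rightarrow> ('x \<times> real \<Rightarrow> real) \<Rightarrow> ('x \<times> real \<Rightarrow> ('x, 'n) mtangent) \<Rightarrow> bool"
where
  "is_weak_grad_mk M q W \<longleftrightarrow>
     (\<forall>x. \<forall>s>0. fst (W (x, s)) \<in> tangent_space M x) \<and>
     (\<forall>c\<in>atlas M.
        (\<forall>i. weak_deriv (cimg c \<times> {0<..}) (\<lambda>y. q (cinv c (fst y), snd y)) (axis i 1, 0)
           (\<lambda>y. (gram M c (cinv c (fst y)) *v fst (W (cinv c (fst y), snd y)) c) $ i)) \<and>
        weak_deriv (cimg c \<times> {0<..}) (\<lambda>y. q (cinv c (fst y), snd y)) (0, 1)
           (\<lambda>y. snd (W (cinv c (fst y), snd y)) / snd y))"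

definition weak_grad_mk ::
  "('x, 'n::finite) riemannian \<Rightarrow> ('x \<times> real \<Rightarrow> real) \<Rightarrow> 'x \<times> real \<Rightarrow> ('x, 'n) mtangent" where
  "weak_grad_mk M q = (SOME W. is_weak_grad_mk M q W)"

definition grad_log_mk ::
  "('x, 'n::finite) riemannian \<Rightarrow> ('x \<times> real \<Rightarrow> real) \<Rightarrow> 'x \<times> real \<Rightarrow> ('x, 'n) mtangent" where
  "grad_log_mk M q z = mscale (1 / q z) (weak_grad_mk M q z)"

definition H_mk ::
  "('x, 'n::finite) riemannian \<Rightarrow> ('x \<times> real \<Rightarrow> real) \<Rightarrow> ('x \<times> real \<Rightarrow> real) \<Rightarrow> 'x \<times> real \<Rightarrow> real"
where
  "H_mk M q \<phi> z =
     - laplace_beltrami M (\<lambda>x. \<phi> (x, snd z)) (fst z)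
     - (snd z)\<^sup>2 * deriv_s 2 \<phi> z - 2 * snd z * deriv_s 1 \<phi> z
     - minner M (fst z) (grad_log_mk M q z) (grad_mk M \<phi> z)"


section \<open>Measures\<close>

definition radon_measure :: "'x::topological_space measure \<Rightarrow> bool" where
  "radon_measure \<mu> \<longleftrightarrow> sets \<mu> = sets borel \<and> (\<forall>K. compact K \<longrightarrow> emeasure \<mu> K < \<infinity>) \<and>
     (\<forall>B\<in>sets borel. emeasure \<mu> B = (SUP K\<in>{K. compact K \<and> K \<subseteq> B}. emeasure \<mu> K))"

definition nonatomic :: "'a measure \<Rightarrow> bool" where
  "nonatomic \<mu> \<longleftrightarrow> (\<forall>A\<in>sets \<mu>. emeasure \<mu> A > 0 \<longrightarrow>
     (\<exists>B\<in>sets \<mu>. B \<subseteq> A \<and> 0 < emeasure \<mu> B \<and> emeasure \<mu> B < emeasure \<mu> A))"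

definition sigma_tilde :: "'x measure \<Rightarrow> ('x \<times> real \<Rightarrow> real) \<Rightarrow> ('x \<times> real) measure" where
  "sigma_tilde m q = density (m \<Otimes>\<^sub>M lebesgue_pos) (\<lambda>z. ennreal (q z))"


section \<open>Marked configurations\<close>

definition marked_configs :: "('x::topological_space \<times> real) set set" where
  "marked_configs = {\<omega>. \<omega> \<subseteq> mk UNIV \<and> inj_on fst \<omega> \<and> (\<forall>K. compact K \<longrightarrow> finite (fst ` \<omega> \<inter> K))}"

definition config_space :: "('x::topological_space \<times> real) set measure" where
  "config_space = sigma marked_configs
     {(\<lambda>\<omega>. card (\<omega> \<inter> B)) -` A \<inter> marked_configs | A B. B \<in> Bc_mk}"

definition mark :: "('x \<times> real) set \<Rightarrow> 'x \<Rightarrow> real" where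
  "mark \<omega> x = (THE s. (x, s) \<in> \<omega>)"

definition pairing :: "('x \<times> real \<Rightarrow> real) \<Rightarrow> ('x \<times> real) set \<Rightarrow> real" where
  "pairing f \<omega> = (\<Sum>\<^sub>\<infinity>z\<in>\<omega>. f z)"

text \<open>The image of the \<open>n\<close>-fold product of \<open>\<sigma>\<close> on \<open>mk \<Lambda>\<close> under \<open>(z1, ..., zn) \<mapsto> {z1, ..., zn}\<close>; for
  \<open>n = 0\<close> it is the unit mass at the empty configuration.\<close>

definition config_measure ::
  "('x::topological_space \<times> real) measure \<Rightarrow> 'x set \<Rightarrow> nat \<Rightarrow> ('x \<times> real) set measure" where
  "config_measure \<sigma> \<Lambda> n =
     distr (restrict_space (\<Pi>\<^sub>M i\<in>{..<n}. restrict_space \<sigma> (mk \<Lambda>)) {z. inj_on (fst \<circ> z) {..<n}})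
       config_space (\<lambda>z. z ` {..<n})"

definition marked_poisson ::
  "('x::topological_space \<times> real) measure \<Rightarrow> ('x \<times> real) set measure \<Rightarrow> bool" where
  "marked_poisson \<sigma> P \<longleftrightarrow> prob_space P \<and> sets P = sets config_space \<and>
     (\<forall>\<Lambda>\<in>Oc. \<forall>A\<in>sets config_space.
        emeasure (distr P config_space (\<lambda>\<omega>. \<omega> \<inter> mk \<Lambda>)) A =
        ennreal (exp (- measure \<sigma> (mk \<Lambda>))) *
          (\<Sum>n. ennreal (1 / fact n) * emeasure (config_measure \<sigma> \<Lambda> n) A))"

definition square_integrable :: "'a measure \<Rightarrow> ('a \<Rightarrow> real) \<Rightarrow> bool" where
  "square_integrable P f \<longleftrightarrow> f \<in> borel_measurable P \<and> integrable P (\<lambda>\<omega>. (f \<omega>)\<^sup>2)"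

definition L2_inner :: "'a measure \<Rightarrow> ('a \<Rightarrow> real) \<Rightarrow> ('a \<Rightarrow> real) \<Rightarrow> real" where
  "L2_inner P f g = (\<integral>\<omega>. f \<omega> * g \<omega> \<partial>P)"


section \<open>Smooth cylinder functions\<close>

text \<open>A function on \<open>real^N\<close>, with \<open>N\<close> a number, is a function of a sequence \<open>r :: nat \<Rightarrow> real\<close> that
  depends on \<open>r 0, ..., r (N - 1)\<close> only (continuity is with respect to the product topology).\<close>

definition pd :: "nat \<Rightarrow> ((nat \<Rightarrow> real) \<Rightarrow> real) \<Rightarrow> (nat \<Rightarrow> real) \<Rightarrow> real" where
  "pd j g r = deriv (\<lambda>t. g (r(j := t))) (r j)"

definition Cb_infinity :: "nat \<Rightarrow> ((nat \<Rightarrow> real) \<Rightarrow> real) set" where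
  "Cb_infinity N = {g.
     (\<forall>r r'. (\<forall>j<N. r j = r' j) \<longrightarrow> g r = g r') \<and>
     (\<forall>js. set js \<subseteq> {..<N} \<longrightarrow>
        continuous_on UNIV (foldr pd js g) \<and> bounded (range (foldr pd js g)) \<and>
        (\<forall>j<N. \<forall>r. (\<lambda>t. foldr pd js g (r(j := t))) differentiable (at (r j))))}"

text \<open>\<open>F\<close> is a smooth cylinder function, represented through \<open>N\<close>, \<open>\<phi>\<close> and \<open>g\<close>. The gradient and the
  operator below are given in terms of a representation.\<close>

definition represents ::
  "('x::topological_space, 'n::finite) riemannian \<Rightarrow> nat \<Rightarrow> (nat \<Rightarrow> 'x \<times> real \<Rightarrow> real) \<Rightarrow>
   ((nat \<Rightarrow> real) \<Rightarrow> real) \<Rightarrow> (('x \<times> real) set \<Rightarrow> real) \<Rightarrow> bool" where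
  "represents M N \<phi> g F \<longleftrightarrow> (\<forall>j<N. \<phi> j \<in> test_functions M) \<and> g \<in> Cb_infinity N \<and>
     (\<forall>\<omega>\<in>marked_configs. F \<omega> = g (\<lambda>j. pairing (\<phi> j) \<omega>))"

type_synonym ('x, 'n) vector_field = "('x \<times> real) set \<Rightarrow> 'x \<Rightarrow> ('x, 'n) mtangent"

definition config_tangent_space ::
  "('x, 'n::finite) riemannian \<Rightarrow> ('x \<times> real) set \<Rightarrow> ('x \<Rightarrow> ('x, 'n) mtangent) set" where
  "config_tangent_space M \<omega> = {V. (\<forall>x\<in>fst ` \<omega>. fst (V x) \<in> tangent_space M x) \<and>
     (\<lambda>x. minner M x (V x) (V x)) summable_on fst ` \<omega>}"

definition config_inner ::
  "('x, 'n::finite) riemannian \<Rightarrow> ('x \<times> real) set \<Rightarrow>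
   ('x \<Rightarrow> ('x, 'n) mtangent) \<Rightarrow> ('x \<Rightarrow> ('x, 'n) mtangent) \<Rightarrow> real" where
  "config_inner M \<omega> V W = (\<Sum>\<^sub>\<infinity>x\<in>fst ` \<omega>. minner M x (V x) (W x))"

definition grad_config ::
  "('x, 'n::finite) riemannian \<Rightarrow> nat \<Rightarrow> (nat \<Rightarrow> 'x \<times> real \<Rightarrow> real) \<Rightarrow> ((nat \<Rightarrow> real) \<Rightarrow> real) \<Rightarrow>
   ('x, 'n) vector_field" where
  "grad_config M N \<phi> g \<omega> x =
     (let r = (\<lambda>j. pairing (\<phi> j) \<omega>); v = (\<lambda>j. grad_mk M (\<phi> j) (x, mark \<omega> x)) in
      (\<lambda>c. \<Sum>j<N. pd j g r *\<^sub>R fst (v j) c, \<Sum>j<N. pd j g r * snd (v j)))"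

definition dirichlet_form ::
  "('x, 'n::finite) riemannian \<Rightarrow> ('x \<times> real) set measure \<Rightarrow>
   ('x, 'n) vector_field \<Rightarrow> ('x, 'n) vector_field \<Rightarrow> real" where
  "dirichlet_form M P dF dG = (\<integral>\<omega>. config_inner M \<omega> (dF \<omega>) (dG \<omega>) \<partial>P)"

definition H_config ::
  "('x, 'n::finite) riemannian \<Rightarrow> ('x \<times> real \<Rightarrow> real) \<Rightarrow> nat \<Rightarrow> (nat \<Rightarrow> 'x \<times> real \<Rightarrow> real) \<Rightarrow>
   ((nat \<Rightarrow> real) \<Rightarrow> real) \<Rightarrow> ('x \<times> real) set \<Rightarrow> real" where
  "H_config M q N \<phi> g \<omega> = (let r = (\<lambda>j. pairing (\<phi> j) \<omega>) in
     - (\<Sum>j<N. \<Sum>k<N. pd j (pd k g) r *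
          pairing (\<lambda>z. minner M (fst z) (grad_mk M (\<phi> j) z) (grad_mk M (\<phi> k) z)) \<omega>)
     + (\<Sum>j<N. pd j g r * pairing (H_mk M q (\<phi> j)) \<omega>))"

text \<open>\<open>D\<close> is (a version of) the divergence of the vector field \<open>V\<close> with respect to \<open>P\<close>.\<close>

definition has_divergence ::
  "('x::topological_space, 'n::finite) riemannian \<Rightarrow> ('x \<times> real) set measure \<Rightarrow>
   ('x, 'n) vector_field \<Rightarrow> (('x \<times> real) set \<Rightarrow> real) \<Rightarrow> bool" where
  "has_divergence M P V D \<longleftrightarrow>
     (\<forall>\<omega>\<in>marked_configs. V \<omega> \<in> config_tangent_space M \<omega>) \<and> square_integrable P D \<and>
     (\<forall>N \<phi> g F. represents M N \<phi> g F \<longrightarrow>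
        integrable P (\<lambda>\<omega>. config_inner M \<omega> (V \<omega>) (grad_config M N \<phi> g \<omega>)) \<and>
        (\<integral>\<omega>. config_inner M \<omega> (V \<omega>) (grad_config M N \<phi> g \<omega>) \<partial>P) = - (\<integral>\<omega>. F \<omega> * D \<omega> \<partial>P))"

end

theory Submission
  imports Defs
begin

text \<open>Fix a relatively compact open \<open>La\<close> that contains the bases of all test functions. Under the marked
Poisson measure the part of a configuration over \<open>La\<close> is a Poisson number of independent points, so
the claim is a statement about \<open>n\<close> points for each \<open>n\<close>, with the product of the restrictions of the
intensity (\<open>one_particle_to_configurations\<close>). Writing \<open>\<Gamma>(f, g)\<close> for the scalar product of
the gradients \<open>(\<nabla>, s \<partial>/\<partial>s)\<close>, the difference of the two sides is a sum, over the points \<open>x\<close> and over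
\<open>j\<close>, of \<open>\<Gamma>(\<phi>\<^sub>j, f)(x) - f(x) (H \<phi>\<^sub>j)(x)\<close>, where \<open>f(x) = G \<cdot> \<partial>\<^sub>j g\<close> is seen as a function of \<open>x\<close> alone, the
other points being fixed: the chain rule for \<open>\<Gamma>\<close> produces the second order part of the generator.
By Fubini it suffices that this has integral \<open>0\<close> against \<open>q\<close> (\<open>one_particle_ibp\<close>).

The one-particle formula is a divergence theorem. In a chart, and for \<open>f\<close> with compact support there, it
is the definition of the weak derivatives of \<open>q\<close>, tested against the flux of \<open>\<phi>\<close> times \<open>f\<close>. Smooth bumps
reduce functions that vanish for marks outside a compact interval to this case, and a cutoff in \<open>log s\<close>,
whose gradient \<open>s \<partial>/\<partial>s\<close> tends to \<open>0\<close> uniformly, reduces bounded functions with bounded \<open>\<Gamma>(\<phi>, f)\<close> to them.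

That \<open>q\<close> has weak derivatives comes from \<open>\<surd>q\<close>: locally \<open>q = u\<^sup>2\<close> with \<open>u\<close> a limit of test functions \<open>\<phi>\<^sub>k\<close>
in the Sobolev norm, so \<open>2 \<phi>\<^sub>k \<nabla>\<phi>\<^sub>k\<close> converges to \<open>2 u \<nabla>u\<close> locally in \<open>L\<^sup>1\<close>. Moreover \<open>|\<nabla>q|\<^sup>2/q = 4 |\<nabla>u|\<^sup>2\<close> is
integrable, which makes \<open>H \<phi>\<close> square integrable with respect to \<open>q\<close>, and then sums of \<open>H \<phi>\<close> over a Poisson
configuration are square integrable too (\<open>pairing_L2\<close>).

Throughout, \<open>ph\<close> and \<open>psi\<close> denote test functions, \<open>La\<close> an open subset of the manifold and, in the last two sections, \<open>om\<close> a configuration;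
\<open>hat c f\<close> is \<open>f\<close> read in the chart \<open>c\<close>, and \<open>co c\<close>, \<open>pt c\<close> pass between points and coordinates.\<close>

abbreviation NN :: "('a::euclidean_space => real) => ennreal" where
 "NN f \<equiv> (nn_integral lborel (%y. ennreal (f y)))"

abbreviation FD :: "('a::real_normed_vector \<Rightarrow> 'b::real_normed_vector) \<Rightarrow> 'a \<Rightarrow> 'a \<Rightarrow> 'b" where
 "FD f y \<equiv> frechet_derivative f (at y)"

section \<open>Calculus of smooth functions\<close>

lemma has_derivative_cong_open:
 assumes "open S" "y : S" "!!z. z : S ==> f z = g z"
 shows "(f has_derivative f') (at y) \<longleftrightarrow> (g has_derivative f') (at y)"
 using assms has_derivative_transform_within_open[of f f' y UNIV S g]
  has_derivative_transform_within_open[of g f' y UNIV S f] by auto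

lemma frechet_derivative_cong_open:
 assumes "open S" "y : S" "!!z. z : S ==> f z = g z"
 shows "FD f y = FD g y"
 unfolding frechet_derivative_def using has_derivative_cong_open[OF assms] by simp

lemma differentiable_cong_open:
 assumes "open S" "y : S" "!!z. z : S ==> f z = g z"
 shows "f differentiable (at y) \<longleftrightarrow> g differentiable (at y)"
 unfolding differentiable_def using has_derivative_cong_open[OF assms] by simp

lemma frechet_derivative_eqI: "(f has_derivative f') (at x) ==> FD f x = f'"
 using frechet_derivative_at by metis

lemma Ck_on_cong:
 assumes "open S" "!!y. y : S ==> f y = g y" "Ck_on k S f"
 shows "Ck_on k S g"
 using assms(2,3)
proof (induction k arbitrary: f g)
 case 0
 thus ?case by (auto cong: continuous_on_cong)
next
 case (Suc k)
 have "Ck_on k S (%y. FD g y v)" for v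
 proof (rule Suc.IH[of "%y. FD f y v"])
  show "FD f y v = FD g y v" if "y : S" for y using frechet_derivative_cong_open[OF assms(1) that, of f g] Suc.prems(1) by simp
  show "Ck_on k S (%y. FD f y v)" using Suc.prems(2) by simp
 qed
 moreover have "g differentiable (at y)" if "y : S" for y using differentiable_cong_open[OF assms(1) that, of f g] Suc.prems that by simp
 ultimately show ?case by simp
qed

lemma smooth_on_cong:
 assumes "open S" "!!y. y : S ==> f y = g y" "smooth_on S f"
 shows "smooth_on S g"
 using assms Ck_on_cong unfolding smooth_on_def by blast

lemma Ck_on_subset: "Ck_on k S f ==> T <= S ==> Ck_on k T f"
proof (induction k arbitrary: f)
 case 0
 thus ?case using continuous_on_subset by simp blast
next
 case (Suc k)
 thus ?case by simp blast
qed

lemma smooth_on_subset: "smooth_on S f ==> T <= S ==> smooth_on T f"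
 unfolding smooth_on_def using Ck_on_subset by blast

lemma Ck_on_local:
 assumes "!!y. y : S ==> EX T. open T & y : T & Ck_on k T f"
 shows "Ck_on k S f"
 using assms
proof (induction k arbitrary: f)
 case 0
 show ?case unfolding Ck_on.simps
 proof (rule continuous_at_imp_continuous_on, rule ballI)
  fix y assume "y : S"
  then obtain T where "open T" "y : T" "continuous_on T f" using 0 by (metis Ck_on.simps(1))
  thus "isCont f y" using continuous_on_eq_continuous_at by blast
 qed
next
 case (Suc k)
 have "Ck_on k S (%y. FD f y v)" for v by (rule Suc.IH) (metis Suc.prems Ck_on.simps(2))
 moreover have "f differentiable (at y)" if "y : S" for y using Suc.prems[OF that] by (metis Ck_on.simps(2))
 ultimately show ?case by (metis Ck_on.simps(2))
qed

lemma smooth_on_local: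
 assumes "!!y. y : S ==> EX T. open T & y : T & smooth_on T f"
 shows "smooth_on S f"
 unfolding smooth_on_def
proof
 fix k show "Ck_on k S f" by (rule Ck_on_local) (use assms in \<open>unfold smooth_on_def, metis\<close>)
qed

lemma smooth_on_differentiable: "smooth_on S f ==> y : S ==> f differentiable (at y)"
 unfolding smooth_on_def by (metis Ck_on.simps(2))

lemma smooth_on_has_derivative:
 "smooth_on S f ==> y : S ==> (f has_derivative FD f y) (at y)" using smooth_on_differentiable frechet_derivative_works by blast

lemma smooth_on_continuous: "smooth_on S f ==> continuous_on S f"
 unfolding smooth_on_def by (metis Ck_on.simps(1))

lemma smooth_on_frechet: "smooth_on S f ==> smooth_on S (%y. FD f y v)"
 unfolding smooth_on_def by (metis Ck_on.simps(2))

lemma smooth_on_derivI: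
 assumes "!!y. y : S ==> f differentiable (at y)"
  and "!!v. smooth_on S (%y. FD f y v)"
 shows "smooth_on S f"
 unfolding smooth_on_def
proof
 fix k
 have "Ck_on (Suc k) S f" for k using assms by (auto simp: smooth_on_def)
 moreover have "Ck_on 0 S f" using assms(1) by (auto intro!: continuous_at_imp_continuous_on differentiable_imp_continuous_within)
 ultimately show "Ck_on k S f" by (cases k) auto
qed

lemma Ck_on_const: "Ck_on k S (%y. c)"
 by (induction k arbitrary: c) auto

lemma smooth_on_const [intro, simp]: "smooth_on S (%y. c)"
 by (simp add: smooth_on_def Ck_on_const)

lemma smooth_on_bounded_linear:
 assumes "bounded_linear L"
 shows "smooth_on S L"
proof (rule smooth_on_derivI)
 have d: "(L has_derivative L) (at y)" for y using assms bounded_linear_imp_has_derivative by blast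
 show "L differentiable (at y)" for y using d differentiable_def by blast
 show "smooth_on S (%y. FD L y v)" for v using frechet_derivative_eqI[OF d] by simp
qed

lemma Ck_on_linear_image:
 assumes L: "bounded_linear L" and S: "open S" and f: "Ck_on k S f"
 shows "Ck_on k S (%y. L (f y))"
 using f
proof (induction k arbitrary: f)
 case 0
 thus ?case by (auto intro!: bounded_linear.continuous_on[OF L])
next
 case (Suc k)
 have d: "((%y. L (f y)) has_derivative (%v. L (FD f y v))) (at y)"
  if "y : S" for y using that Suc.prems frechet_derivative_works by (auto intro!: bounded_linear.has_derivative[OF L])
 have "Ck_on k S (%y. frechet_derivative (%y. L (f y)) (at y) v)" for v by (rule Ck_on_cong[OF S, of "%y. L (FD f y v)"])
  (use Suc frechet_derivative_eqI[OF d] in auto)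
 thus ?case using d by (auto simp: differentiable_def)
qed

lemma smooth_on_linear_image:
 "bounded_linear L ==> open S ==> smooth_on S f ==> smooth_on S (%y. L (f y))" unfolding smooth_on_def using Ck_on_linear_image by blast

lemma Ck_on_add:
 assumes S: "open S" and "Ck_on k S f" "Ck_on k S g"
 shows "Ck_on k S (%y. f y + g y)"
 using assms(2,3)
proof (induction k arbitrary: f g)
 case 0
 thus ?case by (auto intro!: continuous_intros)
next
 case (Suc k)
 have d: "((%y. f y + g y) has_derivative
  (%v. FD f y v + FD g y v)) (at y)"
  if "y : S" for y using that Suc.prems frechet_derivative_works by (auto intro!: has_derivative_add)
 have "Ck_on k S (%y. FD (%y. f y + g y) y v)" for v by (rule Ck_on_cong[OF S, of "%y. FD f y v + FD g y v"])
  (use Suc frechet_derivative_eqI[OF d] in auto)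
 thus ?case using d by (auto simp: differentiable_def)
qed

lemma smooth_on_add: "open S ==> smooth_on S f ==> smooth_on S g ==> smooth_on S (%y. f y + g y)"
 unfolding smooth_on_def using Ck_on_add by blast

lemma smooth_on_uminus: "open S ==> smooth_on S f ==> smooth_on S (%y. - f y)"
 using smooth_on_linear_image[of uminus S f] by (simp add: bounded_linear_minus bounded_linear_ident)

lemma smooth_on_diff: "open S ==> smooth_on S f ==> smooth_on S g ==> smooth_on S (%y. f y - g y)"
 using smooth_on_add[of S f "%y. - g y"] smooth_on_uminus[of S g] by simp

lemma smooth_on_sum:
 assumes "open S" "!!i. i : I ==> smooth_on S (f i)"
 shows "smooth_on S (%y. SUM i:I. f i y)"
 using assms(2) by (induction I rule: infinite_finite_induct) (auto intro: smooth_on_add[OF assms(1)])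

lemma Ck_on_Suc_imp: "Ck_on (Suc k) S f ==> Ck_on k S f"
proof (induction k arbitrary: f)
 case 0
 thus ?case by (auto intro!: continuous_at_imp_continuous_on differentiable_imp_continuous_within)
next
 case (Suc k)
 thus ?case by auto
qed

lemma Ck_on_mult:
 fixes f g :: "'a::real_normed_vector => real"
 assumes S: "open S" and "Ck_on k S f" "Ck_on k S g"
 shows "Ck_on k S (%y. f y * g y)"
 using assms(2,3)
proof (induction k arbitrary: f g)
 case 0
 thus ?case by (auto intro!: continuous_intros)
next
 case (Suc k)
 have d: "((%y. f y * g y) has_derivative
  (%v. f y * FD g y v + FD f y v * g y)) (at y)"
  if "y : S" for y using that Suc.prems frechet_derivative_works by (auto intro!: has_derivative_mult)
 have fg: "Ck_on k S f" "Ck_on k S g" using Suc.prems Ck_on_Suc_imp by blast+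
 have "Ck_on k S (%y. FD (%y. f y * g y) y v)" for v by (rule Ck_on_cong[OF S, of "%y. f y * FD g y v + FD f y v * g y"])
  (use Suc fg frechet_derivative_eqI[OF d] in \<open>auto intro!: Ck_on_add[OF S]\<close>)
 thus ?case using d by (auto simp: differentiable_def)
qed

lemma smooth_on_mult:
 fixes f g :: "'a::real_normed_vector => real"
 shows "open S ==> smooth_on S f ==> smooth_on S g ==> smooth_on S (%y. f y * g y)"
 unfolding smooth_on_def using Ck_on_mult by blast

lemma smooth_on_prod:
 fixes f :: "'i => 'a::real_normed_vector => real"
 assumes "open S" "!!i. i : I ==> smooth_on S (f i)"
 shows "smooth_on S (%y. PROD i:I. f i y)"
 using assms(2) by (induction I rule: infinite_finite_induct) (auto intro: smooth_on_mult[OF assms(1)])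

lemma smooth_on_Pair:
 assumes "open S" "smooth_on S f" "smooth_on S g"
 shows "smooth_on S (%y. (f y, g y))"
proof -
 have 1: "bounded_linear (%a. (a, 0))" "bounded_linear (%b. (0, b))"
  by (auto intro!: bounded_linear_Pair bounded_linear_ident bounded_linear_zero)
 have "smooth_on S (%y. (f y, 0) + (0, g y))" by (intro smooth_on_add assms smooth_on_linear_image[OF 1(1)] smooth_on_linear_image[OF 1(2)])
 thus ?thesis by simp
qed

text \<open>If the first derivatives of the members of a family are combinations of members with smooth
coefficients, the same holds for all derivatives, so that every member is smooth.\<close>
lemma smooth_on_family:
 fixes E :: "'h => 'a::real_normed_vector => real"
 assumes S: "open S"
  and der: "!!h y. h : G ==> y : S ==>
  (E h has_derivative (%v. SUM b:B. a b v y * E (d b h) y)) (at y)"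
  and a: "!!b v. b : B ==> smooth_on S (a b v)"
  and d: "!!b h. b : B ==> h : G ==> d b h : G"
  and "h : G"
 shows "smooth_on S (E h)"
proof -
 have "Ck_on k S (E h)" if "h : G" for k h using that
 proof (induction k arbitrary: h)
  case 0
  thus ?case using der by (auto intro!: continuous_at_imp_continuous_on has_derivative_continuous)
 next
  case (Suc k)
  have ck: "finite A ==> A <= B ==> Ck_on k S (%y. SUM b:A. a b v y * E (d b h) y)" for A v by (induction A rule: finite_induct)
  (use Suc a d in \<open>auto simp: Ck_on_const smooth_on_def intro!: Ck_on_add[OF S] Ck_on_mult[OF S]\<close>)
  have ck': "Ck_on k S (%y. SUM b:B. a b v y * E (d b h) y)" for v using ck[of B v] by (cases "finite B") (auto simp: Ck_on_const)
  have "Ck_on k S (%y. FD (E h) y v)" for v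
  by (rule Ck_on_cong[OF S _ ck'[of v]]) (use frechet_derivative_eqI[OF der[OF Suc.prems]] in auto)
  thus ?case using der[OF Suc.prems] by (auto simp: differentiable_def)
 qed
 thus ?thesis using \<open>h : G\<close> by (auto simp: smooth_on_def)
qed

lemma smooth_on_compose:
 fixes f :: "'b::euclidean_space => real" and g :: "'a::real_normed_vector => 'b"
 assumes S: "open S" and T: "open T" and f: "smooth_on T f" and g: "smooth_on S g"
  and gT: "g ` S <= T"
 shows "smooth_on S (%y. f (g y))"
proof (rule smooth_on_family[where E = "%h y. h (g y)" and G = "{h. smooth_on T h}" and B = Basis
  and a = "%b v y. FD g y v \<bullet> b"
  and d = "%b h z. FD h z b", OF S])
 fix h :: "'b => real" and y assume h: "h : {h. smooth_on T h}" and y: "y : S"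
 let ?g = "FD g y" and ?h = "FD h (g y)"
 have hg: "(h has_derivative ?h) (at (g y))" using smooth_on_has_derivative[of T h "g y"] h y gT by auto
 have "((%y. h (g y)) has_derivative (%v. ?h (?g v))) (at y)" using has_derivative_compose[OF smooth_on_has_derivative[OF g y] hg] .
 moreover have "(%v. ?h (?g v)) = (%v. SUM b:Basis. (?g v \<bullet> b) * ?h b)"
 proof
  fix v define w where "w = ?g v"
  have lin: "linear ?h" using hg has_derivative_linear by blast
  have "?h w = ?h (SUM b:Basis. (w \<bullet> b) *\<^sub>R b)" by (simp add: euclidean_representation)
  also have "... = (SUM b:Basis. (w \<bullet> b) * ?h b)" by (simp add: linear_sum[OF lin] linear_scale[OF lin])
  finally show "?h (?g v) = (SUM b:Basis. (?g v \<bullet> b) * ?h b)" unfolding w_def .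
 qed
 ultimately show "((%y. h (g y)) has_derivative (%v. SUM b:Basis. (?g v \<bullet> b) * ?h b)) (at y)" by (simp only:)
next
 fix b :: 'b and v :: 'a
 show "smooth_on S (%y. FD g y v \<bullet> b)" by (rule smooth_on_linear_image[OF bounded_linear_inner_left S smooth_on_frechet[OF g]])
qed (use f smooth_on_frechet in auto)

lemma smooth_on_powr:
 shows "smooth_on {0<..} (%x::real. x powr p)"
proof -
 have "smooth_on {0<..} ((%(c, p) x. c * x powr p) (1::real, p))"
 proof (rule smooth_on_family[where G = UNIV and B = "{()}" and a = "%_ v _. v"
  and d = "%_ (c, p). (c * p, p - 1)"])
  fix h :: "real \<times> real" and y :: real assume y: "y : {0<..}"
  obtain c p where h: "h = (c, p)" by force
  have "((%x. c * x powr p) has_real_derivative c * p * y powr (p - 1)) (at y)" using y by (auto intro!: derivative_eq_intros)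
  thus "((%(c, p) x. c * x powr p) h has_derivative
  (%v. SUM b:{()}. v * (%(c, p) x. c * x powr p) ((%(c, p). (c * p, p - 1)) h) y)) (at y)"
  by (simp add: h has_field_derivative_def mult_commute_abs)
 qed auto
 thus ?thesis by simp
qed

lemma smooth_on_inverse:
 fixes f :: "'a::real_normed_vector => real"
 assumes "open S" "smooth_on S f" "!!y. y : S ==> f y > 0"
 shows "smooth_on S (%y. inverse (f y))"
proof -
 have "smooth_on S (%y. f y powr (-1))" by (rule smooth_on_compose[OF assms(1) _ smooth_on_powr assms(2)]) (use assms(3) in auto)
 thus ?thesis by (rule smooth_on_cong[OF assms(1), rotated])
  (use assms(3) in \<open>auto simp: powr_minus powr_one order_less_imp_le\<close>)
qed

lemma smooth_on_divide:
 fixes f :: "'a::real_normed_vector => real"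
 assumes "open S" "smooth_on S g" "smooth_on S f" "!!y. y : S ==> f y > 0"
 shows "smooth_on S (%y. g y / f y)"
 unfolding divide_inverse by (intro smooth_on_mult smooth_on_inverse assms)

lemma smooth_on_sqrt:
 fixes f :: "'a::real_normed_vector => real"
 assumes "open S" "smooth_on S f" "!!y. y : S ==> f y > 0"
 shows "smooth_on S (%y. sqrt (f y))"
proof -
 have "smooth_on S (%y. f y powr (1/2))" by (rule smooth_on_compose[OF assms(1) _ smooth_on_powr assms(2)]) (use assms(3) in auto)
 thus ?thesis by (rule smooth_on_cong[OF assms(1), rotated])
  (use assms(3) in \<open>auto simp: powr_half_sqrt order_less_imp_le\<close>)
qed

lemma smooth_on_ln: "smooth_on {0<..} (ln :: real => real)"
proof (rule smooth_on_derivI)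
 fix y :: real assume "y : {0<..}"
 hence d: "(ln has_derivative (%v. inverse y * v)) (at y)" using DERIV_ln[of y] by (simp add: has_field_derivative_def)
 thus "ln differentiable (at y)" by (auto simp: differentiable_def)
next
 fix v :: real
 have "smooth_on {0<..} (%y::real. inverse y * v)" by (intro smooth_on_mult smooth_on_inverse smooth_on_const)
  (auto intro: smooth_on_bounded_linear bounded_linear_ident)
 moreover have "FD ln y v = inverse y * v" if "y : {0<..}" for y :: real
 proof -
  have d: "(ln has_derivative (%v. inverse y * v)) (at y)" using that DERIV_ln[of y] by (simp add: has_field_derivative_def)
  show ?thesis using frechet_derivative_eqI[OF d] by simp
 qed
 ultimately show "smooth_on {0<..} (%y::real. FD ln y v)" by (auto intro: smooth_on_cong[of "{0<..}", rotated])
qed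

subsection \<open>A smooth step\<close>

definition flat_exp :: "real => real" where
 "flat_exp x = (if x > 0 then exp (- 1 / x) else 0)"

text \<open>The derivatives of \<open>exp (- 1 / x)\<close>, continued by \<open>0\<close>, stay in the span of this family.\<close>
definition flat_fam :: "real \<times> nat => real => real" where
 "flat_fam h x = (if x > 0 then fst h * inverse x ^ snd h * exp (- inverse x) else 0)"

lemma flat_tendsto: "((%x::real. inverse x ^ k * exp (- inverse x)) \<longlongrightarrow> 0) (at_right 0)"
proof -
 have "((%x::real. x ^ k / exp x) \<longlongrightarrow> 0) at_top" by (rule tendsto_power_div_exp_0)
 hence "((%x::real. inverse x ^ k / exp (inverse x)) \<longlongrightarrow> 0) (at_right 0)"
  using filterlim_compose filterlim_inverse_at_top_right by blast
 thus ?thesis by (simp add: exp_minus divide_inverse)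
qed

lemma flat_fam_deriv:
 "(flat_fam (c, k) has_real_derivative
  (flat_fam (- c * real k, Suc k) y + flat_fam (c, Suc (Suc k)) y)) (at y)"
proof -
 consider "y > 0" | "y < 0" | "y = 0" by linarith
 thus ?thesis
 proof cases
  case 1
  have "((%x. c * inverse x ^ k * exp (- inverse x)) has_real_derivative
  (flat_fam (- c * real k, Suc k) y + flat_fam (c, Suc (Suc k)) y)) (at y)"
  proof -
  have "((%x. inverse x ^ k) has_real_derivative (real k * (- (inverse y ^ 2) * inverse y ^ (k - 1)))) (at y)"
  using DERIV_power[OF DERIV_inverse[of y], of k] 1 by (simp add: numeral_2_eq_2)
  moreover have "real k * (- (inverse y ^ 2) * inverse y ^ (k - 1)) = - real k * inverse y ^ Suc k"
  by (cases k) (auto simp: power2_eq_square algebra_simps)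
  ultimately have i: "((%x. inverse x ^ k) has_real_derivative (- real k * inverse y ^ Suc k)) (at y)" by (simp only:)
  have e: "((%x. exp (- inverse x)) has_real_derivative (exp (- inverse y) * inverse y ^ 2)) (at y)"
  using 1 by (auto intro!: derivative_eq_intros simp: numeral_2_eq_2)
  show ?thesis using DERIV_cmult[OF DERIV_mult[OF i e], of c] 1 by (simp add: flat_fam_def algebra_simps power2_eq_square)
  qed
  thus ?thesis using 1 has_derivative_cong_open[of "{0<..}" y "flat_fam (c, k)" "%x. c * inverse x ^ k * exp (- inverse x)"]
  by (simp add: has_field_derivative_def flat_fam_def)
 next
  case 2
  have "(*) (0::real) = (%_. 0)" by auto
  thus ?thesis using 2 has_derivative_cong_open[of "{..<0}" y "flat_fam (c, k)" "%x. 0"]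
  by (simp add: has_field_derivative_def flat_fam_def)
 next
  case 3
  have "((%h. (flat_fam (c, k) (0 + h) - flat_fam (c, k) 0) / h) \<longlongrightarrow> 0) (at 0)"
  proof (rule filterlim_split_at)
  show "((%h. (flat_fam (c, k) (0 + h) - flat_fam (c, k) 0) / h) \<longlongrightarrow> 0) (at_left 0)"
  by (rule tendsto_eventually) (auto simp: eventually_at_filter flat_fam_def)
  have "((%x. c * (inverse x ^ Suc k * exp (- inverse x))) \<longlongrightarrow> c * 0) (at_right 0)" by (intro tendsto_intros flat_tendsto)
  moreover have "eventually (%h. c * (inverse h ^ Suc k * exp (- inverse h)) =
  (flat_fam (c, k) (0 + h) - flat_fam (c, k) 0) / h) (at_right 0)" by (auto simp: eventually_at_filter flat_fam_def divide_inverse mult_ac)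
  ultimately show "((%h. (flat_fam (c, k) (0 + h) - flat_fam (c, k) 0) / h) \<longlongrightarrow> 0) (at_right 0)"
  using Lim_transform_eventually by fastforce
  qed
  thus ?thesis using 3 by (simp add: DERIV_def flat_fam_def)
 qed
qed

lemma smooth_on_flat_exp: "smooth_on S flat_exp"
proof -
 have "smooth_on UNIV (flat_fam (1, 0))"
 proof (rule smooth_on_family[where G = UNIV and B = "{True, False}" and a = "%_ v _. v"
  and d = "%b h. if b then (- fst h * real (snd h), Suc (snd h)) else (fst h, Suc (Suc (snd h)))"])
  fix h :: "real \<times> nat" and y
  obtain c k where h: "h = (c, k)" by force
  show "(flat_fam h has_derivative (%v. SUM b:{True, False}. v * flat_fam
  (if b then (- fst h * real (snd h), Suc (snd h)) else (fst h, Suc (Suc (snd h)))) y)) (at y)" using flat_fam_deriv[of c k y]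
  by (simp add: h has_field_derivative_def distrib_right mult_commute_abs distrib_left[symmetric])
 qed auto
 moreover have "flat_fam (1, 0) = flat_exp" by (auto simp: fun_eq_iff flat_fam_def flat_exp_def inverse_eq_divide)
 ultimately show ?thesis using smooth_on_subset by auto
qed

definition smooth_step :: "real => real" where
 "smooth_step x = flat_exp x / (flat_exp x + flat_exp (1 - x))"

lemma flat_exp_nonneg: "flat_exp x >= 0" by (simp add: flat_exp_def)

lemma smooth_step_denom: "flat_exp x + flat_exp (1 - x) > 0"
 by (cases "x > 0") (auto simp: flat_exp_def add_pos_nonneg)

lemma smooth_step_simps [simp]:
 "x <= 0 ==> smooth_step x = 0" "x >= 1 ==> smooth_step x = 1"
 "0 <= smooth_step x" "smooth_step x <= 1" using smooth_step_denom[of x] flat_exp_nonneg[of x] flat_exp_nonneg[of "1 - x"]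
 by (auto simp: smooth_step_def flat_exp_def split: if_splits)

lemma smooth_on_smooth_step: "smooth_on UNIV smooth_step"
 unfolding smooth_step_def[abs_def] by (intro smooth_on_divide smooth_on_add smooth_on_flat_exp smooth_step_denom open_UNIV
  smooth_on_compose[OF open_UNIV open_UNIV smooth_on_flat_exp] smooth_on_diff
  smooth_on_const smooth_on_bounded_linear bounded_linear_ident) auto

lemma smooth_on_step_compose:
 assumes "open S" "smooth_on S f"
 shows "smooth_on S (%y. smooth_step (f y))"
 by (rule smooth_on_compose[OF assms(1) open_UNIV smooth_on_smooth_step assms(2)]) simp

section \<open>Compactly supported functions and weak derivatives\<close>

lemma frechet_zero_outside:
 assumes "closed K" "!!y. y ~: K ==> f y = 0" "y ~: K"
 shows "FD f y = (%_. 0)"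
 using frechet_derivative_cong_open[of "- K" y f "%_. 0"] assms by auto

lemma integrable_compact_support:
 fixes f :: "'a::euclidean_space => real"
 assumes "continuous_on UNIV f" "compact K" "!!y. y ~: K ==> f y = 0"
 shows "integrable lborel f"
proof -
 have "integrable lborel (%y. indicator K y *\<^sub>R f y)"
  by (rule borel_integrable_compact[OF assms(2) continuous_on_subset[OF assms(1) subset_UNIV]])
 moreover have "(%y. indicator K y *\<^sub>R f y) = f" using assms(3) by (auto simp: indicator_def fun_eq_iff)
 ultimately show ?thesis by simp
qed

lemma bounded_compact_support:
 fixes f :: "'a::euclidean_space => real"
 assumes "continuous_on UNIV f" "compact K" "!!y. y ~: K ==> f y = 0"
 obtains B where "B >= 0" "!!y. abs (f y) <= B"
proof -
 have "bounded (f ` K)" using assms(1,2) compact_continuous_image continuous_on_subset compact_imp_bounded by (metis top_greatest)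
 then obtain B where "!!y. y : K ==> abs (f y) <= B" by (auto simp: bounded_iff)
 hence "abs (f y) <= max 0 B" for y using assms(3)[of y] by (cases "y : K") (auto simp: le_max_iff_disj)
 thus ?thesis using that[of "max 0 B"] by auto
qed

lemma directional_real_derivative:
 assumes "smooth_on S f" "y + t *\<^sub>R v : S"
 shows "((%t. f (y + t *\<^sub>R v)) has_vector_derivative FD f (y + t *\<^sub>R v) v) (at t)"
proof -
 have "((%t. y + t *\<^sub>R v) has_derivative (%h. h *\<^sub>R v)) (at t)" by (auto intro!: derivative_eq_intros)
 from has_derivative_compose[OF this smooth_on_has_derivative[OF assms]]
 show ?thesis using linear_scale[OF has_derivative_linear[OF smooth_on_has_derivative[OF assms]]] by (simp add: has_vector_derivative_def)
qed

text \<open>The integral of \<open>f\<close> is invariant under translations; differentiate this under the integral.\<close>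
lemma integral_directional_derivative:
 fixes f :: "'a::euclidean_space => real"
 assumes f: "smooth_on UNIV f" and K: "compact K" and supp: "!!y. y ~: K ==> f y = 0"
 shows "(LINT y|lborel. FD f y v) = 0"
proof -
 define D where "D y = FD f y v" for y
 have cf: "continuous_on UNIV f" and cD: "continuous_on UNIV D"
  using f smooth_on_frechet[OF f] smooth_on_continuous unfolding D_def by blast+
 have D0: "D y = 0" if "y ~: K" for y unfolding D_def using frechet_zero_outside[OF compact_imp_closed[OF K] supp that] by simp
 obtain B where B: "B >= 0" "!!y. abs (D y) <= B" using bounded_compact_support[OF cD K D0] by blast
 define K' where "K' = (%(s, x). x - s *\<^sub>R v) ` ({0..1} \<times> K)"
 have K': "compact K'" unfolding K'_def using K
  by (intro compact_continuous_image compact_Times) (auto simp: split_beta intro!: continuous_intros)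
 have inK': "y : K'" if "y + s *\<^sub>R v : K" "0 <= s" "s <= 1" for y s
  unfolding K'_def using that by (auto intro!: image_eqI[of _ _ "(s, y + s *\<^sub>R v)"])
 define q where "q n y = (f (y + inverse (real (Suc n)) *\<^sub>R v) - f y) / inverse (real (Suc n))" for n y
 have mvt: "EX \<xi>. 0 <= \<xi> & \<xi> <= 1 & q n y = D (y + \<xi> *\<^sub>R v)" for n y
 proof -
  let ?t = "inverse (real (Suc n))"
  have t: "0 < ?t" "?t <= 1" by (auto simp: field_simps)
  have "EX z. 0 < z & z < ?t & f (y + ?t *\<^sub>R v) - f (y + 0 *\<^sub>R v) = (?t - 0) * D (y + z *\<^sub>R v)" by (rule MVT2[OF t(1)])
  (use directional_real_derivative[OF f] in \<open>auto simp: D_def has_real_derivative_iff_has_vector_derivative\<close>)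
  then obtain z where z: "0 < z" "z < ?t" "f (y + ?t *\<^sub>R v) - f y = ?t * D (y + z *\<^sub>R v)" by auto
  hence "q n y = D (y + z *\<^sub>R v)" using t unfolding q_def by simp
  thus ?thesis using z t by (intro exI[of _ z]) auto
 qed
 have lim: "(%n. q n y) \<longlonglongrightarrow> D y" for y
 proof -
  have "((%t. f (y + t *\<^sub>R v)) has_real_derivative D y) (at 0)" using directional_real_derivative[OF f, of y 0 v]
  by (simp add: D_def has_real_derivative_iff_has_vector_derivative)
  hence "((%t. (f (y + t *\<^sub>R v) - f y) / t) \<longlongrightarrow> D y) (at 0)" by (simp add: DERIV_def)
  moreover have "filterlim (%n. inverse (real (Suc n))) (at 0) sequentially"
  unfolding filterlim_at using LIMSEQ_inverse_real_of_nat by (auto intro!: always_eventually)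
  ultimately show ?thesis unfolding q_def by (rule filterlim_compose)
 qed
 have bound: "abs (q n y) <= B * indicator K' y" for n y
 proof -
  obtain \<xi> where "0 <= \<xi>" "\<xi> <= 1" "q n y = D (y + \<xi> *\<^sub>R v)" using mvt by blast
  thus ?thesis using D0[of "y + \<xi> *\<^sub>R v"] B inK'[of y \<xi>] by (auto simp: indicator_def)
 qed
 have int_f: "integrable lborel f" by (rule integrable_compact_support[OF cf K supp])
 have shift: "(LINT y|lborel. f (y + c)) = (LINT y|lborel. f y)" "integrable lborel (%y. f (y + c))" for c
 proof -
  have m: "f : borel_measurable borel" using cf borel_measurable_continuous_onI by blast
  have "(LINT y|lborel. f y) = (LINT y|distr lborel borel ((+) c). f y)" by (simp add: lborel_distr_plus)
  also have "... = (LINT y|lborel. f (c + y))" by (rule integral_distr) (use m in auto)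
  finally show "(LINT y|lborel. f (y + c)) = (LINT y|lborel. f y)" by (simp add: add.commute)
  have "integrable (distr lborel borel ((+) c)) f" using int_f by (simp add: lborel_distr_plus)
  hence "integrable lborel (%y. f (c + y))" by (subst (asm) integrable_distr_eq) (use m in auto)
  thus "integrable lborel (%y. f (y + c))" by (simp add: add.commute)
 qed
 have q0: "(LINT y|lborel. q n y) = 0" for n unfolding q_def using shift int_f by simp
 have "(%n. LINT y|lborel. q n y) \<longlonglongrightarrow> (LINT y|lborel. D y)"
 proof (rule integral_dominated_convergence[where w = "%y. B * indicator K' y"])
  show "integrable lborel (%y. B * indicator K' y)"
  proof (intro integrable_mult_right integrable_real_indicator)
  show "K' : sets lborel" using borel_compact[OF K'] by simp
  show "emeasure lborel K' < \<infinity>" by (rule emeasure_compact_finite[OF K'])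
  qed
  show "D : borel_measurable lborel" using cD borel_measurable_continuous_onI by auto
  show "q n : borel_measurable lborel" for n
  unfolding q_def using borel_measurable_integrable[OF shift(2)] borel_measurable_integrable[OF int_f] by measurable
 qed (use lim bound in auto)
 hence "(%n::nat. 0) \<longlonglongrightarrow> (LINT y|lborel. D y)" by (simp only: q0)
 from LIMSEQ_unique[OF this tendsto_const] show ?thesis unfolding D_def .
qed

lemma smooth_on_mult_cutoff:
 fixes f psi :: "'a::euclidean_space => real"
 assumes U: "open U" and f: "smooth_on U f" and psi: "smooth_on UNIV psi"
  and K: "compact K" "K <= U" and supp: "!!y. y ~: K ==> psi y = 0"
 shows "smooth_on UNIV (%y. f y * psi y)"
proof (rule smooth_on_local)
 fix y
 show "EX T. open T & y : T & smooth_on T (%y. f y * psi y)"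
 proof (cases "y : U")
  case True
  thus ?thesis using smooth_on_mult[OF U f smooth_on_subset[OF psi]] U by auto
 next
  case False
  have "smooth_on (- K) (%y. f y * psi y)"
  by (rule smooth_on_cong[of _ "%_. 0"]) (use K supp in \<open>auto simp: compact_imp_closed open_Compl\<close>)
  thus ?thesis using False K by (intro exI[of _ "- K"]) (auto simp: compact_imp_closed open_Compl)
 qed
qed

definition test_on :: "'a::euclidean_space set => ('a => real) => bool" where
 "test_on U psi \<longleftrightarrow> smooth_on UNIV psi & (EX K. compact K & K <= U & (ALL y. y ~: K --> psi y = 0))"

lemma test_on_mult_left:
 "open U ==> smooth_on U f ==> test_on U psi ==> test_on U (%y. f y * psi y)"
 unfolding test_on_def using smooth_on_mult_cutoff[of U f psi] by (metis mult_zero_right)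

lemma test_on_frechet: "test_on U psi ==> test_on U (%y. FD psi y v)"
 unfolding test_on_def using smooth_on_frechet[of UNIV psi] frechet_zero_outside[of _ psi] compact_imp_closed by metis

lemma test_on_mono: "test_on U psi ==> U <= V ==> test_on V psi"
 unfolding test_on_def by blast

lemma test_on_integrable: "test_on U psi ==> integrable lborel psi"
 unfolding test_on_def using integrable_compact_support smooth_on_continuous by blast

lemma test_on_bounded:
 assumes "test_on U psi" obtains B where "B >= 0" "!!y. abs (psi y) <= B"
 using assms bounded_compact_support[of psi] smooth_on_continuous unfolding test_on_def by metis

lemma test_on_zero: "test_on U psi ==> y ~: U ==> psi y = 0"
 unfolding test_on_def by blast

lemma test_on_borel: "test_on U psi ==> psi : borel_measurable borel"
 unfolding test_on_def using smooth_on_continuous borel_measurable_continuous_onI by blast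

lemma integral_set_zero_outside:
 fixes f :: "'a => real"
 shows "(!!y. y ~: U ==> f y = 0) ==> (LINT y:U|N. f y) = (LINT y|N. f y)"
 unfolding set_lebesgue_integral_def by (intro Bochner_Integration.integral_cong) (auto simp: indicator_def)

lemma weak_deriv_test:
 "weak_deriv U f v D ==> test_on U psi ==>
  (LINT y:U|lborel. f y * FD psi y v) = - (LINT y:U|lborel. D y * psi y)" unfolding weak_deriv_def test_on_def by blast

lemma integrable_mult_test:
 assumes "!!K. compact K ==> K <= U ==> set_integrable lborel K f" and "test_on U psi"
 shows "integrable lborel (%y. f y * psi y)"
proof -
 obtain K where K: "compact K" "K <= U" "!!y. y ~: K ==> psi y = 0" using assms(2) unfolding test_on_def by blast
 obtain B where B: "B >= 0" "!!y. abs (psi y) <= B" using test_on_bounded[OF assms(2)] by blast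
 have f: "integrable lborel (%y. indicator K y * f y)" using assms(1)[OF K(1,2)] by (simp add: set_integrable_def)
 have "integrable lborel (%y. (indicator K y * f y) * psi y)"
  by (rule Bochner_Integration.integrable_bound[OF integrable_mult_left[OF f, of B]])
  (use f test_on_borel[OF assms(2)] B in \<open>auto simp: abs_mult intro!: mult_left_mono\<close>)
 moreover have "(indicator K y * f y) * psi y = f y * psi y" for y using K(3)[of y] by (auto simp: indicator_def)
 ultimately show ?thesis by simp
qed

lemma weak_deriv_integrable:
 "weak_deriv U f v D ==> test_on U psi ==> integrable lborel (%y. f y * psi y)"
 "weak_deriv U f v D ==> test_on U psi ==> integrable lborel (%y. D y * psi y)" by (rule integrable_mult_test, auto simp: weak_deriv_def)+

lemma weak_deriv_subset: "weak_deriv U f v D ==> V <= U ==> weak_deriv V f v D"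
proof -
 assume w: "weak_deriv U f v D" and VU: "V <= U"
 have "(LINT y:V|lborel. f y * FD psi y v) = - (LINT y:V|lborel. D y * psi y)"
  if t: "test_on V psi" for psi
 proof -
  have "(LINT y:S|lborel. g y * et y) = (LINT y|lborel. g y * et y)" if "test_on V et" "V <= S" for S g et
  by (rule integral_set_zero_outside) (use that test_on_zero in \<open>auto simp: subset_iff\<close>)
  thus ?thesis using weak_deriv_test[OF w test_on_mono[OF t VU]] t test_on_frechet[OF t, of v] VU by simp
 qed
 thus ?thesis using w VU unfolding weak_deriv_def test_on_def by blast
qed

lemma weak_deriv_smooth:
 assumes U: "open U" and f: "smooth_on U f"
 shows "weak_deriv U f v (%y. FD f y v)"
proof -
 have si: "set_integrable lborel K g" if "smooth_on U g" "compact K" "K <= U" for K and g :: "'a => real" unfolding set_integrable_def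
  by (rule borel_integrable_compact[OF that(2) continuous_on_subset[OF smooth_on_continuous[OF that(1)] that(3)]])
 have "(LINT y:U|lborel. f y * FD psi y v) =
  - (LINT y:U|lborel. FD f y v * psi y)" if t: "test_on U psi" for psi
 proof -
  have t1: "test_on U (%y. f y * FD psi y v)"
  "test_on U (%y. FD f y v * psi y)" "test_on U (%y. f y * psi y)"
  using test_on_mult_left[OF U] test_on_frechet[OF t] t f smooth_on_frechet[OF f] by blast+
  have psi: "smooth_on UNIV psi" using t by (simp add: test_on_def)
  have eq: "FD (%y. f y * psi y) y v =
  f y * FD psi y v + FD f y v * psi y" for y
  proof (cases "y : U")
  case True
  have "((%y. f y * psi y) has_derivative
  (%v. f y * FD psi y v + FD f y v * psi y)) (at y)"
  by (intro has_derivative_mult smooth_on_has_derivative[OF f True] smooth_on_has_derivative[OF psi]) simp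
  thus ?thesis using frechet_derivative_eqI by fastforce
  next
  case False
  thus ?thesis using test_on_zero[OF t] test_on_zero[OF test_on_frechet[OF t]]
  test_on_zero[OF test_on_frechet[OF t1(3)]] by simp
  qed
  obtain K where K: "compact K" "!!y. y ~: K ==> f y * psi y = 0" using t1(3) unfolding test_on_def by blast
  have "0 = (LINT y|lborel. FD (%y. f y * psi y) y v)" using integral_directional_derivative[OF _ K] t1(3) by (simp add: test_on_def)
  also have "... = (LINT y|lborel. f y * FD psi y v) +
  (LINT y|lborel. FD f y v * psi y)"
  unfolding eq by (intro Bochner_Integration.integral_add test_on_integrable[OF t1(1)] test_on_integrable[OF t1(2)])
  finally show ?thesis using test_on_zero[OF t1(1)] test_on_zero[OF t1(2)] by (simp add: integral_set_zero_outside)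
 qed
 thus ?thesis using si f smooth_on_frechet[OF f] unfolding weak_deriv_def test_on_def by blast
qed

text \<open>Multiplying steps in the coordinate directions approximates boxes by test functions; boxes
generate the Borel sets, which leads to the fundamental lemma of the calculus of variations below.\<close>
lemma box_indicator_limit:
 fixes c d :: "'a::euclidean_space"
 obtains psi :: "nat => 'a => real" where
  "!!n. smooth_on UNIV (psi n)" "!!n y. y ~: box c d ==> psi n y = 0"
  "!!n y. 0 <= psi n y" "!!n y. psi n y <= 1" "!!y. (%n. psi n y) \<longlonglongrightarrow> indicator (box c d) y"
proof -
 define st where "st n x = smooth_step (real n * x)" for n :: nat and x
 define psi where "psi n y = (PROD b:Basis. st n (y \<bullet> b - c \<bullet> b) * st n (d \<bullet> b - y \<bullet> b))" for n and y :: 'a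
 have st: "0 <= st n x" "st n x <= 1" "x <= 0 ==> st n x = 0" for n x by (auto simp: st_def mult_nonneg_nonpos)
 have lim: "(%n. st n x) \<longlonglongrightarrow> (if x > 0 then 1 else 0)" for x
 proof (cases "x > 0")
  case True
  obtain n0 where n0: "real n0 * x > 1" using ex_less_of_nat_mult[OF True, of 1] by auto
  have "st n x = 1" if "n >= n0" for n
  proof -
  have "real n0 * x <= real n * x" using that True by (intro mult_right_mono) auto
  thus ?thesis using n0 by (auto simp: st_def)
  qed
  hence "eventually (%n. st n x = 1) sequentially" by (auto simp: eventually_sequentially)
  thus ?thesis using True by (simp add: tendsto_eventually)
 next
  case False thus ?thesis using st(3)[of x] by simp
 qed
 show ?thesis
 proof (rule that[of psi])
  show "smooth_on UNIV (psi n)" for n unfolding psi_def[abs_def] st_def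
  by (intro smooth_on_prod smooth_on_mult smooth_on_step_compose smooth_on_diff smooth_on_const
  smooth_on_bounded_linear bounded_linear_inner_left open_UNIV)
  show "0 <= psi n y" for n y unfolding psi_def by (intro prod_nonneg mult_nonneg_nonneg st)
  show "psi n y <= 1" for n y unfolding psi_def by (intro prod_le_1) (auto intro: st mult_le_one mult_nonneg_nonneg)
  show "psi n y = 0" if "y ~: box c d" for n y
  proof -
  from that obtain b where b: "b : Basis" "y \<bullet> b - c \<bullet> b <= 0 \<or> d \<bullet> b - y \<bullet> b <= 0"
  unfolding box_def by force
  hence "st n (y \<bullet> b - c \<bullet> b) * st n (d \<bullet> b - y \<bullet> b) = 0" using st(3) by auto
  thus ?thesis unfolding psi_def using b(1) by (intro prod_zero bexI[of _ b]) simp_all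
  qed
  show "(%n. psi n y) \<longlonglongrightarrow> indicator (box c d) y" for y
  proof -
  have "(%n. psi n y) \<longlonglongrightarrow> (PROD b:Basis. (if y \<bullet> b - c \<bullet> b > 0 then 1 else 0) * (if d \<bullet> b - y \<bullet> b > 0 then 1 else 0))"
  unfolding psi_def by (intro tendsto_prod tendsto_mult lim)
  moreover have "(PROD b:Basis. (if y \<bullet> b - c \<bullet> b > 0 then 1 else 0) * (if d \<bullet> b - y \<bullet> b > 0 then 1 else 0)) = (indicator (box c d) y :: real)"
  proof (cases "y : box c d")
  case True thus ?thesis by (auto simp: box_def intro!: prod.neutral)
  next
  case False
  then obtain b where b: "b : Basis" "y \<bullet> b - c \<bullet> b <= 0 \<or> d \<bullet> b - y \<bullet> b <= 0"
  unfolding box_def by force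
  show ?thesis using b False by (subst prod_zero) (auto intro!: bexI[of _ b])
  qed
  ultimately show ?thesis by simp
  qed
 qed
qed

lemma AE_zero_if_boxes_zero:
 fixes h :: "'a::euclidean_space => real"
 assumes h: "integrable lborel h" and z: "!!c d. (LINT y:box c d|lborel. h y) = 0"
  and ab: "!!y. y ~: box a b ==> h y = 0"
 shows "AE y in lborel. h y = 0"
proof (rule density_unique_real[OF h, of "%_. 0", simplified])
 have int: "integrable lborel (%y. indicator A y * h y)" if "A : sets borel" for A
  using integrable_mult_indicator[of A lborel h] that h by simp
 let ?E = "range (%(a, b). box a b :: 'a set)"
 fix A :: "'a set" assume "A : sets borel"
 hence A: "A : sigma_sets UNIV ?E" by (simp add: borel_eq_box sets_measure_of)
 have "A : sets borel & (LINT y:A|lborel. h y) = 0"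
 proof (rule sigma_sets_induct_disjoint[OF _ _ A])
  show "Int_stable ?E"
  proof (rule Int_stableI)
  fix X Y assume "X : ?E" "Y : ?E"
  then obtain a b c d where "X = box a b" "Y = box c d" by auto
  thus "X Int Y : ?E" using box_Int_box[of a b c d] by (metis (mono_tags, lifting) case_prod_conv rangeI)
  qed
  show "?E <= Pow UNIV" by simp
  show "B : sets borel & (LINT y:B|lborel. h y) = 0" if "B : ?E" for B using that z by auto
  show "{} : sets borel & (LINT y:{}|lborel. h y) = 0" by (simp add: set_lebesgue_integral_def)
 next
  fix B assume B: "B : sigma_sets UNIV ?E" "B : sets borel & (LINT y:B|lborel. h y) = 0"
  have "(LINT y|lborel. h y) = 0" using z[of a b] integral_set_zero_outside[OF ab, of UNIV] integral_set_zero_outside[of "box a b" h, OF ab] by simp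
  moreover have "(LINT y|lborel. h y) = (LINT y|lborel. indicator B y * h y + indicator (UNIV - B) y * h y)"
  by (intro Bochner_Integration.integral_cong) (auto simp: indicator_def)
  moreover have "... = (LINT y|lborel. indicator B y * h y) + (LINT y|lborel. indicator (UNIV - B) y * h y)"
  by (intro Bochner_Integration.integral_add int) (use B in auto)
  ultimately show "UNIV - B : sets borel & (LINT y:UNIV - B|lborel. h y) = 0" using B by (auto simp: set_lebesgue_integral_def)
 next
  fix F :: "nat => 'a set"
  assume F: "disjoint_family F" "range F <= sigma_sets UNIV ?E" "!!i. F i : sets borel & (LINT y:F i|lborel. h y) = 0"
  have "(LINT y:(\<Union>i. F i)|lborel. h y) = (\<Sum>i. LINT y:F i|lborel. h y)" by (rule lebesgue_integral_countable_add)
  (use F in \<open>auto simp: disjoint_family_on_def set_integrable_def intro!: int sets.countable_UN\<close>)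
  thus "(\<Union>i. F i) : sets borel & (LINT y:(\<Union>i. F i)|lborel. h y) = 0" using F by auto
 qed
 thus "(LINT y:A|lborel. h y) = 0" by simp
qed

lemma AE_zero_if_tests_zero:
 fixes h :: "'a::euclidean_space => real"
 assumes U: "open U" and h: "!!K. compact K ==> K <= U ==> set_integrable lborel K h"
  and z: "!!psi. test_on U psi ==> (LINT y|lborel. h y * psi y) = 0"
 shows "AE y in lborel. y : U --> h y = 0"
proof -
 obtain \<D> where \<D>: "countable \<D>" "\<D> <= Pow U" "!!X. X : \<D> ==> EX a b. X = cbox a b" "\<Union>\<D> = U"
  using open_countable_Union_open_cbox[OF U] by blast
 have "AE y in lborel. y : cbox a b --> h y = 0" if ab: "cbox a b <= U" for a b :: 'a
 proof -
  define H where "H y = indicator (box a b) y * h y" for y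
  have hK: "integrable lborel (%y. indicator (cbox a b) y * h y)" using h[OF compact_cbox ab] by (simp add: set_integrable_def)
  have H: "integrable lborel H"
  proof -
  have "integrable lborel (%y. indicator (box a b) y * (indicator (cbox a b) y * h y))"
  using integrable_mult_indicator[of "box a b" lborel, OF _ hK] by simp
  moreover have "indicator (box a b) y * (indicator (cbox a b) y * h y) = H y" for y
  using box_subset_cbox[of a b] by (auto simp: H_def indicator_def)
  ultimately show ?thesis by simp
  qed
  have box0: "(LINT y|lborel. indicator (box c d) y * h y) = 0" if cd: "box c d <= cbox a b" for c d
  proof -
  obtain psi :: "nat => 'a => real" where psi: "!!n. smooth_on UNIV (psi n)" "!!n y. y ~: box c d ==> psi n y = 0"
  "!!n y. 0 <= psi n y" "!!n y. psi n y <= 1" "!!y. (%n. psi n y) \<longlonglongrightarrow> indicator (box c d) y"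
  by (rule box_indicator_limit[of c d]) blast
  have t: "test_on U (psi n)" for n unfolding test_on_def using psi(1,2) cd ab by (intro conjI exI[of _ "cbox a b"]) auto
  have "(%n. LINT y|lborel. h y * psi n y) \<longlonglongrightarrow> (LINT y|lborel. indicator (box c d) y * h y)"
  proof (rule integral_dominated_convergence[where w = "%y. abs (indicator (cbox a b) y * h y)"])
  show "integrable lborel (%y. abs (indicator (cbox a b) y * h y))" using hK by simp
  show "(%y. h y * psi n y) : borel_measurable lborel" for n using integrable_mult_test[OF h t] by blast
  have "(%y. indicator (box c d) y * (indicator (cbox a b) y * h y)) : borel_measurable lborel"
  using borel_measurable_integrable[OF hK] by measurable
  moreover have "indicator (box c d) y * (indicator (cbox a b) y * h y) = indicator (box c d) y * h y" for y
  using cd by (auto simp: indicator_def)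
  ultimately show "(%y. indicator (box c d) y * h y) : borel_measurable lborel" by simp
  show "AE y in lborel. (%n. h y * psi n y) \<longlonglongrightarrow> indicator (box c d) y * h y"
  proof (rule AE_I2)
  fix y
  have "(%n. h y * psi n y) \<longlonglongrightarrow> h y * indicator (box c d) y" by (rule tendsto_mult[OF tendsto_const psi(5)])
  thus "(%n. h y * psi n y) \<longlonglongrightarrow> indicator (box c d) y * h y"
  by (simp only: mult.commute[of "indicator (box c d) y"])
  qed
  show "AE y in lborel. norm (h y * psi n y) <= abs (indicator (cbox a b) y * h y)" for n
  proof (rule AE_I2)
  fix y
  show "norm (h y * psi n y) <= abs (indicator (cbox a b) y * h y)"
  proof (cases "y : box c d")
  case True
  hence "y : cbox a b" using cd by blast
  thus ?thesis using psi(3,4)[of n y] by (simp add: abs_mult mult_left_le)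
  next
  case False
  thus ?thesis using psi(2)[of y n] by simp
  qed
  qed
  qed
  hence "(%n::nat. 0) \<longlonglongrightarrow> (LINT y|lborel. indicator (box c d) y * h y)" by (simp only: z[OF t])
  from LIMSEQ_unique[OF this tendsto_const] show ?thesis .
  qed
  have "AE y in lborel. H y = 0"
  proof (rule AE_zero_if_boxes_zero[OF H, of a b])
  fix c d :: 'a
  obtain c' d' where cd': "box c d Int box a b = box c' d'" by (rule that[OF box_Int_box])
  hence "box c' d' <= cbox a b" using box_subset_cbox by blast
  hence "(LINT y|lborel. indicator (box c' d') y * h y) = 0" by (rule box0)
  moreover have "indicator (box c d) y *\<^sub>R H y = indicator (box c' d') y * h y" for y
  unfolding cd'[symmetric] H_def by (auto simp: indicator_def)
  ultimately show "(LINT y:box c d|lborel. H y) = 0" by (simp add: set_lebesgue_integral_def)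
  qed (auto simp: H_def)
  moreover have "AE y in lborel. y ~: cbox a b - box a b"
  proof (rule AE_not_in)
  have "emeasure lborel (cbox a b - box a b) = emeasure lborel (cbox a b) - emeasure lborel (box a b)"
  by (rule emeasure_Diff) (auto simp: box_subset_cbox emeasure_lborel_box_eq)
  also have "... = 0" by (simp add: emeasure_lborel_box_eq emeasure_lborel_cbox_eq)
  finally show "cbox a b - box a b : null_sets lborel" by (auto simp: null_sets_def)
  qed
  ultimately show ?thesis by eventually_elim (auto simp: H_def indicator_def split: if_splits)
 qed
 hence "!!X. X : \<D> ==> AE y in lborel. y : X --> h y = 0" using \<D> by blast
 hence "AE y in lborel. ALL X:\<D>. y : X --> h y = 0"
  using AE_ball_countable'[of \<D> "%X y. y : X --> h y = 0" lborel] \<D>(1) by simp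
 thus ?thesis
 proof eventually_elim
  case (elim y)
  thus ?case using \<D>(4) by blast
 qed
qed

lemma weak_deriv_unique:
 assumes U: "open U" and "weak_deriv U f v D" "weak_deriv U f v D'"
 shows "AE y in lborel. y : U --> D y = D' y"
proof -
 have "AE y in lborel. y : U --> D y - D' y = 0"
 proof (rule AE_zero_if_tests_zero[OF U])
  show "set_integrable lborel K (%y. D y - D' y)" if "compact K" "K <= U" for K
  using assms that unfolding weak_deriv_def by (intro set_integral_diff) auto
  fix psi assume t: "test_on U psi"
  have "(LINT y|lborel. D y * psi y) = (LINT y|lborel. D' y * psi y)" using weak_deriv_test[OF assms(2) t] weak_deriv_test[OF assms(3) t]
  integral_set_zero_outside[of U "%y. D y * psi y"] integral_set_zero_outside[of U "%y. D' y * psi y"]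
  test_on_zero[OF t] by simp
  thus "(LINT y|lborel. (D y - D' y) * psi y) = 0"
  using weak_deriv_integrable(2)[OF assms(2) t] weak_deriv_integrable(2)[OF assms(3) t] by (simp add: left_diff_distrib)
 qed
 thus ?thesis by simp
qed

lemma smooth_on_compose_vec:
 fixes f :: "'b::euclidean_space => 'c::euclidean_space" and g :: "'a::real_normed_vector => 'b"
 assumes S: "open S" and T: "open T" and f: "smooth_on T f" and g: "smooth_on S g"
  and gT: "g ` S <= T"
 shows "smooth_on S (%y. f (g y))"
proof -
 have "smooth_on S (%y. SUM b:Basis. (f (g y) \<bullet> b) *\<^sub>R b)"
  by (intro smooth_on_sum[OF S] smooth_on_linear_image[OF bounded_linear_scaleR_left S]
  smooth_on_compose[OF S T _ g gT] smooth_on_linear_image[OF bounded_linear_inner_left T f])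
 thus ?thesis by (simp add: euclidean_representation)
qed

section \<open>Positive definite matrices\<close>

text \<open>By induction on \<open>S\<close>, completing the square in one coordinate at a time.\<close>
lemma pd_factor:
 fixes b :: "'n => 'n => real"
 assumes "finite S" "!!i j. i : S ==> j : S ==> b i j = b j i"
  and "!!v i. i : S ==> v i ~= 0 ==> (SUM i:S. SUM j:S. v i * b i j * v j) > 0"
 shows "EX e :: 'n => 'n => real. ALL i:S. ALL j:S. b i j = (SUM a:S. e a i * e a j)"
 using assms
proof (induction S arbitrary: b rule: finite_induct)
 case empty
 show ?case by simp
next
 case (insert s S)
 have sym: "b i j = b j i" if "i : insert s S" "j : insert s S" for i j using insert.prems(1) that .
 have expand: "(SUM i:insert s S. SUM j:insert s S. w i * b i j * w j) =
  w s * b s s * w s + 2 * w s * (SUM j:S. b s j * w j) + (SUM i:S. SUM j:S. w i * b i j * w j)" for w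
 proof -
  have "(SUM i:S. w i * b i s * w s) = w s * (SUM j:S. b s j * w j)"
  unfolding sum_distrib_left by (intro sum.cong) (use sym in \<open>auto simp: mult_ac\<close>)
  moreover have "(SUM j:S. w s * b s j * w j) = w s * (SUM j:S. b s j * w j)"
  unfolding sum_distrib_left by (intro sum.cong) (auto simp: mult_ac)
  ultimately show ?thesis using insert.hyps by (simp add: sum.distrib)
 qed
 have ss: "b s s > 0"
 proof -
  have "(SUM j:S. b s j * (if j = s then 1 else 0)) = 0"
  "(SUM i:S. SUM j:S. (if i = s then 1 else 0) * b i j * (if j = s then 1 else 0)) = 0" using insert.hyps by (auto intro!: sum.neutral)
  thus ?thesis using insert.prems(2)[of s "%j. if j = s then 1 else 0"] expand[of "%j. if j = s then 1 else 0"] by simp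
 qed
 define b' where "b' i j = b i j - b s i * b s j / b s s" for i j
 have "EX e :: 'n => 'n => real. ALL i:S. ALL j:S. b' i j = (SUM a:S. e a i * e a j)"
 proof (rule insert.IH)
  show "b' i j = b' j i" if "i : S" "j : S" for i j using sym that by (simp add: b'_def)
  fix v :: "'n => real" and i assume i: "i : S" "v i ~= 0"
  define t where "t = (SUM j:S. b s j * v j)"
  define w where "w = v(s := - t / b s s)"
  have wS: "w j = v j" if "j : S" for j using that insert.hyps by (auto simp: w_def)
  have "0 < (SUM i:insert s S. SUM j:insert s S. w i * b i j * w j)" by (rule insert.prems(2)[of i]) (use i wS in auto)
  also have "... = (SUM i:S. SUM j:S. v i * b i j * v j) - t * t / b s s"
  proof -
  have "(SUM j:S. b s j * w j) = t" unfolding t_def by (intro sum.cong) (auto simp: wS)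
  moreover have "(SUM i:S. SUM j:S. w i * b i j * w j) = (SUM i:S. SUM j:S. v i * b i j * v j)" by (intro sum.cong) (auto simp: wS)
  moreover have "w s = - t / b s s" by (simp add: w_def)
  ultimately show ?thesis unfolding expand using ss by (simp add: field_simps)
  qed
  also have "t * t / b s s = (SUM i:S. SUM j:S. v i * (b s i * b s j / b s s) * v j)"
  unfolding t_def sum_product sum_divide_distrib by (intro sum.cong) auto
  finally show "(SUM i:S. SUM j:S. v i * b' i j * v j) > 0" by (simp add: b'_def right_diff_distrib left_diff_distrib sum_subtractf)
 qed
 then obtain e where e: "!!i j. i : S ==> j : S ==> b' i j = (SUM a:S. e a i * e a j)" by blast
 define f where "f a i = (if a = s then b s i / sqrt (b s s) else if i = s then 0 else e a i)" for a i
 have fs: "f s i = b s i / sqrt (b s s)" for i by (simp add: f_def)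
 have sq: "f s i * f s j = b s i * b s j / b s s" for i j using ss by (simp add: fs)
 have fa: "f a i = (if i = s then 0 else e a i)" if "a : S" for a i using that insert.hyps by (auto simp: f_def)
 have "b i j = (SUM a:insert s S. f a i * f a j)" if ij: "i : insert s S" "j : insert s S" for i j
 proof -
  have 1: "(SUM a:insert s S. f a i * f a j) = b s i * b s j / b s s + (SUM a:S. f a i * f a j)" using insert.hyps sq by simp
  show ?thesis
  proof (cases "i = s \<or> j = s")
  case True
  hence "(SUM a:S. f a i * f a j) = 0" by (intro sum.neutral) (auto simp: fa)
  thus ?thesis using 1 True sym[OF ij] ss by auto
  next
  case False
  hence "(SUM a:S. f a i * f a j) = b' i j" using ij e by (auto simp: fa intro!: sum.cong)
  thus ?thesis using 1 by (simp add: b'_def)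
  qed
 qed
 thus ?case by blast
qed

definition pos_def :: "real ^ 'n::finite ^ 'n => bool" where
 "pos_def G \<longleftrightarrow> transpose G = G & (ALL v. v ~= 0 --> v \<bullet> (G *v v) > 0)"

lemma inner_matrix_vector: "v \<bullet> ((G :: real ^ 'n::finite ^ 'm::finite) *v w) = (SUM i:UNIV. SUM j:UNIV. G $ i $ j * v $ i * w $ j)"
 by (simp add: inner_vec_def matrix_vector_mult_def sum_distrib_left mult_ac)

lemma inner_matrix_left: "((A :: real ^ 'n::finite ^ 'm::finite) *v x) \<bullet> y = x \<bullet> (transpose A *v y)"
 by (metis dot_lmul_matrix inner_commute vector_transpose_matrix transpose_transpose)

lemma pos_def_sym: "pos_def G ==> G $ i $ j = G $ j $ i"
proof -
 assume "pos_def G"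
 hence "G $ i $ j = transpose G $ i $ j" by (simp only: pos_def_def)
 thus ?thesis by (simp add: transpose_def)
qed

lemma pos_def_factor:
 fixes G :: "real ^ 'n::finite ^ 'n"
 assumes "pos_def G"
 obtains e :: "'n => 'n => real" where "!!i j. G $ i $ j = (SUM a:UNIV. e a i * e a j)"
proof -
 have "EX e :: 'n => 'n => real. ALL i:UNIV. ALL j:UNIV. G $ i $ j = (SUM a:UNIV. e a i * e a j)"
 proof (rule pd_factor)
  fix v :: "'n => real" and i assume "v i ~= 0"
  hence "(\<chi> i. v i) ~= 0" by (metis vec_lambda_beta zero_index)
  hence "(\<chi> i. v i) \<bullet> (G *v (\<chi> i. v i)) > 0" using assms by (simp add: pos_def_def)
  thus "(SUM i:UNIV. SUM j:UNIV. v i * G $ i $ j * v j) > 0" by (simp add: inner_matrix_vector mult_ac)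
 qed (use pos_def_sym[OF assms] in auto)
 thus ?thesis using that by blast
qed

lemma pos_def_invertible: "pos_def (G :: real ^ 'n::finite ^ 'n) ==> invertible G"
 unfolding invertible_left_inverse matrix_left_invertible_ker pos_def_def by fastforce

lemma pos_def_det:
 fixes G :: "real ^ 'n::finite ^ 'n"
 assumes "pos_def G"
 shows "det G > 0"
proof -
 obtain e :: "'n => 'n => real" where e: "!!i j. G $ i $ j = (SUM a:UNIV. e a i * e a j)" using pos_def_factor[OF assms] by blast
 define A :: "real ^ 'n ^ 'n" where "A = (\<chi> a i. e a i)"
 have "G = transpose A ** A" by (simp add: vec_eq_iff matrix_matrix_mult_def transpose_def A_def e)
 hence "det G = (det A)^2" by (simp add: det_mul power2_eq_square)
 moreover have "det G ~= 0" using pos_def_invertible[OF assms] by (simp add: invertible_det_nz)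
 ultimately show ?thesis by (metis zero_less_power2 zero_eq_power2)
qed

lemma matrix_inv_works:
 fixes G :: "real ^ 'n::finite ^ 'n"
 assumes "invertible G"
 shows "G ** matrix_inv G = mat 1" "matrix_inv G ** G = mat 1"
proof -
 have "EX B. G ** B = mat 1 & B ** G = mat 1" using assms by (auto simp: invertible_def)
 hence "G ** matrix_inv G = mat 1 & matrix_inv G ** G = mat 1" unfolding matrix_inv_def by (rule someI_ex)
 thus "G ** matrix_inv G = mat 1" "matrix_inv G ** G = mat 1" by auto
qed

lemma matrix_inv_vector:
 fixes G :: "real ^ 'n::finite ^ 'n"
 assumes "invertible G"
 shows "G *v (matrix_inv G *v v) = v" "matrix_inv G *v (G *v v) = v"
 by (simp_all add: matrix_vector_mul_assoc matrix_inv_works[OF assms])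

lemma pos_def_inv:
 fixes G :: "real ^ 'n::finite ^ 'n"
 assumes "pos_def G"
 shows "pos_def (matrix_inv G)"
 unfolding pos_def_def
proof (intro conjI allI impI)
 let ?B = "matrix_inv G"
 note w = matrix_inv_works[OF pos_def_invertible[OF assms]]
 have sym: "transpose G = G" using assms by (simp add: pos_def_def)
 have "transpose ?B ** G = transpose (G ** ?B)" by (simp add: matrix_transpose_mul sym)
 hence "transpose ?B ** G = mat 1" by (simp add: w transpose_mat)
 hence "transpose ?B ** (G ** ?B) = ?B" by (simp add: matrix_mul_assoc)
 thus "transpose ?B = ?B" by (simp add: w)
 fix v :: "real ^ 'n" assume v: "v ~= 0"
 define u where "u = ?B *v v"
 have Gu: "G *v u = v" unfolding u_def by (rule matrix_inv_vector[OF pos_def_invertible[OF assms]])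
 hence "u ~= 0" using v by auto
 hence "u \<bullet> (G *v u) > 0" using assms by (simp add: pos_def_def)
 thus "v \<bullet> (?B *v v) > 0" using Gu u_def by (simp add: inner_commute)
qed

lemma matrix_inv_cramer:
 fixes G :: "real ^ 'n::finite ^ 'n"
 assumes "invertible G"
 shows "matrix_inv G $ k $ j = det (\<chi> i l. if l = k then axis j 1 $ i else G $ i $ l) / det G"
proof -
 have "det G ~= 0" using assms by (simp add: invertible_det_nz)
 from cramer[OF this, of "matrix_inv G *v axis j 1" "axis j 1"] matrix_inv_vector(1)[OF assms]
 have "matrix_inv G *v axis j 1 = (\<chi> k. det (\<chi> i l. if l = k then axis j 1 $ i else G $ i $ l) / det G)" by blast
 thus ?thesis by (simp add: matrix_vector_mult_basis column_def vec_eq_iff)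
qed

text \<open>Writing \<open>B\<close> as a Gram matrix reduces the contraction of tensors to a sum of squares; this
bounds the components of covariant derivatives by their norm.\<close>
lemma pos_def_tensor:
 fixes B :: "real ^ 'n::finite ^ 'n" and T :: "'n => 'n => real"
 assumes B: "pos_def B" and l: "!!v. l * (v \<bullet> v) <= v \<bullet> (B *v v)" "l >= 0"
 shows "l\<^sup>2 * (SUM k:UNIV. SUM m:UNIV. (T k m)^2) <=
  (SUM k:UNIV. SUM j:UNIV. B $ k $ j * (SUM m:UNIV. SUM n:UNIV. B $ m $ n * T k m * T j n))"
proof -
 obtain e :: "'n => 'n => real" where e: "!!i j. B $ i $ j = (SUM a:UNIV. e a i * e a j)" using pos_def_factor[OF B] by blast
 define u where "u a k = (SUM m:UNIV. T k m * e a m)" for a k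
 have in1: "(SUM m:UNIV. SUM n:UNIV. B $ m $ n * T k m * T j n) = (SUM a:UNIV. u a k * u a j)" for k j
 proof -
  have "(SUM a:UNIV. u a k * u a j) = (SUM a:UNIV. SUM m:UNIV. SUM n:UNIV. (e a m * e a n) * (T k m * T j n))"
  unfolding u_def sum_product by (intro sum.cong) (auto simp: mult_ac)
  also have "... = (SUM m:UNIV. SUM a:UNIV. SUM n:UNIV. (e a m * e a n) * (T k m * T j n))" by (rule sum.swap)
  also have "... = (SUM m:UNIV. SUM n:UNIV. SUM a:UNIV. (e a m * e a n) * (T k m * T j n))" by (rule sum.cong[OF refl], rule sum.swap)
  also have "... = (SUM m:UNIV. SUM n:UNIV. B $ m $ n * T k m * T j n)" by (simp add: e sum_distrib_right mult.assoc)
  finally show ?thesis by simp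
 qed
 have low: "l * (SUM k:UNIV. (x k)^2) <= (SUM k:UNIV. SUM j:UNIV. B $ k $ j * x k * x j)" for x :: "'n => real"
  using l(1)[of "\<chi> k. x k"] unfolding inner_matrix_vector by (simp add: inner_vec_def power2_eq_square mult_ac)
 have "l\<^sup>2 * (SUM k:UNIV. SUM m:UNIV. (T k m)^2) = l * (SUM k:UNIV. l * (SUM m:UNIV. (T k m)^2))"
  by (simp add: power2_eq_square sum_distrib_left mult_ac)
 also have "... <= l * (SUM k:UNIV. SUM m:UNIV. SUM n:UNIV. B $ m $ n * T k m * T k n)" by (intro mult_left_mono sum_mono low l(2))
 also have "... = l * (SUM k:UNIV. SUM a:UNIV. u a k * u a k)" by (simp add: in1)
 also have "... = (SUM a:UNIV. l * (SUM k:UNIV. (u a k)^2))"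
  unfolding sum.swap[of "%k a. u a k * u a k"] by (simp add: sum_distrib_left power2_eq_square)
 also have "... <= (SUM a:UNIV. SUM k:UNIV. SUM j:UNIV. B $ k $ j * u a k * u a j)" by (intro sum_mono low)
 also have "... = (SUM k:UNIV. SUM a:UNIV. SUM j:UNIV. B $ k $ j * u a k * u a j)" by (rule sum.swap)
 also have "... = (SUM k:UNIV. SUM j:UNIV. SUM a:UNIV. B $ k $ j * u a k * u a j)" by (rule sum.cong[OF refl], rule sum.swap)
 also have "... = (SUM k:UNIV. SUM j:UNIV. B $ k $ j * (SUM m:UNIV. SUM n:UNIV. B $ m $ n * T k m * T j n))"
  unfolding in1 by (simp add: sum_distrib_left mult.assoc)
 finally show ?thesis .
qed

section \<open>Charts of the manifold and of its product with the half line\<close>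

definition cU :: "('x, 'n::finite) chart => ((real ^ 'n) * real) set" where
 "cU c = cimg c \<times> {0<..}"

abbreviation lbU :: "('x, 'n::finite) chart => ((real ^ 'n) * real) measure" where
 "lbU c \<equiv> restrict_space lborel (cU c)"

definition hat :: "('x, 'n::finite) chart => ('x * real => real) => (real ^ 'n) * real => real" where
 "hat c ph y = ph (cinv c (fst y), snd y)"

abbreviation co :: "('x, 'n::finite) chart => 'x * real => (real ^ 'n) * real" where
 "co c z \<equiv> (cmap c (fst z), snd z)"

abbreviation fd :: "('a::real_normed_vector => real) => 'a => 'a => real" where
 "fd f v y \<equiv> FD f y v"

abbreviation ex :: "'n::finite => (real ^ 'n) * real" where
 "ex i \<equiv> (axis i 1, 0)"

abbreviation es :: "(real ^ 'n::finite) \<times> real" where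
 "es \<equiv> (0, 1)"

locale riem_manifold =
 fixes M :: "('x::{t2_space, second_countable_topology}, 'n::finite) riemannian"
 assumes M: "oriented_riemannian_manifold M"
begin

abbreviation Sm :: "('x * real => real) => bool" where
 "Sm \<equiv> smooth_mk M"

definition ginv :: "('x, 'n) chart => 'n => 'n => (real ^ 'n) * real => real" where
 "ginv c i j y = matrix_inv (gram M c (cinv c (fst y))) $ i $ j"

definition sg :: "('x, 'n) chart => (real ^ 'n) * real => real" where
 "sg c y = sqrt (det (gram M c (cinv c (fst y))))"

lemma atlas: "oriented_smooth_atlas (atlas M)"
 using M by (simp add: oriented_riemannian_manifold_def)

lemma chart_facts:
 assumes "c : atlas M"
 shows "open (cdom c)" "open (cimg c)" "homeomorphism (cdom c) (cimg c) (cmap c) (cinv c)"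
 using atlas assms unfolding oriented_smooth_atlas_def by auto

lemma open_cU: "c : atlas M ==> open (cU c)"
 unfolding cU_def using chart_facts open_Times open_greaterThan by blast

lemma cinv_cmap: "c : atlas M ==> x : cdom c ==> cinv c (cmap c x) = x"
 using chart_facts(3) by (simp add: homeomorphism_def)

lemma cmap_cinv: "c : atlas M ==> y : cimg c ==> cmap c (cinv c y) = y"
 by (rule f_inv_into_f)

lemma cinv_in: "y : cimg c ==> cinv c y : cdom c"
 by (rule inv_into_into)

lemma continuous_cmap: "c : atlas M ==> continuous_on (cdom c) (cmap c)"
 using chart_facts(3) homeomorphism_def by blast

lemma continuous_cinv: "c : atlas M ==> continuous_on (cimg c) (cinv c)"
 using chart_facts(3) homeomorphism_def by blast

lemma co_in: "x : cdom c ==> s > 0 ==> (cmap c x, s) : cU c"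
 by (simp add: cU_def)

lemma hat_co: "c : atlas M ==> x : cdom c ==> hat c ph (cmap c x, s) = ph (x, s)"
 by (simp add: hat_def cinv_cmap)

lemma charts_cover: obtains c where "c : atlas M" "x : cdom c"
proof -
 have "x : (UN c:atlas M. cdom c)" using atlas unfolding oriented_smooth_atlas_def by auto
 thus ?thesis using that by blast
qed

lemma chart_at: "chart_at M x : atlas M" "x : cdom (chart_at M x)"
proof -
 have "EX c. c : atlas M & x : cdom c" using charts_cover by blast
 hence "chart_at M x : atlas M & x : cdom (chart_at M x)" unfolding chart_at_def by (rule someI_ex)
 thus "chart_at M x : atlas M" "x : cdom (chart_at M x)" by auto
qed

lemma gram_pos_def:
 assumes "c : atlas M" "x : cdom c"
 shows "pos_def (gram M c x)"
 using M assms unfolding oriented_riemannian_manifold_def pos_def_def by blast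

lemma gram_trans:
 "c : atlas M ==> d : atlas M ==> x : cdom c ==> x : cdom d ==>
  gram M c x = transpose (jac c d x) ** gram M d x ** jac c d x" using M unfolding oriented_riemannian_manifold_def by blast

lemma open_chart_image:
 assumes "c : atlas M" "open V" "V <= cdom c"
 shows "open (cmap c ` V)"
proof -
 have "openin (top_of_set (cimg c)) (cmap c ` V)" by (rule homeomorphism_imp_open_map[OF chart_facts(3)[OF assms(1)]])
  (use assms open_subset in auto)
 thus ?thesis using chart_facts(2)[OF assms(1)] by (simp add: openin_open_eq)
qed

lemma trans_smooth:
 assumes "c : atlas M" "d : atlas M"
 shows "smooth_on (cmap c ` (cdom c Int cdom d)) (cmap d \<circ> cinv c)"
  and "open (cmap c ` (cdom c Int cdom d))"
proof -
 show "smooth_on (cmap c ` (cdom c Int cdom d)) (cmap d \<circ> cinv c)" using atlas assms unfolding oriented_smooth_atlas_def by blast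
 show "open (cmap c ` (cdom c Int cdom d))" using chart_facts(1)[OF assms(1)] chart_facts(1)[OF assms(2)]
  by (intro open_chart_image[OF assms(1)] open_Int) auto
qed

lemma jac_works:
 assumes "c : atlas M" "d : atlas M" "x : cdom c" "x : cdom d"
 shows "jac c d x *v v = FD (cmap d \<circ> cinv c) (cmap c x) v"
  and "((cmap d \<circ> cinv c) has_derivative (*v) (jac c d x)) (at (cmap c x))"
  and "invertible (jac c d x)"
proof -
 have h: "((cmap d \<circ> cinv c) has_derivative FD (cmap d \<circ> cinv c) (cmap c x)) (at (cmap c x))"
  by (rule smooth_on_has_derivative[OF trans_smooth(1)]) (use assms in auto)
 show 1: "jac c d x *v v = FD (cmap d \<circ> cinv c) (cmap c x) v" for v
  unfolding jac_def using has_derivative_linear[OF h] by (simp add: matrix_works linear_matrix_vector_mul_eq)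
 hence "(*v) (jac c d x) = FD (cmap d \<circ> cinv c) (cmap c x)" by (intro ext)
 thus "((cmap d \<circ> cinv c) has_derivative (*v) (jac c d x)) (at (cmap c x))" using h by (simp only:)
 have "det (jac c d x) > 0" using atlas assms unfolding oriented_smooth_atlas_def by blast
 thus "invertible (jac c d x)" by (simp add: invertible_det_nz)
qed

text \<open>Differentials are covariant; raising their index gives a compatible family of coordinate vectors,
that is, a tangent vector.\<close>
lemma chart_pd_trans:
 assumes cd: "c : atlas M" "d : atlas M" "x : cdom c" "x : cdom d"
  and f: "(f \<circ> cinv d) differentiable (at (cmap d x))"
 shows "(\<chi> i. chart_pd c i f x) = transpose (jac c d x) *v (\<chi> i. chart_pd d i f x)"
proof -
 let ?D = "FD (f \<circ> cinv d) (cmap d x)"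
 have x: "(cmap d \<circ> cinv c) (cmap c x) = cmap d x" using cd by (simp add: cinv_cmap)
 have D: "((f \<circ> cinv d) has_derivative ?D) (at ((cmap d \<circ> cinv c) (cmap c x)))" using f frechet_derivative_works x by metis
 have "((%y. (f \<circ> cinv d) ((cmap d \<circ> cinv c) y)) has_derivative (%v. ?D (jac c d x *v v))) (at (cmap c x))"
  by (rule has_derivative_compose[OF jac_works(2)[OF cd] D])
 hence "((f \<circ> cinv c) has_derivative (%v. ?D (jac c d x *v v))) (at (cmap c x))"
  by (rule has_derivative_cong_open[where S = "cmap c ` (cdom c Int cdom d)", THEN iffD1, rotated 3])
  (use cd trans_smooth(2) in \<open>auto simp: cinv_cmap\<close>)
 hence e: "FD (f \<circ> cinv c) (cmap c x) = (%v. ?D (jac c d x *v v))" by (rule frechet_derivative_eqI)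
 have Dw: "?D w = (SUM j:UNIV. w $ j * ?D (axis j 1))" for w
 proof -
  have lin: "linear ?D" using D has_derivative_linear by blast
  have "?D w = ?D (SUM j:UNIV. w $ j *\<^sub>R axis j 1)" using basis_expansion[of w] by (simp add: scalar_mult_eq_scaleR)
  also have "... = (SUM j:UNIV. w $ j * ?D (axis j 1))" by (simp add: linear_sum[OF lin] linear_scale[OF lin])
  finally show ?thesis .
 qed
 have "chart_pd c i f x = (SUM j:UNIV. jac c d x $ j $ i * chart_pd d j f x)" for i
  unfolding chart_pd_def e Dw[of "jac c d x *v axis i 1"] by (simp add: matrix_vector_mult_basis column_def)
 thus ?thesis by (simp add: vec_eq_iff matrix_vector_mult_def transpose_def)
qed

definition raise :: "'x => (('x, 'n) chart => real ^ 'n) => ('x, 'n) tangent" where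
 "raise x \<xi> = (%c. if c : atlas M & x : cdom c then matrix_inv (gram M c x) *v \<xi> c else 0)"

lemma raise_tangent:
 assumes "!!c d. c : atlas M ==> d : atlas M ==> x : cdom c ==> x : cdom d ==> \<xi> c = transpose (jac c d x) *v \<xi> d"
 shows "raise x \<xi> : tangent_space M x"
proof -
 have "matrix_inv (gram M d x) *v \<xi> d = jac c d x *v (matrix_inv (gram M c x) *v \<xi> c)"
  if cd: "c : atlas M" "d : atlas M" "x : cdom c" "x : cdom d" for c d
 proof -
  define w where "w = matrix_inv (gram M c x) *v \<xi> c"
  have ic: "invertible (gram M c x)" and id: "invertible (gram M d x)" using gram_pos_def pos_def_invertible cd by blast+
  have "transpose (jac c d x) *v (gram M d x *v (jac c d x *v w)) = gram M c x *v w"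
  by (simp add: gram_trans[OF cd] matrix_vector_mul_assoc matrix_mul_assoc)
  also have "... = transpose (jac c d x) *v \<xi> d" unfolding w_def matrix_inv_vector(1)[OF ic] by (rule assms[OF cd])
  finally have e: "transpose (jac c d x) *v (gram M d x *v (jac c d x *v w)) = transpose (jac c d x) *v \<xi> d" .
  have "invertible (transpose (jac c d x))" using jac_works(3)[OF cd] by (simp add: invertible_det_nz)
  from arg_cong[OF e, of "(*v) (matrix_inv (transpose (jac c d x)))"]
  have "gram M d x *v (jac c d x *v w) = \<xi> d" by (simp only: matrix_inv_vector(2)[OF \<open>invertible (transpose (jac c d x))\<close>])
  from arg_cong[OF this, of "(*v) (matrix_inv (gram M d x))"]
  show ?thesis unfolding w_def[symmetric] by (simp only: matrix_inv_vector(2)[OF id])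
 qed
 note t = this
 show ?thesis unfolding tangent_space_def mem_Collect_eq
 proof (intro conjI ballI allI impI)
  show "raise x \<xi> c = 0" if "\<not> (c : atlas M & x : cdom c)" for c unfolding raise_def using that by (rule if_not_P)
  show "raise x \<xi> d = jac c d x *v raise x \<xi> c"
  if "c : atlas M" "d : atlas M" "x : cdom c Int cdom d" for c d
  proof -
  have x: "x : cdom c" "x : cdom d" using that(3) by auto
  have "raise x \<xi> d = matrix_inv (gram M d x) *v \<xi> d" "raise x \<xi> c = matrix_inv (gram M c x) *v \<xi> c"
  unfolding raise_def using that x by auto
  thus ?thesis using t[OF that(1,2) x] by (simp only:)
  qed
 qed
qed

lemma tinner_chart:
 assumes "v : tangent_space M x" "w : tangent_space M x" "c : atlas M" "x : cdom c"
 shows "tinner M x v w = v c \<bullet> (gram M c x *v w c)"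
proof -
 let ?d = "chart_at M x"
 have "v ?d = jac c ?d x *v v c" "w ?d = jac c ?d x *v w c" using assms chart_at[of x] unfolding tangent_space_def by blast+
 hence "tinner M x v w = v c \<bullet> (transpose (jac c ?d x) *v (gram M ?d x *v (jac c ?d x *v w c)))"
  unfolding tinner_def Let_def by (simp add: inner_matrix_left)
 thus ?thesis by (simp add: gram_trans[OF assms(3) chart_at(1) assms(4) chart_at(2)] matrix_vector_mul_assoc matrix_mul_assoc)
qed

lemma hat_smooth: "Sm ph ==> c : atlas M ==> smooth_on (cU c) (hat c ph)"
 unfolding smooth_mk_def cU_def hat_def by auto

lemma chart_pd_E:
 assumes c: "c : atlas M" "x : cdom c" and \<Psi>: "\<Psi> differentiable (at (cmap c x, s))"
  and eq: "!!z. z : cdom c ==> Ph z = \<Psi> (cmap c z, s)"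
 shows "chart_pd c i Ph x = fd \<Psi> (ex i) (cmap c x, s)"
  and "(Ph \<circ> cinv c) differentiable (at (cmap c x))"
proof -
 have h: "((%et. (et, s)) has_derivative (%v. (v, 0))) (at (cmap c x))" by (auto intro!: derivative_eq_intros)
 have "((%et. \<Psi> (et, s)) has_derivative (%v. fd \<Psi> (v, 0) (cmap c x, s))) (at (cmap c x))"
  using has_derivative_compose[OF h] \<Psi> frechet_derivative_works by blast
 hence "((Ph \<circ> cinv c) has_derivative (%v. fd \<Psi> (v, 0) (cmap c x, s))) (at (cmap c x))"
  by (rule has_derivative_cong_open[where S = "cimg c", THEN iffD1, rotated 3])
  (use c chart_facts(2) eq in \<open>auto simp: cinv_cmap\<close>)
 thus "chart_pd c i Ph x = fd \<Psi> (ex i) (cmap c x, s)" "(Ph \<circ> cinv c) differentiable (at (cmap c x))"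
  by (auto simp: chart_pd_def frechet_derivative_eqI differentiable_def)
qed

lemma chart_pd_hat:
 assumes "Sm ph" "c : atlas M" "x : cdom c" "s > 0"
 shows "chart_pd c i (%x. ph (x, s)) x = fd (hat c ph) (ex i) (cmap c x, s)"
  and "((%x. ph (x, s)) \<circ> cinv c) differentiable (at (cmap c x))"
proof -
 have "hat c ph differentiable (at (cmap c x, s))" by (rule smooth_on_differentiable[OF hat_smooth[OF assms(1,2)] co_in[OF assms(3,4)]])
 from chart_pd_E[OF assms(2,3) this, of "%x. ph (x, s)"] 
 show "chart_pd c i (%x. ph (x, s)) x = fd (hat c ph) (ex i) (cmap c x, s)"
  "((%x. ph (x, s)) \<circ> cinv c) differentiable (at (cmap c x))" using hat_co[OF assms(2)] by auto
qed

lemma deriv_E: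
 assumes \<Psi>: "smooth_on (cU c) \<Psi>" and s: "(y, s) : cU c" and eq: "!!t. t > 0 ==> f t = \<Psi> (y, t)"
 shows "deriv f s = fd \<Psi> es (y, s)" "(f has_real_derivative fd \<Psi> es (y, s)) (at s)"
proof -
 have s0: "s > 0" using s by (simp add: cU_def)
 have h: "((%t. (y, t)) has_derivative (%v. (0, v))) (at s)" by (auto intro!: derivative_eq_intros)
 have d: "((%t. \<Psi> (y, t)) has_derivative (%v. fd \<Psi> (0, v) (y, s))) (at s)"
  using has_derivative_compose[OF h smooth_on_has_derivative[OF \<Psi> s]] .
 have lin: "linear (frechet_derivative \<Psi> (at (y, s)))" using has_derivative_linear[OF smooth_on_has_derivative[OF \<Psi> s]] .
 have "(%v. fd \<Psi> (0, v) (y, s)) = (*) (fd \<Psi> es (y, s))"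
 proof
  fix v show "fd \<Psi> (0, v) (y, s) = fd \<Psi> es (y, s) * v" using linear_scale[OF lin, of v es] by (simp add: mult.commute)
 qed
 hence "((%t. \<Psi> (y, t)) has_derivative (*) (fd \<Psi> es (y, s))) (at s)" using d by (simp only:)
 hence "(f has_derivative (*) (fd \<Psi> es (y, s))) (at s)"
  by (rule has_derivative_cong_open[where S = "{0<..}", THEN iffD1, rotated 3]) (use s0 eq in auto)
 thus "(f has_real_derivative fd \<Psi> es (y, s)) (at s)" by (simp add: has_field_derivative_def)
 thus "deriv f s = fd \<Psi> es (y, s)" by (rule DERIV_imp_deriv)
qed

lemma deriv_s_hat:
 assumes "Sm ph" "c : atlas M" "x : cdom c" "s > 0"
 shows "deriv_s 1 ph (x, s) = fd (hat c ph) es (cmap c x, s)"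
  and "deriv_s 2 ph (x, s) = fd (fd (hat c ph) es) es (cmap c x, s)"
proof -
 have h: "smooth_on (cU c) (hat c ph)" using hat_smooth assms by blast
 have 1: "deriv (%t. ph (x, t)) t = fd (hat c ph) es (cmap c x, t)" if "t > 0" for t
  by (rule deriv_E(1)[OF h co_in[OF assms(3) that]]) (simp add: hat_co[OF assms(2,3)])
 thus "deriv_s 1 ph (x, s) = fd (hat c ph) es (cmap c x, s)" using assms by (simp add: deriv_s_def)
 have "deriv (deriv (%t. ph (x, t))) s = fd (fd (hat c ph) es) es (cmap c x, s)"
  by (rule deriv_E(1)[OF smooth_on_frechet[OF h] co_in[OF assms(3,4)]]) (rule 1)
 thus "deriv_s 2 ph (x, s) = fd (fd (hat c ph) es) es (cmap c x, s)" by (simp add: deriv_s_def numeral_2_eq_2)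
qed

lemma grad_X_raise: "grad_X M f x = raise x (%c. \<chi> i. chart_pd c i f x)"
 unfolding grad_X_def raise_def ..

lemma grad_mk_tangent:
 assumes "Sm ph" "s > 0"
 shows "fst (grad_mk M ph (x, s)) : tangent_space M x"
 unfolding grad_mk_def grad_X_raise fst_conv snd_conv by (rule raise_tangent, rule chart_pd_trans) (use chart_pd_hat(2) assms in auto)

lemma grad_mk_chart:
 assumes "Sm ph" "s > 0" "c : atlas M" "x : cdom c"
 shows "fst (grad_mk M ph (x, s)) c = matrix_inv (gram M c x) *v (\<chi> i. fd (hat c ph) (ex i) (cmap c x, s))"
  and "snd (grad_mk M ph (x, s)) = s * fd (hat c ph) es (cmap c x, s)"
 unfolding grad_mk_def grad_X_raise raise_def using assms chart_pd_hat(1)[OF assms(1,3,4,2)] deriv_s_hat(1)[OF assms(1,3,4,2)] by auto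

definition Gam :: "('x, 'n) chart => ((real ^ 'n) * real => real) => ((real ^ 'n) * real => real) => (real ^ 'n) * real => real" where
 "Gam c f h y = (SUM i:UNIV. SUM j:UNIV. ginv c i j y * fd f (ex i) y * fd h (ex j) y)
  + (snd y)^2 * (fd f es y * fd h es y)"

lemma minner_tangent_grad:
 assumes c: "c : atlas M" "x : cdom c" and W: "w : tangent_space M x"
  and ph: "Sm ph" "s > 0"
 shows "minner M x (w, r) (grad_mk M ph (x, s)) =
  (SUM i:UNIV. SUM j:UNIV. ginv c i j (cmap c x, s) * (gram M c x *v w c) $ i * fd (hat c ph) (ex j) (cmap c x, s))
  + r * (s * fd (hat c ph) es (cmap c x, s))"
proof -
 let ?g = "gram M c x" and ?d = "\<chi> i. fd (hat c ph) (ex i) (cmap c x, s)"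
 have pd: "pos_def ?g" using gram_pos_def c by blast
 have "tinner M x w (fst (grad_mk M ph (x, s))) = w c \<bullet> (?g *v (matrix_inv ?g *v ?d))"
  using tinner_chart[OF W grad_mk_tangent[OF ph] c] grad_mk_chart(1)[OF ph c] by simp
 also have "... = (?g *v w c) \<bullet> (matrix_inv ?g *v ?d)" using pd by (simp add: inner_matrix_left pos_def_def)
 finally show ?thesis unfolding minner_def using grad_mk_chart(2)[OF ph c] c by (simp add: inner_matrix_vector ginv_def cinv_cmap)
qed

lemma minner_grad:
 assumes "c : atlas M" "x : cdom c" "Sm ph" "Sm psi" "s > 0"
 shows "minner M x (grad_mk M ph (x, s)) (grad_mk M psi (x, s)) = Gam c (hat c ph) (hat c psi) (cmap c x, s)"
proof -
 have "grad_mk M ph (x, s) = (fst (grad_mk M ph (x, s)), snd (grad_mk M ph (x, s)))" by simp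
 thus ?thesis using minner_tangent_grad[OF assms(1,2) grad_mk_tangent[OF assms(3,5)] assms(4,5), of "snd (grad_mk M ph (x, s))"]
  grad_mk_chart[OF assms(3,5,1,2)] matrix_inv_vector(1)[OF pos_def_invertible[OF gram_pos_def[OF assms(1,2)]]]
  by (simp add: Gam_def power2_eq_square mult_ac)
qed

lemma smooth_fst: "smooth_on S (fst :: (real ^ 'n) * real => real ^ 'n)" and smooth_snd: "smooth_on S (snd :: (real ^ 'n) * real => real)"
 by (auto intro: smooth_on_bounded_linear bounded_linear_fst bounded_linear_snd)

lemma smooth_gram:
 assumes "c : atlas M"
 shows "smooth_on (cU c) (%y. gram M c (cinv c (fst y)) $ i $ j)"
proof -
 have "smooth_on (cimg c) (%y. gram M c (cinv c y))" using M assms unfolding oriented_riemannian_manifold_def by blast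
 hence "smooth_on (cimg c) (%y. gram M c (cinv c y) $ i $ j)" by (rule smooth_on_linear_image[rotated 2])
  (auto intro: chart_facts assms bounded_linear_compose[OF bounded_linear_vec_nth bounded_linear_vec_nth])
 thus ?thesis by (rule smooth_on_compose[OF open_cU[OF assms] chart_facts(2)[OF assms] _ smooth_fst]) (auto simp: cU_def)
qed

lemma smooth_det:
 assumes "open S" "!!i j. smooth_on S (%y. A y $ i $ j :: real)"
 shows "smooth_on S (%y. det (A y :: real ^ 'm::finite ^ 'm))"
 unfolding det_def by (intro smooth_on_sum smooth_on_mult smooth_on_prod smooth_on_const assms)

lemma gram_at_pos:
 "c : atlas M ==> y : cU c ==> pos_def (gram M c (cinv c (fst y)))" by (rule gram_pos_def) (auto simp: cU_def intro: inv_into_into)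

lemma sg_pos: "c : atlas M ==> y : cU c ==> sg c y > 0"
 using pos_def_det[OF gram_at_pos] by (simp add: sg_def)

lemma smooth_sg: "c : atlas M ==> smooth_on (cU c) (sg c)"
 unfolding sg_def[abs_def] by (intro smooth_on_sqrt smooth_det smooth_gram open_cU pos_def_det gram_at_pos)

lemma smooth_ginv:
 assumes "c : atlas M"
 shows "smooth_on (cU c) (ginv c i j)"
proof -
 have "smooth_on (cU c) (%y. det (\<chi> k l. if l = i then axis j 1 $ k else gram M c (cinv c (fst y)) $ k $ l)
  / det (gram M c (cinv c (fst y))))"
 proof (intro smooth_on_divide smooth_det smooth_gram open_cU pos_def_det gram_at_pos assms)
  show "smooth_on (cU c) (%y. (\<chi> k l. if l = i then axis j 1 $ k else gram M c (cinv c (fst y)) $ k $ l) $ k $ l)" for k l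
  by (cases "l = i") (auto intro: smooth_gram assms)
 qed
 thus ?thesis by (rule smooth_on_cong[OF open_cU[OF assms], rotated])
  (simp add: ginv_def matrix_inv_cramer[OF pos_def_invertible[OF gram_at_pos[OF assms]]])
qed

lemma ginv_sym: "c : atlas M ==> y : cU c ==> ginv c i j y = ginv c j i y"
 unfolding ginv_def using pos_def_sym[OF pos_def_inv[OF gram_at_pos]] by blast

definition lapE :: "('x, 'n) chart => ((real ^ 'n) * real => real) => (real ^ 'n) * real => real" where
 "lapE c f y = (SUM i:UNIV. fd (%y. sg c y * (SUM j:UNIV. ginv c i j y * fd f (ex j) y)) (ex i) y) / sg c y"

lemma smooth_flux:
 assumes c: "c : atlas M" and f: "smooth_on (cU c) f"
 shows "smooth_on (cU c) (%y. sg c y * (SUM j:UNIV. ginv c i j y * fd f (ex j) y))"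
 by (intro smooth_on_mult smooth_on_sum smooth_on_frechet smooth_sg smooth_ginv open_cU c f)

lemma smooth_lapE:
 assumes c: "c : atlas M" and f: "smooth_on (cU c) f"
 shows "smooth_on (cU c) (lapE c f)"
 unfolding lapE_def[abs_def] by (intro smooth_on_divide smooth_on_sum smooth_on_frechet smooth_flux smooth_sg sg_pos open_cU c f)

lemma smooth_Gam:
 assumes c: "c : atlas M" and f: "smooth_on (cU c) f" "smooth_on (cU c) h"
 shows "smooth_on (cU c) (Gam c f h)"
 unfolding Gam_def[abs_def] power2_eq_square
 by (intro smooth_on_add smooth_on_mult smooth_on_sum smooth_on_frechet smooth_ginv smooth_snd open_cU c f)

lemma laplace_chart_at:
 assumes ph: "Sm ph" and s: "s > 0"
 shows "laplace_beltrami M (%x. ph (x, s)) x = lapE (chart_at M x) (hat (chart_at M x) ph) (cmap (chart_at M x) x, s)"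
proof -
 let ?c = "chart_at M x"
 have c: "?c : atlas M" "x : cdom ?c" by (rule chart_at)+
 have "chart_pd ?c i (%z. sqrt (det (gram M ?c z)) * grad_X M (%x. ph (x, s)) z ?c $ i) x =
  fd (%y. sg ?c y * (SUM j:UNIV. ginv ?c i j y * fd (hat ?c ph) (ex j) y)) (ex i) (cmap ?c x, s)" for i
 proof (rule chart_pd_E(1)[OF c])
  show "(%y. sg ?c y * (SUM j:UNIV. ginv ?c i j y * fd (hat ?c ph) (ex j) y)) differentiable at (cmap ?c x, s)"
  by (rule smooth_on_differentiable[OF smooth_flux[OF c(1) hat_smooth[OF ph c(1)]] co_in[OF c(2) s]])
  fix z assume z: "z : cdom ?c"
  show "sqrt (det (gram M ?c z)) * grad_X M (%x. ph (x, s)) z ?c $ i =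
  sg ?c (cmap ?c z, s) * (SUM j:UNIV. ginv ?c i j (cmap ?c z, s) * fd (hat ?c ph) (ex j) (cmap ?c z, s))"
  using z c s ph by (simp add: sg_def cinv_cmap grad_X_raise raise_def matrix_vector_mult_def ginv_def chart_pd_hat(1))
 qed
 thus ?thesis unfolding laplace_beltrami_def div_X_def Let_def lapE_def using c by (simp add: sg_def cinv_cmap)
qed

definition lift :: "('x, 'n) chart => ((real ^ 'n) * real => real) => 'x * real => real" where
 "lift c psi z = (if fst z : cdom c then psi (cmap c (fst z), snd z) else 0)"

text \<open>Extension by zero is smooth because the support, being compact in a Hausdorff space, is closed:
around a point outside of it the extension vanishes.\<close>
lemma lift_smooth:
 assumes c: "c : atlas M" and psi: "test_on (cU c) psi"
 shows "Sm (lift c psi)"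
proof -
 obtain K where K: "compact K" "K <= cU c" "!!y. y ~: K ==> psi y = 0" using psi unfolding test_on_def by blast
 define C where "C = cinv c ` fst ` K"
 have "compact (fst ` K)" using K by (auto intro!: compact_continuous_image continuous_intros)
 moreover have fK: "fst ` K <= cimg c" using K by (auto simp: cU_def)
 ultimately have "compact C" unfolding C_def using continuous_on_subset[OF continuous_cinv[OF c]] compact_continuous_image by blast
 hence clC: "closed C" by (rule compact_imp_closed)
 have zero: "lift c psi z = 0" if "fst z ~: C" for z
 proof (cases "fst z : cdom c")
  case True
  hence "(cmap c (fst z), snd z) ~: K" using that cinv_cmap[OF c True] unfolding C_def by (metis fst_conv image_eqI)
  thus ?thesis using K(3) by (simp add: lift_def)
 qed (simp add: lift_def)
 have "smooth_on (cU d) (hat d (lift c psi))" if d: "d : atlas M" for d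
 proof (rule smooth_on_local)
  fix y assume y: "y : cU d"
  show "EX T. open T & y : T & smooth_on T (hat d (lift c psi))"
  proof (cases "cinv d (fst y) : cdom c")
  case True
  let ?V = "cmap d ` (cdom d Int cdom c)"
  let ?T = "?V \<times> {(0::real)<..}"
  have oT: "open ?T" by (intro open_Times open_greaterThan trans_smooth(2)[OF d c])
  have yT: "y : ?T" using y True cmap_cinv[OF d, of "fst y"] cinv_in[of "fst y" d] unfolding cU_def
  by (cases y) (auto intro!: rev_image_eqI[of "cinv d (fst y)"])
  have "smooth_on ?T (%y. psi ((cmap c \<circ> cinv d) (fst y), snd y))"
  proof (rule smooth_on_compose[where f = psi and g = "%y. ((cmap c \<circ> cinv d) (fst y), snd y)", OF oT open_UNIV])
  show "smooth_on UNIV psi" using psi by (simp add: test_on_def)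
  show "smooth_on ?T (%y. ((cmap c \<circ> cinv d) (fst y), snd y))"
  proof (intro smooth_on_Pair oT smooth_snd)
  show "smooth_on ?T (%y. (cmap c \<circ> cinv d) (fst y))"
  by (rule smooth_on_compose_vec[OF oT trans_smooth(2)[OF d c] trans_smooth(1)[OF d c] smooth_fst]) auto
  qed
  qed auto
  hence "smooth_on ?T (hat d (lift c psi))"
  by (rule smooth_on_cong[OF oT, rotated]) (use d in \<open>auto simp: hat_def lift_def cinv_cmap\<close>)
  thus ?thesis using oT yT by blast
  next
  case False
  let ?V = "cimg d Int cinv d -` (- C)"
  let ?T = "?V \<times> {(0::real)<..}"
  have "open ?V" by (rule continuous_open_preimage[OF continuous_cinv[OF d] chart_facts(2)[OF d]]) (use clC in auto)
  hence oT: "open ?T" by (intro open_Times open_greaterThan)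
  have "cinv d (fst y) ~: C" using False fK cinv_in[of _ c] unfolding C_def by auto
  hence "y : ?T" using y by (cases y) (auto simp: cU_def)
  moreover have "smooth_on ?T (hat d (lift c psi))" by (rule smooth_on_cong[OF oT, of "%_. 0"]) (auto simp: hat_def zero)
  ultimately show ?thesis using oT by blast
  qed
 qed
 thus ?thesis unfolding smooth_mk_def hat_def cU_def by simp
qed

end

section \<open>The volume in charts\<close>

lemma sets_lebesgue_pos [measurable_cong]: "sets lebesgue_pos = sets (restrict_space borel {0<..})"
 unfolding lebesgue_pos_def by (rule sets_restrict_space_cong) simp

lemma space_lebesgue_pos: "space lebesgue_pos = {0<..}"
 by (simp add: lebesgue_pos_def space_restrict_space)

lemma sigma_finite_lebesgue_pos: "sigma_finite_measure lebesgue_pos"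
proof (rule sigma_finite_measure.intro, intro exI[of _ "range (%n::nat. {0<..real n})"] conjI ballI)
 show "range (%n::nat. {0<..real n}) <= sets lebesgue_pos" by (auto simp: sets_lebesgue_pos sets_restrict_space_iff)
 show "\<Union> (range (%n::nat. {0<..real n})) = space lebesgue_pos" by (auto simp: space_lebesgue_pos real_arch_simple)
 show "emeasure lebesgue_pos a ~= \<infinity>" if a: "a : range (%n::nat. {0<..real n})" for a
 proof -
  obtain n :: nat where n: "a = {0<..real n}" using a by blast
  have "emeasure lebesgue_pos a = emeasure lborel a" unfolding lebesgue_pos_def n by (rule emeasure_restrict_space) auto
  thus ?thesis unfolding n by simp
 qed
qed simp

lemma nn_integral_lebesgue_pos:
 "(\<integral>\<^sup>+s. f s \<partial>lebesgue_pos) = (nn_integral lborel (%s. f s * indicator {0<..} s))"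
 unfolding lebesgue_pos_def by (rule nn_integral_restrict_space) simp

locale riem_volume = riem_manifold +
 fixes m :: "'a measure"
 assumes vol: "riemannian_volume M m"
begin

abbreviation ml :: "('a * real) measure" where
 "ml \<equiv> m \<Otimes>\<^sub>M lebesgue_pos"

abbreviation NM :: "('a * real => real) => ennreal" where
 "NM f \<equiv> (nn_integral ml (%z. ennreal (f z)))"

lemma sets_m [measurable_cong]: "sets m = sets borel"
 using vol by (simp add: riemannian_volume_def)

lemma space_m [simp]: "space m = UNIV"
 using sets_eq_imp_space_eq[OF sets_m] by simp

lemma space_ml: "space ml = mk UNIV"
 by (simp add: space_pair_measure space_lebesgue_pos mk_def)

lemma chart_sq_continuous:
 assumes "c : atlas M"
 shows "continuous_on (cimg c) (%y. sqrt (det (gram M c (cinv c y))))"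
proof -
 have "continuous_on (cimg c) (%y. sg c (y, 1))" by (rule continuous_on_compose2[OF smooth_on_continuous[OF smooth_sg[OF assms]]])
  (auto simp: cU_def intro!: continuous_intros)
 thus ?thesis by (simp add: sg_def)
qed

lemma nn_integral_chart:
 assumes c: "c : atlas M" and F: "F : borel_measurable borel"
 shows "(nn_integral m (%x. F x * indicator (cdom c) x)) =
  (nn_integral lborel (%y. F (cinv c y) * ennreal (sqrt (det (gram M c (cinv c y)))) * indicator (cimg c) y))"
proof -
 let ?sq = "%y. ennreal (sqrt (det (gram M c (cinv c y))))"
 let ?R = "restrict_space borel (cdom c)"
 have oc: "cdom c : sets borel" "cimg c : sets borel" using chart_facts[OF c] by auto
 have sq: "?sq : borel_measurable (restrict_space lborel (cimg c))"
  using borel_measurable_continuous_on_restrict[OF chart_sq_continuous[OF c]]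
  by (subst measurable_cong_sets[OF sets_restrict_space_cong[OF sets_lborel] refl]) simp
 have ci: "cinv c : measurable (restrict_space lborel (cimg c)) ?R"
 proof (rule measurable_restrict_space2)
  show "cinv c : space (restrict_space lborel (cimg c)) \<rightarrow> cdom c" by (auto simp: space_restrict_space intro: inv_into_into)
  show "cinv c : measurable (restrict_space lborel (cimg c)) borel" using borel_measurable_continuous_on_restrict[OF continuous_cinv[OF c]]
  by (subst measurable_cong_sets[OF sets_restrict_space_cong[OF sets_lborel] refl])
 qed
 let ?N = "distr (density (restrict_space lborel (cimg c)) ?sq) ?R (cinv c)"
 have eq: "restrict_space m (cdom c) = ?N"
 proof (rule measure_eqI)
  show "sets (restrict_space m (cdom c)) = sets ?N" by (simp add: sets_restrict_space sets_m)
  fix A assume "A : sets (restrict_space m (cdom c))"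
  hence A: "A : sets borel" "A <= cdom c" using oc by (auto simp: sets_restrict_space_iff sets_m)
  hence AR: "A : sets ?R" using oc by (simp add: sets_restrict_space_iff)
  have im: "cmap c ` A = cinv c -` A Int cimg c" using A(2) cinv_cmap[OF c] cmap_cinv[OF c] by (force simp: image_iff)
  have "emeasure ?N A = emeasure (density (restrict_space lborel (cimg c)) ?sq) (cinv c -` A Int cimg c)"
  using ci AR by (subst emeasure_distr) (auto simp: space_restrict_space)
  also have "... = (\<integral>\<^sup>+y. ?sq y * indicator (cinv c -` A Int cimg c) y \<partial>restrict_space lborel (cimg c))"
  using measurable_sets[OF ci AR] by (intro emeasure_density sq) (auto simp: space_restrict_space)
  also have "... = (nn_integral lborel (%y. ?sq y * indicator (cinv c -` A Int cimg c) y * indicator (cimg c) y))"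
  using oc by (subst nn_integral_restrict_space) auto
  also have "... = (\<integral>\<^sup>+y\<in>cmap c ` A. ?sq y \<partial>lborel)"
  unfolding im by (intro nn_integral_cong) (auto simp: indicator_def)
  also have "... = emeasure m A" using vol c A unfolding riemannian_volume_def by auto
  also have "... = emeasure (restrict_space m (cdom c)) A" using A oc by (subst emeasure_restrict_space) (auto simp: sets_m)
  finally show "emeasure (restrict_space m (cdom c)) A = emeasure ?N A" by simp
 qed
 have FR: "F : borel_measurable ?R" using F by (rule measurable_restrict_space1)
 have Fci: "(%y. F (cinv c y)) : borel_measurable (restrict_space lborel (cimg c))" using measurable_compose[OF ci FR] .
 have "(nn_integral m (%x. F x * indicator (cdom c) x)) = (\<integral>\<^sup>+x. F x \<partial>restrict_space m (cdom c))"
  using oc by (subst nn_integral_restrict_space) (auto simp: sets_m)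
 also have "... = (\<integral>\<^sup>+y. F (cinv c y) \<partial>density (restrict_space lborel (cimg c)) ?sq)"
  unfolding eq by (rule nn_integral_distr) (use ci FR in auto)
 also have "... = (\<integral>\<^sup>+y. ?sq y * F (cinv c y) \<partial>restrict_space lborel (cimg c))"
  by (rule nn_integral_density[OF sq Fci])
 also have "... = (nn_integral lborel (%y. F (cinv c y) * ?sq y * indicator (cimg c) y))"
  using oc by (subst nn_integral_restrict_space) (auto simp: mult_ac)
 finally show ?thesis .
qed

definition cD :: "('a, 'b) chart => ('a * real) set" where
 "cD c = cdom c \<times> {0<..}"

abbreviation mlD :: "('a, 'b) chart => ('a * real) measure" where
 "mlD c \<equiv> restrict_space ml (cD c)"

abbreviation pt :: "('a, 'b) chart => (real ^ 'b) * real => 'a * real" where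
 "pt c y \<equiv> (cinv c (fst y), snd y)"

abbreviation mU :: "('a, 'b) chart => ((real ^ 'b) * real => 'c::topological_space) set" where
 "mU c \<equiv> borel_measurable (restrict_space borel (cU c))"

lemma cD_sets: "c : atlas M ==> cD c : sets ml"
 unfolding cD_def using chart_facts(1)[of c] by (intro pair_measureI) (auto simp: sets_m sets_lebesgue_pos sets_restrict_space_iff)

lemma cU_borel: "c : atlas M ==> cU c : sets borel"
 using open_cU by simp

lemma pt_in: "y : cU c ==> pt c y : cD c"
 by (auto simp: cU_def cD_def intro: inv_into_into)

lemma co_cD: "z : cD c ==> co c z : cU c"
 by (auto simp: cU_def cD_def)

lemma pt_co: "c : atlas M ==> z : cD c ==> pt c (co c z) = z"
 by (cases z) (simp add: cD_def cinv_cmap)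

lemma co_pt: "c : atlas M ==> y : cU c ==> co c (pt c y) = y"
 by (cases y) (simp add: cU_def f_inv_into_f mem_Times_iff)

lemma pt_continuous: "c : atlas M ==> continuous_on (cU c) (%y. pt c y)"
 by (intro continuous_on_Pair continuous_on_compose2[OF continuous_cinv] continuous_intros) (auto simp: cU_def)

lemma co_continuous: "c : atlas M ==> continuous_on (cD c) (%z. co c z)"
 by (intro continuous_on_Pair continuous_on_compose2[OF continuous_cmap] continuous_intros) (auto simp: cD_def)

lemma pt_measurable:
 assumes c: "c : atlas M"
 shows "(%y. pt c y) : measurable (restrict_space borel (cU c)) (mlD c)"
proof (rule measurable_restrict_space2)
 show "(%y. pt c y) : space (restrict_space borel (cU c)) \<rightarrow> cD c" using pt_in[of _ c] by (auto simp: space_restrict_space)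
 have "(%y. cinv c (fst y)) : measurable (restrict_space borel (cU c)) m"
  using borel_measurable_continuous_on_restrict[OF continuous_on_fst[OF pt_continuous[OF c]]]
  by (subst measurable_cong_sets[OF refl sets_m]) simp
 moreover have "snd : measurable (restrict_space borel (cU c)) lebesgue_pos" unfolding lebesgue_pos_def by (rule measurable_restrict_space2)
  (auto simp: cU_def space_restrict_space intro!: measurable_restrict_space1 borel_measurable_continuous_onI continuous_intros)
 ultimately show "(%y. pt c y) : measurable (restrict_space borel (cU c)) ml" by (intro measurable_Pair) auto
qed

lemma co_measurable:
 assumes c: "c : atlas M"
 shows "(%z. co c z) : measurable (mlD c) (restrict_space borel (cU c))"
proof (rule measurable_restrict_space2)
 show "(%z. co c z) : space (mlD c) \<rightarrow> cU c" using co_cD[of _ c] by (auto simp: space_restrict_space)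
 have "fst : measurable (mlD c) (restrict_space m (cdom c))" by (rule measurable_restrict_space3) (auto simp: cD_def)
 moreover have "cmap c : measurable (restrict_space m (cdom c)) borel"
  using borel_measurable_continuous_on_restrict[OF continuous_cmap[OF c]]
  by (subst measurable_cong_sets[OF sets_restrict_space_cong[OF sets_m] refl])
 ultimately have "(%z. cmap c (fst z)) : measurable (mlD c) borel" by (rule measurable_compose)
 moreover have "snd : borel_measurable ml"
 proof -
  have "(%s. s) : measurable lebesgue_pos borel"
  by (subst measurable_cong_sets[OF sets_lebesgue_pos refl]) (rule measurable_restrict_space1, simp)
  from measurable_compose[OF measurable_snd this] show ?thesis .
 qed
 ultimately show "(%z. co c z) : measurable (mlD c) borel"
  by (intro borel_measurable_Pair measurable_restrict_space1[of snd]) auto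
qed

lemma sg_measurable: "c : atlas M ==> sg c : mU c"
 by (intro borel_measurable_continuous_on_restrict smooth_on_continuous smooth_sg)

lemma restrict_lborel_cong:
 "f : measurable (restrict_space lborel A) N \<longleftrightarrow> f : measurable (restrict_space borel A) N"
 by (rule arg_cong2[where f = "%a b. f : a", OF measurable_cong_sets[OF sets_restrict_space_cong[OF sets_lborel] refl] refl])

text \<open>On each slice with a fixed mark this is the defining property of the volume; Tonelli does the rest.\<close>
lemma chart_measure:
 assumes c: "c : atlas M"
 shows "mlD c =
  distr (density (lbU c) (%y. ennreal (sg c y))) (mlD c) (%y. pt c y)"
  (is "_ = ?N")
proof (rule measure_eqI)
 interpret L: sigma_finite_measure lebesgue_pos by (rule sigma_finite_lebesgue_pos)
 have pt: "(%y. pt c y) : measurable (lbU c) (mlD c)"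
  using pt_measurable[OF c] by (simp add: restrict_lborel_cong)
 have sgm: "(%y. ennreal (sg c y)) : borel_measurable (lbU c)"
  using sg_measurable[OF c] by (simp add: restrict_lborel_cong)
 fix A assume "A : sets (mlD c)"
 hence A: "A : sets ml" "A <= cD c" "A : sets (mlD c)" using cD_sets[OF c] by (auto simp: sets_restrict_space_iff)
 let ?B = "(%y. pt c y) -` A Int cU c"
 have B: "?B : sets (lbU c)" using measurable_sets[OF pt A(3)] by (simp add: space_restrict_space)
 hence B': "?B : sets borel" using cU_borel[OF c] by (auto simp: sets_restrict_space_iff)
 have sgB: "(%y. ennreal (sg c y) * indicator ?B y) : borel_measurable (lborel \<Otimes>\<^sub>M lborel)"
 proof -
  have "(%y. ennreal (sg c y) * indicator (cU c) y) : borel_measurable lborel"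
  using sgm cU_borel[OF c] by (subst (asm) borel_measurable_restrict_space_iff_ennreal) auto
  hence "(%y. (ennreal (sg c y) * indicator (cU c) y) * indicator ?B y) : borel_measurable lborel"
  by (rule borel_measurable_times_ennreal) (use B' in auto)
  moreover have "ennreal (sg c y) * indicator (cU c) y * indicator ?B y = ennreal (sg c y) * indicator ?B y" for y
  by (auto simp: indicator_def)
  ultimately show ?thesis by (simp add: lborel_prod)
 qed
 have "emeasure ?N A = emeasure (density (lbU c) (%y. ennreal (sg c y))) ?B"
  using pt A(3) by (subst emeasure_distr) (auto simp: space_restrict_space)
 also have "... = (\<integral>\<^sup>+y. ennreal (sg c y) * indicator ?B y \<partial>lbU c)"
  by (rule emeasure_density[OF sgm B])
 also have "... = (nn_integral lborel (%y. ennreal (sg c y) * indicator ?B y * indicator (cU c) y))"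
  using cU_borel[OF c] by (subst nn_integral_restrict_space) auto
 also have "... = (\<integral>\<^sup>+y. ennreal (sg c y) * indicator ?B y \<partial>(lborel \<Otimes>\<^sub>M lborel))"
  unfolding lborel_prod by (intro nn_integral_cong) (auto simp: indicator_def)
 also have "... = (nn_integral lborel (%et. (nn_integral lborel (%s. ennreal (sg c (et, s)) * indicator ?B (et, s)))))"
  by (rule lborel.nn_integral_fst[symmetric, OF sgB])
 also have "... = (nn_integral lborel (%et. emeasure lebesgue_pos (Pair (cinv c et) -` A) * ennreal (sqrt (det (gram M c (cinv c et)))) * indicator (cimg c) et))"
 proof (rule nn_integral_cong)
  fix et :: "real ^ 'b"
  have S: "Pair (cinv c et) -` A : sets lebesgue_pos" using A(1) by (rule sets_Pair1)
  have "(nn_integral lborel (%s. ennreal (sg c (et, s)) * indicator ?B (et, s))) =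
  (nn_integral lborel (%s. (ennreal (sqrt (det (gram M c (cinv c et)))) * indicator (cimg c) et) *
  (indicator (Pair (cinv c et) -` A) s * indicator {0<..} s)))" by (intro nn_integral_cong) (auto simp: sg_def cU_def indicator_def)
  also have "... = (ennreal (sqrt (det (gram M c (cinv c et)))) * indicator (cimg c) et) *
  (nn_integral lborel (%s. indicator (Pair (cinv c et) -` A) s * indicator {0<..} s))"
  proof (rule nn_integral_cmult)
  have "Pair (cinv c et) -` A : sets borel" using S by (auto simp: sets_lebesgue_pos sets_restrict_space_iff)
  thus "(%s. indicator (Pair (cinv c et) -` A) s * indicator {0<..} s :: ennreal) : borel_measurable lborel"
  by (intro borel_measurable_times_ennreal) auto
  qed
  also have "(nn_integral lborel (%s. indicator (Pair (cinv c et) -` A) s * indicator {0<..} s)) =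
  emeasure lebesgue_pos (Pair (cinv c et) -` A)" using S by (simp add: nn_integral_lebesgue_pos[symmetric])
  finally show "(nn_integral lborel (%s. ennreal (sg c (et, s)) * indicator ?B (et, s))) =
  emeasure lebesgue_pos (Pair (cinv c et) -` A) * ennreal (sqrt (det (gram M c (cinv c et)))) * indicator (cimg c) et"
  by (simp add: mult_ac)
 qed
 also have "... = (nn_integral m (%x. emeasure lebesgue_pos (Pair x -` A) * indicator (cdom c) x))"
  by (rule nn_integral_chart[OF c, symmetric])
  (use L.measurable_emeasure_Pair[OF A(1)] in \<open>simp add: measurable_cong_sets[OF sets_m refl]\<close>)
 also have "... = (nn_integral m (%x. emeasure lebesgue_pos (Pair x -` A)))"
 proof (rule nn_integral_cong)
  fix x
  have "Pair x -` A = {}" if "x ~: cdom c" using A(2) that by (auto simp: cD_def)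
  thus "emeasure lebesgue_pos (Pair x -` A) * indicator (cdom c) x = emeasure lebesgue_pos (Pair x -` A)" by (cases "x : cdom c") auto
 qed
 also have "... = emeasure ml A" by (rule L.emeasure_pair_measure_alt[symmetric, OF A(1)])
 also have "... = emeasure (mlD c) A"
  using A cD_sets[OF c] sets.sets_into_space[OF cD_sets[OF c]] by (subst emeasure_restrict_space) (auto simp: Int_absorb1 Int_absorb2)
 finally show "emeasure (mlD c) A = emeasure ?N A" by simp
qed simp

lemma nn_integral_chart_ml:
 assumes c: "c : atlas M" and fr: "f : borel_measurable (mlD c)"
 shows "(nn_integral ml (%z. f z * indicator (cD c) z)) = (nn_integral lborel (%y. f (pt c y) * ennreal (sg c y) * indicator (cU c) y))"
proof -
 have pt: "(%y. pt c y) : measurable (lbU c) (mlD c)"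
  using pt_measurable[OF c] by (simp add: restrict_lborel_cong)
 have sgm: "(%y. ennreal (sg c y)) : borel_measurable (lbU c)"
  using sg_measurable[OF c] by (simp add: restrict_lborel_cong)
 have "(nn_integral ml (%z. f z * indicator (cD c) z)) = (\<integral>\<^sup>+z. f z \<partial>mlD c)"
  using cD_sets[OF c] by (subst nn_integral_restrict_space) auto
 also have "... = (\<integral>\<^sup>+y. f (pt c y) \<partial>density (lbU c) (%y. ennreal (sg c y)))"
  by (subst chart_measure[OF c], rule nn_integral_distr) (use pt fr in auto)
 also have "... = (\<integral>\<^sup>+y. ennreal (sg c y) * f (pt c y) \<partial>lbU c)"
  by (rule nn_integral_density[OF sgm measurable_compose[OF pt fr]])
 also have "... = (nn_integral lborel (%y. f (pt c y) * ennreal (sg c y) * indicator (cU c) y))"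
  using cU_borel[OF c] by (subst nn_integral_restrict_space) (auto simp: mult_ac)
 finally show ?thesis .
qed

lemma measurable_chart_iff:
 fixes h :: "'a * real => 'c::topological_space"
 assumes c: "c : atlas M"
 shows "h : borel_measurable (mlD c) \<longleftrightarrow>
  (%y. h (pt c y)) : mU c"
proof
 assume "h : borel_measurable (mlD c)"
 thus "(%y. h (pt c y)) : mU c" using measurable_compose[OF pt_measurable[OF c]] by blast
next
 assume "(%y. h (pt c y)) : mU c"
 from measurable_compose[OF co_measurable[OF c] this]
 show "h : borel_measurable (mlD c)"
  by (rule measurable_cong[THEN iffD1, rotated]) (use pt_co[OF c] in \<open>auto simp: space_restrict_space\<close>)
qed

lemma integral_chart_ml:
 fixes h :: "'a * real => real"
 assumes c: "c : atlas M" and h: "set_integrable lborel (cU c) (%y. sg c y * h (pt c y))"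
 shows "set_integrable ml (cD c) h" "(LINT z:cD c|ml. h z) = (LINT y:cU c|lborel. sg c y * h (pt c y))"
proof -
 have pt: "(%y. pt c y) : measurable (lbU c) (mlD c)"
  using pt_measurable[OF c] by (simp add: restrict_lborel_cong)
 have sgm: "sg c : borel_measurable (lbU c)" using sg_measurable[OF c] by (simp add: restrict_lborel_cong)
 have Ub: "cU c Int space lborel : sets lborel" using cU_borel[OF c] by simp
 have hi: "integrable (lbU c) (%y. sg c y * h (pt c y))"
  using h by (simp add: integrable_restrict_space[OF Ub] set_integrable_def)
 have "(%y. sg c y * h (pt c y) / sg c y) : borel_measurable (lbU c)"
  using borel_measurable_integrable[OF hi] sgm by (rule borel_measurable_divide)
 hence "(%y. h (pt c y)) : borel_measurable (lbU c)"
 proof (rule measurable_cong[THEN iffD1, rotated])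
  fix y assume "y : space (lbU c)"
  hence "sg c y > 0" using sg_pos[OF c] by (simp add: space_restrict_space)
  thus "sg c y * h (pt c y) / sg c y = h (pt c y)" by simp
 qed
 hence hp: "(%y. h (pt c y)) : borel_measurable (lbU c)"
  and hm: "h : borel_measurable (mlD c)"
  using measurable_chart_iff[OF c, of h] by (auto simp: restrict_lborel_cong)
 have nn: "AE y in lbU c. 0 <= sg c y"
  using sg_pos[OF c] by (intro AE_I2) (auto simp: space_restrict_space less_imp_le)
 have Db: "cD c Int space ml : sets ml" using cD_sets[OF c] by simp
 have "integrable (density (lbU c) (%y. ennreal (sg c y))) (%y. h (pt c y))"
  using hi by (subst integrable_density[OF hp sgm nn]) simp
 hence "integrable (mlD c) h" by (subst chart_measure[OF c], subst integrable_distr_eq) (use pt hm in auto)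
 thus "set_integrable ml (cD c) h" by (simp add: integrable_restrict_space[OF Db] set_integrable_def)
 have "(LINT z:cD c|ml. h z) = (LINT z|mlD c. h z)"
  by (simp add: integral_restrict_space[OF Db] set_lebesgue_integral_def)
 also have "... = (LINT y|density (lbU c) (%y. ennreal (sg c y)). h (pt c y))"
  by (subst chart_measure[OF c], rule integral_distr) (use pt hm in auto)
 also have "... = (LINT y|lbU c. sg c y * h (pt c y))" by (subst integral_density[OF hp sgm nn]) simp
 also have "... = (LINT y:cU c|lborel. sg c y * h (pt c y))" by (simp add: integral_restrict_space[OF Ub] set_lebesgue_integral_def)
 finally show "(LINT z:cD c|ml. h z) = (LINT y:cU c|lborel. sg c y * h (pt c y))" .
qed

subsection \<open>Exhaustion by relatively compact sets\<close>

lemma compact_chart_neighbourhood: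
 assumes c: "c : atlas M" and x: "x : cdom c" "x : Q" "open Q"
 obtains V C where "open V" "x : V" "V <= C" "compact C" "C <= cdom c Int Q"
proof -
 have "open (cmap c ` (cdom c Int Q))" using chart_facts(1)[OF c] x by (intro open_chart_image[OF c]) auto
 then obtain e where e: "e > 0" "cball (cmap c x) e <= cmap c ` (cdom c Int Q)" using x open_contains_cball by blast
 define C where "C = cinv c ` cball (cmap c x) e"
 have im: "cball (cmap c x) e <= cimg c" using e by blast
 have C: "compact C" unfolding C_def by (intro compact_continuous_image continuous_on_subset[OF continuous_cinv[OF c] im]) simp
 have "C <= cdom c Int Q"
 proof
  fix z assume "z : C"
  then obtain y where y: "y : cball (cmap c x) e" "z = cinv c y" unfolding C_def by blast
  then obtain w where "w : cdom c Int Q" "y = cmap c w" using e(2) by blast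
  thus "z : cdom c Int Q" using y cinv_cmap[OF c] by simp
 qed
 moreover have "open (cdom c Int cmap c -` ball (cmap c x) e)"
  by (rule continuous_open_preimage[OF continuous_cmap[OF c] chart_facts(1)[OF c]]) simp
 moreover have "cdom c Int cmap c -` ball (cmap c x) e <= C"
 proof
  fix z assume "z : cdom c Int cmap c -` ball (cmap c x) e"
  thus "z : C" unfolding C_def using cinv_cmap[OF c, of z] by (intro image_eqI[of _ _ "cmap c z"]) auto
 qed
 ultimately show ?thesis using that[of "cdom c Int cmap c -` ball (cmap c x) e" C] C x e by simp
qed

lemma countable_compact_chart_cover:
 obtains V C c where "!!n::nat. open (V n)" "!!n. V n <= C n" "!!n. compact (C n)"
  "!!n. c n : atlas M" "!!n. C n <= cdom (c n)" "(\<Union>n. V n) = UNIV"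
proof -
 let ?F = "{V. open V & (EX C c. V <= C & compact C & c : atlas M & C <= cdom c)}"
 have cover: "\<Union>?F = UNIV"
 proof -
  have "x : \<Union>?F" for x
  proof -
  obtain c where c: "c : atlas M" "x : cdom c" using charts_cover by blast
  obtain V C where "open V" "x : V" "V <= C" "compact C" "C <= cdom c Int UNIV" by (rule compact_chart_neighbourhood[OF c, of UNIV]) auto
  thus ?thesis using c by blast
  qed
  thus ?thesis by blast
 qed
 obtain F where F: "F <= ?F" "countable F" "\<Union>F = \<Union>?F" using Lindelof[of ?F] by blast
 have ne: "F ~= {}" using F cover by auto
 let ?V = "from_nat_into F"
 have V: "?V n : F" for n using from_nat_into[OF ne] .
 have "ALL n. EX C c. ?V n <= C & compact C & c : atlas M & C <= cdom c" using V F(1) by blast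
 then obtain C c where Cc: "!!n. ?V n <= C n & compact (C n) & c n : atlas M & C n <= cdom (c n)" by metis
 have "(\<Union>n. ?V n) = UNIV" using F cover range_from_nat_into[OF ne F(2)] by simp
 note un = this
 show ?thesis
 proof (rule that[of ?V C c])
  show "open (?V n)" for n using V[of n] F(1) by blast
 qed (use Cc un in auto)
qed

lemma compact_Times_measurable: "compact C ==> C \<times> {0<..} : sets ml"
 by (intro pair_measureI) (auto simp: sets_m sets_lebesgue_pos sets_restrict_space_iff borel_compact)

lemma emeasure_m_compact:
 assumes c: "c : atlas M" and C: "compact C" "C <= cdom c"
 shows "emeasure m C < \<infinity>"
proof -
 let ?sq = "%y. sqrt (det (gram M c (cinv c y)))"
 have K: "compact (cmap c ` C)" using C continuous_on_subset[OF continuous_cmap[OF c]] compact_continuous_image by blast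
 have "bounded (?sq ` (cmap c ` C))"
  by (intro compact_imp_bounded compact_continuous_image K continuous_on_subset[OF chart_sq_continuous[OF c]]) (use C in auto)
 then obtain B where B: "!!y. y : cmap c ` C ==> abs (?sq y) <= B" unfolding bounded_iff by auto
 have "emeasure m C = (\<integral>\<^sup>+y\<in>cmap c ` C. ennreal (?sq y) \<partial>lborel)"
  using vol c C borel_compact[OF C(1)] unfolding riemannian_volume_def by blast
 also have "... <= (nn_integral lborel (%y. ennreal B * indicator (cmap c ` C) y))"
 proof (rule nn_integral_mono)
  fix y
  show "ennreal (?sq y) * indicator (cmap c ` C) y <= ennreal B * indicator (cmap c ` C) y"
  using B[of y] by (cases "y : cmap c ` C") (auto intro!: ennreal_leI simp del: image_iff)
 qed
 also have "... = ennreal B * emeasure lborel (cmap c ` C)" using borel_compact[OF K] by (intro nn_integral_cmult_indicator) simp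
 also have "... < \<infinity>" using emeasure_compact_finite[OF K] by (simp add: ennreal_mult_less_top)
 finally show ?thesis .
qed

lemma sigma_finite_m: "sigma_finite_measure m"
proof -
 obtain V C c where *: "!!n::nat. open (V n)" "!!n. V n <= C n" "!!n. compact (C n)"
  "!!n. c n : atlas M" "!!n. C n <= cdom (c n)" "(\<Union>n. V n) = UNIV" using countable_compact_chart_cover by blast
 show ?thesis
 proof (rule sigma_finite_measure.intro, intro exI[of _ "range C"] conjI ballI)
  show "range C <= sets m" using *(3) borel_compact by (auto simp: sets_m)
  show "\<Union> (range C) = space m" using *(2,6) by fastforce
  show "emeasure m a ~= \<infinity>" if "a : range C" for a
  using that emeasure_m_compact[OF *(4) *(3) *(5)] by (metis image_iff infinity_ennreal_def order_less_irrefl)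
 qed simp
qed

lemma pair_sigma_finite_ml: "pair_sigma_finite m lebesgue_pos"
 using sigma_finite_m sigma_finite_lebesgue_pos by (simp add: pair_sigma_finite_def)

lemma exhaustion:
 obtains La :: "nat => 'a set" where "!!n. La n : Oc" "!!n k. n <= k ==> La n <= La k" "(\<Union>n. La n) = UNIV"
  "!!C. compact C ==> EX n. C <= La n"
proof -
 obtain V C c where *: "!!n::nat. open (V n)" "!!n. V n <= C n" "!!n. compact (C n)"
  "!!n. c n : atlas M" "!!n. C n <= cdom (c n)" "(\<Union>n. V n) = UNIV" using countable_compact_chart_cover by blast
 define La where "La n = (UN i<=n. V i)" for n
 have 1: "La n : Oc" for n
 proof -
  have cC: "compact (UN i<=n. C i)" using *(3) by (intro compact_UN) auto
  have "closure (La n) <= (UN i<=n. C i)" unfolding La_def by (rule closure_minimal) (use *(2) cC compact_imp_closed in blast)+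
  hence "compact (closure (La n))" using cC by (metis closed_closure compact_Int_closed inf.absorb_iff2)
  thus ?thesis unfolding Oc_def La_def using *(1) by auto
 qed
 have 2: "La n <= La k" if "n <= k" for n k unfolding La_def using that by force
 have 3: "(\<Union>n. La n) = UNIV" unfolding La_def using *(6) by blast
 have 4: "EX n. D <= La n" if D: "compact D" for D
 proof -
  have "D <= (UN i:UNIV. V i)" unfolding *(6) by simp
  from compactE_image[OF D _ this] *(1)
  obtain I where I: "finite I" "D <= (UN i:I. V i)" by metis
  obtain n where "ALL i:I. i <= n" using I(1) unfolding finite_nat_set_iff_bounded_le by (rule exE)
  hence "D <= La n" unfolding La_def using I(2) by blast
  thus ?thesis by blast
 qed
 show ?thesis by (rule that[of La, OF 1 2 3 4])
qed

end

section \<open>Integration by parts in a chart\<close>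

lemma fd_mult:
 fixes f g :: "'a::real_normed_vector => real"
 assumes "f differentiable (at y)" "g differentiable (at y)"
 shows "fd (%y. f y * g y) v y = f y * fd g v y + fd f v y * g y"
proof -
 have "((%y. f y * g y) has_derivative (%v. f y * fd g v y + fd f v y * g y)) (at y)"
  using assms frechet_derivative_works by (intro has_derivative_mult) auto
 from frechet_derivative_eqI[OF this] show ?thesis by simp
qed

lemma fd_add:
 fixes f g :: "'a::real_normed_vector => real"
 assumes "f differentiable (at y)" "g differentiable (at y)"
 shows "fd (%y. f y + g y) v y = fd f v y + fd g v y"
proof -
 have "((%y. f y + g y) has_derivative (%v. fd f v y + fd g v y)) (at y)"
  using assms frechet_derivative_works by (intro has_derivative_add) auto
 from frechet_derivative_eqI[OF this] show ?thesis by simp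
qed

context riem_volume
begin

lemma fd_sg_es:
 assumes "c : atlas M" "y : cU c"
 shows "fd (sg c) es y = 0"
proof -
 have "((%t. sg c (y + t *\<^sub>R es)) has_vector_derivative fd (sg c) es y) (at 0)"
  by (rule directional_real_derivative[OF smooth_sg[OF assms(1)], of y 0 es, unfolded scaleR_zero_left add_0_right, OF assms(2)])
 moreover have "(%t. sg c (y + t *\<^sub>R es)) = (%_. sg c y)" by (auto simp: sg_def fun_eq_iff)
 ultimately have "((%_. sg c y) has_vector_derivative fd (sg c) es y) (at (0::real))" by simp
 moreover have "((%_. sg c y) has_vector_derivative 0) (at (0::real))" by simp
 ultimately show ?thesis by (rule vector_derivative_unique_at)
qed

definition Aop :: "('a, 'b) chart => ((real ^ 'b) * real => real) => (real ^ 'b) * real => real" where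
 "Aop c f y = lapE c f y + 2 * snd y * fd f es y + (snd y)^2 * fd (fd f es) es y"

lemma smooth_Aop:
 assumes c: "c : atlas M" and f: "smooth_on (cU c) f"
 shows "smooth_on (cU c) (Aop c f)"
 unfolding Aop_def[abs_def] power2_eq_square
 by (intro smooth_on_add smooth_on_mult smooth_on_frechet smooth_lapE smooth_snd smooth_on_const open_cU c f)

text \<open>The test functions are \<open>w\<close> times the components of the flux \<open>sqrt (det g) g\<^sup>-\<^sup>1 \<partial>f\<close>; the product rule for
them yields the scalar product of the gradients and the Laplacian.\<close>
lemma chart_ibp:
 assumes c: "c : atlas M" and f: "smooth_on (cU c) f" and w: "test_on (cU c) w"
  and D: "!!i. weak_deriv (cU c) Q (ex i) (D i)" and Ds: "weak_deriv (cU c) Q es Ds"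
 defines "R \<equiv> %y. Q y * (Gam c f w y + w y * Aop c f y) +
  w y * ((SUM i:UNIV. SUM j:UNIV. ginv c i j y * D i y * fd f (ex j) y) + (snd y)^2 * (Ds y * fd f es y))"
 shows "set_integrable lborel (cU c) (%y. sg c y * R y)"
  and "(LINT y:cU c|lborel. sg c y * R y) = 0"
proof -
 let ?U = "cU c"
 have U: "open ?U" by (rule open_cU[OF c])
 define fl where "fl i y = sg c y * (SUM j:UNIV. ginv c i j y * fd f (ex j) y)" for i y
 define fls where "fls y = sg c y * ((snd y)^2 * fd f es y)" for y
 have sfl: "smooth_on ?U (fl i)" for i unfolding fl_def[abs_def] by (rule smooth_flux[OF c f])
 have sfls: "smooth_on ?U fls" unfolding fls_def[abs_def] power2_eq_square
  by (intro smooth_on_mult smooth_on_frechet smooth_sg smooth_snd U c f)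
 have T: "test_on ?U (%y. fl i y * w y)" "test_on ?U (%y. fls y * w y)" for i using test_on_mult_left[OF U _ w] sfl sfls by blast+
 have wd: "w differentiable (at y)" for y using w smooth_on_differentiable[of UNIV w y] by (simp add: test_on_def)
 let ?S = "%g v E y. g y * fd (%y. E y * w y) v y"
 have int: "integrable lborel (%y. Q y * fd (%y. fl i y * w y) (ex i) y)"
  "integrable lborel (%y. D i y * (fl i y * w y))"
  "integrable lborel (%y. Q y * fd (%y. fls y * w y) es y)"
  "integrable lborel (%y. Ds y * (fls y * w y))" for i
  using weak_deriv_integrable(1)[OF D test_on_frechet[OF T(1)]] weak_deriv_integrable(2)[OF D T(1)]
  weak_deriv_integrable(1)[OF Ds test_on_frechet[OF T(2)]] weak_deriv_integrable(2)[OF Ds T(2)] by auto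
 let ?tot = "%y. (SUM i:UNIV. Q y * fd (%y. fl i y * w y) (ex i) y + D i y * (fl i y * w y)) +
  (Q y * fd (%y. fls y * w y) es y + Ds y * (fls y * w y))"
 have zero: "(LINT y|lborel. Q y * fd T v y) + (LINT y|lborel. DD y * T y) = 0"
  if "weak_deriv ?U Q v DD" "test_on ?U T" for T v DD using weak_deriv_test[OF that] integral_set_zero_outside[of ?U "%y. Q y * fd T v y"]
  integral_set_zero_outside[of ?U "%y. DD y * T y"] test_on_zero[OF that(2)]
  test_on_zero[OF test_on_frechet[OF that(2)]] by simp
 have itot: "integrable lborel ?tot" by (intro Bochner_Integration.integrable_add Bochner_Integration.integrable_sum int)
 have "(LINT y|lborel. ?tot y) =
  (SUM i:UNIV. (LINT y|lborel. Q y * fd (%y. fl i y * w y) (ex i) y) + (LINT y|lborel. D i y * (fl i y * w y))) +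
  ((LINT y|lborel. Q y * fd (%y. fls y * w y) es y) + (LINT y|lborel. Ds y * (fls y * w y)))" by (subst Bochner_Integration.integral_add,
  intro Bochner_Integration.integrable_sum Bochner_Integration.integrable_add int,
  intro Bochner_Integration.integrable_add int,
  subst Bochner_Integration.integral_sum, intro Bochner_Integration.integrable_add int) (simp add: int)
 also have "... = 0" using zero[OF D T(1)] zero[OF Ds T(2)] by simp
 finally have tot0: "(LINT y|lborel. ?tot y) = 0" .
 have eq: "?tot y = indicator ?U y * (sg c y * R y)" for y
 proof (cases "y : ?U")
  case False
  thus ?thesis using test_on_zero[OF w] test_on_zero[OF test_on_frechet[OF T(1)]] test_on_zero[OF test_on_frechet[OF T(2)]] by simp
 next
  case True
  have e1: "fd (%y. fl i y * w y) (ex i) y = fl i y * fd w (ex i) y + fd (fl i) (ex i) y * w y" for i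
  by (rule fd_mult[OF smooth_on_differentiable[OF sfl True] wd])
  have e2: "fd (%y. fls y * w y) es y = fls y * fd w es y + fd fls es y * w y"
  by (rule fd_mult[OF smooth_on_differentiable[OF sfls True] wd])
  have e3: "(SUM i:UNIV. fd (fl i) (ex i) y) = sg c y * lapE c f y" using sg_pos[OF c True] by (simp add: lapE_def fl_def[abs_def])
  have e4: "fd fls es y = sg c y * (2 * snd y * fd f es y + (snd y)^2 * fd (fd f es) es y)"
  proof -
  have d1: "sg c differentiable (at y)" using smooth_on_differentiable[OF smooth_sg[OF c] True] .
  have d2: "fd f es differentiable (at y)" using smooth_on_differentiable[OF smooth_on_frechet[OF f] True] .
  have d3: "((%y::(real ^ 'b) * real. (snd y)^2) has_derivative (%v. 2 * snd y * snd v)) (at y)"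
  by (auto intro!: derivative_eq_intros simp: power2_eq_square)
  have d3': "(%y::(real ^ 'b) * real. (snd y)^2) differentiable (at y)" using d3 differentiable_def by blast
  have d4: "(%y. (snd y)^2 * fd f es y) differentiable (at y)" using d2 d3' by (rule differentiable_mult[rotated])
  show ?thesis unfolding fls_def[abs_def] fd_mult[OF d1 d4] fd_mult[OF d3' d2] fd_sg_es[OF c True] frechet_derivative_eqI[OF d3]
  by (simp add: algebra_simps)
  qed
  have e5: "(SUM i:UNIV. fl i y * fd w (ex i) y) = sg c y * (SUM i:UNIV. SUM j:UNIV. ginv c i j y * fd f (ex i) y * fd w (ex j) y)"
  proof -
  have "(SUM i:UNIV. fl i y * fd w (ex i) y) = sg c y * (SUM i:UNIV. SUM j:UNIV. ginv c i j y * fd f (ex j) y * fd w (ex i) y)"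
  by (simp add: fl_def sum_distrib_left sum_distrib_right mult_ac)
  also have "(SUM i:UNIV. SUM j:UNIV. ginv c i j y * fd f (ex j) y * fd w (ex i) y) =
  (SUM j:UNIV. SUM i:UNIV. ginv c i j y * fd f (ex j) y * fd w (ex i) y)" by (rule sum.swap)
  also have "... = (SUM i:UNIV. SUM j:UNIV. ginv c i j y * fd f (ex i) y * fd w (ex j) y)"
  by (intro sum.cong refl) (simp add: ginv_sym[OF c True])
  finally show ?thesis .
  qed
  have "(SUM i:UNIV. Q y * fd (%y. fl i y * w y) (ex i) y + D i y * (fl i y * w y)) =
  Q y * ((SUM i:UNIV. fl i y * fd w (ex i) y) + (SUM i:UNIV. fd (fl i) (ex i) y) * w y) + (SUM i:UNIV. D i y * fl i y) * w y"
  unfolding e1 by (simp add: sum.distrib sum_distrib_left sum_distrib_right algebra_simps)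
  moreover have "(SUM i:UNIV. D i y * fl i y) = sg c y * (SUM i:UNIV. SUM j:UNIV. ginv c i j y * D i y * fd f (ex j) y)"
  by (simp add: fl_def sum_distrib_left sum_distrib_right mult_ac)
  ultimately show ?thesis using True unfolding e2 e3 e4 e5 by (simp add: R_def Gam_def Aop_def fls_def algebra_simps)
 qed
 show "set_integrable lborel ?U (%y. sg c y * R y)" using itot unfolding eq by (simp add: set_integrable_def)
 show "(LINT y:?U|lborel. sg c y * R y) = 0" using tot0 unfolding eq by (simp add: set_lebesgue_integral_def)
qed

lemma hat_zero_near:
 assumes c: "c : atlas M" and z: "z : cD c" "z : Z" "open Z"
  and be: "!!z'. z' : Z ==> z' : mk UNIV ==> be z' = 0"
 shows "fd (hat c be) v (co c z) = 0"
  and "fd (fd (hat c be) u) v (co c z) = 0" "lapE c (hat c be) (co c z) = 0" "Aop c (hat c be) (co c z) = 0"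
proof -
 let ?T = "cU c Int (%y. pt c y) -` Z"
 have oT: "open ?T" by (rule continuous_open_preimage[OF pt_continuous[OF c] open_cU[OF c] z(3)])
 have zT: "co c z : ?T" using co_cD[OF z(1)] pt_co[OF c z(1)] z(2) by simp
 have h0: "hat c be y = 0" if "y : ?T" for y using be[of "pt c y"] that by (auto simp: hat_def cU_def mk_def)
 have 1: "fd (hat c be) v y = 0" if "y : ?T" for v y using frechet_derivative_cong_open[OF oT that, of "hat c be" "%_. 0"] h0 by simp
 thus "fd (hat c be) v (co c z) = 0" using zT by blast
 have 2: "fd (fd (hat c be) u) v y = 0" if "y : ?T" for v y u
  using frechet_derivative_cong_open[OF oT that, of "fd (hat c be) u" "%_. 0"] 1 by simp
 thus "fd (fd (hat c be) u) v (co c z) = 0" using zT by blast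
 have "fd (%y. sg c y * (SUM j:UNIV. ginv c i j y * fd (hat c be) (ex j) y)) (ex i) (co c z) = 0" for i
  using frechet_derivative_cong_open[OF oT zT, of "%y. sg c y * (SUM j:UNIV. ginv c i j y * fd (hat c be) (ex j) y)" "%_. 0"] 1 by simp
 thus 3: "lapE c (hat c be) (co c z) = 0" by (simp add: lapE_def)
 show "Aop c (hat c be) (co c z) = 0" using 1[OF zT] 2[OF zT] 3 by (simp add: Aop_def)
qed

lemma cD_mk: "cD c <= mk UNIV"
 by (auto simp: cD_def mk_def)

lemma minner_grad_cD:
 "c : atlas M ==> z : cD c ==> Sm ph ==> Sm psi ==>
  minner M (fst z) (grad_mk M ph z) (grad_mk M psi z) = Gam c (hat c ph) (hat c psi) (co c z)"
 using minner_grad[of c "fst z" ph psi "snd z"] by (auto simp: cD_def)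

lemma minner_sym_grad:
 "c : atlas M ==> y : cU c ==> Gam c f h y = Gam c h f y" unfolding Gam_def
 by (subst sum.swap, intro arg_cong2[where f = "(+)"] sum.cong refl) (auto simp: ginv_sym mult_ac)

lemma unlift_test:
 assumes c: "c : atlas M" and be: "Sm be" and K: "compact K" "K <= cD c"
  and z: "!!z. z : mk UNIV ==> z ~: K ==> be z = 0"
 shows "test_on (cU c) (%y. if y : cU c then hat c be y else 0)"
 unfolding test_on_def
proof (intro conjI exI[of _ "(%z. co c z) ` K"] allI impI)
 let ?w = "%y. if y : cU c then hat c be y else 0"
 show K': "compact ((%z. co c z) ` K)" by (intro compact_continuous_image K continuous_on_subset[OF co_continuous[OF c]])
 show KU: "(%z. co c z) ` K <= cU c" using K co_cD by blast
 show w0: "?w y = 0" if "y ~: (%z. co c z) ` K" for y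
 proof (cases "y : cU c")
  case True
  hence "pt c y ~: K" using that co_pt[OF c True] imageI[of "pt c y" K "%z. co c z"] by auto
  thus ?thesis using z[of "pt c y"] True by (auto simp: hat_def cU_def mk_def)
 qed simp
 show "smooth_on UNIV ?w"
 proof (rule smooth_on_local)
  fix y
  show "EX T. open T & y : T & smooth_on T ?w"
  proof (cases "y : cU c")
  case True
  have "smooth_on (cU c) ?w" by (rule smooth_on_cong[OF open_cU[OF c] _ hat_smooth[OF be c]]) simp
  thus ?thesis using True open_cU[OF c] by blast
  next
  case False
  have o: "open (- (%z. co c z) ` K)" using compact_imp_closed[OF K'] by (rule open_Compl)
  have "smooth_on (- (%z. co c z) ` K) ?w" by (rule smooth_on_cong[OF o _ smooth_on_const[of _ 0]]) (use w0 in auto)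
  thus ?thesis using False KU o by (intro exI[of _ "- (%z. co c z) ` K"]) auto
  qed
 qed
qed

lemma ibp_chart_ml:
 assumes c: "c : atlas M" and ph: "Sm ph" and be: "Sm be" and K: "compact K" "K <= cD c"
  and z: "!!z. z : mk UNIV ==> z ~: K ==> be z = 0" and W: "is_weak_grad_mk M q W"
 defines "R \<equiv> %z. q z * (minner M (fst z) (grad_mk M ph z) (grad_mk M be z) + be z * Aop c (hat c ph) (co c z)) +
  be z * minner M (fst z) (W z) (grad_mk M ph z)"
 shows "set_integrable ml (cD c) R" "(LINT z:cD c|ml. R z) = 0"
proof -
 let ?w = "%y. if y : cU c then hat c be y else 0"
 have w: "test_on (cU c) ?w" by (rule unlift_test[OF c be K z])
 let ?D = "%i y. (gram M c (cinv c (fst y)) *v fst (W (cinv c (fst y), snd y)) c) $ i"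
 let ?Ds = "%y. snd (W (cinv c (fst y), snd y)) / snd y"
 let ?Q = "%y. q (cinv c (fst y), snd y)"
 have D: "weak_deriv (cU c) ?Q (ex i) (?D i)" "weak_deriv (cU c) ?Q es ?Ds" for i using W c unfolding is_weak_grad_mk_def cU_def by blast+
 let ?R = "%y. ?Q y * (Gam c (hat c ph) ?w y + ?w y * Aop c (hat c ph) y) +
  ?w y * ((SUM i:UNIV. SUM j:UNIV. ginv c i j y * ?D i y * fd (hat c ph) (ex j) y) + (snd y)^2 * (?Ds y * fd (hat c ph) es y))"
 note ibp = chart_ibp[OF c hat_smooth[OF ph c] w D]
 have eq: "sg c y * ?R y = sg c y * R (pt c y)" if y: "y : cU c" for y
 proof -
  have zz: "pt c y : cD c" "co c (pt c y) = y" using pt_in[OF y] co_pt[OF c y] by auto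
  have x: "cinv c (fst y) : cdom c" "snd y > 0" using y by (auto simp: cU_def intro: inv_into_into)
  have y': "(cmap c (cinv c (fst y)), snd y) = y" using zz(2) by simp
  have tan: "fst (W (pt c y)) : tangent_space M (cinv c (fst y))" using W x(2) unfolding is_weak_grad_mk_def by auto
  have "fd ?w v y = fd (hat c be) v y" for v using frechet_derivative_cong_open[OF open_cU[OF c] y, of ?w "hat c be"] by simp
  hence "Gam c (hat c ph) ?w y = Gam c (hat c ph) (hat c be) y" by (simp add: Gam_def)
  moreover have "minner M (cinv c (fst y)) (grad_mk M ph (pt c y)) (grad_mk M be (pt c y)) = Gam c (hat c ph) (hat c be) y"
  using minner_grad_cD[OF c zz(1) ph be] by (simp add: y')
  moreover have "minner M (cinv c (fst y)) (W (pt c y)) (grad_mk M ph (pt c y)) =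
  (SUM i:UNIV. SUM j:UNIV. ginv c i j y * ?D i y * fd (hat c ph) (ex j) y) + (snd y)^2 * (?Ds y * fd (hat c ph) es y)"
  using minner_tangent_grad[OF c x(1) tan ph x(2), of "snd (W (pt c y))"] x(2) unfolding y' by (simp add: power2_eq_square)
  ultimately show ?thesis using y by (simp add: R_def hat_def y')
 qed
 have si: "set_integrable lborel (cU c) (%y. sg c y * R (pt c y))" by (rule set_integrable_cong[THEN iffD1, OF refl refl eq ibp(1)])
 thus "set_integrable ml (cD c) R" by (rule integral_chart_ml(1)[OF c])
 have "(LINT z:cD c|ml. R z) = (LINT y:cU c|lborel. sg c y * R (pt c y))" by (rule integral_chart_ml(2)[OF c si])
 also have "... = (LINT y:cU c|lborel. sg c y * ?R y)"
 proof (rule set_lebesgue_integral_cong)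
  show "cU c : sets lborel" using cU_borel[OF c] by simp
  show "ALL y. y : cU c --> sg c y * R (pt c y) = sg c y * ?R y" by (intro allI impI) (rule eq[symmetric])
 qed
 also have "... = 0" by (rule ibp(2))
 finally show "(LINT z:cD c|ml. R z) = 0" .
qed

text \<open>Integrating by parts in either chart against the same function, with \<open>q = 1\<close>, gives the same value,
and both expressions are continuous. This avoids transforming second derivatives.\<close>
lemma Aop_chart:
 assumes c: "c : atlas M" and d: "d : atlas M" and ph: "Sm ph" and z0: "z0 : cD c" "z0 : cD d"
 shows "Aop c (hat c ph) (co c z0) = Aop d (hat d ph) (co d z0)"
proof -
 define V where "V = cmap c ` (cdom c Int cdom d) \<times> {(0::real)<..}"
 have oV: "open V" unfolding V_def by (intro open_Times open_greaterThan trans_smooth(2)[OF c d])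
 have VU: "V <= cU c" by (auto simp: V_def cU_def)
 have Vd: "pt c y : cD d" if "y : V" for y using that cinv_cmap[OF c] by (auto simp: V_def cD_def)
 have dV: "co c z : V" if "z : cD c" "z : cD d" for z using that by (auto simp: V_def cD_def)
 define H where "H y = Aop c (hat c ph) y - Aop d (hat d ph) (co d (pt c y))" for y
 have cA: "continuous_on (cU d) (Aop d (hat d ph))" if "d : atlas M" for d by (intro smooth_on_continuous smooth_Aop hat_smooth ph that)
 have "continuous_on V (%y. co d (pt c y))"
  by (rule continuous_on_compose2[OF co_continuous[OF d] continuous_on_subset[OF pt_continuous[OF c] VU]]) (use Vd in blast)
 hence "continuous_on V (%y. Aop d (hat d ph) (co d (pt c y)))"
  by (rule continuous_on_compose2[OF cA[OF d]]) (use co_cD[OF Vd] in blast)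
 hence cH: "continuous_on V H" unfolding H_def by (intro continuous_on_diff continuous_on_subset[OF cA[OF c] VU])
 have csg: "continuous_on V (sg c)" using continuous_on_subset[OF smooth_on_continuous[OF smooth_sg[OF c]] VU] .
 have W: "is_weak_grad_mk M (%_. 1) (%_. (%_. 0, 0))"
 proof -
  have "weak_deriv (cU c) (%_. 1) v (%y. 0)" if "c : atlas M" for c v
  using weak_deriv_smooth[OF open_cU[OF that] smooth_on_const[of _ 1], of v] by simp
  thus ?thesis unfolding is_weak_grad_mk_def cU_def by (simp add: tangent_space_def)
 qed
 have "AE y in lborel. y : V --> sg c y * H y = 0"
 proof (rule AE_zero_if_tests_zero[OF oV])
  show "set_integrable lborel K (%y. sg c y * H y)" if "compact K" "K <= V" for K unfolding set_integrable_def
  by (rule borel_integrable_compact[OF that(1)])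
  (intro continuous_intros continuous_on_subset[OF csg that(2)] continuous_on_subset[OF cH that(2)])
  fix psi assume psi: "test_on V psi"
  then obtain K where K: "compact K" "K <= V" "!!y. y ~: K ==> psi y = 0" unfolding test_on_def by blast
  define be where "be = lift c psi"
  define K' where "K' = (%y. pt c y) ` K"
  have be: "Sm be" unfolding be_def by (rule lift_smooth[OF c test_on_mono[OF psi VU]])
  have K': "compact K'" unfolding K'_def by (intro compact_continuous_image continuous_on_subset[OF pt_continuous[OF c]] K(1))
  (use K(2) VU in blast)
  have K'c: "K' <= cD c" unfolding K'_def using K(2) VU pt_in by blast
  have K'd: "K' <= cD d" unfolding K'_def using K(2) Vd by blast
  have be0: "be z = 0" if "z : mk UNIV" "z ~: K'" for z
  proof (cases "fst z : cdom c")
  case True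
  hence "z : cD c" using that by (cases z) (auto simp: cD_def mk_def)
  hence "co c z ~: K" using that(2) pt_co[OF c, of z] imageI[of "co c z" K "%y. pt c y"] unfolding K'_def by auto
  thus ?thesis using K(3) True by (simp add: be_def lift_def)
  qed (simp add: be_def lift_def)
  let ?R = "%d z. 1 * (minner M (fst z) (grad_mk M ph z) (grad_mk M be z) + be z * Aop d (hat d ph) (co d z)) +
  be z * minner M (fst z) (%_. 0, 0) (grad_mk M ph z)"
  note Rc = ibp_chart_ml[OF c ph be K' K'c be0 W]
  note Rd = ibp_chart_ml[OF d ph be K' K'd be0 W]
  have gz: "minner M (fst z) (grad_mk M ph z) (grad_mk M be z) = 0" if "z : cD e" "e : atlas M" "z ~: K'" for z e
  proof -
  have "fd (hat e be) v (co e z) = 0" for v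
  by (rule hat_zero_near(1)[OF that(2,1), of "- K'"]) (use that compact_imp_closed[OF K'] be0 in auto)
  thus ?thesis using minner_grad_cD[OF that(2,1) ph be] by (simp add: Gam_def)
  qed
  have diff: "indicator (cD c) z *\<^sub>R ?R c z - indicator (cD d) z *\<^sub>R ?R d z =
  indicator (cD c) z *\<^sub>R (psi (co c z) * H (co c z))" for z
  proof (cases "z : K'")
  case True
  hence "z : cD c" "z : cD d" using K'c K'd by auto
  thus ?thesis using pt_co[OF c, of z] by (simp add: H_def be_def lift_def cD_def mem_Times_iff algebra_simps)
  next
  case False
  show ?thesis
  proof (cases "z : cD c \<or> z : cD d")
  case True
  hence "be z = 0" using be0[OF _ False] cD_mk by blast
  moreover have "z : cD c ==> psi (co c z) = 0" using \<open>be z = 0\<close> by (auto simp: be_def lift_def cD_def)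
  ultimately show ?thesis using gz[OF _ c False] gz[OF _ d False] by (auto simp: indicator_def)
  qed simp
  qed
  have "(LINT z|ml. indicator (cD c) z *\<^sub>R (psi (co c z) * H (co c z))) = 0" unfolding diff[symmetric] using Rc Rd
  by (subst Bochner_Integration.integral_diff) (auto simp: set_integrable_def set_lebesgue_integral_def)
  hence i0: "(LINT z:cD c|ml. psi (co c z) * H (co c z)) = 0" by (simp add: set_lebesgue_integral_def)
  have int: "integrable lborel (%y. (sg c y * H y) * psi y)" by (rule integrable_mult_test[OF _ psi]) fact
  have e1: "indicator (cU c) y *\<^sub>R (sg c y * (psi (co c (pt c y)) * H (co c (pt c y)))) = (sg c y * H y) * psi y" for y
  using co_pt[OF c, of y] test_on_zero[OF psi, of y] VU by (cases "y : cU c") auto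
  have "set_integrable lborel (cU c) (%y. sg c y * (psi (co c (pt c y)) * H (co c (pt c y))))" unfolding set_integrable_def e1 by (rule int)
  from integral_chart_ml(2)[OF c this] i0
  have "(LINT y:cU c|lborel. sg c y * (psi (co c (pt c y)) * H (co c (pt c y)))) = 0" by simp
  thus "(LINT y|lborel. (sg c y * H y) * psi y) = 0" unfolding set_lebesgue_integral_def e1 .
 qed
 hence ae: "AE y in lborel. y : V --> H y = 0"
 proof eventually_elim
  case (elim y)
  thus ?case using sg_pos[OF c, of y] VU by (cases "y : V") auto
 qed
 have oN: "open (V Int H -` (- {0}))" by (rule continuous_open_preimage[OF cH oV]) auto
 have "V Int H -` (- {0}) = {}"
 proof (rule ccontr)
  assume "V Int H -` (- {0}) ~= {}"
  hence "\<not> negligible (V Int H -` (- {0}))" using open_not_negligible[OF oN] by blast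
  moreover have "V Int H -` (- {0}) : null_sets lborel"
  proof -
  have "AE y in lborel. y ~: V Int H -` (- {0})" using ae by eventually_elim auto
  thus ?thesis using oN by (subst AE_iff_null_sets) auto
  qed
  ultimately show False using null_sets_completionI negligible_iff_null_sets by blast
 qed
 hence "H (co c z0) = 0" using dV[OF z0] by blast
 thus ?thesis unfolding H_def pt_co[OF c z0(1)] by simp
qed

definition Lop :: "('a * real => real) => 'a * real => real" where
 "Lop ph z = laplace_beltrami M (%x. ph (x, snd z)) (fst z) + 2 * snd z * deriv_s 1 ph z + (snd z)^2 * deriv_s 2 ph z"

lemma Lop_chart:
 assumes c: "c : atlas M" and ph: "Sm ph" and z: "z : cD c"
 shows "Lop ph z = Aop c (hat c ph) (co c z)"
proof -
 let ?d = "chart_at M (fst z)"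
 have d: "?d : atlas M" "fst z : cdom ?d" and s: "snd z > 0" using chart_at z by (auto simp: cD_def)
 hence zd: "z : cD ?d" by (cases z) (auto simp: cD_def)
 have "Lop ph z = Aop ?d (hat ?d ph) (co ?d z)" unfolding Lop_def Aop_def
  using laplace_chart_at[OF ph s, of "fst z"] deriv_s_hat[OF ph d s] by simp
 thus ?thesis using Aop_chart[OF d(1) c ph zd z] by simp
qed

lemma H_mk_Lop: "H_mk M q ph z = - Lop ph z - minner M (fst z) (grad_log_mk M q z) (grad_mk M ph z)"
 by (simp add: H_mk_def Lop_def)

end

section \<open>Bounds for test functions\<close>

lemma fd_base:
 fixes F :: "'a::real_normed_vector \<times> real => real"
 assumes "!!et s. F (et, s) = F (et, 1)"
 shows "fd F v (et, s) = fd F v (et, 1)"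
proof -
 have sh: "F (y + (0, a)) = F y" for y a using assms[of "fst y" "snd y + a"] assms[of "fst y" "snd y"] by (cases y) simp
 have "(F has_derivative F') (at (et, s)) \<longleftrightarrow> (F has_derivative F') (at (et, 1))" for F'
 proof -
  have *: "(F has_derivative F') (at y)" if "(F has_derivative F') (at (y + (0, a)))" for y a
  proof -
  have "((%y. y + (0, a)) has_derivative (%v. v)) (at y)" by (auto intro!: derivative_eq_intros)
  from has_derivative_compose[OF this that] show ?thesis by (simp add: sh)
  qed
  show ?thesis using *[of "(et, s)" "1 - s"] *[of "(et, 1)" "s - 1"] by auto
 qed
 thus ?thesis unfolding frechet_derivative_def by simp
qed

lemma sum_lists_length_1: "(SUM ks:{ks :: 'n::finite list. length ks = 1}. f ks) = (SUM k:UNIV. f [k])"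
proof -
 have "{ks :: 'n list. length ks = 1} = (%k. [k]) ` UNIV" by (auto simp: length_Suc_conv)
 thus ?thesis by (simp add: sum.reindex inj_on_def)
qed

lemma sum_lists_length_2: "(SUM ks:{ks :: 'n::finite list. length ks = 2}. f ks) = (SUM k:UNIV. SUM m:UNIV. f [k, m])"
proof -
 have "{ks :: 'n list. length ks = 2} = (%(k, m). [k, m]) ` (UNIV \<times> UNIV)" by (auto simp: length_Suc_conv numeral_2_eq_2 image_iff)
 thus ?thesis by (simp add: sum.reindex inj_on_def sum.cartesian_product split_beta)
qed

context riem_volume
begin

lemma base_bound:
 assumes c: "c : atlas M" and F: "continuous_on (cU c) F" "!!et s. F (et, s) = (F (et, 1) :: real)"
  and C: "compact C" "C <= cdom c"
 obtains B where "B > 0" "!!x s. x : C ==> abs (F (cmap c x, s)) <= B"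
proof -
 have K: "compact ((%x. (cmap c x, 1::real)) ` C)"
  by (intro compact_continuous_image C continuous_intros continuous_on_subset[OF continuous_cmap[OF c]])
 have "bounded (F ` (%x. (cmap c x, 1)) ` C)" by (intro compact_imp_bounded compact_continuous_image K continuous_on_subset[OF F(1)])
  (use C in \<open>auto simp: cU_def\<close>)
 then obtain B where "!!x. x : C ==> abs (F (cmap c x, 1)) <= B" unfolding bounded_iff by auto
 thus ?thesis using that[of "max B 1"] F(2) by (metis less_max_iff_disj max.coboundedI1 zero_less_one)
qed

lemma base_lower:
 assumes c: "c : atlas M" and F: "continuous_on (cU c) F" "!!et s. F (et, s) = (F (et, 1) :: real)"
  and pos: "!!y. y : cU c ==> F y > 0" and C: "compact C" "C <= cdom c"
 obtains e where "e > 0" "!!x s. x : C ==> e <= F (cmap c x, s)"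
proof -
 have "continuous_on (cU c) (%y. inverse (F y))" using pos by (intro continuous_on_inverse F(1)) (auto dest: order_less_imp_not_eq2)
 from base_bound[OF c this _ C] obtain B where B: "B > 0" "!!x s. x : C ==> abs (inverse (F (cmap c x, s))) <= B" using F(2) by metis
 have "inverse B <= F (cmap c x, s)" if "x : C" for x s
 proof -
  have F0: "F (cmap c x, s) > 0" using pos[of "(cmap c x, 1)"] F(2)[of "cmap c x" s] C that by (auto simp: cU_def)
  moreover have "inverse (F (cmap c x, s)) <= B" using B(2)[OF that, of s] F0 by simp
  ultimately show ?thesis using inverse_le_iff_le[of "inverse (F (cmap c x, s))" B] B(1)
  by (metis inverse_inverse_eq inverse_positive_iff_positive le_imp_inverse_le)
 qed
 thus ?thesis using that[of "inverse B"] B by simp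
qed

lemma ginv_base: "ginv c i j (et, s) = ginv c i j (et, 1)" by (simp add: ginv_def)
lemma sg_base: "sg c (et, s) = sg c (et, 1)" by (simp add: sg_def)

text \<open>Compactness makes the inverse Gram matrices uniformly elliptic.\<close>
lemma ginv_lower:
 assumes c: "c : atlas M" and C: "compact C" "C <= cdom c"
 obtains l where "l > 0"
  "!!x v. x : C ==> l * (v \<bullet> v) <= v \<bullet> (matrix_inv (gram M c x) *v v)"
proof (cases "C = {}")
 case True
 thus ?thesis using that[of 1] by simp
next
 case False
 let ?S = "C \<times> sphere (0 :: real ^ 'b) 1"
 let ?h = "%(x, v :: real ^ 'b). SUM i:UNIV. SUM j:UNIV. ginv c i j (cmap c x, 1) * v $ i * v $ j"
 have h: "?h (x, v) = v \<bullet> (matrix_inv (gram M c x) *v v)" if "x : C" for x v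
  using C that by (auto simp: inner_matrix_vector ginv_def cinv_cmap[OF c] subset_iff)
 have cS: "compact ?S" using C by (intro compact_Times) auto
 obtain b :: 'b where "True" by simp
 have "axis b 1 : sphere (0 :: real ^ 'b) 1" by (simp add: norm_axis_1)
 hence ne: "?S ~= {}" using False by auto
 have g: "continuous_on ?S (%z. ginv c i j (cmap c (fst z), 1))" for i j
 proof (rule continuous_on_compose2[OF smooth_on_continuous[OF smooth_ginv[OF c]]])
  show "continuous_on ?S (%z. (cmap c (fst z), 1::real))"
  by (intro continuous_intros continuous_on_compose2[OF continuous_cmap[OF c]]) (use C in auto)
  show "(%z. (cmap c (fst z), 1::real)) ` ?S <= cU c" using C by (auto simp: cU_def)
 qed
 have "continuous_on ?S ?h" unfolding split_beta by (intro continuous_intros g)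
 then obtain z where z: "z : ?S" "!!z'. z' : ?S ==> ?h z <= ?h z'" using continuous_attains_inf[OF cS ne, of ?h] by blast
 obtain x0 v0 where zz: "z = (x0, v0)" by force
 have p0: "?h z > 0"
 proof -
  have "pos_def (matrix_inv (gram M c x0))" using z(1) C c zz by (intro pos_def_inv gram_pos_def) auto
  moreover have "v0 ~= 0" using z(1) zz by auto
  ultimately show ?thesis using h[of x0 v0] z(1) unfolding zz by (auto simp: pos_def_def)
 qed
 have "?h z * (v \<bullet> v) <= v \<bullet> (matrix_inv (gram M c x) *v v)" if x: "x : C" for x v
 proof (cases "v = 0")
  case False
  let ?w = "v /\<^sub>R norm v"
  have "?h z <= ?h (x, ?w)" using z(2)[of "(x, ?w)"] x False by auto
  also have "... = ?w \<bullet> (matrix_inv (gram M c x) *v ?w)" by (rule h[OF x])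
  also have "... = (v \<bullet> (matrix_inv (gram M c x) *v v)) / (v \<bullet> v)"
  using False by (simp add: matrix_vector_mult_scaleR divide_inverse power2_norm_eq_inner[symmetric] power2_eq_square)
  finally show ?thesis using False by (simp add: field_simps)
 qed simp
 thus ?thesis using that[OF p0] by blast
qed

lemma test_smooth: "ph : test_functions M ==> Sm ph"
 by (simp add: test_functions_def)

lemma cov_deriv_1: "cov_deriv M c f [j] = chart_pd c j f"
 by auto

text \<open>Test functions are controlled through norms of covariant derivatives only. On compact sets these
bound the components; second partial derivatives differ from the second covariant derivative by
Christoffel symbols times first derivatives.\<close>
lemma test_chart_bounds:
 assumes ph: "ph : test_functions M" and c: "c : atlas M" and C: "compact C" "C <= cdom c"
 obtains B where "B > 0" "!!x s i. x : C ==> s > 0 ==> abs (fd (hat c ph) (ex i) (cmap c x, s)) <= B"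
  "!!x s i j. x : C ==> s > 0 ==> abs (fd (fd (hat c ph) (ex j)) (ex i) (cmap c x, s)) <= B"
proof -
 note sm = test_smooth[OF ph]
 have bd: "EX B. ALL c:atlas M. ALL x:cdom c. ALL s>0. cov_deriv_norm M c k (%z. ph (z, s)) x <= B" for k
 proof -
  have "EX B. ALL c:atlas M. ALL x:cdom c. ALL s>0. cov_deriv_norm M c k (%z. deriv_s 0 ph (z, s)) x <= B"
  using ph unfolding test_functions_def by blast
  thus ?thesis by (simp add: deriv_s_def)
 qed
 obtain B1 where B1: "!!x s. x : cdom c ==> s > 0 ==> cov_deriv_norm M c 1 (%z. ph (z, s)) x <= B1" using bd[of 1] c by blast
 obtain B2 where B2: "!!x s. x : cdom c ==> s > 0 ==> cov_deriv_norm M c 2 (%z. ph (z, s)) x <= B2" using bd[of 2] c by blast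
 obtain l where l: "l > 0" "!!x v. x : C ==> l * (v \<bullet> v) <= v \<bullet> (matrix_inv (gram M c x) *v v)"
  using ginv_lower[OF c C] by blast
 let ?f = "%s z. ph (z, s)"
 have sqrt_bound: "Q <= B\<^sup>2" if "sqrt Q <= B" "0 <= Q" for Q B :: real using that real_sqrt_le_iff sqrt_le_D by blast
 have pd1: "chart_pd c i (?f s) x = fd (hat c ph) (ex i) (cmap c x, s)" if "x : cdom c" "s > 0" for i s x
  by (rule chart_pd_hat(1)[OF sm c that])
 have e1: "(chart_pd c i (?f s) x)^2 <= B1\<^sup>2 / l" if x: "x : C" and s: "s > 0" for x s i
 proof -
  let ?B = "matrix_inv (gram M c x)" and ?v = "\<chi> i. chart_pd c i (?f s) x"
  have xc: "x : cdom c" using x C by blast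
  have n1: "cov_deriv_norm M c 1 (?f s) x = sqrt (?v \<bullet> (?B *v ?v))"
  unfolding cov_deriv_norm_def sum_lists_length_1 inner_matrix_vector by (simp add: mult_ac)
  have lo: "l * (?v \<bullet> ?v) <= ?v \<bullet> (?B *v ?v)" by (rule l(2)[OF x])
  moreover have "0 <= l * (?v \<bullet> ?v)" using l(1) by simp
  ultimately have "?v \<bullet> (?B *v ?v) <= B1\<^sup>2" using sqrt_bound B1[OF xc s] n1 by simp
  hence "l * (?v \<bullet> ?v) <= B1\<^sup>2" using lo by simp
  moreover have "(?v $ i)^2 <= ?v \<bullet> ?v"
  unfolding inner_vec_def by (rule order_trans[OF _ member_le_sum[of i]]) (auto simp: power2_eq_square)
  ultimately have "l * (?v $ i)^2 <= B1\<^sup>2" using mult_left_mono[of "(?v $ i)^2" "?v \<bullet> ?v" l] l(1) by linarith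
  hence "(?v $ i)^2 <= B1\<^sup>2 / l" using l(1) by (simp only: pos_le_divide_eq mult.commute)
  thus ?thesis by (simp only: vec_lambda_beta)
 qed
 have e2: "(cov_deriv M c (?f s) [k, n] x)^2 <= B2\<^sup>2 / l\<^sup>2" if x: "x : C" and s: "s > 0" for x s k n
 proof -
  let ?B = "matrix_inv (gram M c x)" and ?T = "%k n. cov_deriv M c (?f s) [k, n] x"
  have xc: "x : cdom c" using x C by blast
  let ?Q = "SUM k:UNIV. SUM j:UNIV. ?B $ k $ j * (SUM m:UNIV. SUM n:UNIV. ?B $ m $ n * ?T k m * ?T j n)"
  have "cov_deriv_norm M c 2 (?f s) x = sqrt (SUM k:UNIV. SUM m:UNIV. SUM j:UNIV. SUM n:UNIV. (?B $ k $ j * ?B $ m $ n) * ?T k m * ?T j n)"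
  unfolding cov_deriv_norm_def sum_lists_length_2
  by (simp only: numeral_2_eq_2 lessThan_Suc prod.insert finite_lessThan lessThan_0 prod.empty nth_Cons_Suc nth_Cons_0) (simp add: mult_ac)
  also have "(SUM k:UNIV. SUM m:UNIV. SUM j:UNIV. SUM n:UNIV. (?B $ k $ j * ?B $ m $ n) * ?T k m * ?T j n) =
  (SUM k:UNIV. SUM j:UNIV. SUM m:UNIV. SUM n:UNIV. (?B $ k $ j * ?B $ m $ n) * ?T k m * ?T j n)" by (rule sum.cong[OF refl], rule sum.swap)
  also have "... = ?Q" by (simp add: sum_distrib_left mult.assoc)
  finally have n2: "cov_deriv_norm M c 2 (?f s) x = sqrt ?Q" .
  have lo: "l\<^sup>2 * (SUM k:UNIV. SUM m:UNIV. (?T k m)^2) <= ?Q"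
  by (rule pos_def_tensor[OF pos_def_inv[OF gram_pos_def[OF c xc]] l(2)[OF x]]) (use l in auto)
  moreover have "0 <= l\<^sup>2 * (SUM k:UNIV. SUM m:UNIV. (?T k m)^2)" by (intro mult_nonneg_nonneg sum_nonneg) auto
  ultimately have "?Q <= B2\<^sup>2" using sqrt_bound B2[OF xc s] n2 by simp
  hence "l\<^sup>2 * (SUM k:UNIV. SUM m:UNIV. (?T k m)^2) <= B2\<^sup>2" using lo by linarith
  moreover have "(?T k n)^2 <= (SUM k:UNIV. SUM m:UNIV. (?T k m)^2)"
  proof -
  have "(?T k n)^2 <= (SUM m:UNIV. (?T k m)^2)" by (rule member_le_sum) auto
  also have "... <= (SUM k:UNIV. SUM m:UNIV. (?T k m)^2)"
  by (rule member_le_sum[of k UNIV "%k. SUM m:UNIV. (?T k m)^2"]) (auto intro: sum_nonneg)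
  finally show ?thesis .
  qed
  ultimately have "l\<^sup>2 * (?T k n)^2 <= B2\<^sup>2" by (meson mult_left_mono order_trans zero_le_power2)
  thus ?thesis using l(1) by (simp add: field_simps)
 qed
 define E1 where "E1 = sqrt (B1\<^sup>2 / l)"
 have E1: "abs (chart_pd c i (?f s) x) <= E1" if "x : C" "s > 0" for x s i
  unfolding E1_def using e1[OF that] real_le_rsqrt[of "abs (chart_pd c i (?f s) x)"] by simp
 define E2 where "E2 = sqrt (B2\<^sup>2 / l\<^sup>2)"
 have E2: "abs (cov_deriv M c (?f s) [k, n] x) <= E2" if "x : C" "s > 0" for x s k n
  unfolding E2_def using e2[OF that, of k n] real_le_rsqrt[of "abs (cov_deriv M c (?f s) [k, n] x)"] by simp
 have chr: "EX G. ALL x:C. abs (christoffel M c x k i j) <= G" for k i j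
 proof -
  define g where "g a b y = gram M c (cinv c (fst y)) $ a $ b" for a b and y :: "(real ^ 'b) * real"
  have sg': "smooth_on (cU c) (g a b)" for a b unfolding g_def by (rule smooth_gram[OF c])
  define F where "F y = (1 / 2) * (SUM l:UNIV. ginv c k l y * (fd (g j l) (ex i) y + fd (g i l) (ex j) y - fd (g i j) (ex l) y))" for y
  have "continuous_on (cU c) F" unfolding F_def by (intro continuous_intros smooth_on_continuous smooth_ginv smooth_on_frechet sg' c)
  moreover have "F (et, s) = F (et, 1)" for et s
  proof -
  have gb: "g a b (et, s) = g a b (et, 1)" for a b et s by (simp add: g_def)
  have fdb: "fd (g a b) v (et, s) = fd (g a b) v (et, 1)" for a b v by (rule fd_base[where F = "g a b", OF gb])
  show ?thesis unfolding F_def by (simp only: ginv_base[of c _ _ et s] fdb)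
  qed
  ultimately obtain B where B: "!!x. x : C ==> abs (F (cmap c x, 1)) <= B" using base_bound[OF c _ _ C] by metis
  have "christoffel M c x k i j = F (cmap c x, 1)" if x: "x : C" for x
  proof -
  have xc: "x : cdom c" using x C by blast
  have "chart_pd c n (%z. gram M c z $ a $ b) x = fd (g a b) (ex n) (cmap c x, 1)" for n a b
  by (rule chart_pd_E(1)[OF c xc smooth_on_differentiable[OF sg' co_in[OF xc]]]) (auto simp: g_def cinv_cmap[OF c])
  thus ?thesis unfolding christoffel_def F_def by (simp add: ginv_def cinv_cmap[OF c xc])
  qed
  thus ?thesis using B by (intro exI[of _ B]) simp
 qed
 then obtain G where G: "!!k i j x. x : C ==> abs (christoffel M c x k i j) <= G k i j" by metis
 define GG where "GG = (SUM i:UNIV. SUM j:UNIV. SUM k:UNIV. abs (G k i j))"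
 have E1p: "E1 >= 0" "E2 >= 0" "GG >= 0" unfolding E1_def E2_def GG_def using l by (auto intro!: sum_nonneg)
 have "abs (fd (fd (hat c ph) (ex j)) (ex i) (cmap c x, s)) <= E2 + GG * E1" if x: "x : C" and s: "s > 0" for x s i j
 proof -
  have xc: "x : cdom c" using x C by blast
  have "chart_pd c i (chart_pd c j (?f s)) x = fd (fd (hat c ph) (ex j)) (ex i) (cmap c x, s)"
  by (rule chart_pd_E(1)[OF c xc smooth_on_differentiable[OF smooth_on_frechet[OF hat_smooth[OF sm c]] co_in[OF xc s]]])
  (rule pd1[OF _ s])
  moreover have "cov_deriv M c (?f s) [i, j] x =
  chart_pd c i (chart_pd c j (?f s)) x - (SUM k:UNIV. christoffel M c x k i j * chart_pd c k (?f s) x)"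
  by (subst cov_deriv.simps(2)) (simp add: cov_deriv_1 lessThan_Suc del: cov_deriv.simps(2))
  moreover have "abs (SUM k:UNIV. christoffel M c x k i j * chart_pd c k (?f s) x) <= GG * E1"
  proof -
  have "abs (SUM k:UNIV. christoffel M c x k i j * chart_pd c k (?f s) x) <= (SUM k:UNIV. abs (G k i j) * E1)"
  by (rule order_trans[OF sum_abs], intro sum_mono, unfold abs_mult, intro mult_mono E1 x s order_trans[OF G[OF x] abs_ge_self]) auto
  also have "... = (SUM k:UNIV. abs (G k i j)) * E1" by (simp add: sum_distrib_right)
  also have "... <= GG * E1"
  proof (rule mult_right_mono[OF _ E1p(1)])
  have "(SUM k:UNIV. abs (G k i j)) <= (SUM j:UNIV. SUM k:UNIV. abs (G k i j))"
  by (rule member_le_sum[of j UNIV "%j. SUM k:UNIV. abs (G k i j)"]) (auto intro: sum_nonneg)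
  also have "... <= GG"
  unfolding GG_def by (rule member_le_sum[of i UNIV "%i. SUM j:UNIV. SUM k:UNIV. abs (G k i j)"]) (auto intro: sum_nonneg)
  finally show "(SUM k:UNIV. abs (G k i j)) <= GG" .
  qed
  finally show ?thesis .
  qed
  ultimately show ?thesis using E2[OF x s, of i j] by linarith
 qed
 note second = this
 have first: "abs (fd (hat c ph) (ex i) (cmap c x, s)) <= E1" if "x : C" "s > 0" for x s i
 proof -
  have "x : cdom c" using that C by blast
  from E1[OF that, of i] show ?thesis unfolding pd1[OF \<open>x : cdom c\<close> that(2)] .
 qed
 have p: "0 <= GG * E1" using E1p by simp
 show ?thesis
 proof (rule that[of "E1 + (E2 + GG * E1) + 1"])
  show "0 < E1 + (E2 + GG * E1) + 1" using p E1p by linarith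
  show "abs (fd (hat c ph) (ex i) (cmap c x, s)) <= E1 + (E2 + GG * E1) + 1" if "x : C" "s > 0" for x s i
  using first[OF that, of i] p E1p by linarith
  show "abs (fd (fd (hat c ph) (ex j)) (ex i) (cmap c x, s)) <= E1 + (E2 + GG * E1) + 1" if "x : C" "s > 0" for x s i j
  using second[OF that, of j i] p E1p by linarith
 qed
qed

definition base :: "('a * real => real) => 'a set" where
 "base ph = closure (fst ` support_mk ph)"

lemma base_compact: "ph : test_functions M ==> compact (base ph)"
 unfolding test_functions_def base_def Bc_mk_def Bc_def by blast

lemma base_zero:
 assumes "z : mk UNIV" "fst z ~: base ph"
 shows "ph z = 0"
proof (rule ccontr)
 assume "ph z ~= 0"
 hence "z : {z : mk UNIV. ph z ~= 0}" using assms(1) by simp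
 from subsetD[OF closure_subset this] have "z : support_mk ph" using assms(1) unfolding support_mk_def by (rule IntI)
 hence "fst z : fst ` support_mk ph" by (rule imageI)
 from subsetD[OF closure_subset this] show False using assms(2) unfolding base_def by simp
qed

lemma s_deriv_bounds:
 assumes ph: "ph : test_functions M"
 obtains B where "B > 0" "!!x s. s > 0 ==> abs (ph (x, s)) <= B"
  "!!x s. s > 0 ==> abs (s * deriv_s 1 ph (x, s)) <= B" "!!x s. s > 0 ==> abs (s\<^sup>2 * deriv_s 2 ph (x, s)) <= B"
proof -
 have "EX C. ALL x. ALL s>0. abs (deriv_s n ph (x, s)) <= C / max 1 s ^ n" for n using ph unfolding test_functions_def by blast
 then obtain C where C: "!!n x s. s > 0 ==> abs (deriv_s n ph (x, s)) <= C n / max 1 s ^ n" by metis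
 have Cp: "C n >= 0" for n using C[of 1 n undefined] by simp
 have sn: "abs (s ^ n * deriv_s n ph (x, s)) <= C n" if s: "s > 0" for n x s
 proof -
  have "abs (s ^ n * deriv_s n ph (x, s)) = s ^ n * abs (deriv_s n ph (x, s))" using s by (simp add: abs_mult)
  also have "... <= max 1 s ^ n * (C n / max 1 s ^ n)" using s C[OF s] by (intro mult_mono power_mono) auto
  also have "... = C n" by (simp add: max_def)
  finally show ?thesis .
 qed
 show ?thesis
 proof (rule that[of "C 0 + C 1 + C 2 + 1"])
  show "C 0 + C 1 + C 2 + 1 > 0" using Cp[of 0] Cp[of 1] Cp[of 2] by simp
  fix x and s :: real assume s: "s > 0"
  show "abs (ph (x, s)) <= C 0 + C 1 + C 2 + 1" using sn[OF s, of 0 x] Cp[of 0] Cp[of 1] Cp[of 2] by (simp add: deriv_s_def)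
  show "abs (s * deriv_s 1 ph (x, s)) <= C 0 + C 1 + C 2 + 1" using sn[OF s, of 1 x] Cp[of 0] Cp[of 1] Cp[of 2] by simp
  show "abs (s\<^sup>2 * deriv_s 2 ph (x, s)) <= C 0 + C 1 + C 2 + 1" using sn[OF s, of 2 x] Cp[of 0] Cp[of 1] Cp[of 2] by simp
 qed
qed

text \<open>The compact set is covered by finitely many compact sets in chart domains.\<close>
lemma bounded_by_charts:
 assumes K: "compact K" and zero: "!!z. z : mk UNIV ==> fst z ~: K ==> h z = (0::real)"
  and bd: "!!c C. c : atlas M ==> compact C ==> C <= cdom c ==> EX B. ALL x:C. ALL s>0. abs (h (x, s)) <= B"
 obtains B where "B > 0" "!!z. z : mk UNIV ==> abs (h z) <= B"
proof -
 obtain V C c where *: "!!n::nat. open (V n)" "!!n. V n <= C n" "!!n. compact (C n)"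
  "!!n. c n : atlas M" "!!n. C n <= cdom (c n)" "(\<Union>n. V n) = UNIV" using countable_compact_chart_cover by blast
 have "K <= (UN n:UNIV. V n)" unfolding *(6) by simp
 from compactE_image[OF K _ this] *(1)
 obtain I where I: "finite I" "K <= (UN i:I. V i)" by metis
 have "ALL i. EX B. ALL x:C i. ALL s>0. abs (h (x, s)) <= B" using bd[OF *(4) *(3) *(5)] by blast
 then obtain B where B: "!!i x s. x : C i ==> s > 0 ==> abs (h (x, s)) <= B i" by metis
 have "abs (h z) <= (SUM i:I. abs (B i)) + 1" if z: "z : mk UNIV" for z
 proof (cases "fst z : K")
  case True
  then obtain i where i: "i : I" "fst z : V i" using I(2) by blast
  have "abs (h z) <= B i" using B[of "fst z" i "snd z"] i *(2)[of i] z by (cases z) (auto simp: mk_def)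
  also have "... <= abs (B i)" by simp
  also have "... <= (SUM i:I. abs (B i))" by (rule member_le_sum[OF i(1)]) (use I(1) in auto)
  finally show ?thesis by simp
 next
  case False
  thus ?thesis using zero[OF z False] by (simp add: sum_nonneg add_nonneg_nonneg)
 qed
 moreover have "(SUM i:I. abs (B i)) + 1 > 0" by (simp add: sum_nonneg add_nonneg_pos)
 ultimately show ?thesis using that by blast
qed

lemma mk_cD: "z : mk UNIV ==> fst z : cdom c ==> z : cD c"
 by (cases z) (simp add: mk_def cD_def)

lemma off_base:
 assumes ph: "compact (base ph)" and z: "z : mk UNIV" "fst z ~: base ph" and c: "c : atlas M" "fst z : cdom c"
 shows "fd (hat c ph) v (co c z) = 0" "Aop c (hat c ph) (co c z) = 0"
proof -
 have o: "open ((- base ph) \<times> (UNIV :: real set))" using compact_imp_closed[OF ph] by (intro open_Times) auto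
 have "z : (- base ph) \<times> UNIV" using z by (cases z) auto
 from hat_zero_near[OF c(1) mk_cD[OF z(1) c(2)] this o, of ph] base_zero[of _ ph]
 show "fd (hat c ph) v (co c z) = 0" "Aop c (hat c ph) (co c z) = 0" by (auto simp: mem_Times_iff)
qed

lemma minner_off_base:
 assumes ph: "Sm ph" "compact (base ph)" and psi: "Sm psi" and z: "z : mk UNIV" "fst z ~: base ph"
 shows "minner M (fst z) (grad_mk M ph z) (grad_mk M psi z) = 0"
proof -
 obtain c where c: "c : atlas M" "fst z : cdom c" using charts_cover by blast
 thus ?thesis using minner_grad_cD[OF c(1) mk_cD[OF z(1) c(2)] ph(1) psi] off_base[OF ph(2) z c] by (simp add: Gam_def)
qed

lemma Lop_off_base:
 assumes ph: "Sm ph" "compact (base ph)" and z: "z : mk UNIV" "fst z ~: base ph"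
 shows "Lop ph z = 0"
proof -
 obtain c where c: "c : atlas M" "fst z : cdom c" using charts_cover by blast
 thus ?thesis using Lop_chart[OF c(1) ph(1) mk_cD[OF z(1) c(2)]] off_base[OF ph(2) z c] by simp
qed

lemma minner_grad_bounded:
 assumes ph: "ph : test_functions M" and psi: "psi : test_functions M"
 obtains B where "B > 0" "!!z. z : mk UNIV ==> abs (minner M (fst z) (grad_mk M ph z) (grad_mk M psi z)) <= B"
proof (rule bounded_by_charts[OF base_compact[OF ph], of "%z. minner M (fst z) (grad_mk M ph z) (grad_mk M psi z)"])
 show "minner M (fst z) (grad_mk M ph z) (grad_mk M psi z) = 0" if "z : mk UNIV" "fst z ~: base ph" for z
  using minner_off_base[OF test_smooth[OF ph] base_compact[OF ph] test_smooth[OF psi] that] .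
 fix c C assume c: "c : atlas M" and C: "compact C" "C <= cdom c"
 obtain B1 where B1: "B1 > 0" "!!x s i. x : C ==> s > 0 ==> abs (fd (hat c ph) (ex i) (cmap c x, s)) <= B1"
  using test_chart_bounds[OF ph c C] by metis
 obtain B2 where B2: "B2 > 0" "!!x s i. x : C ==> s > 0 ==> abs (fd (hat c psi) (ex i) (cmap c x, s)) <= B2"
  using test_chart_bounds[OF psi c C] by metis
 obtain S1 where S1: "S1 > 0" "!!x s. s > 0 ==> abs (s * deriv_s 1 ph (x, s)) <= S1" using s_deriv_bounds[OF ph] by metis
 obtain S2 where S2: "S2 > 0" "!!x s. s > 0 ==> abs (s * deriv_s 1 psi (x, s)) <= S2" using s_deriv_bounds[OF psi] by metis
 have "EX G. ALL x:C. ALL s. abs (ginv c i j (cmap c x, s)) <= G" for i j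
  using base_bound[OF c smooth_on_continuous[OF smooth_ginv[OF c]] ginv_base C] by metis
 then obtain G where G: "!!i j x s. x : C ==> abs (ginv c i j (cmap c x, s)) <= G i j" by metis
 have "abs (minner M x (grad_mk M ph (x, s)) (grad_mk M psi (x, s))) <= (SUM i:UNIV. SUM j:UNIV. G i j * B1 * B2) + S1 * S2"
  if x: "x : C" and s: "s > 0" for x s
 proof -
  have xc: "x : cdom c" using x C by blast
  have m: "minner M x (grad_mk M ph (x, s)) (grad_mk M psi (x, s)) = Gam c (hat c ph) (hat c psi) (cmap c x, s)"
  by (rule minner_grad[OF c xc test_smooth[OF ph] test_smooth[OF psi] s])
  have "abs (SUM i:UNIV. SUM j:UNIV. ginv c i j (cmap c x, s) * fd (hat c ph) (ex i) (cmap c x, s) * fd (hat c psi) (ex j) (cmap c x, s))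
  <= (SUM i:UNIV. SUM j:UNIV. G i j * B1 * B2)"
  proof (rule order_trans[OF sum_abs], rule sum_mono, rule order_trans[OF sum_abs], rule sum_mono)
  fix i j
  show "abs (ginv c i j (cmap c x, s) * fd (hat c ph) (ex i) (cmap c x, s) * fd (hat c psi) (ex j) (cmap c x, s)) <= G i j * B1 * B2"
  unfolding abs_mult using G[OF x, of i j s] B1(2)[OF x s, of i] B2(2)[OF x s, of j] B1(1) B2(1) by (intro mult_mono) auto
  qed
  moreover have "abs ((s * deriv_s 1 ph (x, s)) * (s * deriv_s 1 psi (x, s))) <= S1 * S2"
  unfolding abs_mult using S1(2)[OF s, of x] S2(2)[OF s, of x] S1(1) by (metis abs_ge_zero abs_mult less_imp_le mult_mono)
  moreover have "s\<^sup>2 * (fd (hat c ph) es (cmap c x, s) * fd (hat c psi) es (cmap c x, s)) =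
  (s * deriv_s 1 ph (x, s)) * (s * deriv_s 1 psi (x, s))"
  using deriv_s_hat(1)[OF test_smooth[OF ph] c xc s] deriv_s_hat(1)[OF test_smooth[OF psi] c xc s] by (simp add: power2_eq_square)
  ultimately show ?thesis unfolding m Gam_def snd_conv by linarith
 qed
 thus "EX B. ALL x:C. ALL s>0. abs (minner M (fst (x, s)) (grad_mk M ph (x, s)) (grad_mk M psi (x, s))) <= B" by auto
qed (use that in blast)

lemma Lop_bounded:
 assumes ph: "ph : test_functions M"
 obtains B where "B > 0" "!!z. z : mk UNIV ==> abs (Lop ph z) <= B"
proof (rule bounded_by_charts[OF base_compact[OF ph], of "Lop ph"])
 note sm = test_smooth[OF ph]
 show "Lop ph z = 0" if "z : mk UNIV" "fst z ~: base ph" for z using Lop_off_base[OF sm base_compact[OF ph] that] .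
 fix c C assume c: "c : atlas M" and C: "compact C" "C <= cdom c"
 obtain B where B: "B > 0" "!!x s i. x : C ==> s > 0 ==> abs (fd (hat c ph) (ex i) (cmap c x, s)) <= B"
  "!!x s i j. x : C ==> s > 0 ==> abs (fd (fd (hat c ph) (ex j)) (ex i) (cmap c x, s)) <= B"
  using test_chart_bounds[OF ph c C] by metis
 obtain S where S: "S > 0" "!!x s. s > 0 ==> abs (s * deriv_s 1 ph (x, s)) <= S" "!!x s. s > 0 ==> abs (s\<^sup>2 * deriv_s 2 ph (x, s)) <= S"
  using s_deriv_bounds[OF ph] by metis
 define a where "a i j y = sg c y * ginv c i j y" for i j y
 have sa: "smooth_on (cU c) (a i j)" for i j unfolding a_def[abs_def] by (intro smooth_on_mult smooth_sg smooth_ginv open_cU c)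
 have ab: "a i j (et, s) = a i j (et, 1)" for i j et s by (simp add: a_def sg_def ginv_def)
 define b where "b i j y = fd (a i j) (ex i) y / sg c y" for i j y
 have bb: "b i j (et, s) = b i j (et, 1)" for i j et s
  unfolding b_def using fd_base[of "a i j" et s "ex i", OF ab] sg_base[of c et s] by simp
 have cb: "continuous_on (cU c) (b i j)" for i j unfolding b_def
  by (intro continuous_on_divide smooth_on_continuous smooth_on_frechet sa smooth_sg c)
  (use sg_pos[OF c] in \<open>force dest: order_less_imp_not_eq2\<close>)
 have "EX G. ALL x:C. ALL s. abs (ginv c i j (cmap c x, s)) <= G" for i j
  using base_bound[OF c smooth_on_continuous[OF smooth_ginv[OF c]] ginv_base C] by metis
 then obtain G where G: "!!i j x s. x : C ==> abs (ginv c i j (cmap c x, s)) <= G i j" by metis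
 have "EX G. ALL x:C. ALL s. abs (b i j (cmap c x, s)) <= G" for i j using base_bound[OF c cb bb C] by metis
 then obtain H where H: "!!i j x s. x : C ==> abs (b i j (cmap c x, s)) <= H i j" by metis
 have "abs (Lop ph (x, s)) <= (SUM i:UNIV. SUM j:UNIV. G i j * B + H i j * B) + 2 * S + S"
  if x: "x : C" and s: "s > 0" for x s
 proof -
  have xc: "x : cdom c" using x C by blast
  let ?y = "(cmap c x, s)" and ?f = "hat c ph"
  have y: "?y : cU c" by (rule co_in[OF xc s])
  have sf: "smooth_on (cU c) ?f" by (rule hat_smooth[OF sm c])
  have e: "fd (%y. sg c y * (SUM j:UNIV. ginv c i j y * fd ?f (ex j) y)) (ex i) ?y =
  (SUM j:UNIV. a i j ?y * fd (fd ?f (ex j)) (ex i) ?y + fd (a i j) (ex i) ?y * fd ?f (ex j) ?y)" for i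
  proof -
  have "((%y. SUM j:UNIV. a i j y * fd ?f (ex j) y) has_derivative
  (%v. SUM j:UNIV. a i j ?y * fd (fd ?f (ex j)) v ?y + fd (a i j) v ?y * fd ?f (ex j) ?y)) (at ?y)"
  by (intro has_derivative_sum has_derivative_mult smooth_on_has_derivative[OF sa y]
  smooth_on_has_derivative[OF smooth_on_frechet[OF sf] y])
  from frechet_derivative_eqI[OF this] show ?thesis by (simp add: a_def sum_distrib_left mult.assoc)
  qed
  have sgp: "sg c ?y > 0" by (rule sg_pos[OF c y])
  have lap: "lapE c ?f ?y = (SUM i:UNIV. SUM j:UNIV. ginv c i j ?y * fd (fd ?f (ex j)) (ex i) ?y + b i j ?y * fd ?f (ex j) ?y)"
  unfolding lapE_def e sum_divide_distrib using sgp by (intro sum.cong refl) (simp add: a_def b_def add_divide_distrib)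
  have "abs (lapE c ?f ?y) <= (SUM i:UNIV. SUM j:UNIV. G i j * B + H i j * B)" unfolding lap
  proof (rule order_trans[OF sum_abs], rule sum_mono, rule order_trans[OF sum_abs], rule sum_mono, rule order_trans[OF abs_triangle_ineq], rule add_mono)
  fix i j
  show "abs (ginv c i j ?y * fd (fd ?f (ex j)) (ex i) ?y) <= G i j * B"
  unfolding abs_mult using G[OF x, of i j s] B(3)[OF x s, of j i] B(1) by (intro mult_mono) auto
  show "abs (b i j ?y * fd ?f (ex j) ?y) <= H i j * B"
  unfolding abs_mult using H[OF x, of i j s] B(2)[OF x s, of j] B(1) by (intro mult_mono) auto
  qed
  moreover have "Lop ph (x, s) = lapE c ?f ?y + 2 * (s * deriv_s 1 ph (x, s)) + s\<^sup>2 * deriv_s 2 ph (x, s)"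
  using Lop_chart[OF c sm, of "(x, s)"] xc s deriv_s_hat[OF sm c xc s] by (simp add: Aop_def cD_def)
  ultimately show ?thesis using S(2)[OF s, of x] S(3)[OF s, of x] by linarith
 qed
 thus "EX B. ALL x:C. ALL s>0. abs (Lop ph (x, s)) <= B" by auto
qed (use that in blast)

end

section \<open>Rapidly convergent sequences of square integrable functions\<close>

lemma suminf_quarter: "(\<Sum>j. ennreal (K * (1/4) ^ j)) < \<infinity>" if "K >= 0" for K :: real
proof -
 have "(%j. K * (1/4) ^ j) sums (K * (1 / (1 - 1/4)))" by (intro sums_mult geometric_sums) simp
 hence "(\<Sum>j. ennreal (K * (1/4) ^ j)) = ennreal (K * (1 / (1 - 1/4)))" using that by (intro suminf_ennreal_eq) auto
 thus ?thesis by simp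
qed

lemma suminf_finite_summable:
 fixes f :: "nat => real"
 assumes "!!j. 0 <= f j" "(\<Sum>j. ennreal (f j)) ~= \<infinity>"
 shows "summable f" "f j <= enn2real (\<Sum>j. ennreal (f j))"
proof -
 show s: "summable f" using assms by (intro summable_suminf_not_top) auto
 have "(\<Sum>j. ennreal (f j)) = ennreal (\<Sum>j. f j)" using assms by (intro suminf_ennreal) auto
 moreover have "f j <= (\<Sum>j. f j)" using sum_le_suminf[OF s, of "{j}"] assms(1) by simp
 moreover have "0 <= (\<Sum>j. f j)" using assms(1) by (intro suminf_nonneg s)
 ultimately show "f j <= enn2real (\<Sum>j. ennreal (f j))" by simp
qed

lemma L2_AE_dominated:
 fixes f :: "nat => 'a => real"
 assumes m: "!!j. f j : borel_measurable M" "g : borel_measurable M" and K: "K >= 0"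
  and le: "!!j. (nn_integral M (%z. ennreal ((f j z - g z)^2))) <= ennreal (K * (1/4) ^ j)"
 obtains S where "integrable M S" "AE z in M. (%j. f j z) \<longlonglongrightarrow> g z" "AE z in M. ALL j. (f j z - g z)^2 <= S z"
proof -
 define S' where "S' z = (\<Sum>j. ennreal ((f j z - g z)^2))" for z
 have S'm: "S' : borel_measurable M" unfolding S'_def[abs_def] using m by measurable
 have "(nn_integral M (%z. S' z)) = (\<Sum>j. (nn_integral M (%z. ennreal ((f j z - g z)^2))))"
  unfolding S'_def using m by (intro nn_integral_suminf) measurable
 also have "... <= (\<Sum>j. ennreal (K * (1/4) ^ j))" by (intro suminf_le le) auto
 finally have fin: "(nn_integral M (%z. S' z)) < \<infinity>" using suminf_quarter[OF K] by simp
 hence ae: "AE z in M. S' z ~= \<infinity>" using S'm by (intro nn_integral_noteq_infinite) auto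
 let ?S = "%z. enn2real (S' z)"
 have "integrable M ?S"
 proof (rule integrableI_nonneg)
  have "(nn_integral M (%z. ennreal (?S z))) <= (nn_integral M (%z. S' z))"
  by (intro nn_integral_mono) (metis ennreal_enn2real_if ennreal_zero_less_top less_imp_le top_greatest order_refl zero_le)
  thus "(nn_integral M (%z. ennreal (?S z))) < \<infinity>" using fin by simp
 qed (use S'm in auto)
 moreover have "AE z in M. (%j. f j z) \<longlonglongrightarrow> g z" using ae
 proof eventually_elim
  case (elim z)
  hence "summable (%j. (f j z - g z)^2)" by (intro suminf_finite_summable(1)) (auto simp: S'_def)
  hence "(%j. (f j z - g z)^2) \<longlonglongrightarrow> 0" by (rule summable_LIMSEQ_zero)
  hence "(%j. sqrt ((f j z - g z)^2)) \<longlonglongrightarrow> sqrt 0" by (rule tendsto_real_sqrt)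
  hence "(%j. f j z - g z) \<longlonglongrightarrow> 0" by (simp add: tendsto_rabs_zero_iff)
  thus ?case by (simp add: LIM_zero_iff)
 qed
 moreover have "AE z in M. ALL j. (f j z - g z)^2 <= ?S z" using ae
 proof eventually_elim
  case (elim z)
  thus ?case using suminf_finite_summable(2)[of "%j. (f j z - g z)^2"] by (simp add: S'_def)
 qed
 ultimately show ?thesis using that by blast
qed

lemma L2_limit:
 fixes f :: "nat => 'a => real"
 assumes m: "!!j. f j : borel_measurable M" and K: "K >= 0"
  and le: "!!j k. j <= k ==> (nn_integral M (%z. ennreal ((f j z - f k z)^2))) <= ennreal (K * (1/4) ^ j)"
 shows "AE z in M. convergent (%j. f j z)"
  and "(nn_integral M (%z. ennreal ((f j z - lim (%j. f j z))^2))) <= ennreal (K * (1/4) ^ j)"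
proof -
 define S where "S z = (\<Sum>j. ennreal (2 ^ j * (f j z - f (Suc j) z)^2))" for z
 have Sm: "S : borel_measurable M" unfolding S_def[abs_def] using m by measurable
 have "(nn_integral M (%z. S z)) = (\<Sum>j. (nn_integral M (%z. ennreal (2 ^ j * (f j z - f (Suc j) z)^2))))"
  unfolding S_def using m by (intro nn_integral_suminf) measurable
 also have "... <= (\<Sum>j. ennreal (K * (1/2) ^ j))"
 proof (intro suminf_le)
  fix j
  have "(nn_integral M (%z. ennreal (2 ^ j * (f j z - f (Suc j) z)^2))) = ennreal (2 ^ j) * (nn_integral M (%z. ennreal ((f j z - f (Suc j) z)^2)))"
  using m by (subst nn_integral_cmult[symmetric]) (auto simp: ennreal_mult)
  also have "... <= ennreal (2 ^ j) * ennreal (K * (1/4) ^ j)" by (intro mult_left_mono le) auto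
  also have "... = ennreal (K * (1/2) ^ j)"
  using K by (simp add: ennreal_mult'[symmetric] power_divide power_mult_distrib[symmetric] field_simps flip: power_mult_distrib)
  finally show "(nn_integral M (%z. ennreal (2 ^ j * (f j z - f (Suc j) z)^2))) <= ennreal (K * (1/2) ^ j)" .
 qed auto
 also have "(\<Sum>j. ennreal (K * (1/2) ^ j)) < \<infinity>"
 proof -
  have "(%j. K * (1/2) ^ j) sums (K * (1 / (1 - 1/2)))" by (intro sums_mult geometric_sums) simp
  hence "(\<Sum>j. ennreal (K * (1/2) ^ j)) = ennreal (K * (1 / (1 - 1/2)))" using K by (intro suminf_ennreal_eq) auto
  thus ?thesis by simp
 qed
 finally have "AE z in M. S z ~= \<infinity>" using Sm by (intro nn_integral_noteq_infinite) auto
 thus conv: "AE z in M. convergent (%j. f j z)"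
 proof eventually_elim
  case (elim z)
  have s: "summable (%j. 2 ^ j * (f j z - f (Suc j) z)^2)" by (rule suminf_finite_summable(1)) (use elim in \<open>auto simp: S_def\<close>)
  have "summable (%j. f (Suc j) z - f j z)"
  proof (rule summable_comparison_test')
  show "summable (%j. (2 ^ j * (f j z - f (Suc j) z)^2 + (1/2) ^ j))" by (intro summable_add s summable_geometric) simp
  fix j
  define d where "d = abs (f j z - f (Suc j) z)"
  define p :: real where "p = 2 ^ j"
  have p: "p > 0" "(1/2) ^ j = 1 / p" by (auto simp: p_def power_divide)
  have "0 <= (p * d - 1)^2" by simp
  hence "2 * (p * d) <= (p * d)^2 + 1" by (simp add: power2_diff)
  hence "p * d <= (p * d)^2 + 1" using zero_le_power2[of "p * d"] by linarith
  hence "p * d <= p * (p * d\<^sup>2 + 1 / p)" using p by (simp add: power2_eq_square algebra_simps)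
  hence "d <= p * d\<^sup>2 + 1 / p" using p by simp
  thus "norm (f (Suc j) z - f j z) <= 2 ^ j * (f j z - f (Suc j) z)^2 + (1/2) ^ j"
  using p unfolding d_def p_def by (simp add: abs_minus_commute)
  qed
  hence "convergent (%n. \<Sum>j<n. f (Suc j) z - f j z)" by (simp add: summable_iff_convergent)
  moreover have "(%n. \<Sum>j<n. f (Suc j) z - f j z) = (%n. f n z - f 0 z)" by (rule ext) (rule sum_lessThan_telescope[of "%j. f j z"])
  ultimately have "convergent (%n. f n z - f 0 z)" by (simp only:)
  hence "convergent (%n. (f n z - f 0 z) + f 0 z)" by (rule convergent_add[OF _ convergent_const])
  thus ?case by simp
 qed
 have ae: "AE z in M. ennreal ((f j z - lim (%j. f j z))^2) = liminf (%k. ennreal ((f j z - f k z)^2))" using conv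
 proof eventually_elim
  case (elim z)
  hence "(%k. f k z) \<longlonglongrightarrow> lim (%j. f j z)" by (simp add: convergent_LIMSEQ_iff)
  hence "(%k. ennreal ((f j z - f k z)^2)) \<longlonglongrightarrow> ennreal ((f j z - lim (%j. f j z))^2)"
  by (intro tendsto_ennrealI tendsto_intros)
  thus ?case using lim_imp_Liminf by (metis trivial_limit_sequentially)
 qed
 have "(nn_integral M (%z. ennreal ((f j z - lim (%j. f j z))^2))) = (nn_integral M (%z. liminf (%k. ennreal ((f j z - f k z)^2))))"
  by (rule nn_integral_cong_AE[OF ae])
 also have "... <= liminf (%k. (nn_integral M (%z. ennreal ((f j z - f k z)^2))))" using m by (intro nn_integral_liminf) measurable
 also have "... <= limsup (%k. (nn_integral M (%z. ennreal ((f j z - f k z)^2))))" by (rule Liminf_le_Limsup) simp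
 also have "... <= ennreal (K * (1/4) ^ j)" by (rule Limsup_bounded) (use le in \<open>auto simp: eventually_sequentially\<close>)
 finally show "(nn_integral M (%z. ennreal ((f j z - lim (%j. f j z))^2))) <= ennreal (K * (1/4) ^ j)" .
qed

lemma L2_prod:
 fixes f g :: "nat => 'a => real"
 assumes m: "!!j. f j : borel_measurable M" "F : borel_measurable M" "!!j. g j : borel_measurable M" "G : borel_measurable M"
  "b : borel_measurable M" and b: "!!z. abs (b z) <= (B::real)" and K: "K >= 0" "K' >= 0"
  and f: "!!j. (nn_integral M (%z. ennreal ((f j z - F z)^2))) <= ennreal (K * (1/4) ^ j)"
  and g: "!!j. (nn_integral M (%z. ennreal ((g j z - G z)^2))) <= ennreal (K' * (1/4) ^ j)"
  and F: "(nn_integral M (%z. ennreal ((F z)^2))) < \<infinity>" and G: "(nn_integral M (%z. ennreal ((G z)^2))) < \<infinity>"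
 shows "integrable M (%z. F z * G z * b z)"
  and "(%j. LINT z|M. f j z * g j z * b z) \<longlonglongrightarrow> (LINT z|M. F z * G z * b z)"
proof -
 obtain S where S: "integrable M S" "AE z in M. (%j. f j z) \<longlonglongrightarrow> F z" "AE z in M. ALL j. (f j z - F z)^2 <= S z"
  using L2_AE_dominated[OF m(1,2) K(1) f] by blast
 obtain T where T: "integrable M T" "AE z in M. (%j. g j z) \<longlonglongrightarrow> G z" "AE z in M. ALL j. (g j z - G z)^2 <= T z"
  using L2_AE_dominated[OF m(3,4) K(2) g] by blast
 have F2: "integrable M (%z. (F z)^2)" and G2: "integrable M (%z. (G z)^2)" using F G m by (auto intro!: integrableI_nonneg)
 let ?w = "%z. ((F z)^2 + S z + (G z)^2 + T z) * B"
 have w: "integrable M ?w" by (intro integrable_mult_left Bochner_Integration.integrable_add F2 G2 S T)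
 have lim: "AE z in M. (%j. f j z * g j z * b z) \<longlonglongrightarrow> F z * G z * b z"
  using S(2) T(2) by eventually_elim (intro tendsto_intros)
 have bd: "AE z in M. norm (f j z * g j z * b z) <= ?w z" for j using S(3) T(3)
 proof eventually_elim
  case (elim z)
  have sq: "x\<^sup>2 <= 2 * y\<^sup>2 + 2 * (x - y)^2" for x y :: real
  proof -
  have "0 <= (x - 2 * y)^2" by simp
  thus ?thesis by (simp add: power2_eq_square algebra_simps)
  qed
  have am: "2 * abs (x * y) <= x\<^sup>2 + y\<^sup>2" for x y :: real
  using sum_squares_bound[of "abs (x)" "abs (y)"] by (simp add: abs_mult)
  have "abs (f j z * g j z) <= (F z)^2 + S z + (G z)^2 + T z"
  using sq[of "f j z" "F z"] sq[of "g j z" "G z"] am[of "f j z" "g j z"] elim(1)[rule_format, of j] elim(2)[rule_format, of j] by linarith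
  thus ?case unfolding real_norm_def abs_mult[of _ "b z"] using b[of z] by (intro mult_mono) auto
 qed
 show "integrable M (%z. F z * G z * b z)" by (rule integrable_dominated_convergence[OF _ _ w lim bd]) (use m in measurable)
 show "(%j. LINT z|M. f j z * g j z * b z) \<longlonglongrightarrow> (LINT z|M. F z * G z * b z)"
  by (rule integral_dominated_convergence[OF _ _ w lim bd]) (use m in measurable)
qed

section \<open>The weak gradient of the density\<close>

context riem_volume
begin

definition KC :: "('a, 'b) chart => 'a set => ((real ^ 'b) * real) set" where
 "KC c C = cmap c ` C \<times> {0<..}"

abbreviation IK :: "('a, 'b) chart => 'a set => (real ^ 'b) * real => 'c::zero_neq_one" where
 "IK c C y \<equiv> indicator (KC c C) y"

abbreviation n1 :: "('a, 'b) chart => 'a set => ((real ^ 'b) * real => real) => ennreal" where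
 "n1 c C f \<equiv> NN (%y. IK c C y * f y)"

abbreviation n2 :: "('a, 'b) chart => 'a set => ((real ^ 'b) * real => real) => ennreal" where
 "n2 c C f \<equiv> NN (%y. (IK c C y * f y)^2)"

abbreviation d2 :: "('a, 'b) chart => 'a set => ((real ^ 'b) * real => real) => ((real ^ 'b) * real => real) => ennreal" where
 "d2 c C f g \<equiv> NN (%y. (IK c C y * f y - IK c C y * g y)^2)"

lemma KC_props:
 assumes c: "c : atlas M" and C: "compact C" "C <= cdom c"
 shows "KC c C : sets borel" "KC c C <= cU c"
proof -
 have "compact (cmap c ` C)" using C continuous_on_subset[OF continuous_cmap[OF c]] compact_continuous_image by blast
 hence "cmap c ` C : sets borel" by (rule borel_compact)
 hence "KC c C : sets (borel \<Otimes>\<^sub>M borel)" unfolding KC_def by (intro pair_measureI) auto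
 thus "KC c C : sets borel" unfolding borel_prod .
 show "KC c C <= cU c" using C by (auto simp: KC_def cU_def)
qed

lemma KC_measurable:
 assumes c: "c : atlas M" and C: "compact C" "C <= cdom c" and f: "f : mU c"
 shows "(%y. IK c C y * (f y :: real)) : borel_measurable lborel"
proof -
 have "(%y. indicator (cU c) y *\<^sub>R f y) : borel_measurable borel"
  using f cU_borel[OF c] by (subst (asm) borel_measurable_restrict_space_iff) auto
 hence 1: "(%y. IK c C y * (indicator (cU c) y *\<^sub>R f y)) : borel_measurable borel" using KC_props(1)[OF c C] by measurable
 have eq: "(%y. IK c C y * (indicator (cU c) y *\<^sub>R f y)) = (%y. IK c C y * f y)"
  using KC_props(2)[OF c C] by (auto simp: indicator_def fun_eq_iff)
 show ?thesis using 1 unfolding eq by simp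
qed

lemma smooth_measurable: "smooth_on (cU c) f ==> f : mU c"
 by (intro borel_measurable_continuous_on_restrict smooth_on_continuous)

lemma KC_nn_integral:
 assumes c: "c : atlas M" and C: "compact C" "C <= cdom c"
 obtains ka :: real where "ka > 0"
  "!!h. h : borel_measurable (mlD c) ==>
  (nn_integral lborel (%y. h (pt c y) * IK c C y)) <= ennreal ka * (nn_integral ml (%z. h z))"
proof -
 obtain e where e: "e > 0" "!!x s. x : C ==> e <= sg c (cmap c x, s)"
  using base_lower[OF c smooth_on_continuous[OF smooth_sg[OF c]] sg_base sg_pos[OF c] C] by metis
 have "(nn_integral lborel (%y. h (pt c y) * IK c C y)) <= ennreal (1 / e) * (nn_integral ml (%z. h z))"
  if h: "h : borel_measurable (mlD c)" for h :: "'a * real => ennreal"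
 proof -
  have hm: "(%y. h (pt c y) * ennreal (sg c y) * indicator (cU c) y) : borel_measurable lborel"
  proof -
  have "(%y. h (pt c y) * ennreal (sg c y)) : mU c"
  using measurable_chart_iff[OF c, of h] h sg_measurable[OF c] by (intro borel_measurable_times_ennreal) auto
  thus ?thesis using cU_borel[OF c] by (subst (asm) borel_measurable_restrict_space_iff_ennreal) auto
  qed
  have "(nn_integral lborel (%y. h (pt c y) * IK c C y))
  <= (nn_integral lborel (%y. ennreal (1 / e) * (h (pt c y) * ennreal (sg c y) * indicator (cU c) y)))"
  proof (rule nn_integral_mono)
  fix y
  show "h (pt c y) * IK c C y <= ennreal (1 / e) * (h (pt c y) * ennreal (sg c y) * indicator (cU c) y)"
  proof (cases "y : KC c C")
  case True
  hence yU: "y : cU c" using KC_props(2)[OF c C] by blast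
  have "e <= sg c y" using True e(2) by (auto simp: KC_def)
  hence "1 <= 1 / e * sg c y" using e(1) by (simp add: field_simps)
  hence "1 <= ennreal (1 / e * sg c y)" using ennreal_leI[of 1] by simp
  also have "... = ennreal (1 / e) * ennreal (sg c y)" using e(1) by (intro ennreal_mult') auto
  finally have "h (pt c y) * 1 <= h (pt c y) * (ennreal (1 / e) * ennreal (sg c y))" by (rule mult_left_mono) simp
  thus ?thesis using True yU by (simp add: mult_ac)
  qed simp
  qed
  also have "... = ennreal (1 / e) * (nn_integral lborel (%y. h (pt c y) * ennreal (sg c y) * indicator (cU c) y))"
  by (rule nn_integral_cmult[OF hm])
  also have "... = ennreal (1 / e) * (nn_integral ml (%z. h z * indicator (cD c) z))" by (simp add: nn_integral_chart_ml[OF c h])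
  also have "... <= ennreal (1 / e) * (nn_integral ml (%z. h z))" by (intro mult_left_mono nn_integral_mono) (auto simp: indicator_def)
  finally show ?thesis .
 qed
 thus ?thesis using that[of "1 / e"] e(1) by simp
qed

lemma AE_chart:
 assumes c: "c : atlas M" and ae: "AE z in ml. P z"
 shows "AE y in lborel. y : cU c --> P (pt c y)"
proof -
 obtain N where N: "N : null_sets ml" "{z : space ml. \<not> P z} <= N" using ae by (auto elim!: AE_E simp: null_sets_def)
 have Nm: "indicator N : borel_measurable (mlD c)" using N(1) by (intro measurable_restrict_space1) auto
 have hm: "(%y. indicator N (pt c y) * ennreal (sg c y) * indicator (cU c) y) : borel_measurable lborel"
 proof -
  have "(%y. indicator N (pt c y) * ennreal (sg c y)) : mU c"
  using measurable_chart_iff[OF c, of "indicator N :: _ => ennreal"] Nm sg_measurable[OF c] by (intro borel_measurable_times_ennreal) auto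
  thus ?thesis using cU_borel[OF c] by (subst (asm) borel_measurable_restrict_space_iff_ennreal) auto
 qed
 have "(nn_integral lborel (%y. indicator N (pt c y) * ennreal (sg c y) * indicator (cU c) y)) = (nn_integral ml (%z. indicator N z * indicator (cD c) z))"
  by (rule nn_integral_chart_ml[OF c Nm, symmetric])
 also have "... <= (nn_integral ml (%z. indicator N z))" by (intro nn_integral_mono) (auto simp: indicator_def)
 also have "... = 0" using N(1) by (simp add: null_setsD1 null_setsD2)
 finally have "AE y in lborel. indicator N (pt c y) * ennreal (sg c y) * indicator (cU c) y = 0"
  using hm by (simp add: nn_integral_0_iff_AE)
 thus ?thesis
 proof eventually_elim
  case (elim y)
  show ?case
  proof
  assume y: "y : cU c"
  hence "pt c y ~: N" using elim sg_pos[OF c y] by (auto simp: indicator_def)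
  moreover have "pt c y : space ml" using pt_in[OF y] cD_mk space_ml by blast
  ultimately show "P (pt c y)" using N(2) by blast
  qed
 qed
qed

lemma smooth_mk_diff: "Sm ph ==> Sm psi ==> Sm (%z. ph z - psi z)"
 unfolding smooth_mk_def
proof (intro ballI)
 fix c assume *: "ALL c:atlas M. smooth_on (cimg c \<times> {0<..}) (%y. ph (cinv c (fst y), snd y))"
  "ALL c:atlas M. smooth_on (cimg c \<times> {0<..}) (%y. psi (cinv c (fst y), snd y))" "c : atlas M"
 show "smooth_on (cimg c \<times> {0<..}) (%y. ph (cinv c (fst y), snd y) - psi (cinv c (fst y), snd y))"
  by (intro smooth_on_diff) (use * open_cU[of c] in \<open>auto simp: cU_def\<close>)
qed

lemma fd_hat_diff:
 assumes "Sm ph" "Sm psi" "c : atlas M" "y : cU c"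
 shows "fd (hat c (%z. ph z - psi z)) v y = fd (hat c ph) v y - fd (hat c psi) v y"
proof -
 have e: "hat c (%z. ph z - psi z) = (%y. hat c ph y - hat c psi y)" by (simp add: hat_def fun_eq_iff)
 have "((%y. hat c ph y - hat c psi y) has_derivative (%v. fd (hat c ph) v y - fd (hat c psi) v y)) (at y)"
  by (intro has_derivative_diff smooth_on_has_derivative[OF hat_smooth] assms)
 from frechet_derivative_eqI[OF this] show ?thesis unfolding e by simp
qed

text \<open>By uniform ellipticity on the compact set, the coordinate gradient is dominated by the Riemannian one.\<close>
lemma KC_sobolev:
 assumes c: "c : atlas M" and C: "compact C" "C <= cdom c"
 obtains ka :: real where "ka > 0"
  "!!ph i. Sm ph ==> (n2 c C (%y. fd (hat c ph) (ex i) y)) <= ennreal ka * sobolev_sq M m ph"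
  "!!ph. Sm ph ==> (n2 c C (%y. (snd y * fd (hat c ph) es y))) <= ennreal ka * sobolev_sq M m ph"
  "!!ph. Sm ph ==> (n2 c C (%y. hat c ph y)) <= ennreal ka * sobolev_sq M m ph"
proof -
 obtain ka :: real where ka: "ka > 0" "!!h. h : borel_measurable (mlD c) ==>
  (nn_integral lborel (%y. h (pt c y) * IK c C y)) <= ennreal ka * (nn_integral ml (%z. h z))" using KC_nn_integral[OF c C] by blast
 obtain l where l: "l > 0" "!!x v. x : C ==> l * (v \<bullet> v) <= v \<bullet> (matrix_inv (gram M c x) *v v)"
  using ginv_lower[OF c C] by blast
 define L where "L = 1 / l + 1"
 have L: "L > 0" "L * l >= 1" "L >= 1" using l(1) by (auto simp: L_def distrib_right add_pos_pos)
 have main: "(n2 c C (%y. a y)) <= ennreal (L * ka) * sobolev_sq M m ph"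
  if ph: "Sm ph" and a: "!!y. y : KC c C ==> (a y)\<^sup>2 <= L * (Gam c (hat c ph) (hat c ph) y + (hat c ph y)^2)" for ph a
 proof -
  let ?h = "%z. ennreal (minner M (fst z) (grad_mk M ph z) (grad_mk M ph z) + (ph z)^2)"
  have hp: "?h (pt c y) = ennreal (Gam c (hat c ph) (hat c ph) y + (hat c ph y)^2)" if y: "y : cU c" for y
  unfolding minner_grad_cD[OF c pt_in[OF y] ph ph] co_pt[OF c y] by (simp add: hat_def)
  have "?h : borel_measurable (mlD c)" unfolding measurable_chart_iff[OF c]
  proof (rule measurable_cong[THEN iffD2, OF hp])
  show "(%y. ennreal (Gam c (hat c ph) (hat c ph) y + (hat c ph y)^2)) : mU c"
  using smooth_measurable[OF smooth_Gam[OF c hat_smooth[OF ph c] hat_smooth[OF ph c]]] smooth_measurable[OF hat_smooth[OF ph c]]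
  by measurable
  qed (simp add: space_restrict_space)
  note k = ka(2)[OF this]
  have "(n2 c C (%y. a y)) <= (nn_integral lborel (%y. ennreal L * (?h (pt c y) * IK c C y)))"
  proof (rule nn_integral_mono)
  fix y
  show "ennreal ((IK c C y * a y)^2) <= ennreal L * (?h (pt c y) * IK c C y)"
  proof (cases "y : KC c C")
  case True
  hence yU: "y : cU c" using KC_props(2)[OF c C] by blast
  show ?thesis unfolding hp[OF yU] using True ennreal_leI[OF a[OF True]] L(1) by (simp add: ennreal_mult')
  qed simp
  qed
  also have "... = ennreal L * (nn_integral lborel (%y. ?h (pt c y) * IK c C y))"
  proof (rule nn_integral_cmult)
  have 1: "(%y. IK c C y * (Gam c (hat c ph) (hat c ph) y + (hat c ph y)^2)) : borel_measurable lborel"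
  using smooth_measurable[OF smooth_Gam[OF c hat_smooth[OF ph c] hat_smooth[OF ph c]]] smooth_measurable[OF hat_smooth[OF ph c]]
  by (intro KC_measurable[OF c C] borel_measurable_add borel_measurable_power)
  have 2: "?h (pt c y) * IK c C y = ennreal (IK c C y * (Gam c (hat c ph) (hat c ph) y + (hat c ph y)^2))" for y
  using hp[of y] KC_props(2)[OF c C] by (cases "y : KC c C") auto
  show "(%y. ?h (pt c y) * IK c C y) : borel_measurable lborel" unfolding 2 using 1 by measurable
  qed
  also have "... <= ennreal L * (ennreal ka * sobolev_sq M m ph)" unfolding sobolev_sq_def by (intro mult_left_mono k) simp
  finally show ?thesis using L(1) ka(1) by (simp add: ennreal_mult' mult.assoc)
 qed
 have lower: "l * (SUM i:UNIV. (fd (hat c ph) (ex i) y)^2) + (snd y * fd (hat c ph) es y)^2 <= Gam c (hat c ph) (hat c ph) y" if y: "y : KC c C" for y ph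
 proof -
  obtain x s where x: "x : C" "y = (cmap c x, s)" using y by (auto simp: KC_def)
  let ?v = "\<chi> i. fd (hat c ph) (ex i) y"
  have cx: "cinv c (cmap c x) = x" using cinv_cmap[OF c] x C by blast
  have "l * (?v \<bullet> ?v) <= (SUM i:UNIV. SUM j:UNIV. ginv c i j y * fd (hat c ph) (ex i) y * fd (hat c ph) (ex j) y)"
  using l(2)[OF x(1), of ?v] unfolding inner_matrix_vector x(2) by (simp add: ginv_def cx)
  moreover have "?v \<bullet> ?v = (SUM i:UNIV. (fd (hat c ph) (ex i) y)^2)" by (simp add: inner_vec_def power2_eq_square)
  ultimately show ?thesis unfolding Gam_def by (simp add: power_mult_distrib power2_eq_square mult_ac)
 qed
 have big: "A <= L * B" if "A <= B" "0 <= A" for A B using mult_mono[of 1 L A B] L that by simp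
 show ?thesis
 proof (rule that[of "L * ka"])
  show "L * ka > 0" using L ka by simp
  fix ph assume ph: "Sm ph"
  have nn: "0 <= l * (SUM i:UNIV. (fd (hat c ph) (ex i) y)^2)" for y using l(1) by (intro mult_nonneg_nonneg sum_nonneg) auto
  show "(n2 c C (%y. fd (hat c ph) (ex i) y)) <= ennreal (L * ka) * sobolev_sq M m ph" for i
  proof (rule main[OF ph])
  fix y assume y: "y : KC c C"
  have "(fd (hat c ph) (ex i) y)^2 <= (SUM i:UNIV. (fd (hat c ph) (ex i) y)^2)"
  by (rule member_le_sum[of i UNIV "%i. (fd (hat c ph) (ex i) y)^2"]) auto
  moreover have "1 * (fd (hat c ph) (ex i) y)^2 <= (L * l) * (fd (hat c ph) (ex i) y)^2" by (rule mult_right_mono[OF L(2)]) simp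
  ultimately have "(fd (hat c ph) (ex i) y)^2 <= L * (l * (SUM i:UNIV. (fd (hat c ph) (ex i) y)^2))"
  using mult_left_mono[of "(fd (hat c ph) (ex i) y)^2" "SUM i:UNIV. (fd (hat c ph) (ex i) y)^2" "L * l"] L(2) by (simp add: mult.assoc)
  also have "... <= L * (Gam c (hat c ph) (hat c ph) y + (hat c ph y)^2)"
  using lower[OF y, of ph] L(1) zero_le_power2[of "snd y * fd (hat c ph) es y"] zero_le_power2[of "hat c ph y"]
  by (intro mult_left_mono) linarith+
  finally show "(fd (hat c ph) (ex i) y)^2 <= L * (Gam c (hat c ph) (hat c ph) y + (hat c ph y)^2)" .
  qed
  show "(n2 c C (%y. (snd y * fd (hat c ph) es y))) <= ennreal (L * ka) * sobolev_sq M m ph"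
  proof (rule main[OF ph], rule big)
  fix y assume y: "y : KC c C"
  show "(snd y * fd (hat c ph) es y)^2 <= Gam c (hat c ph) (hat c ph) y + (hat c ph y)^2"
  using lower[OF y, of ph] nn[of y] zero_le_power2[of "hat c ph y"] by linarith
  qed simp
  show "(n2 c C (%y. hat c ph y)) <= ennreal (L * ka) * sobolev_sq M m ph"
  proof (rule main[OF ph], rule big)
  fix y assume y: "y : KC c C"
  show "(hat c ph y)^2 <= Gam c (hat c ph) (hat c ph) y + (hat c ph y)^2"
  using lower[OF y, of ph] nn[of y] zero_le_power2[of "snd y * fd (hat c ph) es y"] by linarith
  qed simp
 qed
qed

text \<open>Along a subsequence the squared distances are at most \<open>(1/4)^j\<close>; their roots are summable, so there
is convergence almost everywhere as well.\<close>
lemma H12_fast: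
 assumes u: "u : H12 M m"
 obtains ph :: "nat => 'a * real => real" where "!!j. ph j : test_functions M" "!!j. sobolev_sq M m (ph j) < \<infinity>"
  "!!j k. j <= k ==> sobolev_sq M m (%z. ph j z - ph k z) <= ennreal ((1/4) ^ j)"
  "!!j. (NM (%z. (ph j z - u z)^2)) <= ennreal ((1/4) ^ j)"
proof -
 obtain f :: "nat => 'a * real => real" where f: "!!n. f n : test_functions M" "!!n. sobolev_sq M m (f n) < \<infinity>"
  "!!\<epsilon>. \<epsilon> > 0 ==> EX n0. ALL i>=n0. ALL j>=n0. sobolev_sq M m (%z. f i z - f j z) < ennreal \<epsilon>"
  "(%n. NM (%z. (f n z - u z)^2)) \<longlonglongrightarrow> 0" using u unfolding H12_def by blast
 have "EX n0. ALL i>=n0. (ALL k>=n0. sobolev_sq M m (%z. f i z - f k z) <= ennreal ((1/4) ^ j)) &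
  (NM (%z. (f i z - u z)^2)) <= ennreal ((1/4) ^ j)" for j
 proof -
  have p: "(1/4) ^ j > (0::real)" by simp
  obtain n0 where n0: "ALL i>=n0. ALL k>=n0. sobolev_sq M m (%z. f i z - f k z) < ennreal ((1/4) ^ j)" using f(3)[OF p] by blast
  have "eventually (%n. (NM (%z. (f n z - u z)^2)) < ennreal ((1/4) ^ j)) sequentially"
  using order_tendstoD(2)[OF f(4)] p by (simp del: power_one_over)
  then obtain n1 where "ALL i>=n1. (NM (%z. (f i z - u z)^2)) < ennreal ((1/4) ^ j)" unfolding eventually_sequentially by blast
  thus ?thesis using n0 by (intro exI[of _ "max n0 n1"]) (auto intro: less_imp_le)
 qed
 hence "ALL j. EX n0. ALL i>=n0. (ALL k>=n0. sobolev_sq M m (%z. f i z - f k z) <= ennreal ((1/4) ^ j)) &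
  (NM (%z. (f i z - u z)^2)) <= ennreal ((1/4) ^ j)" by (intro allI)
 from choice[OF this] obtain N where N0: "ALL j. ALL i>=N j. (ALL k>=N j. sobolev_sq M m (%z. f i z - f k z) <= ennreal ((1/4) ^ j)) &
  (NM (%z. (f i z - u z)^2)) <= ennreal ((1/4) ^ j)" by (rule exE)
 have N: "sobolev_sq M m (%z. f i z - f k z) <= ennreal ((1/4) ^ j)" if "N j <= i" "N j <= k" for j i k
  using N0[rule_format, OF that(1), THEN conjunct1, rule_format, OF that(2)] .
 have N': "(NM (%z. (f i z - u z)^2)) <= ennreal ((1/4) ^ j)" if "N j <= i" for j i using N0[rule_format, OF that, THEN conjunct2] .
 define n where "n j = (SUM i<=j. N i)" for j
 have n: "N j <= n k" if "j <= k" for j k unfolding n_def by (rule member_le_sum) (use that in auto)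
 show ?thesis
 proof (rule that[of "%j. f (n j)"])
  show "sobolev_sq M m (%z. f (n j) z - f (n k) z) <= ennreal ((1/4) ^ j)" if "j <= k" for j k by (rule N[OF n[OF order_refl] n[OF that]])
  show "(NM (%z. (f (n j) z - u z)^2)) <= ennreal ((1/4) ^ j)" for j by (rule N'[OF n[OF order_refl]])
 qed (rule f(1) f(2))+
qed

end

lemma L2_finite:
 fixes f F :: "'a => real"
 assumes m: "f : borel_measurable M" "F : borel_measurable M"
  and "(nn_integral M (%z. ennreal ((f z)^2))) < \<infinity>" "(nn_integral M (%z. ennreal ((f z - F z)^2))) < \<infinity>"
 shows "(nn_integral M (%z. ennreal ((F z)^2))) < \<infinity>"
proof -
 have sq: "y\<^sup>2 <= 2 * x\<^sup>2 + 2 * (x - y)^2" for x y :: real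
 proof -
  have "0 <= (2 * x - y)^2" by simp
  thus ?thesis by (simp add: power2_eq_square algebra_simps)
 qed
 have "(nn_integral M (%z. ennreal ((F z)^2))) <= (nn_integral M (%z. 2 * ennreal ((f z)^2) + 2 * ennreal ((f z - F z)^2)))"
 proof (rule nn_integral_mono)
  fix z
  have "ennreal ((F z)^2) <= ennreal (2 * (f z)^2 + 2 * (f z - F z)^2)" by (rule ennreal_leI[OF sq])
  also have "... = 2 * ennreal ((f z)^2) + 2 * ennreal ((f z - F z)^2)" by (simp add: ennreal_mult')
  finally show "ennreal ((F z)^2) <= 2 * ennreal ((f z)^2) + 2 * ennreal ((f z - F z)^2)" .
 qed
 also have "... = 2 * (nn_integral M (%z. ennreal ((f z)^2))) + 2 * (nn_integral M (%z. ennreal ((f z - F z)^2)))"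
  using m by (simp add: nn_integral_add nn_integral_cmult)
 also have "... < \<infinity>" using assms(3,4) by (simp add: ennreal_mult_less_top)
 finally show ?thesis .
qed

lemma lim_or_zero_linear:
 fixes A :: "real ^ 'n::finite ^ 'm::finite" and A' :: "real ^ 'm ^ 'n"
 assumes X: "!!j. X j = A *v Y j" and Y: "!!j. Y j = A' *v X j"
 shows "(if Cauchy X then lim X else 0) = A *v (if Cauchy Y then lim Y else 0)"
proof (cases "Cauchy Y")
 case True
 hence "Y \<longlonglongrightarrow> lim Y" by (simp add: Cauchy_convergent_iff convergent_LIMSEQ_iff)
 hence "(%j. A *v Y j) \<longlonglongrightarrow> A *v lim Y" by (rule bounded_linear.tendsto[OF matrix_vector_mul_bounded_linear])
 moreover have "(%j. A *v Y j) = X" by (rule ext) (rule X[symmetric])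
 ultimately have l: "X \<longlonglongrightarrow> A *v lim Y" by (simp only:)
 hence "Cauchy X" by (rule LIMSEQ_imp_Cauchy)
 thus ?thesis using True limI[OF l] by simp
next
 case False
 have "\<not> Cauchy X"
 proof
  assume "Cauchy X"
  hence "Cauchy (%j. A' *v X j)" by (rule bounded_linear.Cauchy[OF matrix_vector_mul_bounded_linear])
  moreover have "(%j. A' *v X j) = Y" by (rule ext) (rule Y[symmetric])
  ultimately show False using False by (simp only:)
 qed
 thus ?thesis using False by simp
qed

context riem_volume
begin

definition covec :: "(nat => 'a * real => real) => ('a, 'b) chart => nat => (real ^ 'b) * real => real ^ 'b" where
 "covec ph c j y = (\<chi> i. fd (hat c (ph j)) (ex i) y)"

definition cov :: "(nat => 'a * real => real) => ('a, 'b) chart => (real ^ 'b) * real => real ^ 'b" where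
 "cov ph c y = (if Cauchy (%j. covec ph c j y) then lim (%j. covec ph c j y) else 0)"

definition slim :: "(nat => 'a * real => real) => 'a * real => real" where
 "slim ph z = lim (%j. deriv_s 1 (ph j) z)"

lemma cov_trans:
 assumes ph: "!!j. Sm (ph j)" and cd: "c : atlas M" "d : atlas M" "x : cdom c" "x : cdom d" and s: "s > 0"
 shows "cov ph c (cmap c x, s) = transpose (jac c d x) *v cov ph d (cmap d x, s)"
proof -
 have t: "covec ph c j (cmap c x, s) = transpose (jac c d x) *v covec ph d j (cmap d x, s)"
  if "c : atlas M" "d : atlas M" "x : cdom c" "x : cdom d" for c d j using chart_pd_trans[OF that chart_pd_hat(2)[OF ph that(2,4) s]]
  unfolding covec_def chart_pd_hat(1)[OF ph that(1,3) s] chart_pd_hat(1)[OF ph that(2,4) s] .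
 show ?thesis unfolding cov_def by (rule lim_or_zero_linear[OF t[OF cd] t[OF cd(2,1,4,3)]])
qed

lemma cov_measurable:
 assumes ph: "!!j. Sm (ph j)" and c: "c : atlas M"
 shows "(%y. cov ph c y $ i) : mU c"
proof -
 have m: "covec ph c j : mU c" for j unfolding covec_def[abs_def]
  by (intro borel_measurable_continuous_on_restrict continuous_on_vec_lambda smooth_on_continuous smooth_on_frechet hat_smooth ph c)
 have "(%y. cov ph c y) : mU c" unfolding cov_def
  by (intro measurable_If borel_measurable_lim_metric m borel_measurable_const sets_Collect_Cauchy)
 from bounded_linear_vec_nth[THEN bounded_linear.continuous_on, OF continuous_on_id, of UNIV i]
 have "(%v :: real ^ 'b. v $ i) : borel_measurable borel" by (intro borel_measurable_continuous_onI) simp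
 from measurable_compose[OF \<open>(%y. cov ph c y) : _\<close> this] show ?thesis .
qed

lemma slim_measurable:
 assumes ph: "!!j. Sm (ph j)" and c: "c : atlas M"
 shows "(%y. slim ph (pt c y)) : mU c"
proof (rule measurable_cong[THEN iffD2])
 show "(%y. lim (%j. fd (hat c (ph j)) es y)) : mU c"
  by (intro borel_measurable_lim_metric smooth_measurable smooth_on_frechet hat_smooth ph c)
 fix y assume "y : space (restrict_space borel (cU c))"
 hence y: "y : cU c" by (simp add: space_restrict_space)
 have x: "cinv c (fst y) : cdom c" "snd y > 0" using y by (auto simp: cU_def intro: inv_into_into)
 have "deriv_s 1 (ph j) (pt c y) = fd (hat c (ph j)) es y" for j using deriv_s_hat(1)[OF ph c x] co_pt[OF c y] by simp
 thus "slim ph (pt c y) = lim (%j. fd (hat c (ph j)) es y)" by (simp only: slim_def)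
qed

definition VV :: "('a, 'b) chart => 'a set => ((real ^ 'b) * real) set" where
 "VV c La = cmap c ` (cdom c Int La) \<times> {0<..}"

lemma VV_props: "c : atlas M ==> open La ==> open (VV c La)" "VV c La <= cU c"
 unfolding VV_def cU_def by (auto intro!: open_Times open_greaterThan open_chart_image open_Int chart_facts)

lemma compact_in_VV:
 assumes c: "c : atlas M" and K: "compact K" "K <= VV c La"
 obtains C where "compact C" "C <= cdom c Int La" "K <= KC c C"
proof (rule that[of "cinv c ` fst ` K"])
 have f: "fst ` K <= cmap c ` (cdom c Int La)" using K(2) by (auto simp: VV_def)
 have cf: "compact (fst ` K)" using K(1) by (intro compact_continuous_image continuous_intros)
 show "compact (cinv c ` fst ` K)" by (rule compact_continuous_image[OF continuous_on_subset[OF continuous_cinv[OF c]] cf]) (use f in auto)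
 show "cinv c ` fst ` K <= cdom c Int La"
 proof
  fix x assume "x : cinv c ` fst ` K"
  then obtain et where e: "et : fst ` K" "x = cinv c et" by blast
  from subsetD[OF f e(1)] obtain w where w: "et = cmap c w" "w : cdom c Int La" by (rule imageE)
  have "x = w" unfolding e(2) w(1) by (rule cinv_cmap[OF c]) (use w(2) in simp)
  thus "x : cdom c Int La" using w(2) by simp
 qed
 show "K <= KC c (cinv c ` fst ` K)"
 proof
  fix y assume y: "y : K"
  hence "fst y : cimg c" using f by blast
  hence e: "cmap c (cinv c (fst y)) = fst y" by (simp add: f_inv_into_f)
  have "cmap c (cinv c (fst y)) : cmap c ` cinv c ` fst ` K" by (intro imageI y)
  hence "fst y : cmap c ` cinv c ` fst ` K" unfolding e .
  moreover have "snd y > 0" using y K(2) by (auto simp: VV_def)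
  ultimately show "y : KC c (cinv c ` fst ` K)" unfolding KC_def by (simp add: mem_Times_iff)
 qed
qed

text \<open>Squares of test functions satisfy the product rule; all terms pass to the limit, as a product of
two sequences converging in \<open>L\<^sup>2\<close> converges in \<open>L\<^sup>1\<close>. The weight \<open>om\<close> is \<open>1\<close> for the directions of the
manifold and \<open>s\<close> for the direction of the marks, where only \<open>s \<partial>/\<partial>s\<close> converges.\<close>
lemma weak_local:
 assumes c: "c : atlas M" and La: "open La" and ph: "!!j. Sm (ph j)"
  and u: "u : borel_measurable ml" and phu: "!!j. (NM (%z. (ph j z - u z)^2)) <= ennreal ((1/4) ^ j)"
  and q: "q : borel_measurable ml" and qu: "AE z in ml. z : mk La --> q z = (u z)^2"
  and om: "smooth_on (cU c) om" "!!y. y : cU c ==> om y > 0"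
  and A: "A : mU c"
  and conv: "!!C. compact C ==> C <= cdom c ==> EX K>=0. ALL j.
  (d2 c C (%y. (om y * fd (hat c (ph j)) v y)) (%y. (om y * A y))) <= ennreal (K * (1/4) ^ j)"
  and fin: "!!C. compact C ==> C <= cdom c ==>
  (n2 c C (%y. (om y * fd (hat c (ph 0)) v y))) < \<infinity>"
  "!!C. compact C ==> C <= cdom c ==> (n2 c C (%y. hat c (ph 0) y)) < \<infinity>"
 shows "weak_deriv (VV c La) (%y. q (pt c y)) v (%y. 2 * u (pt c y) * A y)"
  and "!!C. compact C ==> C <= cdom c Int La ==>
  (n1 c C (%y. (om y * (2 * u (pt c y) * A y))^2 / q (pt c y))) < \<infinity>"
proof -
 let ?V = "VV c La"
 let ?u = "%y. u (pt c y)" and ?q = "%y. q (pt c y)"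
 have um: "?u : mU c" and qm: "?q : mU c"
  using measurable_chart_iff[OF c, of u] measurable_chart_iff[OF c, of q] measurable_restrict_space1[OF u] measurable_restrict_space1[OF q] by auto
 have hm: "hat c (ph j) : mU c"
  "(%y. om y * fd (hat c (ph j)) v y) : mU c" for j
  by (intro borel_measurable_times smooth_measurable hat_smooth[OF ph c] om(1) smooth_on_frechet)+
 have omm: "om : mU c" by (rule smooth_measurable[OF om(1)])
 have AEq: "AE y in lborel. y : ?V --> ?q y = (?u y)^2" using AE_chart[OF c qu]
 proof eventually_elim
  case (elim y)
  show ?case
  proof
  assume y: "y : ?V"
  hence "pt c y : mk La" by (auto simp: VV_def mk_def cinv_cmap[OF c])
  thus "?q y = (?u y)^2" using elim y VV_props(2) by blast
  qed
 qed
 have data: "EX K K'. K >= 0 & K' >= 0 &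
  (ALL j. (d2 c C (%y. hat c (ph j) y) (%y. ?u y)) <= ennreal (K * (1/4) ^ j)) &
  (ALL j. (d2 c C (%y. (om y * fd (hat c (ph j)) v y)) (%y. (om y * A y))) <= ennreal (K' * (1/4) ^ j)) &
  (n2 c C (%y. ?u y)) < \<infinity> &
  (n2 c C (%y. (om y * A y))) < \<infinity>"
  if C: "compact C" "C <= cdom c" for C
 proof -
  obtain ka :: real where ka: "ka > 0" "!!h. h : borel_measurable (mlD c) ==>
  (nn_integral lborel (%y. h (pt c y) * IK c C y)) <= ennreal ka * (nn_integral ml (%z. h z))" using KC_nn_integral[OF c C] by blast
  obtain K' where K': "K' >= 0" "!!j. (d2 c C (%y. (om y * fd (hat c (ph j)) v y)) (%y. (om y * A y))) <= ennreal (K' * (1/4) ^ j)"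
  using conv[OF C] by blast
  have 1: "(d2 c C (%y. hat c (ph j) y) (%y. ?u y)) <= ennreal (ka * (1/4) ^ j)" for j
  proof -
  have "(%z. ennreal ((ph j z - u z)^2)) : borel_measurable (mlD c)"
  unfolding measurable_chart_iff[OF c] using hm(1)[of j, unfolded hat_def[abs_def]] um by measurable
  from ka(2)[OF this]
  have "(nn_integral lborel (%y. ennreal ((ph j (pt c y) - ?u y)^2) * IK c C y)) <= ennreal ka * ennreal ((1/4) ^ j)"
  using phu[of j] by (meson mult_left_mono order_trans zero_le)
  moreover have "ennreal ((ph j (pt c y) - ?u y)^2) * IK c C y = ennreal ((IK c C y * hat c (ph j) y - IK c C y * ?u y)^2)" for y
  by (auto simp: indicator_def hat_def)
  ultimately show ?thesis using ka(1) by (simp add: ennreal_mult')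
  qed
  have 2: "(n2 c C (%y. ?u y)) < \<infinity>" by (rule L2_finite[OF KC_measurable[OF c C hm(1)] KC_measurable[OF c C um] fin(2)[OF C]])
  (rule order_le_less_trans[OF 1], simp)
  have 3: "(n2 c C (%y. (om y * A y))) < \<infinity>"
  by (rule L2_finite[OF KC_measurable[OF c C hm(2)] KC_measurable[OF c C borel_measurable_times[OF omm A]] fin(1)[OF C]])
  (rule order_le_less_trans[OF K'(2)], simp)
  show ?thesis by (rule exI[of _ ka], rule exI[of _ K']) (use ka(1) K' 1 2 3 in auto)
 qed
 show "(n1 c C (%y. (om y * (2 * ?u y * A y))^2 / ?q y)) < \<infinity>"
  if C: "compact C" "C <= cdom c Int La" for C
 proof -
  have C': "C <= cdom c" using C by blast
  have KV: "KC c C <= ?V" using C by (auto simp: KC_def VV_def)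
  have "(n1 c C (%y. (om y * (2 * ?u y * A y))^2 / ?q y)) <=
  (nn_integral lborel (%y. 4 * ennreal ((IK c C y * (om y * A y))^2)))"
  proof (rule nn_integral_mono_AE)
  show "AE y in lborel. ennreal (IK c C y * ((om y * (2 * ?u y * A y))^2 / ?q y)) <= 4 * ennreal ((IK c C y * (om y * A y))^2)" using AEq
  proof eventually_elim
  case (elim y)
  show ?case
  proof (cases "y : KC c C")
  case True
  hence "?q y = (?u y)^2" using elim KV by blast
  hence "(om y * (2 * ?u y * A y))^2 / ?q y <= 4 * (om y * A y)^2" by (cases "?u y = 0") (auto simp: power_mult_distrib)
  from ennreal_leI[OF this] show ?thesis using True by (simp add: ennreal_mult')
  qed simp
  qed
  qed
  also have "... = 4 * (n2 c C (%y. (om y * A y)))"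
  by (rule nn_integral_cmult[OF measurable_compose[OF borel_measurable_power[OF KC_measurable[OF c C(1) C' borel_measurable_times[OF omm A]]] measurable_ennreal]])
  also have "... < \<infinity>" using data[OF C(1) C'] by (auto simp: ennreal_mult_less_top)
  finally show ?thesis .
 qed
 have si: "set_integrable lborel K ?q" "set_integrable lborel K (%y. 2 * ?u y * A y)"
  if K: "compact K" "K <= ?V" for K
 proof -
  obtain C where C: "compact C" "C <= cdom c Int La" "K <= KC c C" using compact_in_VV[OF c K] by blast
  hence C': "C <= cdom c" by blast
  obtain ka K' where d: "ka >= 0" "K' >= 0"
  "!!j. (d2 c C (%y. hat c (ph j) y) (%y. ?u y)) <= ennreal (ka * (1/4) ^ j)"
  "!!j. (d2 c C (%y. (om y * fd (hat c (ph j)) v y)) (%y. (om y * A y))) <= ennreal (K' * (1/4) ^ j)"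
  "(n2 c C (%y. ?u y)) < \<infinity>"
  "(n2 c C (%y. (om y * A y))) < \<infinity>" using data[OF C(1) C'] by blast
  note KM = KC_measurable[OF c C(1) C']
  have KU: "K <= cU c" using K VV_props(2) by blast
  have Kb: "K : sets borel" by (rule borel_compact[OF K(1)])
  have ci: "continuous_on K (%y. 1 / om y)" by (intro continuous_intros continuous_on_subset[OF smooth_on_continuous[OF om(1)] KU])
  (use om(2) KU in \<open>force dest: order_less_imp_not_eq2\<close>)
  hence "bounded ((%y. 1 / om y) ` K)" using K(1) by (intro compact_imp_bounded compact_continuous_image)
  then obtain B where B: "!!y. y : K ==> abs (1 / om y) <= B" unfolding bounded_iff by auto
  have "integrable lborel (%y. (IK c C y * ?u y) * (IK c C y * (om y * A y)) * (indicator K y *\<^sub>R (1 / om y)))"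
  proof (rule L2_prod(1)[OF KM[OF hm(1)] KM[OF um] KM[OF hm(2)] KM[OF borel_measurable_times[OF omm A]] _ _ d])
  show "(%y. indicator K y *\<^sub>R (1 / om y)) : borel_measurable lborel" using borel_measurable_continuous_on_indicator[OF Kb ci] by simp
  show "abs (indicator K y *\<^sub>R (1 / om y)) <= max B 0" for y using B[of y] by (cases "y : K") (simp_all add: le_max_iff_disj)
  qed
  hence "integrable lborel (%y. 2 * ((IK c C y * ?u y) * (IK c C y * (om y * A y)) * (indicator K y *\<^sub>R (1 / om y))))"
  by (rule integrable_mult_right)
  moreover have e: "2 * ((IK c C y * ?u y) * (IK c C y * (om y * A y)) * (indicator K y *\<^sub>R (1 / om y))) =
  indicator K y *\<^sub>R (2 * ?u y * A y)" for y
  proof (cases "y : K")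
  case True
  hence "om y ~= 0" "y : KC c C" using om(2)[of y] KU C(3) by auto
  thus ?thesis using True by simp
  qed simp
  ultimately show "set_integrable lborel K (%y. 2 * ?u y * A y)" unfolding set_integrable_def by (simp only: e)
  have i1: "integrable lborel (%y. (IK c C y * ?u y) * (IK c C y * ?u y) * (indicator K y :: real))"
  by (rule L2_prod(1)[OF KM[OF hm(1)] KM[OF um] KM[OF hm(1)] KM[OF um] _ _ d(1) d(1) d(3) d(3) d(5) d(5), where B = 1])
  (use Kb in \<open>auto simp: indicator_def\<close>)
  have qK: "(%y. indicator K y *\<^sub>R ?q y) : borel_measurable lborel"
  proof -
  have "(%y. indicator K y * (IK c C y * ?q y)) : borel_measurable lborel" using KM[OF qm] Kb by measurable
  moreover have "(%y. indicator K y * (IK c C y * ?q y)) = (%y. indicator K y *\<^sub>R ?q y)"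
  using C(3) by (auto simp: indicator_def fun_eq_iff)
  ultimately show ?thesis by simp
  qed
  have ae: "AE y in lborel. (IK c C y * ?u y) * (IK c C y * ?u y) * indicator K y = indicator K y *\<^sub>R ?q y" using AEq
  proof eventually_elim
  case (elim y)
  show ?case
  proof (cases "y : K")
  case True
  hence "y : ?V" "y : KC c C" using K(2) C(3) by blast+
  thus ?thesis using elim True by (simp add: power2_eq_square)
  qed simp
  qed
  show "set_integrable lborel K ?q" unfolding set_integrable_def by (rule integrable_cong_AE_imp[OF i1 qK ae])
 qed
 have ibp: "(LINT y:?V|lborel. ?q y * fd psi v y) = - (LINT y:?V|lborel. (2 * ?u y * A y) * psi y)" if t: "test_on ?V psi" for psi
 proof -
  obtain K where K: "compact K" "K <= ?V" "!!y. y ~: K ==> psi y = 0" using t unfolding test_on_def by blast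
  obtain C where C: "compact C" "C <= cdom c Int La" "K <= KC c C" using compact_in_VV[OF c K(1,2)] by blast
  hence C': "C <= cdom c" by blast
  obtain ka K' where d: "ka >= 0" "K' >= 0"
  "!!j. (d2 c C (%y. hat c (ph j) y) (%y. ?u y)) <= ennreal (ka * (1/4) ^ j)"
  "!!j. (d2 c C (%y. (om y * fd (hat c (ph j)) v y)) (%y. (om y * A y))) <= ennreal (K' * (1/4) ^ j)"
  "(n2 c C (%y. ?u y)) < \<infinity>"
  "(n2 c C (%y. (om y * A y))) < \<infinity>" using data[OF C(1) C'] by blast
  note KM = KC_measurable[OF c C(1) C']
  have tU: "test_on (cU c) psi" by (rule test_on_mono[OF t VV_props(2)])
  have D0: "fd psi v y = 0" if "y ~: K" for y using frechet_zero_outside[OF compact_imp_closed[OF K(1)] K(3) that] by simp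
  have tD: "test_on ?V (%y. fd psi v y)" by (rule test_on_frechet[OF t])
  have tw: "test_on (cU c) (%y. inverse (om y) * psi y)"
  by (intro test_on_mult_left[OF open_cU[OF c] _ tU] smooth_on_inverse open_cU[OF c] om)
  obtain B1 where B1: "!!y. abs (fd psi v y) <= B1" using test_on_bounded[OF tD] by blast
  obtain B2 where B2: "!!y. abs (inverse (om y) * psi y) <= B2" using test_on_bounded[OF tw] by blast
  have m1: "(%y. fd psi v y) : borel_measurable lborel" using test_on_borel[OF tD] by simp
  have m2: "(%y. inverse (om y) * psi y) : borel_measurable lborel" using test_on_borel[OF tw] by simp
  note p1 = L2_prod[OF KM[OF hm(1)] KM[OF um] KM[OF hm(1)] KM[OF um] m1 B1 d(1) d(1) d(3) d(3) d(5) d(5)]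
  note p2 = L2_prod[OF KM[OF hm(1)] KM[OF um] KM[OF hm(2)] KM[OF borel_measurable_times[OF omm A]] m2 B2 d]
  have e1: "(LINT y|lborel. (IK c C y * hat c (ph j) y) * (IK c C y * hat c (ph j) y) * fd psi v y) =
  - 2 * (LINT y|lborel. (IK c C y * hat c (ph j) y) * (IK c C y * (om y * fd (hat c (ph j)) v y)) * (inverse (om y) * psi y))" for j
  proof -
  let ?h = "hat c (ph j)"
  have sh: "smooth_on (cU c) ?h" by (rule hat_smooth[OF ph c])
  have "weak_deriv (cU c) (%y. ?h y * ?h y) v (%y. fd (%y. ?h y * ?h y) v y)" by (intro weak_deriv_smooth smooth_on_mult open_cU[OF c] sh)
  from weak_deriv_test[OF this tU]
  have "(LINT y:cU c|lborel. ?h y * ?h y * fd psi v y) = - (LINT y:cU c|lborel. fd (%y. ?h y * ?h y) v y * psi y)" .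
  moreover have "(LINT y:cU c|lborel. ?h y * ?h y * fd psi v y) =
  (LINT y|lborel. (IK c C y * ?h y) * (IK c C y * ?h y) * fd psi v y)" unfolding set_lebesgue_integral_def
  proof (rule Bochner_Integration.integral_cong[OF refl])
  fix y
  show "indicator (cU c) y *\<^sub>R (?h y * ?h y * fd psi v y) = (IK c C y * ?h y) * (IK c C y * ?h y) * fd psi v y"
  proof (cases "y : K")
  case True
  hence "y : cU c" "y : KC c C" using K(2) VV_props(2)[of c La] C(3) by auto
  thus ?thesis by simp
  qed (simp add: D0)
  qed
  moreover have "(LINT y:cU c|lborel. fd (%y. ?h y * ?h y) v y * psi y) =
  (LINT y|lborel. 2 * ((IK c C y * ?h y) * (IK c C y * (om y * fd ?h v y)) * (inverse (om y) * psi y)))" unfolding set_lebesgue_integral_def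
  proof (rule Bochner_Integration.integral_cong[OF refl])
  fix y
  show "indicator (cU c) y *\<^sub>R (fd (%y. ?h y * ?h y) v y * psi y) =
  2 * ((IK c C y * ?h y) * (IK c C y * (om y * fd ?h v y)) * (inverse (om y) * psi y))"
  proof (cases "y : K")
  case True
  hence y: "y : cU c" "y : KC c C" using K(2) VV_props(2)[of c La] C(3) by auto
  have "om y ~= 0" using om(2)[OF y(1)] by simp
  moreover have "?h differentiable (at y)" by (rule smooth_on_differentiable[OF sh y(1)])
  ultimately show ?thesis using y by (simp add: fd_mult)
  qed (simp add: K(3))
  qed
  ultimately show ?thesis by simp
  qed
  have "(LINT y|lborel. (IK c C y * ?u y) * (IK c C y * ?u y) * fd psi v y) =
  - 2 * (LINT y|lborel. (IK c C y * ?u y) * (IK c C y * (om y * A y)) * (inverse (om y) * psi y))"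
  by (rule LIMSEQ_unique[OF p1(2)]) (unfold e1, intro tendsto_mult tendsto_const p2(2))
  moreover have "(LINT y:?V|lborel. ?q y * fd psi v y) =
  (LINT y|lborel. (IK c C y * ?u y) * (IK c C y * ?u y) * fd psi v y)"
  proof -
  have "(LINT y:?V|lborel. ?q y * fd psi v y) = (LINT y|lborel. (IK c C y * ?q y) * fd psi v y)" unfolding set_lebesgue_integral_def
  by (rule Bochner_Integration.integral_cong[OF refl]) (use K(2) C(3) D0 in \<open>auto simp: indicator_def\<close>)
  also have "... = (LINT y|lborel. (IK c C y * ?u y) * (IK c C y * ?u y) * fd psi v y)"
  proof (rule integral_cong_AE)
  show "(%y. (IK c C y * ?q y) * fd psi v y) : borel_measurable lborel" using KM[OF qm] m1 by measurable
  show "(%y. (IK c C y * ?u y) * (IK c C y * ?u y) * fd psi v y) : borel_measurable lborel" using KM[OF um] m1 by measurable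
  show "AE y in lborel. (IK c C y * ?q y) * fd psi v y = (IK c C y * ?u y) * (IK c C y * ?u y) * fd psi v y" using AEq
  proof eventually_elim
  case (elim y)
  thus ?case using D0[of y] K(2) by (cases "y : K") (auto simp: power2_eq_square indicator_def)
  qed
  qed
  finally show ?thesis .
  qed
  moreover have "(LINT y:?V|lborel. (2 * ?u y * A y) * psi y) =
  (LINT y|lborel. 2 * ((IK c C y * ?u y) * (IK c C y * (om y * A y)) * (inverse (om y) * psi y)))" unfolding set_lebesgue_integral_def
  proof (rule Bochner_Integration.integral_cong[OF refl])
  fix y
  show "indicator ?V y *\<^sub>R ((2 * ?u y * A y) * psi y) =
  2 * ((IK c C y * ?u y) * (IK c C y * (om y * A y)) * (inverse (om y) * psi y))"
  proof (cases "y : K")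
  case True
  hence y: "y : ?V" "y : cU c" "y : KC c C" using K(2) VV_props(2)[of c La] C(3) by auto
  have "om y ~= 0" using om(2)[OF y(2)] by simp
  thus ?thesis using y by simp
  qed (simp add: K(3))
  qed
  ultimately show ?thesis by simp
 qed
 show "weak_deriv ?V ?q v (%y. 2 * ?u y * A y)" unfolding weak_deriv_def using si ibp unfolding test_on_def by blast
qed

text \<open>The components, in a chart, of a vector field, with the index of the first part lowered.\<close>

definition lowx :: "('a, 'b) chart => ('a * real => ('a, 'b) mtangent) => 'b => (real ^ 'b) * real => real" where
 "lowx c W i y = (gram M c (cinv c (fst y)) *v fst (W (pt c y)) c) $ i"

definition lows :: "('a, 'b) chart => ('a * real => ('a, 'b) mtangent) => (real ^ 'b) * real => real" where
 "lows c W y = snd (W (pt c y)) / snd y"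

text \<open>Weak gradients over \<open>La\<close> for which \<open>|W|\<^sup>2/f\<close> is in addition integrable over compact sets.\<close>
definition good_grad :: "'a set => ('a * real => real) => ('a * real => ('a, 'b) mtangent) => bool" where
 "good_grad La q W \<longleftrightarrow> (ALL x. ALL s>0. fst (W (x, s)) : tangent_space M x) &
  (ALL c:atlas M. (ALL i. weak_deriv (VV c La) (%y. q (pt c y)) (ex i) (lowx c W i)) &
  weak_deriv (VV c La) (%y. q (pt c y)) es (lows c W) &
  (ALL i. lowx c W i : mU c) &
  lows c W : mU c &
  (ALL C. compact C & C <= cdom c Int La -->
  (ALL i. (n1 c C (%y. (lowx c W i y)^2 / q (pt c y))) < \<infinity>) &
  (n1 c C (%y. (snd y * lows c W y)^2 / q (pt c y))) < \<infinity>))"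

text \<open>Whether the coordinate gradients of the approximating sequence converge at a point does not depend on
the chart. Taking their limit there and \<open>0\<close> elsewhere gives an honest field of tangent vectors.\<close>
lemma local_weak_grad:
 assumes La: "open La" and u: "u : H12 M m" and q: "q : borel_measurable ml"
  and qu: "AE z in ml. z : mk La --> q z = (u z)^2"
 obtains W where "good_grad La q W"
proof -
 obtain ph :: "nat => 'a * real => real" where pht: "!!j. ph j : test_functions M" and phf: "!!j. sobolev_sq M m (ph j) < \<infinity>"
  and phc: "!!j k. j <= k ==> sobolev_sq M m (%z. ph j z - ph k z) <= ennreal ((1/4) ^ j)"
  and phu: "!!j. (NM (%z. (ph j z - u z)^2)) <= ennreal ((1/4) ^ j)"
  using H12_fast[OF u] by blast
 have ph: "Sm (ph j)" for j by (rule test_smooth[OF pht])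
 have um: "u : borel_measurable ml" using u unfolding H12_def by blast
 define W :: "'a * real => ('a, 'b) mtangent" where
  "W z = (raise (fst z) (%c. (2 * u z) *\<^sub>R cov ph c (co c z)), snd z * (2 * u z * slim ph z))" for z
 have tan: "fst (W (x, s)) : tangent_space M x" if s: "s > 0" for x s unfolding W_def fst_conv snd_conv
 proof (rule raise_tangent)
  fix c d assume cd: "c : atlas M" "d : atlas M" "x : cdom c" "x : cdom d"
  show "(2 * u (x, s)) *\<^sub>R cov ph c (cmap c x, s) = transpose (jac c d x) *v ((2 * u (x, s)) *\<^sub>R cov ph d (cmap d x, s))"
  by (simp only: matrix_vector_mult_scaleR cov_trans[OF ph cd s])
 qed
 have lx: "lowx c W i y = 2 * u (pt c y) * (cov ph c y $ i)" if c: "c : atlas M" and y: "y : cU c" for c i y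
 proof -
  have x: "cinv c (fst y) : cdom c" using y by (auto simp: cU_def intro: inv_into_into)
  have "fst (W (pt c y)) c = matrix_inv (gram M c (cinv c (fst y))) *v ((2 * u (pt c y)) *\<^sub>R cov ph c y)"
  using x c co_pt[OF c y] by (simp add: W_def raise_def)
  thus ?thesis unfolding lowx_def using matrix_inv_vector(1)[OF pos_def_invertible[OF gram_pos_def[OF c x]]] by simp
 qed
 have ls: "lows c W y = 2 * u (pt c y) * slim ph (pt c y)" if "y : cU c" for c y using that by (auto simp: lows_def W_def cU_def)
 have cong: "weak_deriv (VV c La) f v D" if w: "weak_deriv (VV c La) f v D'" and e: "!!y. y : cU c ==> D y = D' y" for c f v D D'
 proof -
  have e': "indicator K y *\<^sub>R D y = indicator K y *\<^sub>R D' y" if "K <= VV c La" for K y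
  using e[of y] that VV_props(2)[of c La] by (auto simp: indicator_def)
  have e'': "indicator (VV c La) y *\<^sub>R (D y * psi y) = indicator (VV c La) y *\<^sub>R (D' y * psi y)" for psi y
  using e[of y] VV_props(2)[of c La] by (auto simp: indicator_def)
  have s: "set_integrable lborel K D" if "compact K" "K <= VV c La" for K
  proof -
  have "set_integrable lborel K D'" using w that unfolding weak_deriv_def by blast
  thus ?thesis unfolding set_integrable_def e'[OF that(2)] .
  qed
  show ?thesis using w s unfolding weak_deriv_def set_lebesgue_integral_def e'' by blast
 qed
 have m: "u : borel_measurable (mlD c)" for c using um by (rule measurable_restrict_space1)
 have main: "(ALL i. weak_deriv (VV c La) (%y. q (pt c y)) (ex i) (lowx c W i)) &
  weak_deriv (VV c La) (%y. q (pt c y)) es (lows c W) &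
  (ALL i. lowx c W i : mU c) &
  lows c W : mU c &
  (ALL C. compact C & C <= cdom c Int La -->
  (ALL i. (n1 c C (%y. (lowx c W i y)^2 / q (pt c y))) < \<infinity>) &
  (n1 c C (%y. (snd y * lows c W y)^2 / q (pt c y))) < \<infinity>)"
  if c: "c : atlas M" for c
 proof -
  have uc: "(%y. u (pt c y)) : mU c" using measurable_chart_iff[OF c, of u] m by blast
  have sob: "EX ka>0. (ALL ph i. Sm ph --> (n2 c C (%y. fd (hat c ph) (ex i) y)) <= ennreal ka * sobolev_sq M m ph) &
  (ALL ph. Sm ph --> (n2 c C (%y. (snd y * fd (hat c ph) es y))) <= ennreal ka * sobolev_sq M m ph) &
  (ALL ph. Sm ph --> (n2 c C (%y. hat c ph y)) <= ennreal ka * sobolev_sq M m ph)"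
  if "compact C" "C <= cdom c" for C
  proof -
  note C = that
  obtain ka :: real where k: "ka > 0"
  "!!ph i. Sm ph ==> (n2 c C (%y. fd (hat c ph) (ex i) y)) <= ennreal ka * sobolev_sq M m ph"
  "!!ph. Sm ph ==> (n2 c C (%y. (snd y * fd (hat c ph) es y))) <= ennreal ka * sobolev_sq M m ph"
  "!!ph. Sm ph ==> (n2 c C (%y. hat c ph y)) <= ennreal ka * sobolev_sq M m ph" using KC_sobolev[OF c C] by blast
  show ?thesis by (intro exI[of _ ka] conjI allI impI k)
  qed
  have fin0: "ennreal ka * sobolev_sq M m (ph 0) < \<infinity>" for ka using phf[of 0] by (simp add: ennreal_mult_less_top)
  have quarter: "ennreal ka * sobolev_sq M m (%z. ph j z - ph k z) <= ennreal (ka * (1/4) ^ j)" if "j <= k" "ka > 0" for ka j k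
  using mult_left_mono[OF phc[OF that(1)], of "ennreal ka"] that(2) by (simp add: ennreal_mult')
  have fx: "fd (hat c (ph j)) v y - fd (hat c (ph k)) v y = fd (hat c (%z. ph j z - ph k z)) v y" if "y : cU c" for j k v y
  using fd_hat_diff[OF ph ph c that] by simp
  have dx: "EX K>=0. ALL j. (d2 c C (%y. (1 * fd (hat c (ph j)) (ex i) y)) (%y. (1 * cov ph c y $ i))) <= ennreal (K * (1/4) ^ j)"
  if C: "compact C" "C <= cdom c" for C i
  proof -
  obtain ka where ka: "ka > 0" "!!ph i. Sm ph ==> (n2 c C (%y. fd (hat c ph) (ex i) y)) <= ennreal ka * sobolev_sq M m ph"
  using sob[OF C] by blast
  let ?f = "%i j y. IK c C y * fd (hat c (ph j)) (ex i) y"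
  have fm: "?f i j : borel_measurable lborel" for i j
  by (intro KC_measurable[OF c C] smooth_measurable smooth_on_frechet hat_smooth[OF ph c])
  have ca: "(NN (%y. (?f i j y - ?f i k y)^2)) <= ennreal (ka * (1/4) ^ j)" if "j <= k" for i j k
  proof -
  have "?f i j y - ?f i k y = IK c C y * fd (hat c (%z. ph j z - ph k z)) (ex i) y" for y
  using fx[of y j "ex i" k] KC_props(2)[OF c C] by (cases "y : KC c C") auto
  thus ?thesis using order_trans[OF ka(2)[OF smooth_mk_diff[OF ph ph]] quarter[OF that ka(1)]] by simp
  qed
  have "AE y in lborel. ALL i. convergent (%j. ?f i j y)"
  unfolding AE_all_countable using L2_limit(1)[OF fm less_imp_le[OF ka(1)] ca] by blast
  hence ae: "AE y in lborel. lim (%j. ?f i j y) = IK c C y * cov ph c y $ i"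
  proof eventually_elim
  case (elim y)
  show ?case
  proof (cases "y : KC c C")
  case True
  have "(%j. fd (hat c (ph j)) (ex i) y) \<longlonglongrightarrow> lim (%j. fd (hat c (ph j)) (ex i) y)" for i
  using elim True by (auto simp: convergent_LIMSEQ_iff)
  hence l: "(%j. covec ph c j y) \<longlonglongrightarrow> (\<chi> i. lim (%j. fd (hat c (ph j)) (ex i) y))"
  unfolding covec_def by (intro vec_tendstoI) simp
  hence "cov ph c y = (\<chi> i. lim (%j. fd (hat c (ph j)) (ex i) y))"
  unfolding cov_def using LIMSEQ_imp_Cauchy[OF l] limI[OF l] by simp
  thus ?thesis using True by simp
  qed simp
  qed
  have "(NN (%y. (?f i j y - IK c C y * cov ph c y $ i)^2)) <= ennreal (ka * (1/4) ^ j)" for j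
  proof -
  have "(NN (%y. (?f i j y - IK c C y * cov ph c y $ i)^2)) = (NN (%y. (?f i j y - lim (%j. ?f i j y))^2))"
  by (rule nn_integral_cong_AE) (use ae in eventually_elim, simp)
  thus ?thesis using L2_limit(2)[OF fm less_imp_le[OF ka(1)] ca, of j] by simp
  qed
  thus ?thesis using ka(1) by (intro exI[of _ ka]) auto
  qed
  have ds: "EX K>=0. ALL j. (d2 c C (%y. (snd y * fd (hat c (ph j)) es y)) (%y. (snd y * slim ph (pt c y)))) <= ennreal (K * (1/4) ^ j)"
  if C: "compact C" "C <= cdom c" for C
  proof -
  obtain ka where ka: "ka > 0" "!!ph. Sm ph ==> (n2 c C (%y. (snd y * fd (hat c ph) es y))) <= ennreal ka * sobolev_sq M m ph"
  using sob[OF C] by blast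
  let ?f = "%j y. IK c C y * (snd y * fd (hat c (ph j)) es y)"
  have fm: "?f j : borel_measurable lborel" for j
  by (intro KC_measurable[OF c C] borel_measurable_times smooth_measurable smooth_on_frechet hat_smooth[OF ph c] smooth_snd)
  have ca: "(NN (%y. (?f j y - ?f k y)^2)) <= ennreal (ka * (1/4) ^ j)" if "j <= k" for j k
  proof -
  have "?f j y - ?f k y = IK c C y * (snd y * fd (hat c (%z. ph j z - ph k z)) es y)" for y
  using fx[of y j es k, symmetric] KC_props(2)[OF c C] by (cases "y : KC c C") (auto simp: right_diff_distrib)
  thus ?thesis using order_trans[OF ka(2)[OF smooth_mk_diff[OF ph ph]] quarter[OF that ka(1)]] by simp
  qed
  have cv: "AE y in lborel. convergent (%j. ?f j y)" by (rule L2_limit(1)[OF fm less_imp_le[OF ka(1)]]) (rule ca)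
  have ae: "AE y in lborel. lim (%j. ?f j y) = IK c C y * (snd y * slim ph (pt c y))" using cv
  proof eventually_elim
  case (elim y)
  show ?case
  proof (cases "y : KC c C")
  case True
  hence yU: "y : cU c" using KC_props(2)[OF c C] by blast
  have x: "cinv c (fst y) : cdom c" and s: "snd y > 0" using yU by (auto simp: cU_def intro: inv_into_into)
  have fe: "(%j. ?f j y) = (%j. snd y * deriv_s 1 (ph j) (pt c y))"
  using deriv_s_hat(1)[OF ph c x s] co_pt[OF c yU] True by (intro ext) simp
  have cv: "convergent (%j. snd y * deriv_s 1 (ph j) (pt c y))" using elim unfolding fe .
  have le: "lim (%j. ?f j y) = lim (%j. snd y * deriv_s 1 (ph j) (pt c y))" unfolding fe ..
  have "convergent (%j. deriv_s 1 (ph j) (pt c y))" using cv s by (simp add: convergent_mult_const_iff)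
  hence "(%j. deriv_s 1 (ph j) (pt c y)) \<longlonglongrightarrow> slim ph (pt c y)" by (simp add: slim_def convergent_LIMSEQ_iff)
  hence "(%j. snd y * deriv_s 1 (ph j) (pt c y)) \<longlonglongrightarrow> snd y * slim ph (pt c y)" by (intro tendsto_intros)
  thus ?thesis using le limI True by fastforce
  qed simp
  qed
  have "(NN (%y. (?f j y - IK c C y * (snd y * slim ph (pt c y)))^2)) <= ennreal (ka * (1/4) ^ j)" for j
  proof -
  have "(NN (%y. (?f j y - IK c C y * (snd y * slim ph (pt c y)))^2)) = (NN (%y. (?f j y - lim (%j. ?f j y))^2))"
  by (rule nn_integral_cong_AE) (use ae in eventually_elim, simp)
  thus ?thesis using L2_limit(2)[OF fm less_imp_le[OF ka(1)] ca, of j] by simp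
  qed
  thus ?thesis using ka(1) by (intro exI[of _ ka]) auto
  qed
  have f1: "(n2 c C (%y. (1 * fd (hat c (ph 0)) (ex i) y))) < \<infinity>"
  "(n2 c C (%y. (snd y * fd (hat c (ph 0)) es y))) < \<infinity>"
  "(n2 c C (%y. hat c (ph 0) y)) < \<infinity>"
  if C: "compact C" "C <= cdom c" for C i using sob[OF C] ph[of 0] fin0 by (auto intro: order_le_less_trans)
  note wx = weak_local[where ph = ph, OF c La ph um phu q qu smooth_on_const[of _ 1] _ cov_measurable[of ph c, OF ph c] dx f1(1) f1(3)]
  have pos: "y : cU c ==> snd y > 0" for y by (auto simp: cU_def)
  note ws = weak_local[where ph = ph, OF c La ph um phu q qu smooth_snd pos slim_measurable[of ph c, OF ph c] ds f1(2) f1(3)]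
  have lowxm: "lowx c W i : mU c" for i by (rule measurable_cong[THEN iffD2, of _ _ "%y. 2 * u (pt c y) * cov ph c y $ i"])
  (use lx[OF c] uc cov_measurable[of ph c i, OF ph c] in \<open>auto simp: space_restrict_space\<close>)
  have lowsm: "lows c W : mU c" by (rule measurable_cong[THEN iffD2, of _ _ "%y. 2 * u (pt c y) * slim ph (pt c y)"])
  (use ls uc slim_measurable[of ph c, OF ph c] in \<open>auto simp: space_restrict_space\<close>)
  have bx: "(n1 c C (%y. (lowx c W i y)^2 / q (pt c y))) < \<infinity>"
  and bs: "(n1 c C (%y. (snd y * lows c W y)^2 / q (pt c y))) < \<infinity>"
  if C: "compact C" "C <= cdom c Int La" for C i
  proof -
  have KU: "KC c C <= cU c" using KC_props(2)[OF c C(1)] C(2) by blast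
  have e1: "IK c C y * ((lowx c W i y)^2 / q (pt c y)) = IK c C y * ((1 * (2 * u (pt c y) * cov ph c y $ i))^2 / q (pt c y))" for y
  using lx[OF c, of y i] KU by (cases "y : KC c C") auto
  have e2: "IK c C y * ((snd y * lows c W y)^2 / q (pt c y)) = IK c C y * ((snd y * (2 * u (pt c y) * slim ph (pt c y)))^2 / q (pt c y))" for y
  using ls[of y c] KU by (cases "y : KC c C") auto
  show "(n1 c C (%y. (lowx c W i y)^2 / q (pt c y))) < \<infinity>" unfolding e1 by (rule wx(2)) (assumption | rule C zero_less_one)+
  show "(n1 c C (%y. (snd y * lows c W y)^2 / q (pt c y))) < \<infinity>" unfolding e2 by (rule ws(2)) (assumption | rule C)+
  qed
  have w1: "weak_deriv (VV c La) (%y. q (pt c y)) (ex i) (lowx c W i)" for i by (rule cong[OF wx(1) lx[OF c]]) auto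
  have w2: "weak_deriv (VV c La) (%y. q (pt c y)) es (lows c W)" by (rule cong[OF ws(1) ls]) auto
  show ?thesis
  proof (intro conjI allI impI)
  fix C assume C: "compact C & C <= cdom c Int La"
  show "(n1 c C (%y. (lowx c W i y)^2 / q (pt c y))) < \<infinity>" for i by (rule bx[OF C[THEN conjunct1] C[THEN conjunct2]])
  show "(n1 c C (%y. (snd y * lows c W y)^2 / q (pt c y))) < \<infinity>" by (rule bs[OF C[THEN conjunct1] C[THEN conjunct2]])
  qed (rule w1 w2 lowxm lowsm)+
 qed
 show ?thesis by (rule that[of W], unfold good_grad_def, intro conjI[OF _ ballI[OF main]] allI impI tan)
qed

end

lemma measurable_if_locally_integrable:
 fixes f :: "'a::euclidean_space => real"
 assumes U: "open U" and f: "!!K. compact K ==> K <= U ==> set_integrable lborel K f"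
 shows "f : borel_measurable (restrict_space borel U)"
proof -
 obtain \<D> where \<D>: "countable \<D>" "\<D> <= Pow U" "!!X. X : \<D> ==> EX a b. X = cbox a b" "\<Union>\<D> = U"
  using open_countable_Union_open_cbox[OF U] by blast
 show ?thesis
 proof (rule measurable_piecewise_restrict[OF \<D>(1)])
  show "space (restrict_space borel U) <= \<Union>\<D>" using \<D>(4) by (simp add: space_restrict_space)
  fix X assume X: "X : \<D>"
  obtain a b where ab: "X = cbox a b" using \<D>(3)[OF X] by blast
  have XU: "X <= U" using X \<D>(2) by blast
  show "X Int space (restrict_space borel U) : sets (restrict_space borel U)"
  using U ab XU by (auto simp: space_restrict_space sets_restrict_space_iff)
  have "set_integrable lborel X f" using f XU ab by auto
  hence "(%y. indicator X y *\<^sub>R f y) : borel_measurable borel"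
  unfolding set_integrable_def using borel_measurable_integrable by force
  hence "f : borel_measurable (restrict_space borel X)" using ab by (subst borel_measurable_restrict_space_iff) auto
  moreover have "restrict_space (restrict_space borel U) X = restrict_space borel X"
  using U ab XU by (subst restrict_restrict_space) (auto simp: Int_absorb1 Int_absorb2)
  ultimately show "f : borel_measurable (restrict_space (restrict_space borel U) X)" by simp
 qed
qed

lemma weak_deriv_exhaust:
 fixes f D :: "'a::euclidean_space => real"
 assumes U: "open U" and V: "!!n. V n <= U" and ex: "!!K. compact K ==> K <= U ==> EX n::nat. K <= V n"
  and w: "!!n. weak_deriv (V n) f v (D' n)" and D: "D : borel_measurable (restrict_space borel U)"
  and ae: "!!n. AE y in lborel. y : V n --> D y = D' n y"
 shows "weak_deriv U f v D"
proof -
 have DK: "(%y. indicator K y * D y) : borel_measurable lborel" if "compact K" "K <= U" for K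
 proof -
  have "(%y. indicator U y *\<^sub>R D y) : borel_measurable borel" using D U by (subst (asm) borel_measurable_restrict_space_iff) auto
  hence 1: "(%y. indicator K y * (indicator U y *\<^sub>R D y)) : borel_measurable borel" using borel_compact[OF that(1)] by measurable
  have "(%y. indicator K y * (indicator U y *\<^sub>R D y)) = (%y. indicator K y * D y)"
  using that(2) by (auto simp: indicator_def fun_eq_iff)
  thus ?thesis using 1 by simp
 qed
 have s: "set_integrable lborel K f & set_integrable lborel K D" if K: "compact K" "K <= U" for K
 proof -
  obtain n where n: "K <= V n" using ex[OF K] by blast
  have i: "set_integrable lborel K f" "set_integrable lborel K (D' n)" using w[of n] K(1) n unfolding weak_deriv_def by blast+
  have "integrable lborel (%y. indicator K y * D y)"
  proof (rule integrable_cong_AE_imp[OF i(2)[unfolded set_integrable_def] DK[OF K]])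
  show "AE y in lborel. indicator K y *\<^sub>R D' n y = indicator K y * D y"
  using ae[of n] by eventually_elim (use n in \<open>auto simp: indicator_def\<close>)
  qed
  thus ?thesis using i(1) by (simp add: set_integrable_def)
 qed
 have t: "(LINT y:U|lborel. f y * fd psi v y) = - (LINT y:U|lborel. D y * psi y)" if psi: "test_on U psi" for psi
 proof -
  obtain K where K: "compact K" "K <= U" "!!y. y ~: K ==> psi y = 0" using psi unfolding test_on_def by blast
  obtain n where n: "K <= V n" using ex[OF K(1,2)] by blast
  have tn: "test_on (V n) psi" using psi K n unfolding test_on_def by blast
  have z: "(LINT y:S|lborel. g y * et y) = (LINT y|lborel. g y * et y)" if "test_on (V n) et" "V n <= S" for S g et
  by (rule integral_set_zero_outside) (use that test_on_zero in \<open>auto simp: subset_iff\<close>)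
  have "(LINT y|lborel. D y * psi y) = (LINT y|lborel. D' n y * psi y)"
  proof (rule integral_cong_AE)
  have "(%y. (indicator K y * D y) * psi y) : borel_measurable lborel" using DK[OF K(1,2)] test_on_borel[OF psi] by measurable
  moreover have "(%y. (indicator K y * D y) * psi y) = (%y. D y * psi y)" using K(3) by (auto simp: indicator_def fun_eq_iff)
  ultimately show "(%y. D y * psi y) : borel_measurable lborel" by simp
  show "(%y. D' n y * psi y) : borel_measurable lborel" using weak_deriv_integrable(2)[OF w tn] by blast
  show "AE y in lborel. D y * psi y = D' n y * psi y" using ae[of n] by eventually_elim (use test_on_zero[OF tn] in force)
  qed
  thus ?thesis
  using weak_deriv_test[OF w tn] z[OF tn order_refl] z[OF tn V] z[OF test_on_frechet[OF tn] order_refl] z[OF test_on_frechet[OF tn] V]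
  by simp
 qed
 show ?thesis using s t unfolding weak_deriv_def test_on_def by blast
qed

locale marked_density = riem_volume +
 fixes q :: "'a * real => real"
 assumes q_meas: "q : borel_measurable ml"
  and q_pos: "AE z in ml. q z > 0"
  and q_int: "!!La. La : Bc ==> (\<integral>\<^sup>+z\<in>mk La. ennreal (max 1 (snd z) * q z) \<partial>ml) < \<infinity>"
  and q_sob: "(%z. sqrt (q z)) : H12_loc M m"
begin

lemma n1_cong_AE:
 assumes "AE y in lborel. y : S --> f y = g y" "KC c C <= S"
 shows "n1 c C (%y. F y (f y)) = n1 c C (%y. F y (g y))"
proof (rule nn_integral_cong_AE)
 show "AE y in lborel. ennreal (IK c C y * F y (f y)) = ennreal (IK c C y * F y (g y))"
  using assms(1) by eventually_elim (use assms(2) in \<open>auto simp: indicator_def\<close>)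
qed

lemma Oc_Bc: "La : Oc ==> La : Bc"
 by (auto simp: Oc_def Bc_def)

lemma good_gradD:
 assumes W: "good_grad La f W" and c: "c : atlas M"
 shows "weak_deriv (VV c La) (%y. f (pt c y)) (ex i) (lowx c W i)"
  and "weak_deriv (VV c La) (%y. f (pt c y)) es (lows c W)"
  and "lowx c W i : mU c"
  and "lows c W : mU c"
  and "compact C ==> C <= cdom c Int La ==> (n1 c C (%y. (lowx c W i y)^2 / f (pt c y))) < \<infinity>"
  and "compact C ==> C <= cdom c Int La ==> (n1 c C (%y. (snd y * lows c W y)^2 / f (pt c y))) < \<infinity>"
proof -
 note w = bspec[OF W[unfolded good_grad_def, THEN conjunct2] c]
 note w5 = w[THEN conjunct2, THEN conjunct2, THEN conjunct2, THEN conjunct2, THEN spec[of _ C], THEN mp]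
 show "weak_deriv (VV c La) (%y. f (pt c y)) (ex i) (lowx c W i)" by (rule w[THEN conjunct1, THEN spec])
 show "weak_deriv (VV c La) (%y. f (pt c y)) es (lows c W)" by (rule w[THEN conjunct2, THEN conjunct1])
 show "lowx c W i : mU c" by (rule w[THEN conjunct2, THEN conjunct2, THEN conjunct1, THEN spec])
 show "lows c W : mU c" by (rule w[THEN conjunct2, THEN conjunct2, THEN conjunct2, THEN conjunct1])
 assume C: "compact C" "C <= cdom c Int La"
 show "(n1 c C (%y. (lowx c W i y)^2 / f (pt c y))) < \<infinity>" by (rule w5[OF conjI[OF C], THEN conjunct1, THEN spec])
 show "(n1 c C (%y. (snd y * lows c W y)^2 / f (pt c y))) < \<infinity>" by (rule w5[OF conjI[OF C], THEN conjunct2])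
qed

text \<open>Over an exhaustion the local gradients agree almost everywhere by uniqueness; at a point the one
belonging to the first member containing its projection is taken.\<close>
lemma good_grad_exists: obtains W where "good_grad UNIV q W"
proof -
 obtain La :: "nat => 'a set" where La: "!!n. La n : Oc" "!!n k. n <= k ==> La n <= La k" "(\<Union>n. La n) = UNIV"
  "!!C. compact C ==> EX n. C <= La n" using exhaustion by blast
 have o: "open (La n)" for n using La(1) by (auto simp: Oc_def)
 have "EX W. good_grad (La n) q W" for n
 proof -
  have "mk (La n) : Bc_mk"
  proof -
  have "open (mk (La n))" unfolding mk_def by (intro open_Times o open_greaterThan)
  hence "mk (La n) : sets borel" by (rule borel_open)
  moreover have "fst ` mk (La n) = La n" unfolding mk_def by (rule fst_image_times[THEN trans]) simp
  moreover have "mk (La n) <= mk UNIV" by (auto simp: mk_def)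
  ultimately show ?thesis using Oc_Bc[OF La(1)[of n]] by (simp add: Bc_mk_def)
  qed
  then obtain u where u: "u : H12 M m" "AE z in ml. z : mk (La n) --> sqrt (q z) = u z" using q_sob unfolding H12_loc_def by blast
  have "AE z in ml. z : mk (La n) --> q z = (u z)^2" using q_pos u(2)
  proof eventually_elim
  case (elim z)
  show ?case
  proof
  assume "z : mk (La n)"
  with elim(2) have "u z = sqrt (q z)" by simp
  thus "q z = (u z)^2" using elim(1) by simp
  qed
  qed
  from local_weak_grad[OF o u(1) q_meas this] show ?thesis by blast
 qed
 hence "ALL n. EX W. good_grad (La n) q W" by blast
 from choice[OF this] obtain Wn where Wn: "!!n. good_grad (La n) q (Wn n)" by blast
 \<comment> \<open>The first member of the exhaustion that contains \<open>x\<close>.\<close>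
 define k where "k x = (LEAST n. x : La n)" for x
 have k: "x : La (k x)" "x : La n ==> k x <= n" for x n
 proof -
  have "EX n. x : La n" using La(3) by blast
  thus "x : La (k x)" unfolding k_def by (rule LeastI_ex)
  show "x : La n ==> k x <= n" unfolding k_def by (rule Least_le)
 qed
 define W where "W z = Wn (k (fst z)) z" for z
 have lw: "lowx c W i y = lowx c (Wn (k (cinv c (fst y)))) i y" "lows c W y = lows c (Wn (k (cinv c (fst y)))) y" for c i y
  by (simp_all add: lowx_def lows_def W_def)
 have main: "(ALL i. weak_deriv (VV c UNIV) (%y. q (pt c y)) (ex i) (lowx c W i)) &
  weak_deriv (VV c UNIV) (%y. q (pt c y)) es (lows c W) &
  (ALL i. lowx c W i : mU c) &
  lows c W : mU c &
  (ALL C. compact C & C <= cdom c Int UNIV -->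
  (ALL i. (n1 c C (%y. (lowx c W i y)^2 / q (pt c y))) < \<infinity>) &
  (n1 c C (%y. (snd y * lows c W y)^2 / q (pt c y))) < \<infinity>)"
  if c: "c : atlas M" for c
 proof -
  let ?V = "%n. VV c (La n)"
  have VU: "VV c UNIV = cU c" by (simp add: VV_def cU_def)
  note g = good_gradD[OF Wn c]
  have Vmono: "?V j <= ?V n" if "j <= n" for j n using La(2)[OF that] by (auto simp: VV_def)
  have oV: "open (?V n)" for n by (rule VV_props(1)[OF c o])
  have cons: "AE y in lborel. y : ?V n --> D (k (cinv c (fst y))) y = D n y"
  if wd: "!!n. weak_deriv (?V n) (%y. q (pt c y)) v (D n)" for D v n
  proof -
  have "AE y in lborel. y : ?V j --> D j y = D n y" if "j <= n" for j
  by (rule weak_deriv_unique[OF oV wd weak_deriv_subset[OF wd Vmono[OF that]]])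
  hence "AE y in lborel. ALL j:{..n}. y : ?V j --> D j y = D n y" by (intro AE_finite_allI) auto
  thus ?thesis
  proof eventually_elim
  case (elim y)
  show ?case
  proof
  assume y: "y : ?V n"
  let ?x = "cinv c (fst y)"
  have x: "?x : cdom c" "?x : La n" "snd y > 0" "fst y = cmap c ?x" using y by (auto simp: VV_def cinv_cmap[OF c])
  have "y : ?V (k ?x)" using x k(1)[of ?x] by (cases y) (auto simp: VV_def)
  thus "D (k ?x) y = D n y" using elim k(2)[OF x(2)] by blast
  qed
  qed
  qed
  have km: "(%y. k (cinv c (fst y))) : measurable (restrict_space borel (cU c)) (count_space UNIV)" unfolding k_def
  proof (rule measurable_Least)
  fix n
  have 1: "{y : space (restrict_space borel (cU c)). cinv c (fst y) : La n} = ?V n"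
  proof (intro set_eqI iffI)
  fix y assume "y : {y : space (restrict_space borel (cU c)). cinv c (fst y) : La n}"
  hence y: "y : cU c" "cinv c (fst y) : La n" by (simp_all add: space_restrict_space)
  have f: "fst y : cimg c" "snd y > 0" using y(1) by (auto simp: cU_def)
  have "fst y = cmap c (cinv c (fst y))" using f(1) by (simp add: f_inv_into_f)
  moreover have "cinv c (fst y) : cdom c" by (rule inv_into_into[OF f(1)])
  ultimately show "y : ?V n" using y(2) f(2) unfolding VV_def by (cases y) auto
  next
  fix y assume y: "y : ?V n"
  then obtain x where x: "x : cdom c" "x : La n" "fst y = cmap c x" "snd y > 0" by (auto simp: VV_def)
  have "cinv c (fst y) = x" unfolding x(3) by (rule cinv_cmap[OF c x(1)])
  thus "y : {y : space (restrict_space borel (cU c)). cinv c (fst y) : La n}"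
  using x by (cases y) (simp add: space_restrict_space cU_def)
  qed
  have "?V n : sets (restrict_space borel (cU c))"
  using oV[of n] VV_props(2)[of c "La n"] open_cU[OF c] by (simp add: sets_restrict_space_iff borel_open)
  thus "(%y. cinv c (fst y) : La n) : measurable (restrict_space borel (cU c)) (count_space UNIV)" unfolding pred_def 1 .
  qed
  have meas: "(%y. D (k (cinv c (fst y))) y) : mU c"
  if "!!n. D n : mU c" for D :: "nat => (real ^ 'b) * real => real" by (rule measurable_compose_countable[OF that km])
  have exh: "EX n. K <= ?V n" if K: "compact K" "K <= cU c" for K
  proof -
  have "K <= VV c UNIV" using K(2) VU by simp
  then obtain C where C: "compact C" "C <= cdom c Int UNIV" "K <= KC c C" using compact_in_VV[OF c K(1)] by blast
  obtain n where "C <= La n" using La(4)[OF C(1)] by blast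
  hence "KC c C <= ?V n" using C(2) by (auto simp: KC_def VV_def)
  thus ?thesis using C(3) by blast
  qed
  have fe: "lowx c W i = (%y. lowx c (Wn (k (cinv c (fst y)))) i y)" "lows c W = (%y. lows c (Wn (k (cinv c (fst y)))) y)" for i
  by (auto simp: lw fun_eq_iff)
  have m1: "lowx c W i : mU c" for i unfolding fe by (rule meas[OF g(3)])
  have m2: "lows c W : mU c" unfolding fe by (rule meas[OF g(4)])
  have a1: "AE y in lborel. y : ?V n --> lowx c W i y = lowx c (Wn n) i y" for n i
  unfolding lw by (rule cons[of _ "%n. lowx c (Wn n) i", OF g(1)])
  have a2: "AE y in lborel. y : ?V n --> lows c W y = lows c (Wn n) y" for n unfolding lw by (rule cons[of _ "%n. lows c (Wn n)", OF g(2)])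
  have w1: "weak_deriv (VV c UNIV) (%y. q (pt c y)) (ex i) (lowx c W i)" for i
  unfolding VU by (rule weak_deriv_exhaust[OF open_cU[OF c] VV_props(2) exh g(1) m1 a1])
  have w2: "weak_deriv (VV c UNIV) (%y. q (pt c y)) es (lows c W)"
  unfolding VU by (rule weak_deriv_exhaust[OF open_cU[OF c] VV_props(2) exh g(2) m2 a2])
  show ?thesis
  proof (intro conjI allI impI)
  fix C assume "compact C & C <= cdom c Int UNIV"
  hence C: "compact C" "C <= cdom c" by auto
  obtain n where n: "C <= La n" using La(4)[OF C(1)] by blast
  hence Cn: "C <= cdom c Int La n" and KV: "KC c C <= ?V n" using C(2) by (auto simp: KC_def VV_def)
  show "(n1 c C (%y. (lowx c W i y)^2 / q (pt c y))) < \<infinity>" for i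
  proof -
  have "(n1 c C (%y. (lowx c W i y)^2 / q (pt c y))) =
  (n1 c C (%y. (lowx c (Wn n) i y)^2 / q (pt c y)))" by (rule n1_cong_AE[OF a1[of n i] KV])
  thus ?thesis using g(5)[OF C(1) Cn] by simp
  qed
  have "(n1 c C (%y. (snd y * lows c W y)^2 / q (pt c y))) =
  (n1 c C (%y. (snd y * lows c (Wn n) y)^2 / q (pt c y)))" by (rule n1_cong_AE[OF a2[of n] KV])
  thus "(n1 c C (%y. (snd y * lows c W y)^2 / q (pt c y))) < \<infinity>" using g(6)[OF C(1) Cn] by simp
  qed (rule w1 w2 m1 m2)+
 qed
 have tan: "fst (W (x, s)) : tangent_space M x" if "s > 0" for x s using Wn[of "k x"] that unfolding good_grad_def W_def fst_conv by blast
 show ?thesis by (rule that[of W], unfold good_grad_def, intro conjI[OF _ ballI[OF main]] allI impI tan)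
qed

abbreviation W0 :: "'a * real => ('a, 'b) mtangent" where
 "W0 \<equiv> weak_grad_mk M q"

lemma weak_grad_lowered:
 "is_weak_grad_mk M q W \<longleftrightarrow> (ALL x. ALL s>0. fst (W (x, s)) : tangent_space M x) &
  (ALL c:atlas M. (ALL i. weak_deriv (cU c) (%y. q (pt c y)) (ex i) (lowx c W i)) &
  weak_deriv (cU c) (%y. q (pt c y)) es (lows c W))" unfolding is_weak_grad_mk_def cU_def lowx_def[abs_def] lows_def[abs_def] ..

lemma W0_weak: "is_weak_grad_mk M q W0"
proof -
 obtain W where W: "good_grad UNIV q W" by (rule good_grad_exists)
 have VU: "VV c UNIV = cU c" for c :: "('a, 'b) chart" by (simp add: VV_def cU_def)
 note W' = W[unfolded good_grad_def VU]
 have "is_weak_grad_mk M q W" unfolding weak_grad_lowered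
 proof (intro conjI ballI)
  show "ALL x. ALL s>0. fst (W (x, s)) : tangent_space M x" using W'[THEN conjunct1] by simp
  fix c assume "c : atlas M"
  note wc = bspec[OF W'[THEN conjunct2] this]
  show "ALL i. weak_deriv (cU c) (%y. q (pt c y)) (ex i) (lowx c W i)" by (rule wc[THEN conjunct1])
  show "weak_deriv (cU c) (%y. q (pt c y)) es (lows c W)" by (rule wc[THEN conjunct2, THEN conjunct1])
 qed
 thus ?thesis unfolding weak_grad_mk_def by (rule someI[of "is_weak_grad_mk M q"])
qed

text \<open>By uniqueness of weak derivatives, integrability passes to the gradient that was chosen arbitrarily.\<close>
lemma W0_facts:
 assumes c: "c : atlas M"
 shows "lowx c W0 i : mU c"
  and "lows c W0 : mU c"
  and "!!C. compact C ==> C <= cdom c ==> (n1 c C (%y. (lowx c W0 i y)^2 / q (pt c y))) < \<infinity>"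
  and "!!C. compact C ==> C <= cdom c ==> (n1 c C (%y. (snd y * lows c W0 y)^2 / q (pt c y))) < \<infinity>"
proof -
 obtain W where W: "good_grad UNIV q W" by (rule good_grad_exists)
 have VU: "VV c UNIV = cU c" by (simp add: VV_def cU_def)
 note g = good_gradD[OF W c, unfolded VU]
 have h: "!!i. weak_deriv (cU c) (%y. q (pt c y)) (ex i) (lowx c W0 i)"
  "weak_deriv (cU c) (%y. q (pt c y)) es (lows c W0)" using W0_weak c unfolding weak_grad_lowered by blast+
 show "lowx c W0 i : mU c" "lows c W0 : mU c"
  by (rule measurable_if_locally_integrable[OF open_cU[OF c]], use h(1)[of i] h(2) in \<open>unfold weak_deriv_def, blast\<close>)+
 have a1: "AE y in lborel. y : cU c --> lowx c W0 i y = lowx c W i y" by (rule weak_deriv_unique[OF open_cU[OF c] h(1) g(1)])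
 have a2: "AE y in lborel. y : cU c --> lows c W0 y = lows c W y" by (rule weak_deriv_unique[OF open_cU[OF c] h(2) g(2)])
 fix C assume C: "compact C" "C <= cdom c"
 have KU: "KC c C <= cU c" by (rule KC_props(2)[OF c C])
 have "(n1 c C (%y. (lowx c W0 i y)^2 / q (pt c y))) =
  (n1 c C (%y. (lowx c W i y)^2 / q (pt c y)))" by (rule n1_cong_AE[OF a1 KU])
 thus "(n1 c C (%y. (lowx c W0 i y)^2 / q (pt c y))) < \<infinity>" using g(5)[OF C(1)] C(2) by simp
 have "(n1 c C (%y. (snd y * lows c W0 y)^2 / q (pt c y))) =
  (n1 c C (%y. (snd y * lows c W y)^2 / q (pt c y)))" by (rule n1_cong_AE[OF a2 KU])
 thus "(n1 c C (%y. (snd y * lows c W0 y)^2 / q (pt c y))) < \<infinity>" using g(6)[OF C(1)] C(2) by simp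
qed

subsection \<open>Square integrability of the generator\<close>

lemma measurable_ml_charts:
 fixes h :: "'a * real => 'c::topological_space"
 assumes "!!c. c : atlas M ==> (%y. h (pt c y)) : mU c"
 shows "h : borel_measurable ml"
proof -
 obtain V C c where *: "!!n::nat. open (V n)" "!!n. V n <= C n" "!!n. compact (C n)"
  "!!n. c n : atlas M" "!!n. C n <= cdom (c n)" "(\<Union>n. V n) = UNIV" using countable_compact_chart_cover by blast
 show ?thesis
 proof (rule measurable_piecewise_restrict[of "range (%n. cD (c n))"])
  show "space ml <= \<Union> (range (%n. cD (c n)))"
  proof
  fix z assume z: "z : space ml"
  have "fst z : (\<Union>n. V n)" using *(6) by simp
  then obtain n where "fst z : V n" by blast
  hence "fst z : cdom (c n)" using *(2,5) by blast
  thus "z : \<Union> (range (%n. cD (c n)))" using z mk_cD[of z "c n"] by (auto simp: space_ml)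
  qed
  fix \<Omega> assume "\<Omega> : range (%n. cD (c n))"
  then obtain n where n: "\<Omega> = cD (c n)" by blast
  show "\<Omega> Int space ml : sets ml" unfolding n using cD_sets[OF *(4)] by simp
  show "h : borel_measurable (restrict_space ml \<Omega>)" unfolding n measurable_chart_iff[OF *(4)] by (rule assms[OF *(4)])
 qed simp
qed

lemma minner_grad_measurable:
 assumes "Sm ph" "Sm psi"
 shows "(%z. minner M (fst z) (grad_mk M ph z) (grad_mk M psi z)) : borel_measurable ml"
proof (rule measurable_ml_charts)
 fix c assume c: "c : atlas M"
 show "(%y. minner M (fst (pt c y)) (grad_mk M ph (pt c y)) (grad_mk M psi (pt c y))) : mU c"
 proof (rule measurable_cong[THEN iffD2])
  show "Gam c (hat c ph) (hat c psi) : mU c" by (intro smooth_measurable smooth_Gam c hat_smooth assms)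
  fix y assume "y : space (restrict_space borel (cU c))"
  hence y: "y : cU c" by (simp add: space_restrict_space)
  show "minner M (fst (pt c y)) (grad_mk M ph (pt c y)) (grad_mk M psi (pt c y)) = Gam c (hat c ph) (hat c psi) y"
  unfolding minner_grad_cD[OF c pt_in[OF y] assms] co_pt[OF c y] ..
 qed
qed

lemma Lop_measurable:
 assumes "Sm ph"
 shows "Lop ph : borel_measurable ml"
proof (rule measurable_ml_charts)
 fix c assume c: "c : atlas M"
 show "(%y. Lop ph (pt c y)) : mU c"
 proof (rule measurable_cong[THEN iffD2])
  show "Aop c (hat c ph) : mU c" by (intro smooth_measurable smooth_Aop c hat_smooth assms)
  fix y assume "y : space (restrict_space borel (cU c))"
  hence y: "y : cU c" by (simp add: space_restrict_space)
  show "Lop ph (pt c y) = Aop c (hat c ph) y" unfolding Lop_chart[OF c assms pt_in[OF y]] co_pt[OF c y] ..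
 qed
qed

lemma smooth_mk_measurable:
 assumes "Sm ph"
 shows "ph : borel_measurable ml"
proof (rule measurable_ml_charts)
 fix c assume c: "c : atlas M"
 show "(%y. ph (pt c y)) : mU c" using smooth_measurable[OF hat_smooth[OF assms c]] by (simp add: hat_def[abs_def])
qed

definition drift :: "('a * real => real) => 'a * real => real" where
 "drift ph z = minner M (fst z) (W0 z) (grad_mk M ph z)"

lemma H_mk_drift: "H_mk M q ph z = - Lop ph z - drift ph z / q z"
proof -
 have "minner M (fst z) (grad_log_mk M q z) (grad_mk M ph z) = 1 / q z * drift ph z"
  by (simp add: drift_def grad_log_mk_def minner_def tinner_def Let_def mscale_def divide_inverse distrib_left)
 thus ?thesis unfolding H_mk_Lop by simp
qed

lemma drift_chart:
 assumes c: "c : atlas M" and ph: "Sm ph" and y: "y : cU c"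
 shows "drift ph (pt c y) = (SUM i:UNIV. SUM j:UNIV. ginv c i j y * lowx c W0 i y * fd (hat c ph) (ex j) y)
  + (snd y * lows c W0 y) * (snd y * fd (hat c ph) es y)"
proof -
 have x: "cinv c (fst y) : cdom c" "snd y > 0" using y by (auto simp: cU_def intro: inv_into_into)
 have y': "(cmap c (cinv c (fst y)), snd y) = y" using co_pt[OF c y] by simp
 have tan: "fst (W0 (pt c y)) : tangent_space M (cinv c (fst y))" using W0_weak x(2) unfolding is_weak_grad_mk_def by blast
 show ?thesis using minner_tangent_grad[OF c x(1) tan ph x(2), of "snd (W0 (pt c y))"] x(2)
  unfolding y' by (simp add: drift_def lowx_def lows_def)
qed

lemma drift_measurable:
 assumes ph: "Sm ph"
 shows "drift ph : borel_measurable ml"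
proof (rule measurable_ml_charts)
 fix c assume c: "c : atlas M"
 show "(%y. drift ph (pt c y)) : mU c"
 proof (rule measurable_cong[THEN iffD2])
  show "(%y. (SUM i:UNIV. SUM j:UNIV. ginv c i j y * lowx c W0 i y * fd (hat c ph) (ex j) y)
  + (snd y * lows c W0 y) * (snd y * fd (hat c ph) es y)) : mU c"
  by (intro borel_measurable_add borel_measurable_sum borel_measurable_times W0_facts(1)[OF c] W0_facts(2)[OF c]
  smooth_measurable smooth_ginv smooth_snd smooth_on_frechet hat_smooth ph c)
  fix y assume "y : space (restrict_space borel (cU c))"
  hence y: "y : cU c" by (simp add: space_restrict_space)
  show "drift ph (pt c y) = (SUM i:UNIV. SUM j:UNIV. ginv c i j y * lowx c W0 i y * fd (hat c ph) (ex j) y)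
  + (snd y * lows c W0 y) * (snd y * fd (hat c ph) es y)" by (rule drift_chart[OF c ph y])
 qed
qed

lemma H_measurable: "Sm ph ==> H_mk M q ph : borel_measurable ml"
 unfolding H_mk_drift[abs_def]
 by (intro borel_measurable_diff borel_measurable_uminus borel_measurable_divide Lop_measurable drift_measurable q_meas)

lemma drift_off_base:
 assumes ph: "Sm ph" "compact (base ph)" and z: "z : mk UNIV" "fst z ~: base ph"
 shows "drift ph z = 0"
proof -
 obtain c where c: "c : atlas M" "fst z : cdom c" using charts_cover by blast
 have zD: "z : cD c" by (rule mk_cD[OF z(1) c(2)])
 have "drift ph (pt c (co c z)) = 0" unfolding drift_chart[OF c(1) ph(1) co_cD[OF zD]] using off_base(1)[OF ph(2) z c] by simp
 thus ?thesis unfolding pt_co[OF c(1) zD] .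
qed

lemma H_off_base:
 assumes "Sm ph" "compact (base ph)" "z : mk UNIV" "fst z ~: base ph"
 shows "H_mk M q ph z = 0"
 unfolding H_mk_drift using drift_off_base[OF assms] Lop_off_base[OF assms] by simp

lemma sigma_finite_compact:
 assumes "compact K"
 shows "(nn_integral ml (%z. ennreal (q z) * indicator (mk K) z)) < \<infinity>"
proof -
 have K: "K : Bc" using assms by (auto simp: Bc_def borel_compact compact_imp_closed)
 have "(nn_integral ml (%z. ennreal (q z) * indicator (mk K) z)) <= (\<integral>\<^sup>+z\<in>mk K. ennreal (max 1 (snd z) * q z) \<partial>ml)"
 proof (rule nn_integral_mono_AE)
  show "AE z in ml. ennreal (q z) * indicator (mk K) z <= ennreal (max 1 (snd z) * q z) * indicator (mk K) z" using q_pos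
  proof eventually_elim
  case (elim z)
  hence "1 * q z <= max 1 (snd z) * q z" by (intro mult_right_mono) auto
  thus ?case by (intro mult_right_mono ennreal_leI) auto
  qed
 qed
 thus ?thesis using q_int[OF K] by simp
qed

lemma cover_by_charts:
 assumes K: "compact K"
 obtains I :: "nat set" and C c where "finite I" "!!i. compact (C i)" "!!i. c i : atlas M" "!!i. C i <= cdom (c i)" "K <= (UN i:I. C i)"
proof -
 obtain V C c where *: "!!n::nat. open (V n)" "!!n. V n <= C n" "!!n. compact (C n)"
  "!!n. c n : atlas M" "!!n. C n <= cdom (c n)" "(\<Union>n. V n) = UNIV" using countable_compact_chart_cover by blast
 have "K <= (UN n:UNIV. V n)" unfolding *(6) by simp
 from compactE_image[OF K _ this] *(1)
 obtain I where I: "finite I" "K <= (UN i:I. V i)" by metis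
 have "K <= (UN i:I. C i)" using I(2) *(2) by blast
 thus ?thesis using that[of I C c, OF I(1) *(3) *(4) *(5)] by blast
qed

text \<open>The pairing with \<open>\<nabla>ph\<close>, which is bounded, is at most a constant times \<open>|\<nabla>q|\<close>, by Cauchy-Schwarz in a chart.\<close>
lemma drift_L2:
 assumes ph: "ph : test_functions M"
 shows "(NM (%z. (drift ph z)^2 / q z)) < \<infinity>"
proof -
 note sm = test_smooth[OF ph]
 have loc: "(nn_integral ml (%z. ennreal ((drift ph z)^2 / q z) * indicator (mk C) z)) < \<infinity>"
  if c: "c : atlas M" and C: "compact C" "C <= cdom c" for c C
 proof -
  obtain B where B: "B > 0" "!!x s i. x : C ==> s > 0 ==> abs (fd (hat c ph) (ex i) (cmap c x, s)) <= B"
  using test_chart_bounds[OF ph c C] by metis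
  obtain S where S: "S > 0" "!!x s. s > 0 ==> abs (s * deriv_s 1 ph (x, s)) <= S" using s_deriv_bounds[OF ph] by metis
  have "EX G. ALL x:C. ALL s. abs (ginv c i j (cmap c x, s)) <= G" for i j
  using base_bound[OF c smooth_on_continuous[OF smooth_ginv[OF c]] ginv_base C] by metis
  then obtain G where G: "!!i j x s. x : C ==> abs (ginv c i j (cmap c x, s)) <= G i j" by metis
  obtain T where T: "T > 0" "!!x s. x : C ==> abs (sg c (cmap c x, s)) <= T"
  using base_bound[OF c smooth_on_continuous[OF smooth_sg[OF c]] sg_base C] by metis
  define E where "E = (SUM i:UNIV. SUM j:UNIV. abs (G i j) * B) + S"
  have Gn: "0 <= (SUM i:UNIV. SUM j:UNIV. abs (G i j) * B)" using B by (intro sum_nonneg) auto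
  have E: "E > 0" unfolding E_def using Gn S by simp
  define n where "n = real CARD('b) + 1"
  let ?Q = "%y. (SUM i:UNIV. (lowx c W0 i y)^2) + (snd y * lows c W0 y)^2"
  have pw: "(drift ph (pt c y))^2 <= E\<^sup>2 * n * ?Q y" if y: "y : KC c C" for y
  proof -
  obtain x s where xs: "x : C" "y = (cmap c x, s)" "s > 0" using y by (auto simp: KC_def)
  have xc: "x : cdom c" using xs C by blast
  have yU: "y : cU c" using KC_props(2)[OF c C] y by blast
  let ?L = "%i. abs (lowx c W0 i y)"
  have "abs (SUM i:UNIV. SUM j:UNIV. ginv c i j y * lowx c W0 i y * fd (hat c ph) (ex j) y) <= (SUM i:UNIV. E * ?L i)"
  proof (rule order_trans[OF sum_abs], rule sum_mono)
  fix i
  have "abs (SUM j:UNIV. ginv c i j y * lowx c W0 i y * fd (hat c ph) (ex j) y) <= (SUM j:UNIV. abs (G i j) * ?L i * B)"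
  unfolding xs(2) by (rule order_trans[OF sum_abs], intro sum_mono, unfold abs_mult,
  intro mult_mono B(2) xs order_trans[OF G[OF xs(1)] abs_ge_self]) auto
  also have "... = (SUM j:UNIV. abs (G i j) * B) * ?L i" unfolding sum_distrib_right by (intro sum.cong refl) (simp add: mult_ac)
  also have "... <= E * ?L i"
  proof (rule mult_right_mono)
  have "(SUM j:UNIV. abs (G i j) * B) <= (SUM i:UNIV. SUM j:UNIV. abs (G i j) * B)"
  by (rule member_le_sum[of i UNIV "%i. SUM j:UNIV. abs (G i j) * B"]) (use B in \<open>auto intro!: sum_nonneg\<close>)
  thus "(SUM j:UNIV. abs (G i j) * B) <= E" unfolding E_def using S by simp
  qed simp
  finally show "abs (SUM j:UNIV. ginv c i j y * lowx c W0 i y * fd (hat c ph) (ex j) y) <= E * ?L i" .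
  qed
  moreover have "abs ((snd y * lows c W0 y) * (snd y * fd (hat c ph) es y)) <= E * abs (snd y * lows c W0 y)"
  proof -
  have "abs (snd y * fd (hat c ph) es y) <= E"
  using S(2)[OF xs(3), of x] deriv_s_hat(1)[OF sm c xc xs(3)] Gn unfolding xs(2) E_def by simp
  thus ?thesis unfolding abs_mult[of "snd y * lows c W0 y"] by (metis abs_ge_zero mult.commute mult_left_mono)
  qed
  ultimately have "abs (drift ph (pt c y)) <= E * ((SUM i:UNIV. ?L i) + abs (snd y * lows c W0 y))"
  unfolding drift_chart[OF c sm yU] distrib_left sum_distrib_left by linarith
  hence "(drift ph (pt c y))^2 <= E\<^sup>2 * ((SUM i:UNIV. ?L i) + abs (snd y * lows c W0 y))^2"
  proof -
  assume "abs (drift ph (pt c y)) <= E * ((SUM i:UNIV. ?L i) + abs (snd y * lows c W0 y))"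
  hence "\<bar>drift ph (pt c y)\<bar>\<^sup>2 <= (E * ((SUM i:UNIV. ?L i) + \<bar>snd y * lows c W0 y\<bar>))^2" by (rule power_mono) simp
  thus ?thesis by (simp only: power2_abs power_mult_distrib)
  qed
  also have "((SUM i:UNIV. ?L i) + abs (snd y * lows c W0 y))^2 <= n * ?Q y"
  proof -
  let ?l = "%k. case k of None => \<bar>snd y * lows c W0 y\<bar> | Some i => ?L i"
  have s: "(SUM k:UNIV. f k) = f None + (SUM i:UNIV. f (Some i))" for f :: "'b option => real" by (simp add: UNIV_option_conv sum.reindex)
  have "(SUM k:UNIV. ?l k)^2 <= real CARD('b option) * (SUM k:UNIV. (?l k)^2)"
  using Cauchy_Schwarz_ineq_sum[of "%_. 1" ?l "UNIV :: 'b option set"] by simp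
  thus ?thesis unfolding s by (simp add: n_def add_ac)
  qed
  finally show ?thesis using E by (simp add: mult_left_mono mult.assoc)
  qed
  let ?R = "%y. (SUM i:UNIV. ennreal (IK c C y * ((lowx c W0 i y)^2 / q (pt c y)))) + ennreal (IK c C y * ((snd y * lows c W0 y)^2 / q (pt c y)))"
  have mk_C: "mk C = C \<times> {0<..}" by (simp add: mk_def)
  have hm: "(%z. ennreal ((drift ph z)^2 / q z) * indicator (mk C) z) : borel_measurable ml"
  proof -
  have "mk C : sets ml" unfolding mk_C by (rule compact_Times_measurable[OF C(1)])
  thus ?thesis using drift_measurable[OF sm] q_meas by measurable
  qed
  have "(nn_integral ml (%z. ennreal ((drift ph z)^2 / q z) * indicator (mk C) z)) =
  (nn_integral ml (%z. (ennreal ((drift ph z)^2 / q z) * indicator (mk C) z) * indicator (cD c) z))"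
  by (rule nn_integral_cong) (use C in \<open>auto simp: indicator_def mk_def cD_def\<close>)
  also have "... = (nn_integral lborel (%y. (ennreal ((drift ph (pt c y))^2 / q (pt c y)) * indicator (mk C) (pt c y)) * ennreal (sg c y) * indicator (cU c) y))"
  by (rule nn_integral_chart_ml[OF c measurable_restrict_space1[OF hm]])
  also have "... <= (nn_integral lborel (%y. ennreal (T * E\<^sup>2 * n) * (?R y)))"
  proof (rule nn_integral_mono_AE)
  show "AE y in lborel. (ennreal ((drift ph (pt c y))^2 / q (pt c y)) * indicator (mk C) (pt c y)) * ennreal (sg c y) * indicator (cU c) y <=
  ennreal (T * E\<^sup>2 * n) * (?R y)" using AE_chart[OF c q_pos]
  proof eventually_elim
  case (elim y)
  show ?case
  proof (cases "y : cU c & pt c y : mk C")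
  case True
  hence yU: "y : cU c" by simp
  hence qp: "q (pt c y) > 0" using elim by simp
  have "fst y = cmap c (cinv c (fst y))" using yU by (auto simp: cU_def cinv_cmap[OF c])
  moreover have "cinv c (fst y) : C" using True by (simp add: mk_def)
  ultimately have yK: "y : KC c C" using yU unfolding KC_def cU_def by (metis imageI mem_Times_iff)
  obtain x s where xs: "x : C" "y = (cmap c x, s)" using yK by (auto simp: KC_def)
  have sT: "sg c y <= T" unfolding xs(2) by (rule order_trans[OF abs_ge_self T(2)[OF xs(1)]])
  have sp: "0 <= sg c y" using sg_pos[OF c yU] by simp
  have "(drift ph (pt c y))^2 / q (pt c y) * sg c y <= (E\<^sup>2 * n * ?Q y) / q (pt c y) * T"
  by (intro mult_mono divide_right_mono pw[OF yK] sT sp less_imp_le[OF qp] divide_nonneg_pos[OF order_trans[OF zero_le_power2 pw[OF yK]] qp])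
  also have "... = (T * E\<^sup>2 * n) * ((SUM i:UNIV. (lowx c W0 i y)^2 / q (pt c y)) + (snd y * lows c W0 y)^2 / q (pt c y))"
  by (simp add: sum_divide_distrib[symmetric] add_divide_distrib[symmetric])
  finally have "ennreal ((drift ph (pt c y))^2 / q (pt c y) * sg c y) <=
  ennreal ((T * E\<^sup>2 * n) * ((SUM i:UNIV. (lowx c W0 i y)^2 / q (pt c y)) + (snd y * lows c W0 y)^2 / q (pt c y)))"
  by (rule ennreal_leI)
  also have "... = ennreal (T * E\<^sup>2 * n) * ((SUM i:UNIV. ennreal ((lowx c W0 i y)^2 / q (pt c y))) + ennreal ((snd y * lows c W0 y)^2 / q (pt c y)))"
  proof -
  have "0 <= T * E\<^sup>2 * n" using T(1) by (simp add: n_def)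
  moreover have "0 <= (lowx c W0 i y)^2 / q (pt c y)" for i using qp by simp
  moreover have "0 <= (snd y * lows c W0 y)^2 / q (pt c y)" using qp by simp
  ultimately show ?thesis by (simp only: ennreal_mult' ennreal_plus sum_nonneg sum_ennreal)
  qed
  finally have F: "ennreal ((drift ph (pt c y))^2 / q (pt c y)) * ennreal (sg c y) <= ennreal (T * E\<^sup>2 * n) * ((SUM i:UNIV. ennreal ((lowx c W0 i y)^2 / q (pt c y))) + ennreal ((snd y * lows c W0 y)^2 / q (pt c y)))"
  unfolding ennreal_mult''[OF sp] .
  thus ?thesis using True yK by simp
  qed auto
  qed
  qed
  also have "... < \<infinity>"
  proof -
  have qm: "(%y. q (pt c y)) : mU c" using measurable_chart_iff[OF c, of q] measurable_restrict_space1[OF q_meas] by blast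
  have m1: "(%y. IK c C y * ((lowx c W0 i y)^2 / q (pt c y))) : borel_measurable lborel" for i
  by (intro KC_measurable[OF c C] borel_measurable_divide borel_measurable_power W0_facts(1)[OF c] qm)
  have m2: "(%y. IK c C y * ((snd y * lows c W0 y)^2 / q (pt c y))) : borel_measurable lborel"
  by (intro KC_measurable[OF c C] borel_measurable_divide borel_measurable_power borel_measurable_times W0_facts(2)[OF c] qm smooth_measurable smooth_snd)
  note m1' = measurable_compose[OF m1 measurable_ennreal] and m2' = measurable_compose[OF m2 measurable_ennreal]
  have "(nn_integral lborel (%y. ennreal (T * E\<^sup>2 * n) * (?R y))) = ennreal (T * E\<^sup>2 * n) * (nn_integral lborel (%y. ?R y))"
  by (intro nn_integral_cmult borel_measurable_add borel_measurable_sum m1' m2')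
  also have "(nn_integral lborel (%y. ?R y)) =
  (SUM i:UNIV. n1 c C (%y. (lowx c W0 i y)^2 / q (pt c y))) +
  (n1 c C (%y. (snd y * lows c W0 y)^2 / q (pt c y)))"
  by (subst nn_integral_add, intro borel_measurable_sum m1', rule m2', subst nn_integral_sum, rule m1', rule refl)
  also have "ennreal (T * E\<^sup>2 * n) * ... < \<infinity>" using W0_facts(3,4)[OF c C] by (simp add: ennreal_mult_less_top)
  finally show ?thesis .
  qed
  finally show ?thesis .
 qed
 obtain I :: "nat set" and C c where I: "finite I" "!!i. compact (C i)" "!!i. c i : atlas M" "!!i. C i <= cdom (c i)" "base ph <= (UN i:I. C i)"
  using cover_by_charts[OF base_compact[OF ph]] by blast
 have hm: "(%z. ennreal ((drift ph z)^2 / q z) * indicator (mk (C i)) z) : borel_measurable ml" for i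
 proof -
  have "mk (C i) : sets ml" unfolding mk_def by (rule compact_Times_measurable[OF I(2)])
  thus ?thesis using drift_measurable[OF sm] q_meas by measurable
 qed
 have "(NM (%z. (drift ph z)^2 / q z)) <= (nn_integral ml (%z. (SUM i:I. ennreal ((drift ph z)^2 / q z) * indicator (mk (C i)) z)))"
 proof (rule nn_integral_mono)
  fix z assume "z : space ml"
  hence z: "z : mk UNIV" by (simp add: space_ml)
  show "ennreal ((drift ph z)^2 / q z) <= (SUM i:I. ennreal ((drift ph z)^2 / q z) * indicator (mk (C i)) z)"
  proof (cases "fst z : base ph")
  case True
  then obtain i where i: "i : I" "fst z : C i" using I(5) by blast
  have "z : mk (C i)" using i(2) z by (cases z) (auto simp: mk_def)
  hence "ennreal ((drift ph z)^2 / q z) = ennreal ((drift ph z)^2 / q z) * indicator (mk (C i)) z" by simp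
  also have "... <= (SUM i:I. ennreal ((drift ph z)^2 / q z) * indicator (mk (C i)) z)"
  by (rule member_le_sum[OF i(1), of "%i. ennreal ((drift ph z)^2 / q z) * indicator (mk (C i)) z"]) (use I(1) in auto)
  finally show ?thesis .
  next
  case False
  thus ?thesis using drift_off_base[OF sm base_compact[OF ph] z] by simp
  qed
 qed
 also have "... = (SUM i:I. (nn_integral ml (%z. ennreal ((drift ph z)^2 / q z) * indicator (mk (C i)) z)))"
  by (rule nn_integral_sum[OF hm])
 also have "... < \<infinity>" using loc[OF I(3) I(2) I(4)] I(1) by (simp add: ennreal_sum_less_top)
 finally show ?thesis .
qed

lemma H_L2:
 assumes ph: "ph : test_functions M"
 shows "(nn_integral ml (%z. ennreal ((H_mk M q ph z)^2) * ennreal (q z))) < \<infinity>"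
proof -
 note sm = test_smooth[OF ph] and K = base_compact[OF ph]
 obtain B where B: "B > 0" "!!z. z : mk UNIV ==> abs (Lop ph z) <= B" using Lop_bounded[OF ph] by blast
 have "(nn_integral ml (%z. ennreal ((H_mk M q ph z)^2) * ennreal (q z))) <=
  (nn_integral ml (%z. ennreal (2 * B\<^sup>2) * (ennreal (q z) * indicator (mk (base ph)) z) + 2 * ennreal ((drift ph z)^2 / q z)))"
 proof (rule nn_integral_mono_AE)
  show "AE z in ml. ennreal ((H_mk M q ph z)^2) * ennreal (q z) <=
  ennreal (2 * B\<^sup>2) * (ennreal (q z) * indicator (mk (base ph)) z) + 2 * ennreal ((drift ph z)^2 / q z)" using q_pos AE_space
  proof eventually_elim
  case (elim z)
  hence z: "z : mk UNIV" and qp: "q z > 0" by (auto simp: space_ml)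
  show ?case
  proof (cases "fst z : base ph")
  case False
  thus ?thesis using H_off_base[OF sm K z] by simp
  next
  case True
  hence zb: "z : mk (base ph)" using z by (cases z) (auto simp: mk_def)
  have sq: "(- a - b)^2 <= 2 * a\<^sup>2 + 2 * b\<^sup>2" for a b :: real
  proof -
  have "0 <= (a - b)^2" by simp
  thus ?thesis by (simp add: power2_eq_square algebra_simps)
  qed
  have "(Lop ph z)^2 <= B\<^sup>2" using B(2)[OF z] B(1) abs_le_square_iff[of "Lop ph z" B] by simp
  hence "(H_mk M q ph z)^2 * q z <= (2 * B\<^sup>2 + 2 * (drift ph z / q z)^2) * q z"
  unfolding H_mk_drift using sq[of "Lop ph z" "drift ph z / q z"] qp by (intro mult_right_mono) auto
  also have "... = 2 * B\<^sup>2 * q z + 2 * ((drift ph z)^2 / q z)" using qp by (simp add: power2_eq_square distrib_right)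
  finally have "ennreal ((H_mk M q ph z)^2 * q z) <= ennreal (2 * B\<^sup>2 * q z + 2 * ((drift ph z)^2 / q z))" by (rule ennreal_leI)
  also have "... = ennreal (2 * B\<^sup>2) * ennreal (q z) + 2 * ennreal ((drift ph z)^2 / q z)"
  proof -
  have "0 <= 2 * B\<^sup>2" "0 <= (drift ph z)^2 / q z" "0 <= q z" "0 <= (2::real)" using qp by simp_all
  hence "ennreal (2 * B\<^sup>2 * q z + 2 * ((drift ph z)^2 / q z)) = ennreal (2 * B\<^sup>2) * ennreal (q z) + ennreal 2 * ennreal ((drift ph z)^2 / q z)"
  by (simp only: ennreal_mult ennreal_plus mult_nonneg_nonneg)
  thus ?thesis by simp
  qed
  finally show ?thesis using zb qp by (simp add: ennreal_mult')
  qed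
  qed
 qed
 also have "... = ennreal (2 * B\<^sup>2) * (nn_integral ml (%z. ennreal (q z) * indicator (mk (base ph)) z)) + 2 * (NM (%z. (drift ph z)^2 / q z))"
 proof -
  have "mk (base ph) : sets ml" unfolding mk_def by (rule compact_Times_measurable[OF K])
  hence m1: "(%z. ennreal (q z) * indicator (mk (base ph)) z) : borel_measurable ml" using q_meas by measurable
  have m2: "(%z. ennreal ((drift ph z)^2 / q z)) : borel_measurable ml" using q_meas drift_measurable[OF sm] by measurable
  show ?thesis using m1 m2 by (simp add: nn_integral_add nn_integral_cmult)
 qed
 also have "... < \<infinity>" using sigma_finite_compact[OF K] drift_L2[OF ph] by (simp add: ennreal_mult_less_top)
 finally show ?thesis .
qed

end

section \<open>Smooth functions of finitely many real variables\<close>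

text \<open>Cylinder functions depend on finitely many variables and have continuous partial derivatives. Changing
one variable at a time, by the mean value theorem they are differentiable along smooth curves of
arguments, and all derivatives are again of this form.\<close>
lemma tendsto_fun_componentwise:
 fixes f :: "'a => 'i => 'b::topological_space"
 assumes "!!i. ((%y. f y i) \<longlongrightarrow> l i) F"
 shows "(f \<longlongrightarrow> l) F"
proof -
 have "limitin (product_topology (%i. euclidean) UNIV) f l F" unfolding limitin_componentwise using assms by simp
 thus ?thesis unfolding euclidean_product_topology by simp
qed

text \<open>The factor \<open>s\<close> need only be continuous, as \<open>f\<close> vanishes at \<open>y\<close>: this fits the difference quotients
delivered by the mean value theorem.\<close>
lemma has_derivative_continuous_factor:
 fixes f s :: "'a::real_normed_vector => real"
 assumes f: "(f has_derivative f') (at y)" "f y = 0" and s: "(s \<longlongrightarrow> d) (at y)"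
 shows "((%z. s z * f z) has_derivative (%v. d * f' v)) (at y)"
proof -
 have bl: "bounded_linear f'" using f(1) by (rule has_derivative_bounded_linear)
 have l0: "((%z. (f z - f' (z - y)) /\<^sub>R norm (z - y)) \<longlongrightarrow> 0) (at y)"
  using f unfolding has_derivative_at_within by simp
 obtain K where K: "0 <= K" "!!v. norm (f' v) <= norm v * K" using bounded_linear.nonneg_bounded[OF bl] by blast
 have l1: "((%z. (s z - d) * (f' (z - y) / norm (z - y))) \<longlongrightarrow> 0) (at y)"
 proof (rule tendsto_0_le[of "%z. s z - d" _ _ K])
  show "((%z. s z - d) \<longlongrightarrow> 0) (at y)" using s by (simp add: LIM_zero)
  show "\<forall>\<^sub>F z in at y. norm ((s z - d) * (f' (z - y) / norm (z - y))) <= norm (s z - d) * K"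
  proof (rule always_eventually, rule allI)
  fix z
  have "norm (f' (z - y) / norm (z - y)) <= K"
  proof (cases "z = y")
  case True
  thus ?thesis using K(1) by simp
  next
  case False
  thus ?thesis using K(2)[of "z - y"] by (simp add: divide_le_eq mult.commute)
  qed
  thus "norm ((s z - d) * (f' (z - y) / norm (z - y))) <= norm (s z - d) * K" unfolding norm_mult by (intro mult_left_mono) auto
  qed
 qed
 have "((%z. s z * ((f z - f' (z - y)) /\<^sub>R norm (z - y)) + (s z - d) * (f' (z - y) / norm (z - y))) \<longlongrightarrow> d * 0 + 0) (at y)"
  by (intro tendsto_add tendsto_mult s l0 l1)
 hence "((%z. ((s z * f z - s y * f y) - d * f' (z - y)) /\<^sub>R norm (z - y)) \<longlongrightarrow> 0) (at y)"
  using f(2) by (simp add: algebra_simps divide_inverse)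
 thus ?thesis unfolding has_derivative_at_within using bl by (auto intro: bounded_linear_const_mult)
qed

lemma pd_cong:
 assumes "!!r r'. (!!j. j < N ==> r j = r' j) ==> g r = g r'" "!!j. j < N ==> r j = r' j" "j < N"
 shows "pd j g r = pd j g r'"
proof -
 have "(%t. g (r(j := t))) = (%t. g (r'(j := t)))" by (rule ext, rule assms(1)) (use assms(2) in auto)
 thus ?thesis unfolding pd_def using assms(2)[OF assms(3)] by simp
qed

lemma Cb_infinity_pd:
 assumes g: "g : Cb_infinity N" and j: "j < N"
 shows "pd j g : Cb_infinity N"
proof -
 have 1: "!!r r'. (!!j. j < N ==> r j = r' j) ==> g r = g r'" using g unfolding Cb_infinity_def by blast
 have *: "foldr pd js (pd j g) = foldr pd (js @ [j]) g" for js by simp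
 have s: "set js <= {..<N} ==> set (js @ [j]) <= {..<N}" for js using j by simp
 show ?thesis unfolding Cb_infinity_def mem_Collect_eq *
 proof (intro conjI allI impI)
  fix r r' :: "nat => real" assume "ALL j<N. r j = r' j"
  thus "pd j g r = pd j g r'" by (intro pd_cong[OF 1 _ j]) auto
 qed (use g s in \<open>unfold Cb_infinity_def, blast+\<close>)
qed

lemma Cb_infinity_facts:
 assumes g: "g : Cb_infinity N"
 shows "(!!j. j < N ==> r j = r' j) ==> g r = g r'" "continuous_on UNIV g" "bounded (range g)"
  "j < N ==> ((%t. g (r(j := t))) has_real_derivative pd j g (r(j := t))) (at t)"
proof -
 have *: "continuous_on UNIV (foldr pd [] g) & bounded (range (foldr pd [] g)) &
  (ALL j<N. ALL r. (%t. foldr pd [] g (r(j := t))) differentiable (at (r j)))"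
  by (rule spec[OF conjunct2[OF g[unfolded Cb_infinity_def mem_Collect_eq]], of "[]", THEN mp]) simp
 show "(!!j. j < N ==> r j = r' j) ==> g r = g r'" using g unfolding Cb_infinity_def by blast
 show "continuous_on UNIV g" "bounded (range g)" using * by auto
 assume j: "j < N"
 have "(%u. g ((r(j := t))(j := u))) differentiable (at ((r(j := t)) j))"
  using *[THEN conjunct2, THEN conjunct2, rule_format, OF j, of "r(j := t)"] by simp
 hence "((%u. g ((r(j := t))(j := u))) has_real_derivative deriv (%u. g ((r(j := t))(j := u))) t) (at t)"
  by (simp add: DERIV_deriv_iff_real_differentiable)
 thus "((%t. g (r(j := t))) has_real_derivative pd j g (r(j := t))) (at t)" by (simp add: pd_def)
qed

lemma mean_value_pd:
 assumes g: "g : Cb_infinity N" and j: "j < N"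
 shows "EX \<xi>. abs (\<xi> - a) <= abs (b - a) & g (r(j := b)) - g (r(j := a)) = pd j g (r(j := \<xi>)) * (b - a)"
proof -
 note D = Cb_infinity_facts(4)[OF g j]
 consider "a = b" | "a < b" | "b < a" by linarith
 thus ?thesis
 proof cases
  case 2
  from MVT2[OF 2 D, of r] obtain \<xi> where "a < \<xi>" "\<xi> < b" "g (r(j := b)) - g (r(j := a)) = (b - a) * pd j g (r(j := \<xi>))" by blast
  thus ?thesis by (intro exI[of _ \<xi>]) (simp add: mult.commute)
 next
  case 3
  from MVT2[OF 3 D, of r] obtain \<xi> where "b < \<xi>" "\<xi> < a" "g (r(j := a)) - g (r(j := b)) = (a - b) * pd j g (r(j := \<xi>))" by blast
  thus ?thesis by (intro exI[of _ \<xi>]) (simp add: algebra_simps)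
 qed auto
qed

lemma cylinder_has_derivative:
 fixes Ph :: "nat => 'a::real_normed_vector => real"
 assumes g: "g : Cb_infinity N" and Ph: "!!j. j < N ==> (Ph j has_derivative Ph' j) (at y)"
 shows "((%z. g (%j. Ph j z)) has_derivative (%v. \<Sum>j<N. Ph' j v * pd j g (%j. Ph j y))) (at y)"
proof -
 define r where "r = (%j. Ph j y)"
 \<comment> \<open>The first \<open>j\<close> variables are already moved to \<open>z\<close>, the others are still those of \<open>y\<close>.\<close>
 define mix where "mix j z = (%i. if i < j then Ph i z else r i)" for j z
 have mix: "mix j z = (mix j z)(j := r j)" "mix (Suc j) z = (mix j z)(j := Ph j z)" for j z by (auto simp: mix_def fun_eq_iff less_Suc_eq)
 define \<xi> where "\<xi> j z = (SOME t. abs (t - r j) <= abs (Ph j z - r j) &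
  g ((mix j z)(j := Ph j z)) - g ((mix j z)(j := r j)) = pd j g ((mix j z)(j := t)) * (Ph j z - r j))" for j z
 have \<xi>: "abs (\<xi> j z - r j) <= abs (Ph j z - r j)"
  "g (mix (Suc j) z) - g (mix j z) = pd j g ((mix j z)(j := \<xi> j z)) * (Ph j z - r j)" if "j < N" for j z
  using someI_ex[OF mean_value_pd[OF g that, of "r j" "Ph j z" "mix j z"]] unfolding mix(2) \<xi>_def[symmetric]
  by (simp_all add: mix(1)[symmetric])
 have lim: "((%z. Ph i z) \<longlongrightarrow> r i) (at y)" if "i < N" for i
  using has_derivative_continuous[OF Ph[OF that]] unfolding r_def continuous_within .
 have s: "((%z. pd j g ((mix j z)(j := \<xi> j z))) \<longlongrightarrow> pd j g r) (at y)" if j: "j < N" for j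
 proof -
  have "((%z. (mix j z)(j := \<xi> j z)) \<longlongrightarrow> r) (at y)"
  proof (rule tendsto_fun_componentwise)
  fix i
  consider "i = j" | "i < j" | "i > j" by linarith
  thus "((%z. ((mix j z)(j := \<xi> j z)) i) \<longlongrightarrow> r i) (at y)"
  proof cases
  case 1
  have "((%z. \<xi> j z - r j) \<longlongrightarrow> 0) (at y)"
  by (rule tendsto_0_le[of "%z. Ph j z - r j" _ _ 1]) (use lim[OF j] \<xi>(1)[OF j] in \<open>auto simp: LIM_zero\<close>)
  thus ?thesis using 1 by (simp add: LIM_zero_iff)
  next
  case 2
  thus ?thesis using lim[of i] j by (simp add: mix_def)
  next
  case 3
  thus ?thesis by (simp add: mix_def)
  qed
  qed
  moreover have "isCont (pd j g) r" using Cb_infinity_facts(2)[OF Cb_infinity_pd[OF g j]] by (simp add: continuous_on_eq_continuous_at)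
  ultimately show ?thesis by (rule isCont_tendsto_compose[rotated])
 qed
 have "((%z. g r + (\<Sum>j<N. pd j g ((mix j z)(j := \<xi> j z)) * (Ph j z - r j))) has_derivative (%v. 0 + (\<Sum>j<N. pd j g r * Ph' j v))) (at y)"
 proof (intro has_derivative_add has_derivative_const has_derivative_sum)
  fix j assume "j : {..<N}"
  hence j: "j < N" by simp
  have "((%z. Ph j z - r j) has_derivative (%v. Ph' j v - 0)) (at y)" by (intro has_derivative_diff has_derivative_const Ph j)
  thus "((%z. pd j g ((mix j z)(j := \<xi> j z)) * (Ph j z - r j)) has_derivative (%v. pd j g r * Ph' j v)) (at y)"
  using has_derivative_continuous_factor[OF _ _ s[OF j], of "%z. Ph j z - r j" "Ph' j"] by (simp add: r_def)
 qed
 moreover have "g r + (\<Sum>j<N. pd j g ((mix j z)(j := \<xi> j z)) * (Ph j z - r j)) = g (%j. Ph j z)" for z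
 proof -
  have "(\<Sum>j<N. pd j g ((mix j z)(j := \<xi> j z)) * (Ph j z - r j)) = (\<Sum>j<N. g (mix (Suc j) z) - g (mix j z))"
  by (rule sum.cong) (simp_all add: \<xi>(2))
  also have "... = g (mix N z) - g (mix 0 z)" by (rule sum_lessThan_telescope)
  also have "g (mix N z) = g (%j. Ph j z)" by (rule Cb_infinity_facts(1)[OF g]) (simp add: mix_def)
  also have "mix 0 z = r" by (simp add: mix_def fun_eq_iff)
  finally show ?thesis by linarith
 qed
 ultimately show ?thesis by (simp add: r_def mult.commute)
qed

lemma smooth_on_cylinder:
 fixes Ph :: "nat => 'a::real_normed_vector => real"
 assumes S: "open S" and g: "g : Cb_infinity N" and Ph: "!!j. j < N ==> smooth_on S (Ph j)"
 shows "smooth_on S (%z. g (%j. Ph j z))"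
proof (rule smooth_on_family[where E = "%h z. h (%j. Ph j z)" and G = "Cb_infinity N" and B = "{..<N}"
  and a = "%j v y. FD (Ph j) y v" and d = pd, OF S])
 fix h y assume h: "h : Cb_infinity N" and y: "y : S"
 show "((%z. h (%j. Ph j z)) has_derivative (%v. SUM j:{..<N}. FD (Ph j) y v * pd j h (%j. Ph j y))) (at y)"
  by (rule cylinder_has_derivative[OF h smooth_on_has_derivative[OF Ph y]])
qed (use g Ph Cb_infinity_pd in \<open>auto intro: smooth_on_frechet\<close>)

section \<open>The generator on one particle\<close>

context marked_density
begin

abbreviation GG :: "('a * real => real) => ('a * real => real) => 'a * real => real" where
 "GG ph f z \<equiv> minner M (fst z) (grad_mk M ph z) (grad_mk M f z)"

text \<open>The gradient in the second argument enters linearly, so any chain rule for differentials carries over.\<close>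
lemma GG_chain:
 assumes ph: "Sm ph" and h: "Sm h" and et: "!!k. k : I ==> Sm (et k)" and z: "z : mk UNIV"
  and d: "!!c v. c : atlas M ==> z : cD c ==> fd (hat c h) v (co c z) = (SUM k:I. a k * fd (hat c (et k)) v (co c z))"
 shows "GG ph h z = (SUM k:I. a k * GG ph (et k) z)"
proof -
 obtain c where c: "c : atlas M" "fst z : cdom c" using charts_cover by blast
 have zD: "z : cD c" by (rule mk_cD[OF z c(2)])
 have sw: "(SUM i:UNIV. SUM j:UNIV. x i j * (SUM k:I. a k * y k j)) = (SUM k:I. a k * (SUM i:UNIV. SUM j:UNIV. x i j * y k j))"
  for x :: "'b => 'b => real" and y
 proof -
  have "(SUM k:I. a k * (SUM i:UNIV. SUM j:UNIV. x i j * y k j)) = (SUM i:UNIV. SUM k:I. SUM j:UNIV. a k * (x i j * y k j))"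
  unfolding sum_distrib_left by (rule sum.swap)
  also have "... = (SUM i:UNIV. SUM j:UNIV. SUM k:I. a k * (x i j * y k j))" by (intro sum.cong refl sum.swap)
  finally show ?thesis unfolding sum_distrib_left by (simp add: mult.left_commute)
 qed
 have se: "(snd y)^2 * (x * (SUM k:I. a k * w k)) = (SUM k:I. a k * ((snd y)^2 * (x * w k)))" for x w and y :: "(real ^ 'b) * real"
  by (simp add: sum_distrib_left mult_ac)
 have "GG ph h z = Gam c (hat c ph) (hat c h) (co c z)" by (rule minner_grad_cD[OF c(1) zD ph h])
 also have "... = (SUM k:I. a k * Gam c (hat c ph) (hat c (et k)) (co c z))"
  unfolding Gam_def d[OF c(1) zD] sw se distrib_left sum.distrib ..
 also have "... = (SUM k:I. a k * GG ph (et k) z)"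
  by (intro sum.cong refl arg_cong2[where f = "(*)"]) (rule minner_grad_cD[OF c(1) zD ph et, symmetric])
 finally show ?thesis .
qed

lemma smooth_mkI: "(!!c. c : atlas M ==> smooth_on (cU c) (hat c f)) ==> Sm f"
 unfolding smooth_mk_def cU_def hat_def by auto

lemma smooth_mk_mult: "Sm f ==> Sm g ==> Sm (%z. f z * g z)"
 by (rule smooth_mkI, unfold hat_def) (intro smooth_on_mult open_cU, (drule (1) hat_smooth, simp add: hat_def[abs_def])+)

lemma smooth_mk_add: "Sm f ==> Sm g ==> Sm (%z. f z + g z)"
 by (rule smooth_mkI, unfold hat_def) (intro smooth_on_add open_cU, (drule (1) hat_smooth, simp add: hat_def[abs_def])+)

lemma smooth_mk_const: "Sm (%z. a)"
 by (rule smooth_mkI) (simp add: hat_def[abs_def])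

lemma hat_diff: "Sm f ==> c : atlas M ==> z : cD c ==> hat c f differentiable (at (co c z))"
 by (rule smooth_on_differentiable[OF hat_smooth co_cD])

lemma GG_mult:
 assumes ph: "Sm ph" and f: "Sm f" and g: "Sm g" and z: "z : mk UNIV"
 shows "GG ph (%z. f z * g z) z = f z * GG ph g z + g z * GG ph f z"
proof -
 have "GG ph (%z. f z * g z) z = (SUM k:UNIV. (if k then f z else g z) * GG ph (if k then g else f) z)"
 proof (rule GG_chain[OF ph smooth_mk_mult[OF f g] _ z])
  fix c v assume c: "c : atlas M" "z : cD c"
  have e: "hat c (%z. f z * g z) = (%y. hat c f y * hat c g y)" by (simp add: hat_def fun_eq_iff)
  have v: "hat c h (co c z) = h z" for h using pt_co[OF c] by (simp add: hat_def)
  show "fd (hat c (%z. f z * g z)) v (co c z) = (SUM k:UNIV. (if k then f z else g z) * fd (hat c (if k then g else f)) v (co c z))"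
  unfolding e fd_mult[OF hat_diff[OF f c] hat_diff[OF g c]] v by (simp add: UNIV_bool)
 qed (use f g in simp)
 thus ?thesis by (simp add: UNIV_bool)
qed

lemma GG_add:
 assumes ph: "Sm ph" and f: "Sm f" and g: "Sm g" and z: "z : mk UNIV"
 shows "GG ph (%z. f z + g z) z = GG ph f z + GG ph g z"
proof -
 have "GG ph (%z. f z + g z) z = (SUM k:UNIV. 1 * GG ph (if k then g else f) z)"
 proof (rule GG_chain[OF ph smooth_mk_add[OF f g] _ z])
  fix c v assume c: "c : atlas M" "z : cD c"
  have e: "hat c (%z. f z + g z) = (%y. hat c f y + hat c g y)" by (simp add: hat_def fun_eq_iff)
  show "fd (hat c (%z. f z + g z)) v (co c z) = (SUM k:UNIV. 1 * fd (hat c (if k then g else f)) v (co c z))"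
  unfolding e fd_add[OF hat_diff[OF f c] hat_diff[OF g c]] by (simp add: UNIV_bool)
 qed (use f g in simp)
 thus ?thesis by (simp add: UNIV_bool)
qed

lemma GG_zero_near:
 assumes ph: "Sm ph" and f: "Sm f" and z: "z : mk UNIV" "z : Z" "open Z"
  and 0: "!!z'. z' : Z ==> z' : mk UNIV ==> f z' = 0"
 shows "GG ph f z = 0"
proof -
 have "GG ph f z = (SUM k:({}::nat set). 0 * GG ph f z)" by (rule GG_chain[OF ph f _ z(1)]) (use hat_zero_near(1)[OF _ _ z(2,3) 0] in auto)
 thus ?thesis by simp
qed

text \<open>The integrand of the one-particle formula multiplied by \<open>q\<close>, so that no division by \<open>q\<close> occurs.\<close>
definition ibp :: "('a * real => real) => ('a * real => real) => 'a * real => real" where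
 "ibp ph h z = q z * (GG ph h z + h z * Lop ph z) + h z * drift ph z"

lemma ibp_zero_near:
 assumes ph: "Sm ph" and f: "Sm f" and z: "z : mk UNIV" "z : Z" "open Z"
  and 0: "!!z'. z' : Z ==> z' : mk UNIV ==> f z' = 0"
 shows "ibp ph f z = 0"
proof -
 have "f z = 0" by (rule 0[OF z(2,1)])
 moreover have "GG ph f z = 0" by (rule GG_zero_near[OF ph f z 0])
 ultimately show ?thesis by (simp add: ibp_def)
qed

lemma ibp_off_base:
 assumes ph: "Sm ph" "compact (base ph)" and f: "Sm f" and z: "z : mk UNIV" "fst z ~: base ph"
 shows "ibp ph f z = 0"
 unfolding ibp_def minner_off_base[OF ph f z] Lop_off_base[OF ph z] drift_off_base[OF ph z] by simp

lemma ibp_add: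
 assumes ph: "Sm ph" and f: "Sm f" and g: "Sm g" and z: "z : mk UNIV"
 shows "ibp ph (%z. f z + g z) z = ibp ph f z + ibp ph g z"
 unfolding ibp_def GG_add[OF assms] by (simp add: algebra_simps)

lemma ibp_chart:
 assumes c: "c : atlas M" and ph: "Sm ph" and be: "Sm be" and K: "compact K" "K <= cD c"
  and z: "!!z. z : mk UNIV ==> z ~: K ==> be z = 0"
 shows "integrable ml (ibp ph be)" "(\<integral>z. ibp ph be z \<partial>ml) = 0"
proof -
 let ?R = "%z. q z * (GG ph be z + be z * Aop c (hat c ph) (co c z)) + be z * minner M (fst z) (W0 z) (grad_mk M ph z)"
 have e: "indicator (cD c) z *\<^sub>R ?R z = ibp ph be z" if "z : space ml" for z
 proof (cases "z : cD c")
  case True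
  thus ?thesis by (simp add: ibp_def drift_def Lop_chart[OF c ph True])
 next
  case False
  have "ibp ph be z = 0"
  proof (rule ibp_zero_near[OF ph be, of z "- K"])
  show "open (- K)" using compact_imp_closed[OF K(1)] by (rule open_Compl)
  qed (use that False K(2) z in \<open>auto simp: space_ml\<close>)
  thus ?thesis using False by simp
 qed
 have "set_integrable ml (cD c) ?R" "(LINT z:cD c|ml. ?R z) = 0" by (rule ibp_chart_ml[OF c ph be K _ W0_weak], rule z, assumption+)+
 moreover have "integrable ml (%z. indicator (cD c) z *\<^sub>R ?R z) \<longleftrightarrow> integrable ml (ibp ph be)"
  by (rule Bochner_Integration.integrable_cong[OF refl e])
 moreover have "(\<integral>z. indicator (cD c) z *\<^sub>R ?R z \<partial>ml) = (\<integral>z. ibp ph be z \<partial>ml)"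
  by (rule Bochner_Integration.integral_cong[OF refl e])
 ultimately show "integrable ml (ibp ph be)" "(\<integral>z. ibp ph be z \<partial>ml) = 0"
  unfolding set_integrable_def set_lebesgue_integral_def by simp_all
qed

lemma bump_exists:
 assumes c: "c : atlas M" and z0: "z0 : cD c"
 obtains b K Z where "Sm b" "compact K" "K <= cD c" "!!z. z : mk UNIV ==> z ~: K ==> b z = 0"
  "open Z" "z0 : Z" "!!z. z : Z ==> b z = (1::real)"
proof -
 define y0 where "y0 = co c z0"
 have "y0 : cU c" unfolding y0_def by (rule co_cD[OF z0])
 then obtain e where e: "e > 0" "cball y0 e <= cU c" using open_cU[OF c] open_contains_cball by blast
 define N where "N y = (SUM b:Basis. ((y - y0) \<bullet> b) * ((y - y0) \<bullet> b))" for y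
 have N: "N y = (dist y y0)^2" for y by (simp add: N_def dist_norm power2_norm_eq_inner euclidean_inner[of "y - y0" "y - y0"])
 define psi where "psi y = smooth_step (2 - 2 * (N y / e\<^sup>2))" for y
 have sm: "smooth_on UNIV psi" unfolding psi_def N_def inner_diff_left
  by (intro smooth_on_step_compose smooth_on_diff smooth_on_mult smooth_on_divide smooth_on_sum smooth_on_const open_UNIV
  smooth_on_bounded_linear bounded_linear_inner_left) (use e in auto)
 have p0: "psi y = 0" if "y ~: cball y0 e" for y
 proof -
  have "e\<^sup>2 <= (dist y y0)^2" using that e(1) by (intro power_mono) (auto simp: dist_commute)
  hence "1 <= N y / e\<^sup>2" using e(1) unfolding N by simp
  thus ?thesis unfolding psi_def by simp
 qed
 have p1: "psi y = 1" if "y : ball y0 (e / 2)" for y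
 proof -
  have "(dist y y0)^2 <= (e / 2)^2" using that e(1) by (intro power_mono) (auto simp: dist_commute)
  hence "N y / e\<^sup>2 <= 1 / 4" using e(1) unfolding N by (simp add: power_divide field_simps)
  hence "1 <= 2 - 2 * (N y / e\<^sup>2)" by linarith
  thus ?thesis unfolding psi_def by (rule smooth_step_simps(2))
 qed
 have t: "test_on (cU c) psi" unfolding test_on_def using sm e(2) p0 compact_cball by blast
 define K where "K = (%y. pt c y) ` cball y0 e"
 define Z where "Z = cD c Int (%z. co c z) -` ball y0 (e / 2)"
 show ?thesis
 proof (rule that[of "lift c psi" K Z])
  show "Sm (lift c psi)" by (rule lift_smooth[OF c t])
  show "compact K" unfolding K_def by (rule compact_continuous_image[OF continuous_on_subset[OF pt_continuous[OF c] e(2)] compact_cball])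
  show "K <= cD c" unfolding K_def using e(2) pt_in by blast
  show "lift c psi z = 0" if "z : mk UNIV" "z ~: K" for z
  proof (cases "fst z : cdom c")
  case True
  hence zD: "z : cD c" by (rule mk_cD[OF that(1)])
  have "co c z ~: cball y0 e"
  proof
  assume "co c z : cball y0 e"
  hence "pt c (co c z) : K" unfolding K_def by (rule imageI)
  thus False using that(2) unfolding pt_co[OF c zD] by simp
  qed
  thus ?thesis using True p0 by (simp add: lift_def)
  qed (simp add: lift_def)
  have "open (cD c)" unfolding cD_def by (intro open_Times open_greaterThan chart_facts(1)[OF c])
  thus "open Z" unfolding Z_def by (rule continuous_open_preimage[OF co_continuous[OF c] _ open_ball])
  show "z0 : Z" using z0 e(1) by (simp add: Z_def y0_def)
  show "lift c psi z = 1" if "z : Z" for z using that p1 by (auto simp: Z_def lift_def cD_def)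
 qed
qed

text \<open>Since \<open>f = b f + (1 - b) f\<close> and \<open>b f\<close> lives in a chart, \<open>f\<close> may be replaced by \<open>(1 - b) f\<close>, which vanishes
where \<open>b = 1\<close>. After finitely many steps nothing is left.\<close>
lemma ibp_by_bumps:
 assumes ph: "Sm ph" and "finite I"
  and b: "!!i. i : I ==> Sm (b i) & open (Z i) & (ALL z:Z i. b i z = 1) &
  (EX c:atlas M. EX K. compact K & K <= cD c & (ALL z. z : mk UNIV --> z ~: K --> b i z = 0))"
  and "Sm f"
  and "!!u z. Sm u ==> z : mk UNIV ==> z ~: (UN i:I. Z i) ==> ibp ph (%z. u z * f z) z = 0"
 shows "integrable ml (ibp ph f) & (\<integral>z. ibp ph f z \<partial>ml) = 0"
 using assms(2-)
proof (induction I arbitrary: f)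
 case empty
 have "ibp ph f z = 0" if "z : space ml" for z using empty.prems(3)[OF smooth_mk_const[of 1], of z] that by (simp add: space_ml)
 thus ?case using Bochner_Integration.integrable_cong[OF refl, of ml "ibp ph f" "%_. 0"]
  Bochner_Integration.integral_cong[OF refl, of ml "ibp ph f" "%_. 0"] by simp
next
 case (insert i I)
 note bi = insert.prems(1)[OF insertI1]
 then obtain c K where bs: "Sm (b i)" "open (Z i)" "!!z. z : Z i ==> b i z = 1"
  and cK: "c : atlas M" "compact K" "K <= cD c" "!!z. z : mk UNIV ==> z ~: K ==> b i z = 0" by blast
 note f = insert.prems(2)
 let ?b' = "%z. 1 + (- 1) * b i z"
 have b': "Sm ?b'" by (intro smooth_mk_add smooth_mk_mult smooth_mk_const bs)
 have bf: "Sm (%z. b i z * f z)" "Sm (%z. ?b' z * f z)" by (intro smooth_mk_mult b' bs f)+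
 have 1: "integrable ml (ibp ph (%z. b i z * f z)) & (\<integral>z. ibp ph (%z. b i z * f z) z \<partial>ml) = 0"
  using ibp_chart[OF cK(1) ph bf(1) cK(2,3)] cK(4) by simp
 have 2: "integrable ml (ibp ph (%z. ?b' z * f z)) & (\<integral>z. ibp ph (%z. ?b' z * f z) z \<partial>ml) = 0"
 proof (rule insert.IH[OF insert.prems(1)[OF insertI2] bf(2)])
  fix u z assume u: "Sm u" and z: "z : mk UNIV" "z ~: (UN i:I. Z i)"
  have ub: "Sm (%z. u z * ?b' z)" by (rule smooth_mk_mult[OF u b'])
  show "ibp ph (%z. u z * (?b' z * f z)) z = 0"
  proof (cases "z : Z i")
  case True
  show ?thesis by (rule ibp_zero_near[OF ph smooth_mk_mult[OF u bf(2)] z(1) True bs(2)]) (simp add: bs(3))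
  next
  case False
  hence "z ~: (UN i:insert i I. Z i)" using z(2) by blast
  from insert.prems(3)[OF ub z(1) this] show ?thesis by (simp only: mult.assoc)
  qed
 qed
 have e: "ibp ph f z = ibp ph (%z. b i z * f z) z + ibp ph (%z. ?b' z * f z) z" if "z : space ml" for z
  unfolding ibp_add[OF ph bf that[unfolded space_ml], symmetric]
  by (rule arg_cong[where f = "%h. ibp ph h z"]) (simp add: fun_eq_iff algebra_simps)
 have "integrable ml (ibp ph f) \<longleftrightarrow> integrable ml (%z. ibp ph (%z. b i z * f z) z + ibp ph (%z. ?b' z * f z) z)"
  by (rule Bochner_Integration.integrable_cong[OF refl e])
 moreover have "(\<integral>z. ibp ph f z \<partial>ml) = (\<integral>z. ibp ph (%z. b i z * f z) z + ibp ph (%z. ?b' z * f z) z \<partial>ml)"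
  by (rule Bochner_Integration.integral_cong[OF refl e])
 moreover have "(\<integral>z. ibp ph (%z. b i z * f z) z + ibp ph (%z. ?b' z * f z) z \<partial>ml) = 0"
  using 1 2 by (subst Bochner_Integration.integral_add) simp_all
 ultimately show ?case using 1 2 by (simp only: Bochner_Integration.integrable_add)
qed

lemma ibp_mark_bounded:
 assumes ph: "Sm ph" "compact (base ph)" and f: "Sm f" and a: "0 < a"
  and 0: "!!z. z : mk UNIV ==> snd z ~: {a..d} ==> f z = 0"
 shows "integrable ml (ibp ph f) & (\<integral>z. ibp ph f z \<partial>ml) = 0"
proof -
 let ?S = "base ph \<times> {a..d}"
 have S: "compact ?S" by (intro compact_Times ph(2) compact_Icc)
 have Smk: "?S <= mk UNIV" using a by (auto simp: mk_def)
 have "ALL z0:?S. EX p. z0 : snd p & Sm (fst p) & open (snd p) & (ALL z:snd p. fst p z = (1::real)) &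
  (EX c:atlas M. EX K. compact K & K <= cD c & (ALL z. z : mk UNIV --> z ~: K --> fst p z = 0))"
 proof
  fix z0 assume "z0 : ?S"
  hence z0: "z0 : mk UNIV" using Smk by blast
  obtain c where c: "c : atlas M" "fst z0 : cdom c" using charts_cover by blast
  obtain b K Z where "Sm b" "compact K" "K <= cD c" "!!z. z : mk UNIV ==> z ~: K ==> b z = 0"
  "open Z" "z0 : Z" "!!z. z : Z ==> b z = (1::real)" using bump_exists[OF c(1) mk_cD[OF z0 c(2)]] by blast
  with c(1) show "EX p. z0 : snd p & Sm (fst p) & open (snd p) & (ALL z:snd p. fst p z = (1::real)) &
  (EX c:atlas M. EX K. compact K & K <= cD c & (ALL z. z : mk UNIV --> z ~: K --> fst p z = 0))"
  by (intro exI[of _ "(b, Z)"] conjI bexI[of _ c] exI[of _ K] ballI allI impI) (simp_all only: fst_conv snd_conv)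
 qed
 from bchoice[OF this] obtain p where p': "ALL z0:?S. z0 : snd (p z0) & Sm (fst (p z0)) & open (snd (p z0)) & (ALL z:snd (p z0). fst (p z0) z = (1::real)) &
  (EX c:atlas M. EX K. compact K & K <= cD c & (ALL z. z : mk UNIV --> z ~: K --> fst (p z0) z = 0))" ..
 note p = bspec[OF p']
 have cov: "?S <= (UN z0:?S. snd (p z0))"
 proof
  fix z assume z: "z : ?S"
  show "z : (UN z0:?S. snd (p z0))" by (rule UN_I[of z ?S z "%z0. snd (p z0)", OF z p[OF z, THEN conjunct1]])
 qed
 obtain I where I: "I <= ?S" "finite I" "?S <= (UN z0:I. snd (p z0))"
  by (rule compactE_image[OF S _ cov]) (rule p[THEN conjunct2, THEN conjunct2, THEN conjunct1])
 show ?thesis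
 proof (rule ibp_by_bumps[OF ph(1) I(2) _ f, of "%z. fst (p z)" "%z. snd (p z)"])
  fix i assume "i : I"
  hence "i : ?S" using I(1) by (rule rev_subsetD)
  from p[OF this] show "Sm (fst (p i)) & open (snd (p i)) & (ALL z:snd (p i). fst (p i) z = 1) &
  (EX c:atlas M. EX K. compact K & K <= cD c & (ALL z. z : mk UNIV --> z ~: K --> fst (p i) z = 0))" by (rule conjunct2)
 next
  fix u z assume u: "Sm u" and z: "z : mk UNIV" "z ~: (UN i:I. snd (p i))"
  have uf: "Sm (%z. u z * f z)" by (rule smooth_mk_mult[OF u f])
  have "z ~: ?S" using z(2) I(3) by blast
  then consider "fst z ~: base ph" | "snd z ~: {a..d}" by (auto simp: mem_Times_iff)
  thus "ibp ph (%z. u z * f z) z = 0"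
  proof cases
  case 1
  thus ?thesis by (rule ibp_off_base[OF ph uf z(1)])
  next
  case 2
  show ?thesis by (rule ibp_zero_near[OF ph(1) uf z(1), of "UNIV \<times> (- {a..d})"])
  (use 2 0 in \<open>auto simp: mem_Times_iff intro!: open_Times\<close>)
  qed
 qed
qed

text \<open>Equal to \<open>1\<close> for \<open>|ln s|\<close> small compared with \<open>k\<close> and to \<open>0\<close> for \<open>|ln s| \<ge> k + 1\<close>; applying \<open>s \<partial>/\<partial>s\<close> costs a
factor \<open>1/(k + 1)\<close>.\<close>
definition cutoff :: "nat => 'a * real => real" where
 "cutoff k z = smooth_step (2 - 2 * (ln (snd z) / real (Suc k))^2)"

lemma smooth_mk_ln: "Sm (%z. ln (snd z))"
proof (rule smooth_mkI)
 fix c assume c: "c : atlas M"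
 have "smooth_on (cU c) (%y. ln (snd y))" by (rule smooth_on_compose[OF open_cU[OF c] _ smooth_on_ln smooth_snd]) (auto simp: cU_def)
 thus "smooth_on (cU c) (hat c (%z. ln (snd z)))" by (simp add: hat_def[abs_def])
qed

lemma step_derivative:
 obtains B' S where "!!t. ((%t. smooth_step (2 - 2 * t\<^sup>2)) has_real_derivative B' t) (at t)" "!!t. abs (B' t) <= S"
proof -
 define B where "B t = smooth_step (2 - 2 * t\<^sup>2)" for t :: real
 have sm: "smooth_on UNIV B" unfolding B_def power2_eq_square
  by (intro smooth_on_step_compose smooth_on_diff smooth_on_mult smooth_on_const open_UNIV smooth_on_bounded_linear bounded_linear_ident)
 define B' where "B' t = fd B 1 t" for t
 have D: "(B has_real_derivative B' t) (at t)" for t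
 proof -
  have h: "(B has_derivative FD B t) (at t)" using smooth_on_has_derivative[OF sm] by simp
  have "linear (FD B t)" by (rule has_derivative_linear[OF h])
  hence "FD B t v = B' t * v" for v using linear_scale[of "FD B t" v 1] by (simp add: B'_def mult.commute)
  hence "FD B t = (*) (B' t)" by (rule ext)
  with h show ?thesis by (simp add: has_field_derivative_def)
 qed
 have "continuous_on {-2..2} B'" unfolding B'_def by (rule continuous_on_subset[OF smooth_on_continuous[OF smooth_on_frechet[OF sm]]]) simp
 hence "bounded (B' ` {-2..2})" by (intro compact_imp_bounded compact_continuous_image compact_Icc)
 then obtain S where "ALL b:B' ` {-2..2}. norm b <= S" unfolding bounded_iff by blast
 hence S: "abs (B' t) <= S" if "t : {-2..2}" for t using that by (metis imageI real_norm_def)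
 have "abs (B' t) <= max S 0" for t
 proof (cases "t : {-2..2}")
  case True
  thus ?thesis using S[OF True] by simp
 next
  case False
  have "((%_. 0) has_real_derivative B' t) (at t)"
  proof (rule has_field_derivative_transform_within_open[OF D, of "- {-2..2}"])
  fix s :: real assume "s : - {-2..2}"
  hence "2 <= abs (s)" by auto
  hence "2\<^sup>2 <= \<bar>s\<bar>\<^sup>2" by (intro power_mono) auto
  thus "B s = 0" unfolding B_def by (intro smooth_step_simps(1)) simp
  qed (use False in auto)
  hence "B' t = 0" using DERIV_unique DERIV_const by blast
  thus ?thesis by simp
 qed
 thus ?thesis using that[of B' "max S 0"] D unfolding B_def[abs_def] by blast
qed

lemma cutoff_facts:
 obtains ka :: "nat => 'a * real => real" and S where
  "!!k. Sm (ka k)" "!!k z. 0 <= ka k z & ka k z <= 1"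
  "!!k z. z : mk UNIV ==> snd z ~: {exp (- real (Suc k))..exp (real (Suc k))} ==> ka k z = 0"
  "!!z. (%k. ka k z) \<longlonglongrightarrow> 1"
  "!!ph k z. Sm ph ==> z : mk UNIV ==> abs (GG ph (ka k) z) <= S * abs (snd z * deriv_s 1 ph z) / real (Suc k)"
proof -
 obtain B' S where B: "!!t. ((%t. smooth_step (2 - 2 * t\<^sup>2)) has_real_derivative B' t) (at t)" "!!t. abs (B' t) <= S"
  using step_derivative by blast
 have sm: "Sm (cutoff k)" for k
 proof (rule smooth_mkI)
  fix c assume c: "c : atlas M"
  have "smooth_on (cU c) (%y. smooth_step (2 - 2 * ((ln (snd y) / real (Suc k)) * (ln (snd y) / real (Suc k)))))"
  by (intro smooth_on_step_compose smooth_on_diff smooth_on_mult smooth_on_divide smooth_on_const open_cU[OF c]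
  smooth_on_compose[OF open_cU[OF c] _ smooth_on_ln smooth_snd]) (auto simp: cU_def)
  thus "smooth_on (cU c) (hat c (cutoff k))" by (simp add: hat_def[abs_def] cutoff_def power2_eq_square)
 qed
 show ?thesis
 proof (rule that[of cutoff S])
  show "Sm (cutoff k)" for k by (rule sm)
  show "0 <= cutoff k z & cutoff k z <= 1" for k z by (simp add: cutoff_def)
  show "cutoff k z = 0" if z: "z : mk UNIV" "snd z ~: {exp (- real (Suc k))..exp (real (Suc k))}" for k z
  proof -
  have s: "snd z > 0" using z by (auto simp: mk_def)
  have "real (Suc k) <= abs (ln (snd z))"
  proof (rule ccontr)
  assume "\<not> real (Suc k) <= abs (ln (snd z))"
  hence "- real (Suc k) <= ln (snd z)" "ln (snd z) <= real (Suc k)" by linarith+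
  hence "exp (- real (Suc k)) <= snd z" "snd z <= exp (real (Suc k))" using s by (metis exp_le_cancel_iff exp_ln)+
  thus False using z(2) by simp
  qed
  hence "1 <= abs (ln (snd z) / real (Suc k))" by (simp add: abs_divide)
  hence "1\<^sup>2 <= \<bar>ln (snd z) / real (Suc k)\<bar>\<^sup>2" by (intro power_mono) auto
  hence "1 <= (ln (snd z) / real (Suc k))^2" unfolding power2_abs by simp
  thus ?thesis unfolding cutoff_def by (intro smooth_step_simps(1)) simp
  qed
  show "(%k. cutoff k z) \<longlonglongrightarrow> 1" for z
  proof -
  have "(%k. smooth_step (2 - 2 * (ln (snd z) / real (Suc k))^2)) \<longlonglongrightarrow> smooth_step (2 - 2 * 0\<^sup>2)"
  proof (rule isCont_tendsto_compose[where g = smooth_step])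
  show "isCont smooth_step (2 - 2 * 0\<^sup>2)"
  using smooth_on_continuous[OF smooth_on_smooth_step] by (simp add: continuous_on_eq_continuous_at)
  have "(%k. ln (snd z) / real (Suc k)) \<longlonglongrightarrow> 0" using LIMSEQ_Suc[OF lim_const_over_n[of "ln (snd z)"]] by simp
  thus "(%k. 2 - 2 * (ln (snd z) / real (Suc k))^2) \<longlonglongrightarrow> 2 - 2 * 0\<^sup>2" by (intro tendsto_intros)
  qed
  thus ?thesis by (simp add: cutoff_def)
  qed
  show "abs (GG ph (cutoff k) z) <= S * abs (snd z * deriv_s 1 ph z) / real (Suc k)" if ph: "Sm ph" and z: "z : mk UNIV" for ph k z
  proof -
  let ?L = "%z::'a * real. ln (snd z)"
  have s: "snd z > 0" using z by (auto simp: mk_def)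
  have dln: "((%y::(real ^ 'b) * real. ln (snd y)) has_derivative (%v. snd v / snd z)) (at y)" if "snd y = snd z" for y
  using that s by (auto intro!: derivative_eq_intros simp: divide_inverse)
  have co: "snd (co c z) = snd z" for c :: "('a, 'b) chart" by simp
  have "GG ph (cutoff k) z = (SUM i:{()}. (B' (ln (snd z) / real (Suc k)) / real (Suc k)) * GG ph ?L z)"
  proof (rule GG_chain[OF ph sm smooth_mk_ln z])
  fix c v assume "c : atlas M" "z : cD c"
  have "((%y::(real ^ 'b) * real. ln (snd y) / real (Suc k)) has_derivative (%v. snd v / snd z / real (Suc k))) (at (co c z))"
  using has_derivative_scaleR_right[OF dln[OF co], of "1 / real (Suc k)" c] by (simp add: mult.commute)
  from has_derivative_compose[OF this, of "%t. smooth_step (2 - 2 * t\<^sup>2)" "(*) (B' (ln (snd z) / real (Suc k)))"]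
  have "(hat c (cutoff k) has_derivative (%v. B' (ln (snd z) / real (Suc k)) * (snd v / snd z / real (Suc k)))) (at (co c z))"
  using B(1)[unfolded has_field_derivative_def] by (simp add: hat_def[abs_def] cutoff_def)
  from frechet_derivative_eqI[OF this] frechet_derivative_eqI[OF dln[OF co]]
  show "fd (hat c (cutoff k)) v (co c z) = (SUM i:{()}. (B' (ln (snd z) / real (Suc k)) / real (Suc k)) * fd (hat c ?L) v (co c z))"
  by (simp add: hat_def[abs_def])
  qed
  hence 1: "GG ph (cutoff k) z = B' (ln (snd z) / real (Suc k)) / real (Suc k) * GG ph ?L z" by simp
  have 2: "GG ph ?L z = snd z * deriv_s 1 ph z"
  proof -
  obtain c where c: "c : atlas M" "fst z : cdom c" using charts_cover by blast
  have zD: "z : cD c" by (rule mk_cD[OF z c(2)])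
  have f: "fd (hat c ?L) v (co c z) = snd v / snd z" for v using frechet_derivative_eqI[OF dln[OF co]] by (simp add: hat_def[abs_def])
  have "GG ph ?L z = snd z * fd (hat c ph) es (co c z)"
  unfolding minner_grad_cD[OF c(1) zD ph smooth_mk_ln] Gam_def f using s by (simp add: power2_eq_square)
  thus ?thesis using deriv_s_hat(1)[OF ph c s] by simp
  qed
  show ?thesis unfolding 1 2 abs_mult[of "_ / _"] abs_divide
  using mult_right_mono[OF B(2), of "abs (snd z * deriv_s 1 ph z)" "ln (snd z) / real (Suc k)"] by (simp add: divide_right_mono)
  qed
 qed
qed

lemma drift_integrable:
 assumes ph: "ph : test_functions M"
 shows "integrable ml (%z. indicator (mk (base ph)) z * q z)" "integrable ml (drift ph)"
proof -
 note sm = test_smooth[OF ph] and K = base_compact[OF ph]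
 have mm: "mk (base ph) : sets ml" unfolding mk_def by (rule compact_Times_measurable[OF K])
 have "(NM (%z. norm (indicator (mk (base ph)) z * q z))) = (nn_integral ml (%z. ennreal (q z) * indicator (mk (base ph)) z))"
  by (rule nn_integral_cong_AE) (use q_pos in \<open>auto simp: indicator_def elim!: eventually_mono\<close>)
 thus 1: "integrable ml (%z. indicator (mk (base ph)) z * q z)"
  using sigma_finite_compact[OF K] q_meas mm by (intro integrableI_bounded) auto
 have 2: "integrable ml (%z. (drift ph z)^2 / q z)"
 proof (rule integrableI_bounded)
  have "(NM (%z. norm ((drift ph z)^2 / q z))) = (NM (%z. (drift ph z)^2 / q z))"
  by (rule nn_integral_cong_AE) (use q_pos in \<open>auto elim!: eventually_mono\<close>)
  thus "(NM (%z. norm ((drift ph z)^2 / q z))) < \<infinity>" using drift_L2[OF ph] by simp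
 qed (use q_meas drift_measurable[OF sm] in measurable)
 show "integrable ml (drift ph)"
 proof (rule Bochner_Integration.integrable_bound[OF Bochner_Integration.integrable_add[OF 1 2] drift_measurable[OF sm]])
  show "AE z in ml. norm (drift ph z) <= norm (indicator (mk (base ph)) z * q z + (drift ph z)^2 / q z)" using q_pos AE_space
  proof eventually_elim
  case (elim z)
  show ?case
  proof (cases "fst z : base ph")
  case True
  hence "z : mk (base ph)" using elim by (cases z) (auto simp: space_ml mk_def)
  moreover have "abs (drift ph z) <= q z + (drift ph z)^2 / q z"
  proof -
  have "0 <= (abs (drift ph z) - q z)^2 + q z * abs (drift ph z)" using elim(1) by simp
  hence "q z * abs (drift ph z) <= q z * q z + (drift ph z)^2" by (simp add: power2_eq_square algebra_simps)
  thus ?thesis using elim(1) by (simp add: field_simps power2_eq_square)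
  qed
  ultimately show ?thesis by simp
  next
  case False
  thus ?thesis using drift_off_base[OF sm K, of z] elim by (simp add: space_ml)
  qed
  qed
 qed
qed

text \<open>Dominated convergence along the cutoffs; the bounds on \<open>f\<close> and \<open>\<Gamma>(ph, f)\<close> provide the majorant.\<close>
theorem one_particle_ibp:
 assumes ph: "ph : test_functions M" and f: "Sm f"
  and bd: "!!z. z : mk UNIV ==> abs (f z) <= B" "!!z. z : mk UNIV ==> abs (GG ph f z) <= B"
 shows "integrable ml (ibp ph f)" "(\<integral>z. ibp ph f z \<partial>ml) = 0"
proof -
 note sm = test_smooth[OF ph] and K = base_compact[OF ph]
 obtain ka S where ka: "!!k. Sm (ka k)" "!!k z. 0 <= ka k z & ka k z <= (1::real)"
  "!!k z. z : mk UNIV ==> snd z ~: {exp (- real (Suc k))..exp (real (Suc k))} ==> ka k z = 0"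
  "!!z. (%k. ka k z) \<longlonglongrightarrow> 1"
  "!!ph k z. Sm ph ==> z : mk UNIV ==> abs (GG ph (ka k) z) <= S * abs (snd z * deriv_s 1 ph z) / real (Suc k)"
  using cutoff_facts by blast
 obtain L where L: "!!z. z : mk UNIV ==> abs (Lop ph z) <= L" using Lop_bounded[OF ph] by blast
 obtain T0 where "!!x s. s > 0 ==> abs (s * deriv_s 1 ph (x, s)) <= T0" using s_deriv_bounds[OF ph] by metis
 hence T0: "abs (snd z * deriv_s 1 ph z) <= T0" if "z : mk UNIV" for z using that by (cases z) (auto simp: mk_def)
 define T where "T = abs (S) * abs (T0)"
 have T: "abs (GG ph (ka k) z) <= T / real (Suc k)" if z: "z : mk UNIV" for k z
 proof -
  have "S * abs (snd z * deriv_s 1 ph z) <= T" unfolding T_def using T0[OF z] by (intro mult_mono) auto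
  thus ?thesis using ka(5)[OF sm z, of k] by (meson divide_right_mono of_nat_0_le_iff order_trans)
 qed
 have Tp: "0 <= T" by (simp add: T_def)
 have fk: "Sm (%z. ka k z * f z)" for k by (rule smooth_mk_mult[OF ka(1) f])
 have form: "ibp ph (%z. ka k z * f z) z = ka k z * ibp ph f z + q z * (f z * GG ph (ka k) z)" if z: "z : mk UNIV" for k z
  unfolding ibp_def GG_mult[OF sm ka(1) f z] by (simp add: algebra_simps)
 have ik: "integrable ml (ibp ph (%z. ka k z * f z)) & (\<integral>z. ibp ph (%z. ka k z * f z) z \<partial>ml) = 0" for k
  by (rule ibp_mark_bounded[OF sm K fk, of "exp (- real (Suc k))" "exp (real (Suc k))"]) (use ka(3) in auto)
 let ?w = "%z. (B + B * L + B * T) * (indicator (mk (base ph)) z * q z) + B * abs (drift ph z)"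
 have w: "integrable ml ?w" by (intro Bochner_Integration.integrable_add integrable_mult_right integrable_abs drift_integrable[OF ph])
 have meas: "ibp ph f : borel_measurable ml" if "Sm f" for f unfolding ibp_def[abs_def]
  by (intro borel_measurable_add borel_measurable_times q_meas minner_grad_measurable sm that smooth_mk_measurable Lop_measurable drift_measurable)
 have lim: "AE z in ml. (%k. ibp ph (%z. ka k z * f z) z) \<longlonglongrightarrow> ibp ph f z"
 proof (rule AE_I2)
  fix z assume "z : space ml"
  hence z: "z : mk UNIV" by (simp add: space_ml)
  have "(%k. T / real (Suc k)) \<longlonglongrightarrow> 0" using LIMSEQ_Suc[OF lim_const_over_n[of T]] by simp
  hence "(%k. GG ph (ka k) z) \<longlonglongrightarrow> 0"
  by (rule Lim_null_comparison[rotated]) (use T[OF z] in \<open>auto intro!: always_eventually\<close>)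
  hence "(%k. ka k z * ibp ph f z + q z * (f z * GG ph (ka k) z)) \<longlonglongrightarrow> 1 * ibp ph f z + q z * (f z * 0)"
  by (intro tendsto_intros ka(4))
  thus "(%k. ibp ph (%z. ka k z * f z) z) \<longlonglongrightarrow> ibp ph f z" unfolding form[OF z] by simp
 qed
 have bound: "AE z in ml. norm (ibp ph (%z. ka k z * f z) z) <= ?w z" for k using q_pos AE_space
 proof eventually_elim
  case (elim z)
  hence z: "z : mk UNIV" and qp: "0 < q z" by (simp_all add: space_ml)
  note b = bd(1)[OF z] bd(2)[OF z]
  have B: "0 <= B" using b(1) by linarith
  show ?case
  proof (cases "fst z : base ph")
  case True
  hence i: "z : mk (base ph)" using z by (cases z) (auto simp: mk_def)
  have k: "abs (ka k z) <= 1" using ka(2)[of k z] by simp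
  have t: "abs (GG ph (ka k) z) <= T"
  using T[OF z, of k] Tp by (smt (verit) divide_le_eq_1 le_divide_eq_1 mult_left_le of_nat_0_less_iff divide_le_eq mult_le_cancel_left1 of_nat_1 of_nat_le_iff One_nat_def Suc_le_mono zero_le zero_less_Suc)
  have "abs (f z * Lop ph z) <= B * L" unfolding abs_mult by (intro mult_mono b L z B) auto
  hence "abs (GG ph f z + f z * Lop ph z) <= B + B * L" using b(2) by linarith
  hence 1: "abs (q z * (GG ph f z + f z * Lop ph z)) <= q z * (B + B * L)"
  unfolding abs_mult using qp by (simp add: mult_left_mono)
  have 2: "abs (f z * drift ph z) <= B * abs (drift ph z)" unfolding abs_mult by (intro mult_right_mono b) auto
  have "abs (ibp ph f z) <= q z * (B + B * L) + B * abs (drift ph z)" unfolding ibp_def using 1 2 by linarith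
  hence 3: "abs (ka k z * ibp ph f z) <= 1 * (q z * (B + B * L) + B * abs (drift ph z))"
  unfolding abs_mult by (intro mult_mono k) auto
  have "abs (f z * GG ph (ka k) z) <= B * T" unfolding abs_mult by (intro mult_mono b t B) auto
  hence 4: "abs (q z * (f z * GG ph (ka k) z)) <= q z * (B * T)"
  unfolding abs_mult[of "q z"] using qp by (simp add: mult_left_mono)
  have "(B + B * L + B * T) * q z = q z * (B + B * L) + q z * (B * T)" by (simp add: algebra_simps)
  thus ?thesis unfolding form[OF z] real_norm_def using 3 4 i by (simp add: indicator_def)
  next
  case False
  have "0 <= B * abs (drift ph z)" using B by simp
  moreover have "z ~: mk (base ph)" using False by (auto simp: mk_def)
  ultimately show ?thesis using ibp_off_base[OF sm K fk z False] by simp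
  qed
 qed
 show "integrable ml (ibp ph f)" by (rule integrable_dominated_convergence[OF meas[OF f] meas[OF fk] w lim bound])
 have "(%k. \<integral>z. ibp ph (%z. ka k z * f z) z \<partial>ml) \<longlonglongrightarrow> (\<integral>z. ibp ph f z \<partial>ml)"
  by (rule integral_dominated_convergence[OF meas[OF f] meas[OF fk] w lim bound])
 hence "(%k. 0) \<longlonglongrightarrow> (\<integral>z. ibp ph f z \<partial>ml)" using ik by simp
 thus "(\<integral>z. ibp ph f z \<partial>ml) = 0" using LIMSEQ_unique tendsto_const by blast
qed

end

section \<open>Marked Poisson measures\<close>

lemma space_config: "space config_space = marked_configs"
 unfolding config_space_def by (rule space_measure_of) auto

lemma card_measurable_Bc:
 assumes "B : Bc_mk"
 shows "(%om. card (om Int B)) : measurable config_space (count_space UNIV)"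
proof (rule measurableI)
 fix A :: "nat set"
 show "(%om. card (om Int B)) -` A Int space config_space : sets config_space"
  unfolding space_config unfolding config_space_def by (rule in_measure_of) (use assms in auto)
qed simp

lemma config_measurableI:
 fixes f :: "'a => ('x::topological_space \<times> real) set"
 assumes f: "f : space N \<rightarrow> marked_configs"
  and m: "!!B. B : Bc_mk ==> (%x. real (card (f x Int B))) : borel_measurable N"
 shows "f : measurable N config_space"
 unfolding config_space_def
proof (rule measurable_measure_of)
 fix y :: "('x * real) set set" assume "y : {(%om. card (om Int B)) -` A Int marked_configs |A B. B : Bc_mk}"
 then obtain A B where y: "y = (%om. card (om Int B)) -` A Int marked_configs" "B : Bc_mk" by blast
 have "real ` A : sets borel" by (rule sets.countable) auto
 from measurable_sets[OF m[OF y(2)] this]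
 have "(%x. real (card (f x Int B))) -` real ` A Int space N : sets N" .
 moreover have "(%x. real (card (f x Int B))) -` real ` A Int space N = f -` y Int space N" using f unfolding y(1) by (auto simp: Pi_iff)
 ultimately show "f -` y Int space N : sets N" by simp
qed (use f in auto)

lemma Oc_mk_Bc:
 assumes "La : Oc"
 shows "mk La : Bc_mk"
proof -
 have "open (mk La)" unfolding mk_def by (rule open_Times) (use assms in \<open>auto simp: Oc_def\<close>)
 hence "mk La : sets borel" by (rule borel_open)
 moreover have "fst ` mk La = La" unfolding mk_def by (rule fst_image_times[THEN trans]) simp
 ultimately show ?thesis using assms by (auto simp: Bc_mk_def Bc_def Oc_def mk_def)
qed

lemma finite_slice: "om : marked_configs ==> La : Oc ==> finite (om Int mk La)"
proof -
 assume om: "om : marked_configs" and La: "La : Oc"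
 have "finite (fst ` om Int closure La)" using om La by (auto simp: marked_configs_def Oc_def)
 moreover have "fst ` (om Int mk La) <= fst ` om Int closure La" using closure_subset[of La] by (auto simp: mk_def)
 ultimately have "finite (fst ` (om Int mk La))" by (rule rev_finite_subset)
 moreover have "inj_on fst (om Int mk La)" using om by (auto simp: marked_configs_def intro: inj_on_subset)
 ultimately show ?thesis by (rule finite_imageD)
qed

lemma slice_config: "om : marked_configs ==> om Int A : marked_configs"
 unfolding marked_configs_def
proof (intro CollectI conjI allI impI; (elim CollectE conjE)?)
 fix K :: "'a set" assume a: "ALL K. compact K --> finite (fst ` om Int K)" and K: "compact K"
 show "finite (fst ` (om Int A) Int K)" by (rule finite_subset[OF _ a[rule_format, OF K]]) auto
qed (auto intro: inj_on_subset)

lemma pairing_slice: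
 assumes "om : marked_configs" "La : Oc" "!!z. z : mk UNIV ==> z ~: mk La ==> f z = 0"
 shows "pairing f om = (SUM z:om Int mk La. f z)"
proof -
 have "pairing f om = infsum f (om Int mk La)" unfolding pairing_def
  by (rule infsum_cong_neutral) (use assms(1,3) in \<open>auto simp: marked_configs_def\<close>)
 thus ?thesis using finite_slice[OF assms(1,2)] by simp
qed

locale marked_poisson_process =
 fixes sgma :: "('x::{t2_space, second_countable_topology} \<times> real) measure" and P :: "('x * real) set measure"
 assumes sets_sgma: "sets sgma = sets (borel \<Otimes>\<^sub>M lebesgue_pos)"
  and fin: "!!La. La : Oc ==> emeasure sgma (mk La) < \<infinity>"
  and P: "marked_poisson sgma P"
begin

lemma space_sgma: "space sgma = mk UNIV"
 using sets_eq_imp_space_eq[OF sets_sgma] by (simp add: space_pair_measure lebesgue_pos_def space_restrict_space mk_def)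

lemma sets_lebesgue_pos': "A : sets lebesgue_pos \<longleftrightarrow> A : sets borel & A <= {0<..}"
 unfolding lebesgue_pos_def by (subst sets_restrict_space_iff) auto

lemma mk_sets: "La : Oc ==> mk La : sets sgma"
 unfolding sets_sgma mk_def by (intro pair_measureI) (auto simp: Oc_def sets_lebesgue_pos')

lemma borel_sets_sgma: 
 assumes "B : sets borel" "B <= mk UNIV"
 shows "B : sets sgma"
proof -
 have "(%z::'x * real. z) : measurable (borel \<Otimes>\<^sub>M lebesgue_pos) (borel \<Otimes>\<^sub>M borel)"
  by (rule measurable_pair) (auto simp: lebesgue_pos_def o_def intro!: measurable_fst measurable_compose[OF measurable_snd measurable_restrict_space1])
 hence "(%z. z) : measurable sgma borel" by (simp only: borel_prod measurable_cong_sets[OF sets_sgma refl])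
 from measurable_sets[OF this assms(1)] show ?thesis using assms(2) by (simp add: space_sgma Int_absorb2)
qed

lemma P_facts: "prob_space P" "sets P = sets config_space" "space P = marked_configs"
 using P sets_eq_imp_space_eq[of P config_space] by (auto simp: marked_poisson_def space_config)

lemma measurable_P: "measurable P N = measurable config_space N"
 by (rule measurable_cong_sets[OF P_facts(2) refl])

text \<open>The generators of the sigma-algebra are counts over sets with a Borel projection. Rectangles are of this
kind, and they suffice by a Dynkin argument, although a Borel set may have a projection that is not Borel.\<close>
lemma count_measurable:
 assumes La: "La : Oc" and A: "A : sets sgma"
 shows "(%om. emeasure (count_space UNIV) ((om Int mk La) Int A)) : borel_measurable config_space"
 using Int_stable_pair_measure_generator pair_measure_closed A[unfolded sets_sgma sets_pair_measure]
proof (induction rule: sigma_sets_induct_disjoint)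
 case (basic A)
 then obtain X S where A: "A = X \<times> S" "X : sets borel" "S : sets borel" "S <= {0<..}" by (auto simp: sets_lebesgue_pos')
 have eq: "(om Int mk La) Int A = om Int ((X Int La) \<times> S)" for om using A(4) by (auto simp: A(1) mk_def)
 have 1: "(%om. card (om Int ((X Int La) \<times> S))) : measurable config_space (count_space UNIV)"
 proof (cases "S = {}")
  case False
  have "compact (closure (X Int La))"
  proof -
  have "closure La Int closure (X Int La) = closure (X Int La)" using closure_mono[of "X Int La" La] by auto
  thus ?thesis using compact_Int_closed[of "closure La" "closure (X Int La)"] La by (simp add: Oc_def)
  qed
  moreover have "X Int La : sets borel" using A(2) La by (auto simp: Oc_def)
  ultimately have "(X Int La) \<times> S : Bc_mk" using False A(3,4) by (auto simp: Bc_mk_def Bc_def mk_def intro: borel_Times)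
  thus ?thesis by (rule card_measurable_Bc)
 qed simp
 show ?case
 proof (rule measurable_cong[THEN iffD2])
  show "(%om. of_nat (card (om Int ((X Int La) \<times> S))) :: ennreal) : borel_measurable config_space"
  by (rule measurable_compose[OF 1]) simp
  fix om :: "('x * real) set" assume "om : space config_space"
  hence "finite (om Int mk La Int A)" using finite_slice[OF _ La] by (simp add: space_config)
  thus "emeasure (count_space UNIV) (om Int mk La Int A) = of_nat (card (om Int ((X Int La) \<times> S)))"
  unfolding eq by (simp add: emeasure_count_space_finite)
 qed
next
 case empty
 show ?case by simp
next
 case (compl A)
 have "mk UNIV : sets sgma" using space_sgma sets.top[of sgma] by simp
 show ?case
 proof (rule measurable_cong[THEN iffD2])
  show "(%om. emeasure (count_space UNIV) (om Int mk La) - emeasure (count_space UNIV) (om Int mk La Int A)) : borel_measurable config_space"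
  proof (rule borel_measurable_minus_ennreal[OF _ compl.IH])
  show "(%om. emeasure (count_space UNIV) (om Int mk La)) : borel_measurable config_space"
  proof (rule measurable_cong[THEN iffD2])
  show "(%om. of_nat (card (om Int mk La)) :: ennreal) : borel_measurable config_space"
  by (rule measurable_compose[OF card_measurable_Bc[OF Oc_mk_Bc[OF La]]]) simp
  fix om :: "('x * real) set" assume "om : space config_space"
  hence "finite (om Int mk La)" using finite_slice[OF _ La] by (simp add: space_config)
  thus "emeasure (count_space UNIV) (om Int mk La) = of_nat (card (om Int mk La))" by (simp add: emeasure_count_space_finite)
  qed
  qed
  fix om :: "('x * real) set" assume "om : space config_space"
  hence f: "finite (om Int mk La)" using finite_slice[OF _ La] by (simp add: space_config)
  have sp: "space borel \<times> space lebesgue_pos = mk UNIV" by (simp add: lebesgue_pos_def space_restrict_space mk_def)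
  have "mk La <= mk UNIV" by (auto simp: mk_def)
  hence e: "om Int mk La Int (space borel \<times> space lebesgue_pos - A) = om Int mk La - om Int mk La Int A" unfolding sp by blast
  show "emeasure (count_space UNIV) (om Int mk La Int (space borel \<times> space lebesgue_pos - A)) =
  emeasure (count_space UNIV) (om Int mk La) - emeasure (count_space UNIV) (om Int mk La Int A)" unfolding e
  proof (rule emeasure_Diff)
  have "finite (om Int mk La Int A)" using f by simp
  thus "emeasure (count_space UNIV) (om Int mk La Int A) ~= \<infinity>" by (simp add: emeasure_count_space_finite)
  qed auto
 qed
next
 case (union A)
 have eq: "emeasure (count_space UNIV) (om Int mk La Int (\<Union>i. A i)) = (\<Sum>i. emeasure (count_space UNIV) (om Int mk La Int A i))" for om
 proof -
  have "disjoint_family (%i. om Int mk La Int A i)" using union(1) unfolding disjoint_family_on_def by blast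
  hence "(\<Sum>i. emeasure (count_space UNIV) (om Int mk La Int A i)) = emeasure (count_space UNIV) (\<Union>i. om Int mk La Int A i)"
  by (intro suminf_emeasure) (simp_all only: sets_count_space Pow_UNIV subset_UNIV)
  thus ?thesis by (simp only: Int_UN_distrib)
 qed
 show ?case unfolding eq by (rule borel_measurable_suminf_order[OF union.IH])
qed

lemma slice_sum_measurable_nn:
 assumes La: "La : Oc" and f: "f : borel_measurable sgma"
 shows "(%om. \<integral>\<^sup>+z. f z \<partial>count_space (om Int mk La)) : borel_measurable config_space"
 using f
proof (induction rule: borel_measurable_induct)
 case (cong f g)
 have "(\<integral>\<^sup>+z. f z \<partial>count_space (om Int mk La)) = (\<integral>\<^sup>+z. g z \<partial>count_space (om Int mk La))" for om
  by (rule nn_integral_cong) (use cong(3) in \<open>auto simp: space_sgma mk_def\<close>)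
 thus ?case using cong(4) by simp
next
 case (set A)
 have "(\<integral>\<^sup>+z. indicator A z \<partial>count_space (om Int mk La)) = emeasure (count_space UNIV) (om Int mk La Int A)" for om
 proof -
  have "(\<integral>\<^sup>+z. indicator A z \<partial>count_space (om Int mk La)) = (\<integral>\<^sup>+z. indicator A z * indicator (om Int mk La) z \<partial>count_space UNIV)"
  by (rule nn_integral_count_space_indicator) simp
  also have "... = (\<integral>\<^sup>+z. indicator (om Int mk La Int A) z \<partial>count_space UNIV)"
  by (rule nn_integral_cong) (auto simp: indicator_def)
  finally show ?thesis by simp
 qed
 thus ?case using count_measurable[OF La set(1)] by simp
next
 case (mult u c)
 thus ?case by (simp add: nn_integral_cmult)
next
 case (add u v)
 thus ?case by (simp add: nn_integral_add)
next
 case (seq U)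
 thus ?case by (simp add: nn_integral_monotone_convergence_SUP[unfolded SUP_apply] SUP_apply[abs_def])
qed

lemma slice_sum_measurable:
 assumes La: "La : Oc" and f: "(f :: _ => real) : borel_measurable sgma"
 shows "(%om. SUM z:om Int mk La. f z) : borel_measurable config_space"
proof (rule measurable_cong[THEN iffD2])
 let ?I = "%g om. enn2real (\<integral>\<^sup>+z. ennreal (g z) \<partial>count_space (om Int mk La))"
 have "?I g : borel_measurable config_space" if "g : borel_measurable sgma" for g
  using slice_sum_measurable_nn[OF La, of "%z. ennreal (g z)"] that by measurable
 thus "(%om. ?I f om - ?I (%z. - f z) om) : borel_measurable config_space" using f by (intro borel_measurable_diff) auto
 fix om :: "('x * real) set" assume "om : space config_space"
 hence fi: "finite (om Int mk La)" using finite_slice[OF _ La] by (simp add: space_config)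
 have "?I g om = (SUM z:om Int mk La. max 0 (g z))" for g
 proof -
  have "enn2real (ennreal x) = max 0 x" for x by (cases "x >= 0") (auto simp: ennreal_neg)
  thus ?thesis unfolding nn_integral_count_space_finite[OF fi] by (subst enn2real_sum) (auto simp: o_def)
 qed
 thus "(SUM z:om Int mk La. f z) = ?I f om - ?I (%z. - f z) om" by (simp add: sum_subtractf[symmetric]) (auto intro!: sum.cong)
qed

lemma pairing_measurable:
 assumes "La : Oc" "f : borel_measurable sgma" "!!z. z : mk UNIV ==> z ~: mk La ==> f z = 0"
 shows "pairing f : borel_measurable P"
 unfolding measurable_P by (rule measurable_cong[THEN iffD2, OF pairing_slice[OF _ assms(1,3)] slice_sum_measurable[OF assms(1,2)]])
  (simp_all add: space_config)

lemma slice_measurable: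
 fixes La :: "'x set"
 assumes La: "La : Oc"
 shows "(%om. om Int mk La) : measurable config_space config_space"
proof (rule config_measurableI)
 show "(%om. om Int mk La) : space config_space \<rightarrow> marked_configs" by (auto simp: space_config intro: slice_config)
 fix B :: "('x * real) set" assume B: "B : Bc_mk"
 hence "B : sets sgma" by (intro borel_sets_sgma) (auto simp: Bc_mk_def)
 from count_measurable[OF La this]
 have "(%om. enn2real (emeasure (count_space UNIV) (om Int mk La Int B))) : borel_measurable config_space" by measurable
 thus "(%om. real (card (om Int mk La Int B))) : borel_measurable config_space"
 proof (rule measurable_cong[THEN iffD2, rotated])
  fix om :: "('x * real) set" assume "om : space config_space"
  hence "finite (om Int mk La Int B)" using finite_slice[OF _ La] by (simp add: space_config)
  thus "real (card (om Int mk La Int B)) = enn2real (emeasure (count_space UNIV) (om Int mk La Int B))"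
  by (simp add: emeasure_count_space_finite)
 qed
qed

lemma nn_integral_slice:
 assumes La: "La : Oc" and u: "u : borel_measurable config_space"
 shows "(nn_integral P (%om. u (om Int mk La))) =
  ennreal (exp (- measure sgma (mk La))) * (\<Sum>n. ennreal (1 / fact n) * (\<integral>\<^sup>+om. u om \<partial>config_measure sgma La n))"
proof -
 let ?D = "distr P config_space (%om. om Int mk La)"
 have sl: "(%om. om Int mk La) : measurable P config_space" unfolding measurable_P by (rule slice_measurable[OF La])
 have sC: "sets (config_measure sgma La n) = sets config_space" for n by (simp add: config_measure_def)
 have mC: "measurable (config_measure sgma La n) (borel :: ennreal measure) = borel_measurable config_space" for n by (rule measurable_cong_sets[OF sC refl])
 have spC: "space (config_measure sgma La n) = space config_space" for n by (rule sets_eq_imp_space_eq[OF sC])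
 have "(nn_integral P (%om. u (om Int mk La))) = (\<integral>\<^sup>+om. u om \<partial>?D)" by (rule nn_integral_distr[OF sl, symmetric]) (simp add: u)
 also have "... = ennreal (exp (- measure sgma (mk La))) * (\<Sum>n. ennreal (1 / fact n) * (\<integral>\<^sup>+om. u om \<partial>config_measure sgma La n))"
  using u
 proof (induction rule: borel_measurable_induct)
  case (cong f g)
  have "(nn_integral N (%om. f om)) = (nn_integral N (%om. g om))" if "space N = space config_space" for N
  by (rule nn_integral_cong) (use cong(3) that in auto)
  thus ?case using cong(4) spC by simp
 next
  case (set A)
  have "emeasure ?D A = ennreal (exp (- measure sgma (mk La))) * (\<Sum>n. ennreal (1 / fact n) * emeasure (config_measure sgma La n) A)"
  using P La set unfolding marked_poisson_def by blast
  thus ?case using set sC by simp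
 next
  case (mult u c)
  have "(\<integral>\<^sup>+om. c * u om \<partial>?D) = c * (\<integral>\<^sup>+om. u om \<partial>?D)" using mult by (intro nn_integral_cmult) simp
  moreover have "(\<integral>\<^sup>+om. c * u om \<partial>config_measure sgma La n) = c * (\<integral>\<^sup>+om. u om \<partial>config_measure sgma La n)" for n
  by (intro nn_integral_cmult) (use mult mC in simp)
  ultimately show ?case using mult by (simp add: mult.left_commute)
 next
  case (add u v)
  have "(\<integral>\<^sup>+om. v om + u om \<partial>?D) = (\<integral>\<^sup>+om. v om \<partial>?D) + (\<integral>\<^sup>+om. u om \<partial>?D)" using add by (intro nn_integral_add) auto
  moreover have "(\<integral>\<^sup>+om. v om + u om \<partial>config_measure sgma La n) = (\<integral>\<^sup>+om. v om \<partial>config_measure sgma La n) + (\<integral>\<^sup>+om. u om \<partial>config_measure sgma La n)" for n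
  by (intro nn_integral_add) (use add mC in auto)
  ultimately show ?case using add by (simp add: distrib_left suminf_add[OF summableI summableI, symmetric])
 next
  case (seq U)
  have S: "(nn_integral N (%om. (SUP i. U i om))) = (SUP i. (nn_integral N (%om. U i om)))" if "sets N = sets config_space" for N
  by (rule nn_integral_monotone_convergence_SUP) (use seq measurable_cong_sets[OF that refl, of "borel :: ennreal measure"] in auto)
  have inc: "incseq (%i. ennreal (1 / fact n) * (\<integral>\<^sup>+om. U i om \<partial>config_measure sgma La n))" for n
  using seq(3) by (auto simp: incseq_def le_fun_def intro!: mult_left_mono nn_integral_mono)
  have D: "sets ?D = sets config_space" by simp
  show ?case unfolding SUP_apply[abs_def] S[OF sC] S[OF D] SUP_mult_left_ennreal ennreal_suminf_SUP_eq[OF inc] by (simp add: seq.IH)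
 qed
 finally show ?thesis .
qed

context
 fixes La :: "'x set"
 assumes La: "La : Oc"
begin

definition muR :: "('x * real) measure" where "muR = restrict_space sgma (mk La)"

abbreviation muRn :: "nat set => (nat => 'x * real) measure" where
 "muRn I \<equiv> \<Pi>\<^sub>M i\<in>I. muR"

definition Inj :: "nat => (nat => 'x * real) set" where
 "Inj n = {z. inj_on (fst \<circ> z) {..<n}}"

lemma muR_facts: "space muR = mk La" "finite_measure muR" "emeasure muR (mk La) = ennreal (measure sgma (mk La))"
 "!!f :: _ => real. f : borel_measurable sgma ==> f : borel_measurable muR"
proof -
 have sub: "mk La <= mk UNIV" by (auto simp: mk_def)
 show 1: "space muR = mk La" using sub by (simp add: muR_def space_restrict_space space_sgma Int_absorb2)
 have "emeasure muR (mk La) = emeasure sgma (mk La)"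
  unfolding muR_def by (rule emeasure_restrict_space) (use mk_sets[OF La] sub in \<open>auto simp: space_sgma Int_absorb2\<close>)
 thus "emeasure muR (mk La) = ennreal (measure sgma (mk La))" using fin[OF La] by (simp add: emeasure_eq_ennreal_measure less_top)
 thus "finite_measure muR" by (intro finite_measureI) (simp add: 1)
 show "f : borel_measurable sgma ==> f : borel_measurable muR" for f :: "_ => real" unfolding muR_def by (rule measurable_restrict_space1)
qed

lemma muR_product: "product_sigma_finite (%_::nat. muR)"
 using finite_measure.axioms(1)[OF muR_facts(2)] by unfold_locales (simp add: sigma_finite_measure_def)

lemma fst_measurable_muR: "fst : measurable muR borel"
proof -
 have "fst : measurable sgma borel" unfolding measurable_cong_sets[OF sets_sgma refl] by (rule measurable_fst)
 thus ?thesis unfolding muR_def by (rule measurable_restrict_space1)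
qed

lemma coord_measurable:
 "f : measurable muR L ==> i : I ==> (%z. f (z i)) : measurable (muRn I) L"
 by (rule measurable_compose[of "%z. z i" _ muR, OF measurable_component_singleton[of i I "%_. muR"]])

lemma Inj_sets: "Inj n Int space (muRn {..<n}) : sets (muRn {..<n})"
proof -
 have c: "(%z. fst (z i)) : measurable (muRn {..<n}) borel" if "i < n" for i
  using coord_measurable[OF fst_measurable_muR, of i "{..<n}"] that by simp
 have p: "{z : space (muRn {..<n}). fst (z i) ~= fst (z j)} : sets (muRn {..<n})" if "i < n" "j < n" for i j
 proof -
  have "(%z. (fst (z i), fst (z j))) : measurable (muRn {..<n}) (borel \<Otimes>\<^sub>M borel)"
  by (rule measurable_Pair[OF c[OF that(1)] c[OF that(2)]])
  hence "(%z. (fst (z i), fst (z j))) : measurable (muRn {..<n}) borel" by (simp only: borel_prod)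
  from measurable_sets[OF this borel_open[OF open_diagonal_complement]]
  show ?thesis by (rule back_subst[where P = "%A. A : sets (muRn {..<n})"]) auto
 qed
 have "Inj n Int space (muRn {..<n}) = (INT i:{..<n}. INT j:{..<n}. {z : space (muRn {..<n}). i ~= j --> fst (z i) ~= fst (z j)}) Int space (muRn {..<n})"
  by (auto simp: Inj_def inj_on_def)
 also have "... = {z : space (muRn {..<n}). ALL i:{..<n}. ALL j:{..<n}. i ~= j --> fst (z i) ~= fst (z j)}" by auto
 also have "... : sets (muRn {..<n})"
 proof (intro sets.sets_Collect_finite_All)
  fix i j assume "i : {..<n}" "j : {..<n}"
  thus "{z : space (muRn {..<n}). i ~= j --> fst (z i) ~= fst (z j)} : sets (muRn {..<n})" using p[of i j] by (cases "i = j") auto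
 qed auto
 finally show ?thesis .
qed

lemma image_config:
 assumes "z : space (muRn {..<n})" "z : Inj n"
 shows "z ` {..<n} : marked_configs" "z ` {..<n} <= mk La" "inj_on z {..<n}"
proof -
 show s: "z ` {..<n} <= mk La" using assms(1) by (auto simp: space_PiM muR_facts(1) PiE_def Pi_iff)
 have i: "inj_on (fst \<circ> z) {..<n}" using assms(2) by (simp add: Inj_def)
 thus "inj_on z {..<n}" by (rule inj_on_imageI2)
 have "inj_on fst (z ` {..<n})" using i by (auto simp: inj_on_def)
 thus "z ` {..<n} : marked_configs" using s by (auto simp: marked_configs_def mk_def)
qed

lemma image_measurable: "(%z. z ` {..<n}) : measurable (restrict_space (muRn {..<n}) (Inj n)) config_space"
proof (rule config_measurableI)
 show "(%z. z ` {..<n}) : space (restrict_space (muRn {..<n}) (Inj n)) \<rightarrow> marked_configs"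
  using image_config(1) by (auto simp: space_restrict_space)
 fix B :: "('x * real) set" assume B: "B : Bc_mk"
 hence "B : sets sgma" by (intro borel_sets_sgma) (auto simp: Bc_mk_def)
 hence iB: "(indicator B :: _ => real) : borel_measurable muR" by (intro muR_facts(4)) simp
 show "(%z. real (card (z ` {..<n} Int B))) : borel_measurable (restrict_space (muRn {..<n}) (Inj n))"
 proof (rule measurable_cong[THEN iffD2])
  show "(%z. \<Sum>i<n. indicator B (z i) :: real) : borel_measurable (restrict_space (muRn {..<n}) (Inj n))"
  by (intro borel_measurable_sum measurable_restrict_space1 coord_measurable[OF iB]) simp
  fix z assume "z : space (restrict_space (muRn {..<n}) (Inj n))"
  hence z: "z : space (muRn {..<n})" "z : Inj n" by (auto simp: space_restrict_space)
  have "(\<Sum>i<n. indicator B (z i) :: real) = (SUM x:z ` {..<n}. indicator B x)" by (simp add: sum.reindex[OF image_config(3)[OF z]])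
  also have "... = real (card (z ` {..<n} Int B))" by (simp add: indicator_def sum.If_cases Int_def)
  finally show "real (card (z ` {..<n} Int B)) = (\<Sum>i<n. indicator B (z i))" by simp
 qed
qed

lemma config_measure_nn_integral:
 assumes u: "u : borel_measurable config_space"
 shows "(\<integral>\<^sup>+om. u om \<partial>config_measure sgma La n) = (\<integral>\<^sup>+z. u (z ` {..<n}) * indicator (Inj n) z \<partial>muRn {..<n})"
proof -
 have "config_measure sgma La n = distr (restrict_space (muRn {..<n}) (Inj n)) config_space (%z. z ` {..<n})"
  by (simp add: config_measure_def muR_def Inj_def)
 hence "(\<integral>\<^sup>+om. u om \<partial>config_measure sgma La n) = (\<integral>\<^sup>+z. u (z ` {..<n}) \<partial>restrict_space (muRn {..<n}) (Inj n))"
  using u by (simp add: nn_integral_distr[OF image_measurable])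
 thus ?thesis by (simp add: nn_integral_restrict_space[OF Inj_sets])
qed

text \<open>The defining series has total mass \<open>1\<close>. As \<open>exp (- s) (\<Sum> s^n / n!) = 1\<close> as well, no mass of the products
can sit on tuples with coinciding projections.\<close>
lemma Inj_AE: "AE z in muRn {..<n}. z : Inj n"
proof -
 interpret product_sigma_finite "%_::nat. muR" by (rule muR_product)
 interpret PP: prob_space P by (rule P_facts(1))
 define s where "s = measure sgma (mk La)"
 have s0: "0 <= s" by (simp add: s_def)
 have tot: "emeasure (muRn {..<n}) (space (muRn {..<n})) = ennreal (s ^ n)" for n
  using emeasure_PiM[of "{..<n}" "%_. mk La"] sets.top[of muR] by (simp add: space_PiM muR_facts s_def ennreal_power)
 define a where "a n = measure (muRn {..<n}) (Inj n Int space (muRn {..<n}))" for n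
 have ea: "emeasure (muRn {..<n}) (Inj n Int space (muRn {..<n})) = ennreal (a n)" and a: "0 <= a n" "a n <= s ^ n" for n
 proof -
  have le: "emeasure (muRn {..<n}) (Inj n Int space (muRn {..<n})) <= ennreal (s ^ n)" unfolding tot[symmetric] by (rule emeasure_mono) auto
  hence "emeasure (muRn {..<n}) (Inj n Int space (muRn {..<n})) ~= top" by (auto simp: top_unique)
  thus e: "emeasure (muRn {..<n}) (Inj n Int space (muRn {..<n})) = ennreal (a n)"
  unfolding a_def by (rule emeasure_eq_ennreal_measure)
  show "0 <= a n" by (simp add: a_def)
  show "a n <= s ^ n" using le unfolding e using s0 by simp
 qed
 have C1: "(\<integral>\<^sup>+om. 1 \<partial>config_measure sgma La n) = ennreal (a n)" for n
 proof -
  have "(\<integral>\<^sup>+z. 1 * indicator (Inj n) z \<partial>muRn {..<n}) = (\<integral>\<^sup>+z. indicator (Inj n Int space (muRn {..<n})) z \<partial>muRn {..<n})"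
  by (rule nn_integral_cong) (auto simp: indicator_def)
  thus ?thesis using config_measure_nn_integral[of "%_. 1" n] Inj_sets[of n] ea by simp
 qed
 have "1 = ennreal (exp (- s)) * (\<Sum>n. ennreal (1 / fact n) * ennreal (a n))"
  using nn_integral_slice[OF La, of "%_. 1"] unfolding C1 by (simp add: PP.emeasure_space_1 s_def)
 moreover have se: "summable (%n. s ^ n / fact n)" "(\<Sum>n. s ^ n / fact n) = exp s"
  using exp_converges[of s] by (auto simp: sums_iff divide_inverse mult.commute)
 have sa: "summable (%n. a n / fact n)"
  by (rule summable_comparison_test'[OF se(1), of 0]) (use a in \<open>auto intro!: divide_right_mono\<close>)
 have "(\<Sum>n. ennreal (1 / fact n) * ennreal (a n)) = ennreal (\<Sum>n. a n / fact n)"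
  using a sa by (simp add: ennreal_mult'[symmetric] suminf_ennreal2)
 ultimately have "1 = exp (- s) * (\<Sum>n. a n / fact n)" using a by (simp add: ennreal_mult'[symmetric] suminf_nonneg[OF sa])
 hence "exp s = (\<Sum>n. a n / fact n)" by (simp add: exp_minus field_simps)
 hence "(\<Sum>n. s ^ n / fact n - a n / fact n) = 0" using se sa by (simp add: suminf_diff[symmetric])
 hence "s ^ n / fact n - a n / fact n = 0" using suminf_eq_zero_iff[of "%n. s ^ n / fact n - a n / fact n"] summable_diff[OF se(1) sa] a
  by (simp add: divide_right_mono)
 hence an: "a n = s ^ n" by simp
 have "AE z in muRn {..<n}. z : Inj n Int space (muRn {..<n})"
 proof (rule AE_I'[of "space (muRn {..<n}) - Inj n Int space (muRn {..<n})"])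
  have "emeasure (muRn {..<n}) (space (muRn {..<n}) - Inj n Int space (muRn {..<n})) = ennreal (s ^ n) - ennreal (a n)"
  unfolding tot[symmetric] ea[symmetric] by (rule emeasure_Diff) (use Inj_sets ea in auto)
  thus "space (muRn {..<n}) - Inj n Int space (muRn {..<n}) : null_sets (muRn {..<n})"
  using Inj_sets[of n] unfolding an by (simp add: null_sets_def)
 qed auto
 thus ?thesis by simp
qed

lemma nn_integral_P:
 assumes u: "u : borel_measurable config_space"
 shows "(nn_integral P (%om. u (om Int mk La))) =
  ennreal (exp (- measure sgma (mk La))) * (\<Sum>n. ennreal (1 / fact n) * (\<integral>\<^sup>+z. u (z ` {..<n}) \<partial>muRn {..<n}))"
proof -
 have "(\<integral>\<^sup>+z. u (z ` {..<n}) * indicator (Inj n) z \<partial>muRn {..<n}) = (\<integral>\<^sup>+z. u (z ` {..<n}) \<partial>muRn {..<n})" for n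
  by (rule nn_integral_cong_AE) (use Inj_AE[of n] in \<open>auto elim!: eventually_mono\<close>)
 thus ?thesis unfolding nn_integral_slice[OF La u] config_measure_nn_integral[OF u] by simp
qed

lemma sum_image:
 assumes "z : space (muRn {..<n})" "z : Inj n"
 shows "(SUM x:z ` {..<n} Int mk La. f x) = (\<Sum>i<n. f (z i))"
 using image_config[OF assms] by (simp add: Int_absorb2 sum.reindex)

lemma nn_integral_coordinate:
 assumes i: "i < n" and f: "f : borel_measurable muR"
 shows "(\<integral>\<^sup>+z. f (z i) \<partial>muRn {..<n}) = (\<integral>\<^sup>+x. f x \<partial>muR) * ennreal (measure sgma (mk La) ^ (n - 1))"
proof -
 interpret product_sigma_finite "%_::nat. muR" by (rule muR_product)
 let ?f = "%k. if k = i then f else (%_. 1)"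
 have R: "{..<n} = insert i ({..<n} - {i})" using i by auto
 have "(PROD k:{..<n}. ?f k (z k)) = f (z i)" for z by (subst R, subst prod.insert) (auto intro: prod.neutral)
 hence "(\<integral>\<^sup>+z. f (z i) \<partial>muRn {..<n}) = (\<integral>\<^sup>+z. (PROD k:{..<n}. ?f k (z k)) \<partial>muRn {..<n})" by simp
 also have "... = (PROD k:{..<n}. integral\<^sup>N muR (?f k))" by (rule product_nn_integral_prod) (use f in auto)
 also have "... = (\<integral>\<^sup>+x. f x \<partial>muR) * (PROD k:{..<n} - {i}. ennreal (measure sgma (mk La)))"
  by (subst R, subst prod.insert) (auto simp: muR_facts(1,3) intro!: prod.cong)
 also have "(PROD k:{..<n} - {i}. ennreal (measure sgma (mk La))) = ennreal (measure sgma (mk La) ^ (n - 1))"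
  using i by (simp add: ennreal_power)
 finally show ?thesis .
qed

text \<open>By Cauchy-Schwarz, \<open>n\<close> points contribute at most \<open>n\<^sup>2 be s^(n - 1) / n!\<close>, the terms of a convergent series.\<close>
lemma pairing_L2:
 assumes b: "b : borel_measurable sgma" and z: "!!z. z : mk UNIV ==> z ~: mk La ==> b z = 0"
  and L2: "(nn_integral sgma (%z. ennreal ((b z)^2))) < \<infinity>"
 shows "pairing b : borel_measurable P" "integrable P (%om. (pairing b om)^2)"
proof -
 show m: "pairing b : borel_measurable P" by (rule pairing_measurable[OF La b z])
 define s where "s = measure sgma (mk La)"
 have s0: "0 <= s" by (simp add: s_def)
 define u where "u om = ennreal ((SUM z:om Int mk La. b z)^2)" for om
 have um: "u : borel_measurable config_space" unfolding u_def[abs_def] using slice_sum_measurable[OF La b] by measurable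
 have b2: "(%x. ennreal ((b x)^2)) : borel_measurable muR" using muR_facts(4)[OF b] by measurable
 have sub: "mk La Int space sgma : sets sgma" using mk_sets[OF La] by simp
 have "(\<integral>\<^sup>+x. ennreal ((b x)^2) \<partial>muR) <= (nn_integral sgma (%z. ennreal ((b z)^2)))"
  unfolding muR_def nn_integral_restrict_space[OF sub] by (rule nn_integral_mono) (auto simp: indicator_def)
 hence "(\<integral>\<^sup>+x. ennreal ((b x)^2) \<partial>muR) < top" using L2 by simp
 then obtain be where be: "0 <= be" "(\<integral>\<^sup>+x. ennreal ((b x)^2) \<partial>muR) = ennreal be" by (cases "\<integral>\<^sup>+x. ennreal ((b x)^2) \<partial>muR") auto
 have step: "(\<integral>\<^sup>+z. u (z ` {..<n}) \<partial>muRn {..<n}) <= ennreal (real n * (real n * (be * s ^ (n - 1))))" for n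
 proof -
  have "(\<integral>\<^sup>+z. u (z ` {..<n}) \<partial>muRn {..<n}) <= (\<integral>\<^sup>+z. ennreal (real n) * (\<Sum>i<n. ennreal ((b (z i))^2)) \<partial>muRn {..<n})"
  proof (rule nn_integral_mono_AE)
  show "AE z in muRn {..<n}. u (z ` {..<n}) <= ennreal (real n) * (\<Sum>i<n. ennreal ((b (z i))^2))" using Inj_AE[of n] AE_space
  proof eventually_elim
  case (elim z)
  have "(\<Sum>i<n. b (z i))^2 <= real n * (\<Sum>i<n. (b (z i))^2)"
  using Cauchy_Schwarz_ineq_sum[of "%_. 1" "%i. b (z i)" "{..<n}"] by simp
  hence "ennreal ((\<Sum>i<n. b (z i))^2) <= ennreal (real n * (\<Sum>i<n. (b (z i))^2))" by (rule ennreal_leI)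
  thus ?case unfolding u_def sum_image[OF elim(2,1)] by (simp add: ennreal_mult' sum_nonneg flip: sum_ennreal)
  qed
  qed
  also have "... = ennreal (real n) * (\<Sum>i<n. \<integral>\<^sup>+z. ennreal ((b (z i))^2) \<partial>muRn {..<n})"
  by (subst nn_integral_cmult, intro borel_measurable_sum coord_measurable[OF b2], simp,
  subst nn_integral_sum, rule coord_measurable[OF b2], simp, rule refl)
  also have "(\<Sum>i<n. \<integral>\<^sup>+z. ennreal ((b (z i))^2) \<partial>muRn {..<n}) = (\<Sum>i<n. ennreal (be * s ^ (n - 1)))"
  proof (rule sum.cong[OF refl])
  fix i assume "i : {..<n}"
  hence "i < n" by simp
  from nn_integral_coordinate[OF this b2] show "(\<integral>\<^sup>+z. ennreal ((b (z i))^2) \<partial>muRn {..<n}) = ennreal (be * s ^ (n - 1))"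
  unfolding be(2) s_def[symmetric] using be(1) s0 by (simp add: ennreal_mult')
  qed
  also have "... = ennreal (real n * (be * s ^ (n - 1)))" using be(1) s0 by (subst sum_ennreal) auto
  finally show ?thesis using be(1) s0 by (simp add: ennreal_mult')
 qed
 define t where "t n = 1 / fact n * (real n * (real n * (be * s ^ (n - 1))))" for n
 have t0: "0 <= t n" for n using be(1) s0 by (simp add: t_def)
 have "summable (%k. t (Suc k))"
 proof (rule summable_comparison_test')
  show "summable (%k. be * ((2 * s) ^ k / fact k))"
  using exp_converges[of "2 * s"] by (intro summable_mult) (auto simp: sums_iff divide_inverse mult.commute)
  fix k :: nat
  have k2: "real (Suc k) <= 2 ^ k" by (induction k) auto
  have "1 / (a * F) * (a * (a * (be * c))) = a * (be * (c / F))" if "a ~= 0" "F ~= 0" for a F c :: real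
  using that by (simp add: field_simps)
  from this[of "real (Suc k)" "fact k" "s ^ k"]
  have "t (Suc k) = real (Suc k) * (be * (s ^ k / fact k))" unfolding t_def fact_Suc diff_Suc_1 by (simp del: of_nat_Suc)
  also have "... <= 2 ^ k * (be * (s ^ k / fact k))" by (rule mult_right_mono[OF k2]) (use be(1) s0 in simp)
  finally show "norm (t (Suc k)) <= be * ((2 * s) ^ k / fact k)" using t0[of "Suc k"] by (simp add: power_mult_distrib mult_ac)
 qed
 hence ts: "summable t" by (simp only: summable_Suc_iff)
 have "(nn_integral P (%om. ennreal ((pairing b om)^2))) = (nn_integral P (%om. u (om Int mk La)))"
  by (rule nn_integral_cong) (simp add: P_facts(3) u_def pairing_slice[OF _ La z] Int_assoc)
 also have "... = ennreal (exp (- s)) * (\<Sum>n. ennreal (1 / fact n) * (\<integral>\<^sup>+z. u (z ` {..<n}) \<partial>muRn {..<n}))"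
  unfolding s_def by (rule nn_integral_P[OF um])
 also have "... <= ennreal (exp (- s)) * (\<Sum>n. ennreal (t n))"
 proof (intro mult_left_mono suminf_le summableI)
  fix n
  have "ennreal (1 / fact n) * (\<integral>\<^sup>+z. u (z ` {..<n}) \<partial>muRn {..<n}) <= ennreal (1 / fact n) * ennreal (real n * (real n * (be * s ^ (n - 1))))"
  by (rule mult_left_mono[OF step]) simp
  also have "... = ennreal (t n)" unfolding t_def by (rule ennreal_mult'[symmetric]) simp
  finally show "ennreal (1 / fact n) * (\<integral>\<^sup>+z. u (z ` {..<n}) \<partial>muRn {..<n}) <= ennreal (t n)" .
 qed simp
 also have "... < \<infinity>" using suminf_ennreal2[OF t0 ts] by (simp add: ennreal_mult_less_top)
 finally have "(nn_integral P (%om. ennreal ((pairing b om)^2))) < \<infinity>" .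
 thus "integrable P (%om. (pairing b om)^2)" using m by (intro integrableI_bounded) auto
qed

text \<open>Positive and negative part have equal integrals over each number of points, hence equal sums; the two
series need not be compared with anything else.\<close>
lemma integral_P_zero:
 assumes m: "Th : borel_measurable config_space" and loc: "!!om. om : marked_configs ==> Th (om Int mk La) = Th om"
  and int: "!!n. integrable (muRn {..<n}) (Thn n)" "!!n. (\<integral>z. Thn n z \<partial>muRn {..<n}) = 0"
  and eq: "!!n z. z : space (muRn {..<n}) ==> z : Inj n ==> Th (z ` {..<n}) = Thn n z"
 shows "(\<integral>om. Th om \<partial>P) = (0 :: real)"
proof (cases "integrable P Th")
 case False
 thus ?thesis by (rule not_integrable_integral_eq)
next
 case True
 have E: "(nn_integral P (%om. ennreal (c * Th om))) = ennreal (exp (- measure sgma (mk La))) * (\<Sum>n. ennreal (1 / fact n) * (\<integral>\<^sup>+z. ennreal (c * Thn n z) \<partial>muRn {..<n}))" for c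
 proof -
  have "(nn_integral P (%om. ennreal (c * Th om))) = (nn_integral P (%om. ennreal (c * Th (om Int mk La))))"
  by (rule nn_integral_cong) (simp add: P_facts(3) loc)
  also have "... = ennreal (exp (- measure sgma (mk La))) * (\<Sum>n. ennreal (1 / fact n) * (\<integral>\<^sup>+z. ennreal (c * Th (z ` {..<n})) \<partial>muRn {..<n}))"
  by (rule nn_integral_P) (use m in measurable)
  also have "... = ennreal (exp (- measure sgma (mk La))) * (\<Sum>n. ennreal (1 / fact n) * (\<integral>\<^sup>+z. ennreal (c * Thn n z) \<partial>muRn {..<n}))"
  proof -
  have "(\<integral>\<^sup>+z. ennreal (c * Th (z ` {..<n})) \<partial>muRn {..<n}) = (\<integral>\<^sup>+z. ennreal (c * Thn n z) \<partial>muRn {..<n})" for n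
  by (rule nn_integral_cong_AE) (use Inj_AE[of n] AE_space in \<open>eventually_elim, simp add: eq\<close>)
  thus ?thesis by simp
  qed
  finally show ?thesis .
 qed
 have "(\<integral>\<^sup>+z. ennreal (1 * Thn n z) \<partial>muRn {..<n}) = (\<integral>\<^sup>+z. ennreal (- 1 * Thn n z) \<partial>muRn {..<n})" for n
 proof -
  have "(\<integral>\<^sup>+z. ennreal (Thn n z) \<partial>muRn {..<n}) ~= \<infinity>" "(\<integral>\<^sup>+z. ennreal (- Thn n z) \<partial>muRn {..<n}) ~= \<infinity>"
  using int(1)[of n] unfolding real_integrable_def by blast+
  moreover have "enn2real (\<integral>\<^sup>+z. ennreal (Thn n z) \<partial>muRn {..<n}) = enn2real (\<integral>\<^sup>+z. ennreal (- Thn n z) \<partial>muRn {..<n})"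
  using int(2)[of n] unfolding real_lebesgue_integral_def[OF int(1)] by simp
  ultimately have "(\<integral>\<^sup>+z. ennreal (Thn n z) \<partial>muRn {..<n}) = (\<integral>\<^sup>+z. ennreal (- Thn n z) \<partial>muRn {..<n})"
  by (metis ennreal_enn2real infinity_ennreal_def less_top)
  thus ?thesis by simp
 qed
 hence "(nn_integral P (%om. ennreal (1 * Th om))) = (nn_integral P (%om. ennreal (- 1 * Th om)))" unfolding E by simp
 thus ?thesis unfolding real_lebesgue_integral_def[OF True] by simp
qed

lemma integral_coordinate_zero:
 assumes i: "i < n" and V: "integrable (muRn {..<n}) V" and 0: "!!z. (\<integral>y. V (z(i := y)) \<partial>muR) = 0"
 shows "(\<integral>z. V z \<partial>muRn {..<n}) = (0 :: real)"
proof -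
 interpret product_sigma_finite "%_::nat. muR" by (rule muR_product)
 have R: "insert i ({..<n} - {i}) = {..<n}" using i by auto
 have "(\<integral>z. V z \<partial>muRn (insert i ({..<n} - {i}))) = (\<integral>z. (\<integral>y. V (z(i := y)) \<partial>muR) \<partial>muRn ({..<n} - {i}))"
  by (rule product_integral_insert) (use V R in auto)
 thus ?thesis unfolding R 0 by simp
qed

text \<open>For each of the \<open>n\<close> points integrate first over this point: the others only shift the arguments by \<open>R\<close>.\<close>
lemma one_particle_to_configurations:
 fixes U :: "('k => real) => 'x * real => real"
 assumes m: "(%om. SUM x:om Int mk La. U (%k. SUM y:om Int mk La. Ph k y) x) : borel_measurable config_space"
  and mn: "!!n i. i < n ==> (%z. U (%k. \<Sum>l<n. Ph k (z l)) (z i)) : borel_measurable (muRn {..<n})"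
  and w: "integrable muR w" "!!r x. x : mk La ==> abs (U r x) <= w x"
  and 0: "!!R. (\<integral>y. U (%k. R k + Ph k y) y \<partial>muR) = 0"
 shows "(\<integral>om. (SUM x:om Int mk La. U (%k. SUM y:om Int mk La. Ph k y) x) \<partial>P) = 0"
proof (rule integral_P_zero[OF m, where Thn = "%n z. \<Sum>i<n. U (%k. \<Sum>l<n. Ph k (z l)) (z i)"])
 have V: "integrable (muRn {..<n}) (%z. U (%k. \<Sum>l<n. Ph k (z l)) (z i))" if i: "i < n" for n i
 proof (rule Bochner_Integration.integrable_bound[OF _ mn[OF i]])
  have wm: "w : borel_measurable muR" using w(1) by simp
  show "integrable (muRn {..<n}) (%z. w (z i))"
  proof (rule integrableI_bounded)
  show "(%z. w (z i)) : borel_measurable (muRn {..<n})" by (rule coord_measurable[OF wm]) (use i in simp)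
  have "(\<integral>\<^sup>+z. ennreal (norm (w (z i))) \<partial>muRn {..<n}) = (\<integral>\<^sup>+x. ennreal (norm (w x)) \<partial>muR) * ennreal (measure sgma (mk La) ^ (n - 1))"
  by (rule nn_integral_coordinate[OF i]) (use wm in measurable)
  also have "... < \<infinity>" using w(1) unfolding integrable_iff_bounded by (simp add: ennreal_mult_less_top)
  finally show "(\<integral>\<^sup>+z. ennreal (norm (w (z i))) \<partial>muRn {..<n}) < \<infinity>" .
  qed
  show "AE z in muRn {..<n}. norm (U (%k. \<Sum>l<n. Ph k (z l)) (z i)) <= norm (w (z i))"
  proof (rule AE_I2)
  fix z assume "z : space (muRn {..<n})"
  hence "z i : mk La" using i by (auto simp: space_PiM muR_facts(1) PiE_def Pi_iff)
  from w(2)[OF this, of "%k. \<Sum>l<n. Ph k (z l)"]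
  show "norm (U (%k. \<Sum>l<n. Ph k (z l)) (z i)) <= norm (w (z i))" by simp
  qed
 qed
 thus "integrable (muRn {..<n}) (%z. \<Sum>i<n. U (%k. \<Sum>l<n. Ph k (z l)) (z i))" for n
  by (intro Bochner_Integration.integrable_sum) simp
 have V0: "(\<integral>z. U (%k. \<Sum>l<n. Ph k (z l)) (z i) \<partial>muRn {..<n}) = 0" if i: "i < n" for n i
 proof (rule integral_coordinate_zero[OF i V[OF i]])
  fix z
  have R: "{..<n} = insert i ({..<n} - {i})" using i by auto
  have "(\<Sum>l<n. Ph k ((z(i := y)) l)) = (SUM l:{..<n} - {i}. Ph k (z l)) + Ph k y" for k y
  by (subst R, subst sum.insert) (auto intro!: sum.cong)
  thus "(\<integral>y. U (%k. \<Sum>l<n. Ph k ((z(i := y)) l)) ((z(i := y)) i) \<partial>muR) = 0"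
  using 0[of "%k. SUM l:{..<n} - {i}. Ph k (z l)"] by simp
 qed
 show "(\<integral>z. (\<Sum>i<n. U (%k. \<Sum>l<n. Ph k (z l)) (z i)) \<partial>muRn {..<n}) = 0" for n
  by (subst Bochner_Integration.integral_sum) (use V V0 in auto)
 fix n z assume z: "z : space (muRn {..<n})" "z : Inj n"
 show "(SUM x:z ` {..<n} Int mk La. U (%k. SUM y:z ` {..<n} Int mk La. Ph k y) x) = (\<Sum>i<n. U (%k. \<Sum>l<n. Ph k (z l)) (z i))"
  unfolding sum_image[OF z] ..
qed (simp add: Int_assoc)

end

end

section \<open>Integration by parts on configurations\<close>

lemma uniform_bound:
 fixes F :: "'i => 'a => real"
 assumes "finite I" "!!i. i : I ==> EX C. ALL x:X. abs (F i x) <= C"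
 shows "EX C>=0. ALL i:I. ALL x:X. abs (F i x) <= C"
 using assms
proof (induction I)
 case empty
 thus ?case by (intro exI[of _ 0]) simp
next
 case (insert i I)
 obtain C where C: "0 <= C" "ALL i:I. ALL x:X. abs (F i x) <= C" using insert by blast
 obtain D where D: "ALL x:X. abs (F i x) <= D" using insert.prems by blast
 show ?case by (rule exI[of _ "max C D"]) (use C D in \<open>auto simp: le_max_iff_disj\<close>)
qed

lemma Cb_infinity_bounded: "g : Cb_infinity N ==> EX C. ALL r:UNIV. abs (g r) <= C"
 using Cb_infinity_facts(3)[of g N] unfolding bounded_iff by auto

lemma cylinder_measurable:
 assumes g: "g : Cb_infinity N" and F: "!!k. k < N ==> F k : borel_measurable S"
 shows "(%x. g (%k. F k x)) : borel_measurable S"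
proof -
 have "(%x. g (%k. if k < N then F k x else 0)) : borel_measurable S"
 proof (rule measurable_compose[of _ S borel g])
  show "(%x k. if k < N then F k x else 0) : borel_measurable S"
  proof (rule measurable_coordinatewise_then_product)
  fix k show "(%x. if k < N then F k x else 0) : borel_measurable S" using F by (cases "k < N") simp_all
  qed
  show "g : borel_measurable borel" by (rule borel_measurable_continuous_onI[OF Cb_infinity_facts(2)[OF g]])
 qed
 moreover have "g (%k. if k < N then F k x else 0) = g (%k. F k x)" for x by (rule Cb_infinity_facts(1)[OF g]) simp
 ultimately show ?thesis by simp
qed

lemma abs_sum_product_bound:
 fixes a b :: "nat => real"
 assumes "!!k. k < n ==> abs (a k) <= C" "!!k. k < n ==> abs (b k) <= C" "0 <= C"
 shows "abs (\<Sum>k<n. a k * b k) <= real n * (C * C)"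
proof -
 have "abs (\<Sum>k<n. a k * b k) <= (\<Sum>k<n. C * C)"
  by (rule order_trans[OF sum_abs], rule sum_mono, unfold abs_mult, rule mult_mono) (use assms in auto)
 thus ?thesis by simp
qed

lemma square_integrable_add:
 assumes "square_integrable P a" "square_integrable P b"
 shows "square_integrable P (%om. a om + b om)"
 unfolding square_integrable_def
proof
 show m: "(%om. a om + b om) : borel_measurable P"
  by (rule borel_measurable_add) (use assms in \<open>simp_all add: square_integrable_def\<close>)
 have "integrable P (%om. 2 * (a om)^2 + 2 * (b om)^2)" using assms unfolding square_integrable_def by simp
 thus "integrable P (%om. (a om + b om)^2)"
 proof (rule Bochner_Integration.integrable_bound)
  show "AE om in P. norm ((a om + b om)^2) <= norm (2 * (a om)^2 + 2 * (b om)^2)"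
  proof (rule AE_I2)
  fix om
  have "0 <= (a om - b om)^2" by simp
  hence "(a om + b om)^2 <= 2 * (a om)^2 + 2 * (b om)^2" by (simp add: power2_eq_square algebra_simps)
  thus "norm ((a om + b om)^2) <= norm (2 * (a om)^2 + 2 * (b om)^2)" by simp
  qed
 qed (use m in measurable)
qed

lemma square_integrable_mult:
 assumes "a : borel_measurable P" "!!om. abs (a om) <= C" "square_integrable P b"
 shows "square_integrable P (%om. a om * b om)"
 unfolding square_integrable_def
proof
 show m: "(%om. a om * b om) : borel_measurable P"
  by (rule borel_measurable_times) (use assms in \<open>simp_all add: square_integrable_def\<close>)
 have "integrable P (%om. C\<^sup>2 * (b om)^2)" using assms unfolding square_integrable_def by simp
 thus "integrable P (%om. (a om * b om)^2)"
 proof (rule Bochner_Integration.integrable_bound)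
  show "AE om in P. norm ((a om * b om)^2) <= norm (C\<^sup>2 * (b om)^2)"
  proof (rule AE_I2)
  fix om
  have "\<bar>a om\<bar>\<^sup>2 <= C\<^sup>2" by (rule power_mono[OF assms(2)]) simp
  thus "norm ((a om * b om)^2) <= norm (C\<^sup>2 * (b om)^2)" by (simp add: power_mult_distrib mult_right_mono)
  qed
 qed (use m in measurable)
qed

lemma square_integrable_zero: "square_integrable P (%om. 0)"
 by (simp add: square_integrable_def)

lemma square_integrable_sum:
 "finite I ==> (!!i. i : I ==> square_integrable P (a i)) ==> square_integrable P (%om. SUM i:I. a i om)"
 by (induction I rule: finite_induct) (auto simp: square_integrable_zero intro: square_integrable_add)

lemma (in prob_space) square_integrable_imp_integrable:
 assumes "square_integrable M a"
 shows "integrable M a"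
proof (rule Bochner_Integration.integrable_bound[of M "%om. 1 + (a om)^2"])
 show "integrable M (%om. 1 + (a om)^2)" using assms unfolding square_integrable_def by simp
 show "a : borel_measurable M" using assms unfolding square_integrable_def by simp
 show "AE om in M. norm (a om) <= norm (1 + (a om)^2)"
 proof (rule AE_I2)
  fix om
  have "0 <= (abs (a om) - 1)^2 + abs (a om)" by simp
  thus "norm (a om) <= norm (1 + (a om)^2)" by (simp add: power2_eq_square algebra_simps)
 qed
qed

lemma minner_sum:
 "minner M x (%c. SUM j:J. a j *\<^sub>R fst (v j) c, SUM j:J. a j * snd (v j)) (%c. SUM k:K. b k *\<^sub>R fst (w k) c, SUM k:K. b k * snd (w k))
 = (SUM j:J. SUM k:K. a j * (b k * minner M x (v j) (w k)))"
proof -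
 have l: "A *v (SUM k:K. b k *\<^sub>R u k) = (SUM k:K. b k *\<^sub>R (A *v u k))" for A :: "real ^ 'b ^ 'b" and u
  by (simp add: linear_sum[OF matrix_vector_mul_linear] matrix_vector_mult_scaleR)
 have A: "(SUM j:J. a j *\<^sub>R y j) \<bullet> (SUM k:K. b k *\<^sub>R u k) = (SUM j:J. SUM k:K. a j * (b k * (y j \<bullet> u k)))" for y u :: "_ => real ^ 'b"
  unfolding inner_sum_left by (intro sum.cong refl) (simp add: inner_sum_right sum_distrib_left mult.left_commute)
 have B: "(SUM j:J. a j * y j) * (SUM k:K. b k * u k) = (SUM j:J. SUM k:K. a j * (b k * (y j * u k)))" for y u
  unfolding sum_product by (intro sum.cong refl) (simp add: mult_ac)
 show ?thesis unfolding minner_def tinner_def Let_def fst_conv snd_conv l A B distrib_left sum.distrib ..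
qed

lemma mark_eq: "om : marked_configs ==> z : om ==> mark om (fst z) = snd z"
 unfolding mark_def
proof (rule the_equality)
 assume om: "om : marked_configs" and z: "z : om"
 hence inj: "inj_on fst om" by (simp add: marked_configs_def)
 show "(fst z, snd z) : om" using z by simp
 fix s assume s: "(fst z, s) : om"
 have "(fst z, s) = z" by (rule inj_onD[OF inj _ s z]) simp
 thus "s = snd z" by (metis snd_conv)
qed

context marked_density
begin

lemma GG_sym: "Sm ph ==> Sm psi ==> z : mk UNIV ==> GG ph psi z = GG psi ph z"
proof -
 assume s: "Sm ph" "Sm psi" and z: "z : mk UNIV"
 obtain c where c: "c : atlas M" "fst z : cdom c" using charts_cover by blast
 have zD: "z : cD c" by (rule mk_cD[OF z c(2)])
 show ?thesis unfolding minner_grad_cD[OF c(1) zD s] minner_grad_cD[OF c(1) zD s(2,1)] by (rule minner_sym_grad[OF c(1) co_cD[OF zD]])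
qed

lemma smooth_mk_cylinder:
 assumes g: "g : Cb_infinity N" and Ph: "!!j. j < N ==> Sm (Ph j)"
 shows "Sm (%z. g (%j. R j + Ph j z))"
proof (rule smooth_mkI)
 fix c assume c: "c : atlas M"
 have "smooth_on (cU c) (%y. g (%j. R j + hat c (Ph j) y))"
  by (rule smooth_on_cylinder[OF open_cU[OF c] g]) (intro smooth_on_add open_cU c smooth_on_const hat_smooth Ph)
 thus "smooth_on (cU c) (hat c (%z. g (%j. R j + Ph j z)))" by (simp add: hat_def[abs_def])
qed

lemma GG_cylinder:
 assumes ph: "Sm ph" and g: "g : Cb_infinity N" and Ph: "!!j. j < N ==> Sm (Ph j)" and z: "z : mk UNIV"
 shows "GG ph (%z. g (%j. R j + Ph j z)) z = (\<Sum>k<N. pd k g (%j. R j + Ph j z) * GG ph (Ph k) z)"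
proof (rule GG_chain[OF ph smooth_mk_cylinder[OF g Ph] Ph z])
 fix c v assume c: "c : atlas M" "z : cD c"
 have v: "hat c f (co c z) = f z" for f using pt_co[OF c] by (simp add: hat_def)
 have "((%y. g (%j. R j + hat c (Ph j) y)) has_derivative
  (%v. \<Sum>j<N. (0 + fd (hat c (Ph j)) v (co c z)) * pd j g (%j. R j + hat c (Ph j) (co c z)))) (at (co c z))"
  by (rule cylinder_has_derivative[OF g])
  (intro has_derivative_add has_derivative_const smooth_on_has_derivative[OF hat_smooth[OF Ph c(1)] co_cD[OF c(2)]])
 from frechet_derivative_eqI[OF this]
 have "fd (%y. g (%j. R j + hat c (Ph j) y)) v (co c z) = (\<Sum>j<N. fd (hat c (Ph j)) v (co c z) * pd j g (%j. R j + Ph j z))"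
  unfolding v by simp
 moreover have "hat c (%z. g (%j. R j + Ph j z)) = (%y. g (%j. R j + hat c (Ph j) y))" by (simp add: hat_def[abs_def])
 ultimately show "fd (hat c (%z. g (%j. R j + Ph j z))) v (co c z) = (\<Sum>k<N. pd k g (%j. R j + Ph j z) * fd (hat c (Ph k)) v (co c z))"
  by (simp add: mult.commute)
qed simp_all

lemma one_particle_generator:
 assumes ph: "ph : test_functions M" and f: "Sm f"
  and bd: "!!z. z : mk UNIV ==> abs (f z) <= B" "!!z. z : mk UNIV ==> abs (GG ph f z) <= B"
 shows "(\<integral>z. GG ph f z - f z * H_mk M q ph z \<partial>sigma_tilde m q) = 0"
proof -
 note sm = test_smooth[OF ph]
 have meas: "(%z. GG ph f z - f z * H_mk M q ph z) : borel_measurable ml"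
  by (intro borel_measurable_diff borel_measurable_times minner_grad_measurable smooth_mk_measurable H_measurable sm f)
 have "(\<integral>z. GG ph f z - f z * H_mk M q ph z \<partial>sigma_tilde m q) = (\<integral>z. q z *\<^sub>R (GG ph f z - f z * H_mk M q ph z) \<partial>ml)"
  unfolding sigma_tilde_def by (rule integral_density[OF meas q_meas]) (use q_pos in \<open>auto elim!: eventually_mono\<close>)
 also have "... = (\<integral>z. ibp ph f z \<partial>ml)"
 proof (rule integral_cong_AE)
  show "(%z. q z *\<^sub>R (GG ph f z - f z * H_mk M q ph z)) : borel_measurable ml" using q_meas meas by measurable
  show "ibp ph f : borel_measurable ml" using one_particle_ibp(1)[OF ph f bd] by simp
  show "AE z in ml. q z *\<^sub>R (GG ph f z - f z * H_mk M q ph z) = ibp ph f z" using q_pos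
  proof eventually_elim
  case (elim z)
  hence "q z * (f z * (drift ph z / q z)) = f z * drift ph z" by simp
  thus ?case unfolding H_mk_drift ibp_def by (simp add: algebra_simps)
  qed
 qed
 also have "... = 0" by (rule one_particle_ibp(2)[OF ph f bd])
 finally show ?thesis .
qed

end

locale poisson_density = marked_density M m q + marked_poisson_process "sigma_tilde m q" P
 for M :: "('a::{t2_space, second_countable_topology}, 'b::finite) riemannian" and m and q :: "'a * real => real" and P
begin

abbreviation sgq :: "('a * real) measure" where
 "sgq \<equiv> sigma_tilde m q"

abbreviation Hq :: "('a * real => real) => 'a * real => real" where
 "Hq ph \<equiv> H_mk M q ph"

lemma measurable_sgma: "(f :: _ => real) : borel_measurable ml ==> f : borel_measurable (sgq)"
 by (simp add: sigma_tilde_def)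

context
 fixes N N' :: nat and ph psi :: "nat => 'a * real => real" and g h :: "(nat => real) => real" and La :: "'a set"
 assumes ph: "!!j. j < N ==> ph j : test_functions M" and psi: "!!j. j < N' ==> psi j : test_functions M"
  and g: "g : Cb_infinity N" and h: "h : Cb_infinity N'"
  and La: "La : Oc" "!!j. j < N ==> base (ph j) <= La" "!!j. j < N' ==> base (psi j) <= La"
begin

lemmas sph = test_smooth[OF ph] and spsi = test_smooth[OF psi]

lemma off_La:
 assumes z: "z : mk UNIV" "z ~: mk La"
 shows "j < N ==> ph j z = 0" "j < N' ==> psi j z = 0" "j < N ==> Sm f ==> GG (ph j) f z = 0" "j < N ==> Hq (ph j) z = 0"
proof -
 have "fst z ~: La" using z by (cases z) (auto simp: mk_def)
 hence n: "j < N ==> fst z ~: base (ph j)" "j < N' ==> fst z ~: base (psi j)" using La(2,3) by blast+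
 show "j < N ==> ph j z = 0" "j < N' ==> psi j z = 0" using base_zero[OF z(1)] n by blast+
 show "j < N ==> Sm f ==> GG (ph j) f z = 0" by (rule minner_off_base[OF sph base_compact[OF ph] _ z(1) n(1)])
 show "j < N ==> Hq (ph j) z = 0" by (rule H_off_base[OF sph base_compact[OF ph] z(1) n(1)])
qed

lemma common_bound:
 obtains C where "0 <= C" "!!r. abs (h r) <= C" "!!j r. j < N ==> abs (pd j g r) <= C" "!!k r. k < N' ==> abs (pd k h r) <= C"
  "!!j k r. j < N ==> k < N ==> abs (pd k (pd j g) r) <= C"
  "!!j k z. j < N ==> k < N ==> z : mk UNIV ==> abs (GG (ph j) (ph k) z) <= C"
  "!!j k z. j < N ==> k < N' ==> z : mk UNIV ==> abs (GG (ph j) (psi k) z) <= C"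
proof -
 obtain C1 where C1: "0 <= C1" "!!r. abs (h r) <= C1" using uniform_bound[of "{()}" UNIV "%_. h"] Cb_infinity_bounded[OF h] by auto
 have "EX C>=0. ALL j:{..<N}. ALL r:UNIV. abs (pd j g r) <= C"
  by (rule uniform_bound) (auto intro!: Cb_infinity_bounded[OF Cb_infinity_pd[OF g], simplified])
 then obtain C2 where C2: "0 <= C2" "!!j r. j < N ==> abs (pd j g r) <= C2" by auto
 have "EX C>=0. ALL j:{..<N'}. ALL r:UNIV. abs (pd j h r) <= C"
  by (rule uniform_bound) (auto intro!: Cb_infinity_bounded[OF Cb_infinity_pd[OF h], simplified])
 then obtain C3 where C3: "0 <= C3" "!!j r. j < N' ==> abs (pd j h r) <= C3" by auto
 have "EX C>=0. ALL i:{..<N} \<times> {..<N}. ALL r:UNIV. abs (pd (snd i) (pd (fst i) g) r) <= C"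
  by (rule uniform_bound) (auto intro!: Cb_infinity_bounded[OF Cb_infinity_pd[OF Cb_infinity_pd[OF g]], simplified])
 then obtain C4 where C4: "0 <= C4" "!!j k r. j < N ==> k < N ==> abs (pd k (pd j g) r) <= C4" by auto
 have "EX C>=0. ALL i:{..<N} \<times> {..<N}. ALL z:mk UNIV. abs (GG (ph (fst i)) (ph (snd i)) z) <= C"
 proof (rule uniform_bound)
  fix i assume "i : {..<N} \<times> {..<N}"
  hence "fst i < N" "snd i < N" by auto
  from minner_grad_bounded[OF ph[OF this(1)] ph[OF this(2)]]
  show "EX C. ALL z:mk UNIV. abs (GG (ph (fst i)) (ph (snd i)) z) <= C" by metis
 qed simp
 then obtain C5 where C5: "0 <= C5" "!!j k z. j < N ==> k < N ==> z : mk UNIV ==> abs (GG (ph j) (ph k) z) <= C5" by auto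
 have "EX C>=0. ALL i:{..<N} \<times> {..<N'}. ALL z:mk UNIV. abs (GG (ph (fst i)) (psi (snd i)) z) <= C"
 proof (rule uniform_bound)
  fix i assume "i : {..<N} \<times> {..<N'}"
  hence "fst i < N" "snd i < N'" by auto
  from minner_grad_bounded[OF ph[OF this(1)] psi[OF this(2)]]
  show "EX C. ALL z:mk UNIV. abs (GG (ph (fst i)) (psi (snd i)) z) <= C" by metis
 qed simp
 then obtain C6 where C6: "0 <= C6" "!!j k z. j < N ==> k < N' ==> z : mk UNIV ==> abs (GG (ph j) (psi k) z) <= C6" by auto
 show ?thesis by (rule that[of "C1 + C2 + C3 + C4 + C5 + C6"])
  (use C1(1) C2(1) C3(1) C4(1) C5(1) C6(1) in \<open>simp_all add: order_trans[OF C1(2)] order_trans[OF C2(2)] order_trans[OF C3(2)] order_trans[OF C4(2)] order_trans[OF C5(2)] order_trans[OF C6(2)]\<close>)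
qed

text \<open>The contribution of a single point \<open>x\<close> and of the index \<open>j\<close>; the arguments \<open>r\<close> collect the sums of the \<open>ph k\<close>
(left) and of the \<open>psi k\<close> (right) over the configuration.\<close>
definition U :: "nat => (nat + nat => real) => 'a * real => real" where
 "U j r x = h (%k. r (Inr k)) * (\<Sum>k<N. pd k (pd j g) (%k. r (Inl k)) * GG (ph j) (ph k) x)
  + pd j g (%k. r (Inl k)) * (\<Sum>k<N'. pd k h (%k. r (Inr k)) * GG (ph j) (psi k) x)
  - h (%k. r (Inr k)) * pd j g (%k. r (Inl k)) * Hq (ph j) x"

definition Ph :: "nat + nat => 'a * real => real" where
 "Ph i = (case i of Inl k => ph k | Inr k => psi k)"

lemma Ph_simps [simp]: "Ph (Inl k) = ph k" "Ph (Inr k) = psi k" by (simp_all add: Ph_def)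

lemma muR_integral:
 assumes "!!z. z : mk UNIV ==> z ~: mk La ==> f z = (0 :: real)"
 shows "(\<integral>z. f z \<partial>muR La) = (\<integral>z. f z \<partial>sgq)"
proof -
 have "mk La Int space (sgq) : sets (sgq)" using mk_sets[OF La(1)] by simp
 hence "(\<integral>z. f z \<partial>muR La) = (\<integral>z. indicator (mk La) z *\<^sub>R f z \<partial>sgq)"
  unfolding muR_def[OF La(1)] by (rule integral_restrict_space)
 also have "... = (\<integral>z. f z \<partial>sgq)"
  by (rule Bochner_Integration.integral_cong[OF refl]) (use assms in \<open>auto simp: space_sgma indicator_def\<close>)
 finally show ?thesis .
qed

text \<open>As a function of \<open>x\<close>, this is \<open>\<Gamma>(ph j, f) - f H (ph j)\<close> for the product \<open>f\<close> of \<open>h\<close> and \<open>\<partial>\<^sub>j g\<close> at shifted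
arguments.\<close>
lemma U_integral_zero:
 assumes j: "j < N"
 shows "(\<integral>y. U j (%k. R k + Ph k y) y \<partial>muR La) = 0"
proof -
 obtain C where C: "0 <= C" "!!r. abs (h r) <= C" "!!j r. j < N ==> abs (pd j g r) <= C" "!!k r. k < N' ==> abs (pd k h r) <= C"
  "!!j k r. j < N ==> k < N ==> abs (pd k (pd j g) r) <= C"
  "!!j k z. j < N ==> k < N ==> z : mk UNIV ==> abs (GG (ph j) (ph k) z) <= C"
  "!!j k z. j < N ==> k < N' ==> z : mk UNIV ==> abs (GG (ph j) (psi k) z) <= C" using common_bound by blast
 note pg = Cb_infinity_pd[OF g j]
 let ?h = "%z. h (%k. R (Inr k) + psi k z)" and ?g = "%z. pd j g (%k. R (Inl k) + ph k z)"
 let ?f = "%z. ?h z * ?g z"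
 have sh: "Sm ?h" by (rule smooth_mk_cylinder[OF h spsi])
 have sg: "Sm ?g" by (rule smooth_mk_cylinder[OF pg sph])
 have sf: "Sm ?f" by (rule smooth_mk_mult[OF sh sg])
 have G: "GG (ph j) ?f z = ?h z * (\<Sum>k<N. pd k (pd j g) (%k. R (Inl k) + ph k z) * GG (ph j) (ph k) z)
  + ?g z * (\<Sum>k<N'. pd k h (%k. R (Inr k) + psi k z) * GG (ph j) (psi k) z)" if z: "z : mk UNIV" for z :: "'a * real"
 proof -
  have 1: "GG (ph j) ?h z = (\<Sum>k<N'. pd k h (%k. R (Inr k) + psi k z) * GG (ph j) (psi k) z)"
  by (rule GG_cylinder[OF sph[OF j] h spsi z])
  have 2: "GG (ph j) ?g z = (\<Sum>k<N. pd k (pd j g) (%k. R (Inl k) + ph k z) * GG (ph j) (ph k) z)"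
  by (rule GG_cylinder[OF sph[OF j] pg sph z])
  show ?thesis unfolding GG_mult[OF sph[OF j] sh sg z] 1 2 ..
 qed
 have U: "U j (%k. R k + Ph k z) z = GG (ph j) ?f z - ?f z * Hq (ph j) z" if z: "z : mk UNIV" for z unfolding G[OF z] U_def by simp
 let ?B = "C * C + C * (real N * (C * C)) + C * (real N' * (C * C))"
 have pos: "0 <= C * C" "0 <= C * (real N * (C * C))" "0 <= C * (real N' * (C * C))" using C(1) by simp_all
 have "(\<integral>z. GG (ph j) ?f z - ?f z * Hq (ph j) z \<partial>sgq) = 0"
 proof (rule one_particle_generator[OF ph[OF j] sf, of ?B])
  fix z :: "'a * real" assume z: "z : mk UNIV"
  have "abs (?f z) <= C * C" unfolding abs_mult by (rule mult_mono[OF C(2) C(3)[OF j] C(1)]) simp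
  thus "abs (?f z) <= ?B" using pos by linarith
  have "abs (?h z * (\<Sum>k<N. pd k (pd j g) (%k. R (Inl k) + ph k z) * GG (ph j) (ph k) z)) <= C * (real N * (C * C))"
  unfolding abs_mult[of "?h z"] by (rule mult_mono[OF C(2) abs_sum_product_bound[OF C(5)[OF j] C(6)[OF j _ z] C(1)] C(1)]) auto
  moreover have "abs (?g z * (\<Sum>k<N'. pd k h (%k. R (Inr k) + psi k z) * GG (ph j) (psi k) z)) <= C * (real N' * (C * C))"
  unfolding abs_mult[of "?g z"] by (rule mult_mono[OF C(3)[OF j] abs_sum_product_bound[OF C(4) C(7)[OF j _ z] C(1)] C(1)]) auto
  ultimately show "abs (GG (ph j) ?f z) <= ?B" unfolding G[OF z] using pos by linarith
 qed
 moreover have "(\<integral>z. GG (ph j) ?f z - ?f z * Hq (ph j) z \<partial>muR La) = (\<integral>z. GG (ph j) ?f z - ?f z * Hq (ph j) z \<partial>sgq)"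
  by (rule muR_integral) (simp add: off_La(3)[OF _ _ j sf] off_La(4)[OF _ _ j])
 moreover have "(\<integral>y. U j (%k. R k + Ph k y) y \<partial>muR La) = (\<integral>z. GG (ph j) ?f z - ?f z * Hq (ph j) z \<partial>muR La)"
  by (rule Bochner_Integration.integral_cong[OF refl], rule U) (auto simp: muR_facts(1)[OF La(1)] mk_def)
 ultimately show ?thesis by simp
qed

lemma GG_measurable: "j < N ==> Sm f ==> GG (ph j) f : borel_measurable (sgq)"
 by (rule measurable_sgma[OF minner_grad_measurable[OF sph]])

lemma Hq_measurable: "j < N ==> Hq (ph j) : borel_measurable (sgq)"
 by (rule measurable_sgma[OF H_measurable[OF sph]])

lemma ph_measurable: "j < N ==> ph j : borel_measurable (sgq)"
 and psi_measurable: "j < N' ==> psi j : borel_measurable (sgq)"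
 by (rule measurable_sgma[OF smooth_mk_measurable], rule sph spsi, assumption)+

lemma Hq_L2: "j < N ==> (\<integral>\<^sup>+z. ennreal ((Hq (ph j) z)^2) \<partial>sgq) < \<infinity>"
proof -
 assume j: "j < N"
 have "(\<integral>\<^sup>+z. ennreal ((Hq (ph j) z)^2) \<partial>sgq) = (nn_integral ml (%z. ennreal (q z) * ennreal ((Hq (ph j) z)^2)))"
  unfolding sigma_tilde_def by (rule nn_integral_density) (use q_meas H_measurable[OF sph[OF j]] in measurable)
 thus ?thesis using H_L2[OF ph[OF j]] by (simp add: mult.commute)
qed

lemma pairing_H: "j < N ==> square_integrable P (pairing (Hq (ph j)))"
 unfolding square_integrable_def using pairing_L2[OF La(1) Hq_measurable off_La(4) Hq_L2] by blast

lemma pairing_bounded: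
 assumes b: "b : borel_measurable (sgq)" and z: "!!z. z : mk UNIV ==> z ~: mk La ==> b z = 0"
  and B: "!!z. z : mk UNIV ==> abs (b z) <= B"
 shows "square_integrable P (pairing b)"
proof -
 have "(\<integral>\<^sup>+z. ennreal ((b z)^2) \<partial>sgq) <= (\<integral>\<^sup>+z. ennreal (B\<^sup>2) * indicator (mk La) z \<partial>sgq)"
 proof (rule nn_integral_mono)
  fix x assume "x : space (sgq)"
  hence x: "x : mk UNIV" by (simp add: space_sgma)
  have "(b x)^2 <= B\<^sup>2" using B[OF x] abs_le_square_iff[of "b x" B] by simp
  thus "ennreal ((b x)^2) <= ennreal (B\<^sup>2) * indicator (mk La) x" using z[OF x] by (cases "x : mk La") (auto intro: ennreal_leI)
 qed
 also have "... = ennreal (B\<^sup>2) * emeasure (sgq) (mk La)"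
  using mk_sets[OF La(1)] by (simp add: nn_integral_cmult_indicator)
 also have "... < \<infinity>" using fin[OF La(1)] by (simp add: ennreal_mult_less_top)
 finally show ?thesis unfolding square_integrable_def using pairing_L2[OF La(1) b z] by blast
qed

lemma pairing_GG:
 assumes j: "j < N"
 shows "k < N ==> square_integrable P (pairing (GG (ph j) (ph k)))" "k < N' ==> square_integrable P (pairing (GG (ph j) (psi k)))"
proof -
 show "square_integrable P (pairing (GG (ph j) (ph k)))" if k: "k < N"
 proof -
  obtain B where B: "!!z. z : mk UNIV ==> abs (GG (ph j) (ph k) z) <= B" using minner_grad_bounded[OF ph[OF j] ph[OF k]] by blast
  show ?thesis by (rule pairing_bounded[OF GG_measurable[OF j sph[OF k]] off_La(3)[OF _ _ j sph[OF k]] B])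
 qed
 show "square_integrable P (pairing (GG (ph j) (psi k)))" if k: "k < N'"
 proof -
  obtain B where B: "!!z. z : mk UNIV ==> abs (GG (ph j) (psi k) z) <= B" using minner_grad_bounded[OF ph[OF j] psi[OF k]] by blast
  show ?thesis by (rule pairing_bounded[OF GG_measurable[OF j spsi[OF k]] off_La(3)[OF _ _ j spsi[OF k]] B])
 qed
qed

lemma U_bound:
 assumes j: "j < N"
 obtains w where "integrable (muR La) w" "!!r x. x : mk La ==> abs (U j r x) <= w x"
proof -
 obtain C where C: "0 <= C" "!!r. abs (h r) <= C" "!!j r. j < N ==> abs (pd j g r) <= C" "!!k r. k < N' ==> abs (pd k h r) <= C"
  "!!j k r. j < N ==> k < N ==> abs (pd k (pd j g) r) <= C"
  "!!j k z. j < N ==> k < N ==> z : mk UNIV ==> abs (GG (ph j) (ph k) z) <= C"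
  "!!j k z. j < N ==> k < N' ==> z : mk UNIV ==> abs (GG (ph j) (psi k) z) <= C" using common_bound by blast
 interpret fm: finite_measure "muR La" by (rule muR_facts(2)[OF La(1)])
 have Hm: "Hq (ph j) : borel_measurable (muR La)" by (rule muR_facts(4)[OF La(1) Hq_measurable[OF j]])
 have sub: "mk La Int space (sgq) : sets (sgq)" using mk_sets[OF La(1)] by simp
 have "(\<integral>\<^sup>+x. ennreal ((Hq (ph j) x)^2) \<partial>muR La) <= (\<integral>\<^sup>+z. ennreal ((Hq (ph j) z)^2) \<partial>sgq)"
  unfolding muR_def[OF La(1)] nn_integral_restrict_space[OF sub] by (rule nn_integral_mono) (auto simp: indicator_def)
 also have "... < \<infinity>" by (rule Hq_L2[OF j])
 finally have "(\<integral>\<^sup>+x. ennreal ((Hq (ph j) x)^2) \<partial>muR La) < \<infinity>" .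
 hence H2: "integrable (muR La) (%x. (Hq (ph j) x)^2)" using Hm by (intro integrableI_bounded) auto
 let ?w = "%x. C * (real N * (C * C)) + C * (real N' * (C * C)) + C * C * (1 + (Hq (ph j) x)^2)"
 show ?thesis
 proof (rule that[of ?w])
  show "integrable (muR La) ?w" by (intro Bochner_Integration.integrable_add integrable_mult_right H2 fm.integrable_const)
  fix r x assume "x : mk La"
  hence x: "x : mk UNIV" by (auto simp: mk_def)
  let ?A = "h (%k. r (Inr k)) * (\<Sum>k<N. pd k (pd j g) (%k. r (Inl k)) * GG (ph j) (ph k) x)"
  let ?B = "pd j g (%k. r (Inl k)) * (\<Sum>k<N'. pd k h (%k. r (Inr k)) * GG (ph j) (psi k) x)"
  let ?C = "h (%k. r (Inr k)) * pd j g (%k. r (Inl k)) * Hq (ph j) x"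
  have A: "abs (?A) <= C * (real N * (C * C))" unfolding abs_mult[of "h _"]
  by (rule mult_mono[OF C(2) abs_sum_product_bound[OF C(5)[OF j] C(6)[OF j _ x] C(1)] C(1)]) auto
  have B: "abs (?B) <= C * (real N' * (C * C))" unfolding abs_mult[of "pd j g _"]
  by (rule mult_mono[OF C(3)[OF j] abs_sum_product_bound[OF C(4) C(7)[OF j _ x] C(1)] C(1)]) auto
  have hh: "abs (Hq (ph j) x) <= 1 + (Hq (ph j) x)^2"
  proof -
  have "0 <= (abs (Hq (ph j) x) - 1)^2 + abs (Hq (ph j) x)" by simp
  thus ?thesis by (simp add: power2_eq_square algebra_simps)
  qed
  have hg: "abs (h (%k. r (Inr k)) * pd j g (%k. r (Inl k))) <= C * C"
  unfolding abs_mult by (rule mult_mono[OF C(2) C(3)[OF j] C(1)]) simp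
  have Cb: "abs (?C) <= C * C * (1 + (Hq (ph j) x)^2)"
  unfolding abs_mult[of _ "Hq (ph j) x"] by (rule mult_mono[OF hg hh]) (use C(1) in auto)
  show "abs (U j r x) <= ?w x" unfolding U_def using A B Cb by linarith
 qed
qed

definition TH :: "nat => ('a * real) set => real" where
 "TH j om = (SUM x:om Int mk La. U j (%k. SUM y:om Int mk La. Ph k y) x)"

lemma TH_slice:
 "TH j om = h (%k. SUM y:om Int mk La. psi k y) * (\<Sum>k<N. pd k (pd j g) (%k. SUM y:om Int mk La. ph k y) * (SUM x:om Int mk La. GG (ph j) (ph k) x))
  + pd j g (%k. SUM y:om Int mk La. ph k y) * (\<Sum>k<N'. pd k h (%k. SUM y:om Int mk La. psi k y) * (SUM x:om Int mk La. GG (ph j) (psi k) x))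
  - h (%k. SUM y:om Int mk La. psi k y) * pd j g (%k. SUM y:om Int mk La. ph k y) * (SUM x:om Int mk La. Hq (ph j) x)"
proof -
 have sw: "(SUM x:S. c * (\<Sum>k<n. a k * f k x)) = c * (\<Sum>k<n. a k * (SUM x:S. f k x))"
  for S :: "('a * real) set" and c and a :: "nat => real" and f and n :: nat unfolding sum_distrib_left by (rule sum.swap)
 show ?thesis unfolding TH_def U_def Ph_simps sum_subtractf sum.distrib sw sum_distrib_left[symmetric] ..
qed

lemma TH_integral:
 assumes j: "j < N"
 shows "(\<integral>om. TH j om \<partial>P) = 0"
proof -
 obtain w where w: "integrable (muR La) w" "!!r x. x : mk La ==> abs (U j r x) <= w x" using U_bound[OF j] by blast
 note pg = Cb_infinity_pd[OF g j]
 have m: "TH j : borel_measurable config_space" unfolding TH_slice[abs_def]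
  by (intro borel_measurable_diff borel_measurable_add borel_measurable_times borel_measurable_sum
  cylinder_measurable[OF h] cylinder_measurable[OF pg] cylinder_measurable[OF Cb_infinity_pd[OF pg]] cylinder_measurable[OF Cb_infinity_pd[OF h]]
  slice_sum_measurable[OF La(1)] GG_measurable j sph spsi Hq_measurable ph_measurable psi_measurable) simp_all
 have mn: "(%z. U j (%k. \<Sum>l<n. Ph k (z l)) (z i)) : borel_measurable (\<Pi>\<^sub>M i\<in>{..<n}. muR La)" if i: "i < n" for n i :: nat
 proof -
  have cm: "(%z. f (z l)) : borel_measurable (\<Pi>\<^sub>M i\<in>{..<n}. muR La)" if "f : borel_measurable (sgq)" "l : {..<n}" for f :: "_ => real" and l
  by (rule coord_measurable[OF La(1) muR_facts(4)[OF La(1) that(1)] that(2)])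
  show ?thesis unfolding U_def Ph_simps by (intro borel_measurable_diff borel_measurable_add borel_measurable_times borel_measurable_sum
  cylinder_measurable[OF h] cylinder_measurable[OF pg] cylinder_measurable[OF Cb_infinity_pd[OF pg]] cylinder_measurable[OF Cb_infinity_pd[OF h]]
  cm GG_measurable j sph spsi Hq_measurable ph_measurable psi_measurable) (use i in simp_all)
 qed
 show ?thesis unfolding TH_def
  by (rule one_particle_to_configurations[OF La(1) _ mn w U_integral_zero[OF j]]) (use m in \<open>simp_all add: TH_def[abs_def]\<close>)
qed

abbreviation rph :: "('a * real) set => nat => real" where "rph om \<equiv> (%j. pairing (ph j) om)"
abbreviation rpsi :: "('a * real) set => nat => real" where "rpsi om \<equiv> (%j. pairing (psi j) om)"

definition A1 :: "nat => ('a * real) set => real" where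
 "A1 j om = (\<Sum>k<N. pd k (pd j g) (rph om) * pairing (GG (ph j) (ph k)) om)"
definition A2 :: "nat => ('a * real) set => real" where
 "A2 j om = pd j g (rph om) * (\<Sum>k<N'. pd k h (rpsi om) * pairing (GG (ph j) (psi k)) om)"
definition A3 :: "nat => ('a * real) set => real" where
 "A3 j om = pd j g (rph om) * pairing (Hq (ph j)) om"

lemma pairing_measurable_tests: "j < N ==> pairing (ph j) : borel_measurable P" "j < N' ==> pairing (psi j) : borel_measurable P"
 by (rule pairing_measurable[OF La(1) ph_measurable off_La(1)], assumption+)
  (rule pairing_measurable[OF La(1) psi_measurable off_La(2)], assumption+)

lemma cyl_P:
 "f : Cb_infinity N ==> (%om. f (rph om)) : borel_measurable P" "f : Cb_infinity N' ==> (%om. f (rpsi om)) : borel_measurable P"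
 by (rule cylinder_measurable, assumption, erule pairing_measurable_tests)+

lemma A_square_integrable:
 assumes j: "j < N"
 shows "square_integrable P (A1 j)" "square_integrable P (A2 j)" "square_integrable P (A3 j)"
proof -
 obtain C where C: "!!j r. j < N ==> abs (pd j g r) <= C" "!!k r. k < N' ==> abs (pd k h r) <= C"
  "!!j k r. j < N ==> k < N ==> abs (pd k (pd j g) r) <= C" using common_bound by metis
 note pg = Cb_infinity_pd[OF g j]
 show "square_integrable P (A1 j)" unfolding A1_def
  by (intro square_integrable_sum square_integrable_mult[OF cyl_P(1) C(3)[OF j]] Cb_infinity_pd[OF pg] pairing_GG(1)[OF j]) auto
 show "square_integrable P (A2 j)" unfolding A2_def
  by (intro square_integrable_mult[OF cyl_P(1)[OF pg] C(1)[OF j]] square_integrable_sum square_integrable_mult[OF cyl_P(2) C(2)]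
  Cb_infinity_pd[OF h] pairing_GG(2)[OF j]) auto
 show "square_integrable P (A3 j)" unfolding A3_def by (rule square_integrable_mult[OF cyl_P(1)[OF pg] C(1)[OF j] pairing_H[OF j]])
qed

lemma TH_pairing:
 assumes om: "om : marked_configs" and j: "j < N"
 shows "TH j om = h (rpsi om) * A1 j om + A2 j om - h (rpsi om) * A3 j om"
proof -
 note ps = pairing_slice[OF om La(1)]
 note pg = Cb_infinity_pd[OF g j]
 have cph: "f (%k. SUM y:om Int mk La. ph k y) = f (rph om)" if "f : Cb_infinity N" for f
  by (rule Cb_infinity_facts(1)[OF that]) (simp add: ps[OF off_La(1)])
 have cpsi: "f (%k. SUM y:om Int mk La. psi k y) = f (rpsi om)" if "f : Cb_infinity N'" for f
  by (rule Cb_infinity_facts(1)[OF that]) (simp add: ps[OF off_La(2)])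
 have 1: "(\<Sum>k<N. pd k (pd j g) (%k. SUM y:om Int mk La. ph k y) * (SUM x:om Int mk La. GG (ph j) (ph k) x)) = A1 j om"
  unfolding A1_def by (rule sum.cong[OF refl]) (simp add: cph[OF Cb_infinity_pd[OF pg]] ps[OF off_La(3)[OF _ _ j sph]])
 have 2: "(\<Sum>k<N'. pd k h (%k. SUM y:om Int mk La. psi k y) * (SUM x:om Int mk La. GG (ph j) (psi k) x)) = (\<Sum>k<N'. pd k h (rpsi om) * pairing (GG (ph j) (psi k)) om)"
  by (rule sum.cong[OF refl]) (simp add: cpsi[OF Cb_infinity_pd[OF h]] ps[OF off_La(3)[OF _ _ j spsi]])
 have 3: "(SUM x:om Int mk La. Hq (ph j) x) = pairing (Hq (ph j)) om" by (rule ps[OF off_La(4)[OF _ _ j], symmetric])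
 show ?thesis unfolding TH_slice 1 2 3 cph[OF pg] cpsi[OF h] A2_def A3_def by simp
qed

lemma H_config_A:
 assumes om: "om : marked_configs"
 shows "H_config M q N ph g om = - (\<Sum>j<N. A1 j om) + (\<Sum>j<N. A3 j om)"
proof -
 have sym: "pairing (GG (ph j) (ph k)) om = pairing (GG (ph k) (ph j)) om" if "j < N" "k < N" for j k
  unfolding pairing_def by (rule infsum_cong, rule GG_sym) (use that sph om in \<open>auto simp: marked_configs_def\<close>)
 have "(\<Sum>j<N. A1 j om) = (\<Sum>k<N. \<Sum>j<N. pd k (pd j g) (rph om) * pairing (GG (ph j) (ph k)) om)"
  unfolding A1_def by (rule sum.swap)
 also have "... = (\<Sum>k<N. \<Sum>j<N. pd k (pd j g) (rph om) * pairing (GG (ph k) (ph j)) om)" by (intro sum.cong refl) (simp add: sym)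
 finally show ?thesis by (simp add: H_config_def Let_def A3_def)
qed

lemma gradient_at:
 assumes om: "om : marked_configs" and z: "z : om"
 shows "minner M (fst z) (grad_config M N ph g om (fst z)) (grad_config M n et f om (fst z)) =
  (\<Sum>j<N. \<Sum>k<n. pd j g (rph om) * (pd k f (%j. pairing (et j) om) * GG (ph j) (et k) z))"
 unfolding grad_config_def Let_def mark_eq[OF assms] prod.collapse minner_sum ..

lemma config_inner_A:
 assumes om: "om : marked_configs"
 shows "config_inner M om (grad_config M N ph g om) (grad_config M N' psi h om) = (\<Sum>j<N. A2 j om)"
proof -
 have inj: "inj_on fst om" and sub: "om <= mk UNIV" using om by (auto simp: marked_configs_def)
 let ?b = "%z. \<Sum>j<N. \<Sum>k<N'. pd j g (rph om) * (pd k h (rpsi om) * GG (ph j) (psi k) z)"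
 have "config_inner M om (grad_config M N ph g om) (grad_config M N' psi h om) = infsum ?b om"
  unfolding config_inner_def infsum_reindex[OF inj] by (rule infsum_cong) (simp add: o_def gradient_at[OF om])
 also have "... = pairing ?b om" by (rule pairing_def[symmetric])
 also have "... = (SUM z:om Int mk La. ?b z)" by (rule pairing_slice[OF om La(1)]) (auto intro!: sum.neutral simp: off_La(3) spsi)
 also have "... = (\<Sum>j<N. pd j g (rph om) * (\<Sum>k<N'. pd k h (rpsi om) * (SUM z:om Int mk La. GG (ph j) (psi k) z)))"
 proof -
  have "(SUM z:om Int mk La. ?b z) = (\<Sum>j<N. SUM z:om Int mk La. \<Sum>k<N'. pd j g (rph om) * (pd k h (rpsi om) * GG (ph j) (psi k) z))"
  by (rule sum.swap)
  also have "... = (\<Sum>j<N. \<Sum>k<N'. SUM z:om Int mk La. pd j g (rph om) * (pd k h (rpsi om) * GG (ph j) (psi k) z))"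
  by (intro sum.cong refl sum.swap)
  finally show ?thesis by (simp only: sum_distrib_left)
 qed
 also have "... = (\<Sum>j<N. A2 j om)"
  unfolding A2_def by (intro sum.cong refl arg_cong2[where f = "(*)"]) (simp add: pairing_slice[OF om La(1) off_La(3)] spsi)
 finally show ?thesis .
qed

lemma grad_config_tangent:
 assumes om: "om : marked_configs"
 shows "grad_config M N ph g om : config_tangent_space M om"
 unfolding config_tangent_space_def
proof (intro CollectI conjI ballI)
 have inj: "inj_on fst om" and sub: "om <= mk UNIV" using om by (auto simp: marked_configs_def)
 fix x assume "x : fst ` om"
 then obtain z where z: "z : om" "x = fst z" by blast
 have s: "snd z > 0" using z sub by (auto simp: mk_def)
 have t: "fst (grad_mk M (ph j) z) : tangent_space M x" if "j < N" for j using grad_mk_tangent[OF sph[OF that] s, of "fst z"] z(2) by simp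
 have t1: "fst (grad_mk M (ph j) z) c = 0" if "j < N" "\<not> (c : atlas M & x : cdom c)" for j c
  using t[OF that(1)] that(2) unfolding tangent_space_def by blast
 have t2: "fst (grad_mk M (ph j) z) d = jac c d x *v fst (grad_mk M (ph j) z) c" if "j < N" "c : atlas M" "d : atlas M" "x : cdom c Int cdom d" for j c d
  using t[OF that(1)] that(2-) unfolding tangent_space_def by blast
 show "fst (grad_config M N ph g om x) : tangent_space M x"
  unfolding tangent_space_def grad_config_def Let_def z(2) mark_eq[OF om z(1)] prod.collapse fst_conv
 proof (intro CollectI conjI allI ballI impI)
  fix c assume "\<not> (c : atlas M & fst z : cdom c)"
  thus "(\<Sum>j<N. pd j g (rph om) *\<^sub>R fst (grad_mk M (ph j) z) c) = 0" by (intro sum.neutral ballI) (simp add: t1 z(2))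
 next
  fix c d assume cd: "c : atlas M" "d : atlas M" "fst z : cdom c Int cdom d"
  have "jac c d (fst z) *v (\<Sum>j<N. pd j g (rph om) *\<^sub>R fst (grad_mk M (ph j) z) c) = (\<Sum>j<N. pd j g (rph om) *\<^sub>R (jac c d (fst z) *v fst (grad_mk M (ph j) z) c))"
  by (simp add: linear_sum[OF matrix_vector_mul_linear] matrix_vector_mult_scaleR)
  also have "... = (\<Sum>j<N. pd j g (rph om) *\<^sub>R fst (grad_mk M (ph j) z) d)"
  by (rule sum.cong[OF refl]) (use t2[OF _ cd[folded z(2)]] z(2) in simp)
  finally show "(\<Sum>j<N. pd j g (rph om) *\<^sub>R fst (grad_mk M (ph j) z) d) = jac c d (fst z) *v (\<Sum>j<N. pd j g (rph om) *\<^sub>R fst (grad_mk M (ph j) z) c)" ..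
 qed
next
 have sub: "om <= mk UNIV" using om by (auto simp: marked_configs_def)
 let ?v = "%x. minner M x (grad_config M N ph g om x) (grad_config M N ph g om x)"
 have "finite (fst ` (om Int mk La))" using finite_slice[OF om La(1)] by simp
 hence "finite {x : fst ` om. ?v x ~= 0}"
 proof (rule rev_finite_subset)
  show "{x : fst ` om. ?v x ~= 0} <= fst ` (om Int mk La)"
  proof
  fix x assume x: "x : {x : fst ` om. ?v x ~= 0}"
  then obtain z where z: "z : om" "x = fst z" by blast
  have "z : mk La"
  proof (rule ccontr)
  assume n: "z ~: mk La"
  have "z : mk UNIV" using z sub by blast
  from off_La(3)[OF this n _ sph] have "?v (fst z) = 0" unfolding gradient_at[OF om z(1)] by (intro sum.neutral ballI) simp
  thus False using x z(2) by simp
  qed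
  thus "x : fst ` (om Int mk La)" using z by blast
  qed
 qed
 thus "?v summable_on fst ` om" by (rule finite_nonzero_values_imp_summable_on)
qed

text \<open>The sum over \<open>j\<close> of the functions \<open>TH j\<close>, which have integral \<open>0\<close>, is the difference of the integrands.\<close>
lemma generator_identity:
 "square_integrable P (H_config M q N ph g)"
 "integrable P (%om. config_inner M om (grad_config M N ph g om) (grad_config M N' psi h om))"
 "(\<integral>om. config_inner M om (grad_config M N ph g om) (grad_config M N' psi h om) \<partial>P) = (\<integral>om. H_config M q N ph g om * h (rpsi om) \<partial>P)"
proof -
 interpret PP: prob_space P by (rule P_facts(1))
 have sq_cong: "square_integrable P a \<longleftrightarrow> square_integrable P b" if "!!om. om : marked_configs ==> a om = b om" for a b
  unfolding square_integrable_def
  by (intro conj_cong measurable_cong Bochner_Integration.integrable_cong refl) (simp_all add: P_facts(3) that)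
 have neg: "square_integrable P (%om. - a om)" if "square_integrable P a" for a using that unfolding square_integrable_def by simp
 let ?H = "%om. - (\<Sum>j<N. A1 j om) + (\<Sum>j<N. A3 j om)" and ?D = "%om. \<Sum>j<N. A2 j om"
 have sH: "square_integrable P ?H" by (intro square_integrable_add neg square_integrable_sum A_square_integrable) auto
 have "square_integrable P (H_config M q N ph g) \<longleftrightarrow> square_integrable P ?H" by (rule sq_cong) (rule H_config_A)
 with sH show "square_integrable P (H_config M q N ph g)" by blast
 have iD: "integrable P ?D" by (intro PP.square_integrable_imp_integrable square_integrable_sum A_square_integrable) auto
 have eD: "integrable P (%om. config_inner M om (grad_config M N ph g om) (grad_config M N' psi h om)) \<longleftrightarrow> integrable P ?D"
  by (intro Bochner_Integration.integrable_cong refl config_inner_A) (simp add: P_facts(3))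
 show "integrable P (%om. config_inner M om (grad_config M N ph g om) (grad_config M N' psi h om))" unfolding eD by (rule iD)
 obtain C where C: "!!r. abs (h r) <= C" using common_bound by metis
 have ih: "integrable P (%om. h (rpsi om) * a om)" if "square_integrable P a" for a
  by (rule PP.square_integrable_imp_integrable[OF square_integrable_mult[OF cyl_P(2)[OF h] C that]])
 note hA1 = ih[OF A_square_integrable(1)] and hA3 = ih[OF A_square_integrable(3)]
 note iA2 = PP.square_integrable_imp_integrable[OF A_square_integrable(2)]
 have iTH: "integrable P (%om. h (rpsi om) * A1 j om + A2 j om - h (rpsi om) * A3 j om)" if "j < N" for j
  by (intro Bochner_Integration.integrable_diff Bochner_Integration.integrable_add hA1 hA3 iA2 that)
 have zTH: "(\<integral>om. h (rpsi om) * A1 j om + A2 j om - h (rpsi om) * A3 j om \<partial>P) = 0" if "j < N" for j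
  unfolding TH_integral[OF that, symmetric]
  by (rule Bochner_Integration.integral_cong[OF refl]) (simp add: P_facts(3) TH_pairing[OF _ that])
 have "(\<integral>om. ?D om \<partial>P) - (\<integral>om. h (rpsi om) * ?H om \<partial>P) = (\<integral>om. ?D om - h (rpsi om) * ?H om \<partial>P)"
  by (rule Bochner_Integration.integral_diff[OF iD ih[OF sH], symmetric])
 also have "... = (\<integral>om. (\<Sum>j<N. h (rpsi om) * A1 j om + A2 j om - h (rpsi om) * A3 j om) \<partial>P)"
  by (rule Bochner_Integration.integral_cong[OF refl]) (simp add: sum.distrib sum_subtractf sum_distrib_left[symmetric] algebra_simps)
 also have "... = (\<Sum>j<N. \<integral>om. h (rpsi om) * A1 j om + A2 j om - h (rpsi om) * A3 j om \<partial>P)"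
  by (rule Bochner_Integration.integral_sum) (simp add: iTH)
 also have "... = 0" by (rule sum.neutral) (simp add: zTH)
 finally have "(\<integral>om. ?D om \<partial>P) = (\<integral>om. h (rpsi om) * ?H om \<partial>P)" by simp
 moreover have "(\<integral>om. config_inner M om (grad_config M N ph g om) (grad_config M N' psi h om) \<partial>P) = (\<integral>om. ?D om \<partial>P)"
  by (intro Bochner_Integration.integral_cong refl config_inner_A) (simp add: P_facts(3))
 moreover have "(\<integral>om. H_config M q N ph g om * h (rpsi om) \<partial>P) = (\<integral>om. h (rpsi om) * ?H om \<partial>P)"
  by (rule Bochner_Integration.integral_cong[OF refl]) (simp add: P_facts(3) H_config_A mult.commute)
 ultimately show "(\<integral>om. config_inner M om (grad_config M N ph g om) (grad_config M N' psi h om) \<partial>P) = (\<integral>om. H_config M q N ph g om * h (rpsi om) \<partial>P)" by simp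
qed

end

end

theorem theorem4p1:
  fixes M :: "('x::{t2_space, second_countable_topology}, 'n::finite) riemannian"
    and m :: "'x measure"
    and \<rho> :: "'x \<Rightarrow> real" and p :: "'x \<Rightarrow> real \<Rightarrow> real" and q :: "'x \<times> real \<Rightarrow> real"
    and P :: "('x \<times> real) set measure"
    and F G :: "('x \<times> real) set \<Rightarrow> real"
    and N N' :: nat and \<phi> \<psi> :: "nat \<Rightarrow> 'x \<times> real \<Rightarrow> real"
    and g h :: "(nat \<Rightarrow> real) \<Rightarrow> real"
  assumes "oriented_riemannian_manifold M"
    and "connected (UNIV :: 'x set)" and "\<not> compact (UNIV :: 'x set)"
    and "riemannian_volume M m"
    and "\<rho> \<in> borel_measurable m" and "AE x in m. \<rho> x > 0"
    and "radon_measure (density m (\<lambda>x. ennreal (\<rho> x)))"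
    and "nonatomic (density m (\<lambda>x. ennreal (\<rho> x)))"
    and "case_prod p \<in> borel_measurable (m \<Otimes>\<^sub>M lebesgue_pos)"
    and "AE x in m. AE s in lebesgue_pos. p x s > 0"
    and "AE x in m. (\<integral>\<^sup>+s. ennreal (p x s) \<partial>lebesgue_pos) < \<infinity>"
    and "q = (\<lambda>(x, s). \<rho> x * p x s)"
    and "emeasure (sigma_tilde m q) (mk UNIV) = \<infinity>"
    and "\<And>\<Lambda>. \<Lambda> \<in> Bc \<Longrightarrow>
      (\<integral>\<^sup>+z\<in>mk \<Lambda>. ennreal (max 1 (snd z) * q z) \<partial>(m \<Otimes>\<^sub>M lebesgue_pos)) < \<infinity>"
    and "(\<lambda>z. sqrt (q z)) \<in> H12_loc M m"
    and "marked_poisson (sigma_tilde m q) P"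
    and "represents M N \<phi> g F" and "represents M N' \<psi> h G"
  shows "square_integrable P (H_config M q N \<phi> g)
    \<and> dirichlet_form M P (grad_config M N \<phi> g) (grad_config M N' \<psi> h)
        = L2_inner P (H_config M q N \<phi> g) G
    \<and> has_divergence M P (grad_config M N \<phi> g) (\<lambda>\<omega>. - H_config M q N \<phi> g \<omega>)"
proof -
 interpret riem_volume M m using assms(1,4) by unfold_locales
 interpret pair_sigma_finite m lebesgue_pos by (rule pair_sigma_finite_ml)
 have q_eq: "q = (%z. \<rho> (fst z) * (case_prod p) z)" unfolding assms(12) by (auto simp: fun_eq_iff)
 have \<rho>m: "(%z. \<rho> (fst z)) : borel_measurable ml" by (rule measurable_compose[OF measurable_fst assms(5)])
 have qm: "q : borel_measurable ml" unfolding q_eq by (intro borel_measurable_times \<rho>m assms(9))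
 have qp: "AE z in ml. q z > 0"
 proof (rule AE_pair_measure)
  show "{z : space ml. 0 < q z} : sets ml" using qm by measurable
  show "AE x in m. AE y in lebesgue_pos. 0 < q (x, y)" using assms(6,10)
  proof eventually_elim
  case (elim x)
  show ?case using elim(2) by eventually_elim (use elim(1) in \<open>simp add: q_eq\<close>)
  qed
 qed
 interpret marked_density M m q using qm qp assms(14,15) by unfold_locales
 have \<sigma>: "marked_poisson_process (sigma_tilde m q) P"
 proof
  show "sets (sigma_tilde m q) = sets (borel \<Otimes>\<^sub>M lebesgue_pos)"
  unfolding sigma_tilde_def sets_density by (rule sets_pair_measure_cong[OF sets_m refl])
  show "marked_poisson (sigma_tilde m q) P" by (rule assms(16))
  fix \<Lambda> :: "'x set" assume \<Lambda>: "\<Lambda> : Oc"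
  have mm: "mk \<Lambda> : sets ml" unfolding mk_def
  by (intro pair_measureI) (use \<Lambda> in \<open>auto simp: Oc_def sets_m sets_lebesgue_pos sets_restrict_space_iff\<close>)
  have "emeasure (sigma_tilde m q) (mk \<Lambda>) = (nn_integral ml (%z. ennreal (q z) * indicator (mk \<Lambda>) z))"
  unfolding sigma_tilde_def using qm mm by (simp add: emeasure_density)
  also have "... <= (nn_integral ml (%z. ennreal (q z) * indicator (mk (closure \<Lambda>)) z))"
  using closure_subset[of \<Lambda>] by (intro nn_integral_mono) (auto simp: indicator_def mk_def)
  also have "... < \<infinity>" using \<Lambda> by (intro sigma_finite_compact) (simp add: Oc_def)
  finally show "emeasure (sigma_tilde m q) (mk \<Lambda>) < \<infinity>" .
 qed
 interpret poisson_density M m q P by (intro poisson_density.intro \<sigma>) (rule marked_density_axioms)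
 have core: "square_integrable P (H_config M q N \<phi> g) & (ALL \<omega>:marked_configs. grad_config M N \<phi> g \<omega> : config_tangent_space M \<omega>) &
  integrable P (%\<omega>. config_inner M \<omega> (grad_config M N \<phi> g \<omega>) (grad_config M n \<eta> f \<omega>)) &
  (\<integral>\<omega>. config_inner M \<omega> (grad_config M N \<phi> g \<omega>) (grad_config M n \<eta> f \<omega>) \<partial>P) = (\<integral>\<omega>. H_config M q N \<phi> g \<omega> * E \<omega> \<partial>P)"
  if rep: "represents M n \<eta> f E" for n \<eta> f E
 proof -
  have r1: "!!j. j < N ==> \<phi> j : test_functions M" "g : Cb_infinity N" using assms(17) unfolding represents_def by blast+
  have r2: "!!j. j < n ==> \<eta> j : test_functions M" "f : Cb_infinity n" using rep unfolding represents_def by blast+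
  have E: "E \<omega> = f (%j. pairing (\<eta> j) \<omega>)" if "\<omega> : marked_configs" for \<omega> using rep that unfolding represents_def by blast
  let ?K = "(\<Union>j<N. base (\<phi> j)) Un (\<Union>j<n. base (\<eta> j))"
  have K: "compact ?K" by (intro compact_Un compact_UN) (auto intro: base_compact r1 r2)
  obtain \<Lambda>n :: "nat => 'x set" where L: "!!i. \<Lambda>n i : Oc" "!!C. compact C ==> EX i. C <= \<Lambda>n i" using exhaustion by metis
  obtain i where i: "?K <= \<Lambda>n i" using L(2)[OF K] by blast
  have b: "!!j. j < N ==> base (\<phi> j) <= \<Lambda>n i" "!!j. j < n ==> base (\<eta> j) <= \<Lambda>n i" using i by blast+
  note ctx = r1(1) r2(1) r1(2) r2(2) L(1)[of i] b
  have H: "(\<integral>\<omega>. H_config M q N \<phi> g \<omega> * E \<omega> \<partial>P) = (\<integral>\<omega>. H_config M q N \<phi> g \<omega> * f (%j. pairing (\<eta> j) \<omega>) \<partial>P)"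
  by (rule Bochner_Integration.integral_cong[OF refl]) (simp add: P_facts(3) E)
  show ?thesis
  unfolding H using generator_identity[where ph = \<phi> and psi = \<eta> and N = N and N' = n and g = g and h = f and La = "\<Lambda>n i", OF ctx] grad_config_tangent[where ph = \<phi> and psi = \<eta> and N = N and N' = n and g = g and h = f and La = "\<Lambda>n i", OF ctx] by blast
 qed
 note core1 = core[OF assms(18)]
 have G: "dirichlet_form M P (grad_config M N \<phi> g) (grad_config M N' \<psi> h) = L2_inner P (H_config M q N \<phi> g) G"
  unfolding dirichlet_form_def L2_inner_def using core1 by blast
 have "square_integrable P (%\<omega>. - H_config M q N \<phi> g \<omega>)" using core1 unfolding square_integrable_def by simp
 hence "has_divergence M P (grad_config M N \<phi> g) (%\<omega>. - H_config M q N \<phi> g \<omega>)" unfolding has_divergence_def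
 proof (intro conjI allI impI)
  fix n \<eta> f E assume rep: "represents M n \<eta> f E"
  note c = core[OF rep]
  show "integrable P (%\<omega>. config_inner M \<omega> (grad_config M N \<phi> g \<omega>) (grad_config M n \<eta> f \<omega>))" using c by blast
  have "(\<integral>\<omega>. E \<omega> * - H_config M q N \<phi> g \<omega> \<partial>P) = - (\<integral>\<omega>. H_config M q N \<phi> g \<omega> * E \<omega> \<partial>P)"
  by (simp add: mult.commute)
  thus "(\<integral>\<omega>. config_inner M \<omega> (grad_config M N \<phi> g \<omega>) (grad_config M n \<eta> f \<omega>) \<partial>P) = - (\<integral>\<omega>. E \<omega> * - H_config M q N \<phi> g \<omega> \<partial>P)"
  using c by simp
 qed (use core1 in blast)
 thus ?thesis using core1 G by blast
qed

end
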